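(* Let $\beta_0>0$ be a number with the following property (such a number is known to exist): for every sequence $\Lambda_1\subseteq\Lambda_2\subseteq\cdots$ of finite subsets of $\mathbb Z^2$ with $\bigcup_N\Lambda_N=\mathbb Z^2$, every $\beta$ with $|\beta|\le\beta_0$, and every finite multiset of loops $s=\{\ell_1,\dots,\ell_n\}$, the sums $\phi(\ell_i)$ converge absolutely and $\lim_{N\to\infty}\phi_{\Lambda_N,N,\beta}(s)=\prod_{i=1}^n\phi(\ell_i)$. Assume $|\beta|\le\min(\beta_0,1/2)$. Let $\ell$ be a simple loop in $\mathbb Z^2$ and $a_\ell=\operatorname{area}(\ell)$. Then $$f_{a_\ell,\beta}(x)=\frac1{2\pi}\Big(1+2\sum_{n=1}^\infty c_n(a_\ell)\cos(nx)\,\beta^{na_\ell}\Big),\qquad x\in[0,2\pi),$$ is a probability density (in particular it is non-negative). Moreover, let $Q_\ell$ be the loop matrix under the lattice Yang–Mills measure $\mu_{\Lambda_N,N,\beta}$, where $\Lambda_1\subseteq\Lambda_2\subseteq\cdots$ are finite subsets of $\mathbb Z^2$ with union $\mathbb Z^2$ (and $N$ is large enough that $\ell$ is contained in $\Lambda_N$), and let $\mu_{\ell,N}=\frac1N\sum_{i=1}^N\delta_{\lambda^i_{\ell,N}}$ be the empirical spectral distribution of $Q_\ell$, where $(\lambda^i_{\ell,N})_i$ are the eigenvalues of $Q_\ell$. Then $$\mu_{\ell,N}\xrightarrow[N\to\infty]{}\mu_{a_\ell}\quad\text{weakly in probability},$$ where $\mu_{a_\ell}$ is the probability measure on the unit circle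 with density $f_{a_\ell,\beta}(x)$, $x\in[0,2\pi)$, under the standard parametrization $x\mapsto e^{ix}$.
   Context: **Lattice and loops.** $E$ is the set of oriented nearest-neighbour edges of $\mathbb Z^2$; $e^{-1}$ is $e$ reversed. A loop is a closed walk $\ell=e_1e_2\cdots e_n$ of oriented edges, considered up to cyclic rotation; the null-loop $\emptyset$ has no edges. A backtrack is an occurrence $\ell=\pi_1\,e\,e^{-1}\,\pi_2$ (cyclically); a loop is trivial if removing all its backtracks gives $\emptyset$. A simple loop is a non-null loop without backtracks such that the endpoints of all its edges are distinct; $\operatorname{area}(\ell)$ is the number of unit squares it encloses. A plaquette is an oriented loop of four edges around a unit square; $\mathcal P$ is the set of all plaquettes (both orientations), $\mathcal P(e)$ the set of those containing the oriented edge $e$. **Lattice Yang–Mills.** For $\Lambda\subset\mathbb Z^2$ finite, $E_\Lambda^+$ is the set of positively oriented (lexicographically increasing) edges of $\Lambda$ and $\mathcal P_\Lambda$ the set of plaquettes (both orientations) in $\Lambda$. A configuration $\mathcal Q=(Q_e)_{e\in E_\Lambda^+}$ assigns a matrix in $\mathrm U(N)$ to each positively oriented edge, with $Q_{e^{-1}}=Q_e^{-1}$; for $\ell=e_1\cdots e_n$, $Q_\ell=Q_{e_1}\cdots Q_{e_n}$. The measure is $$d\mu_{\Lambda,N,\beta}(\mathcal Q)=Z_{\Lambda,N,\beta}^{-1}\prod_{p\in\mathcal P_\Lambda}\exp\big(\beta N\operatorname{Tr}(Q_p)\big)\prod_{e\in E_\Lambda^+}dQ_e,$$ with $dQ_e$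 Haar measure on $\mathrm U(N)$ and $Z_{\Lambda,N,\beta}$ the normalizing constant. For a finite multiset $s$ of loops, $\phi_{\Lambda,N,\beta}(s)=\mathbb E_{\mu_{\Lambda,N,\beta}}\big[\prod_{\ell\in s}\operatorname{tr}(Q_\ell)\big]$, where $\operatorname{tr}=\frac1N\operatorname{Tr}$. **Coefficients $c_n(a)$.** For $n,a\in\mathbb N=\{1,2,\dots\}$, $c_n(a)=\frac{(-1)^{n+1}}n\binom{na-2}{n-1}$, interpreted as $\mathbf 1_{\{n=1\}}$ when $a=1$. **Surface sums.** A plaquette assignment is $K:\mathcal P\to\mathbb Z_{\ge0}$; it is finite if $\operatorname{area}(K)=\sum_pK(p)<\infty$. If $K(p)\ge1$, $K\setminus p$ is $K$ with its value at $p$ decreased by 1. Let $n_e(\ell,K)$ be the number of copies of $e$ in $\ell$ plus $\sum_{p\in\mathcal P(e)}K(p)$; $(\ell,K)$ is balanced if $n_e(\ell,K)=n_{e^{-1}}(\ell,K)$ for all $e$. Loop operations at a specific copy $\mathbf e$ of an edge $e$ in $\ell$ (backtracks created are not removed): $\mathbb S_+(\mathbf e,\ell)$ is the multiset of pairs $\{\pi_1\mathbf e\pi_3,\pi_2\mathbf e'\}$ over other copies $\mathbf e'$ of $e$ in $\ell=\pi_1\mathbf e\pi_2\mathbf e'\pi_3$; $\mathbb S_-(\mathbf e,\ell)$ is the multiset of pairs $\{\pi_1\pi_3,\pi_2\}$ over copies $\mathbf e^{-1}$ of $e^{-1}$ in $\ell=\pi_1\mathbf e\pi_2\mathbf e^{-1}\pi_3$;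 with $\ell=\mathbf e\pi_1$, $\ell\oplus_{\mathbf e}q=\mathbf e\pi_2\mathbf e'\pi_1$ for $q=\mathbf e'\pi_2\in\mathcal P(e)$, and $\ell\ominus_{\mathbf e}p=\pi_2\pi_1$ for $p=\mathbf e^{-1}\pi_2\in\mathcal P(e^{-1})$. The real coefficients $c(\ell,K)$ ($K$ finite) of the large-$N$ surface sum are the unique ones such that: (1) $c(\ell,K)=0$ if $(\ell,K)$ is not balanced; (2) $c(\ell,0)=0$ for non-trivial $\ell$, $c(\emptyset,0)=1$, $c(\emptyset,K)=0$ for $K\ne0$; (3) for every non-null $\ell$, finite $K$ and every copy $\mathbf e$ of an edge $e$ in $\ell$, $$c(\ell,K)=\sum_{\{\ell_1,\ell_2\}\in\mathbb S_-(\mathbf e,\ell)}\ \sum_{K_1+K_2=K}c(\ell_1,K_1)c(\ell_2,K_2)-\sum_{\{\ell_1,\ell_2\}\in\mathbb S_+(\mathbf e,\ell)}\ \sum_{K_1+K_2=K}c(\ell_1,K_1)c(\ell_2,K_2)+\sum_{p\in\mathcal P(e^{-1}),K(p)\ge1}c(\ell\ominus_{\mathbf e}p,K\setminus p)-\sum_{q\in\mathcal P(e),K(q)\ge1}c(\ell\oplus_{\mathbf e}q,K\setminus q).$$ (Such coefficients are known to exist, and to satisfy $c(\pi_1ee^{-1}\pi_2,K)=c(\pi_1\pi_2,K)$ for balanced pairs.) Then $\phi(\ell)=\sum_K c(\ell,K)\beta^{\operatorname{area}(K)}$, summed over finite $K$. **Weak convergence in probability**: $\int g\,d\mu_{\ell,N}\to\int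 g\,d\mu_{a_\ell}$ in probability for every continuous function $g$ on the unit circle. *)

theory Defs
  imports "HOL-Probability.Probability" "Jordan_Normal_Form.Char_Poly"
    "Jordan_Normal_Form.Schur_Decomposition"
begin

section \<open>The lattice, loops and plaquettes\<close>

type_synonym vertex = "int \<times> int"
type_synonym edge = "vertex \<times> vertex"

definition lattice_edges :: "edge set" where
  "lattice_edges = {((x, y), (x', y')). \<bar>x - x'\<bar> + \<bar>y - y'\<bar> = 1}"

abbreviation rev_edge :: "edge \<Rightarrow> edge" where
  "rev_edge \<equiv> prod.swap"

definition pos_oriented :: "edge \<Rightarrow> bool" where
  "pos_oriented e \<longleftrightarrow> (case e of ((x, y), (x', y')) \<Rightarrow> x < x' \<or> (x = x' \<and> y < y'))"

text \<open>
  Loops are represented by closed walks with a marked starting point. A loop proper is a class of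
  closed walks modulo \<^const>\<open>rotate\<close>; functions of loops are functions of closed walks that are
  invariant under rotation. The empty list is the null-loop.
\<close>

definition closed_walk :: "edge list \<Rightarrow> bool" where
  "closed_walk l \<longleftrightarrow> set l \<subseteq> lattice_edges \<and>
     (\<forall>i < length l. snd (l ! i) = fst (l ! (Suc i mod length l)))"

definition has_backtrack :: "edge list \<Rightarrow> bool" where
  "has_backtrack l \<longleftrightarrow> (\<exists>k e \<pi>. rotate k l = e # rev_edge e # \<pi>)"

inductive trivial_loop :: "edge list \<Rightarrow> bool" where
  null: "trivial_loop []"
| backtrack: "rotate k l = e # rev_edge e # \<pi> \<Longrightarrow> trivial_loop \<pi> \<Longrightarrow> trivial_loop l"

definition simple_loop :: "edge list \<Rightarrow> bool" where
  "simple_loop l \<longleftrightarrow> closed_walk l \<and> l \<noteq> [] \<and> \<not> has_backtrack l \<and> distinct (map snd l)"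

definition point :: "vertex \<Rightarrow> complex" where
  "point v = Complex (of_int (fst v)) (of_int (snd v))"

definition loop_trace :: "edge list \<Rightarrow> complex set" where
  "loop_trace l = (\<Union>e\<in>set l. closed_segment (point (fst e)) (point (snd e)))"

text \<open>
  A unit square is named by its lower left corner. The square is enclosed if its interior lies in
  the bounded part of the complement of the curve traced by the loop.
\<close>

definition loop_area :: "edge list \<Rightarrow> nat" where
  "loop_area l = card {(x, y). box (point (x, y)) (point (x + 1, y + 1)) \<subseteq> inside (loop_trace l)}"

text \<open>
  A plaquette is given by the lower left corner of its unit square together with its orientation;
  \<^const>\<open>True\<close> stands for counterclockwise.
\<close>

type_synonym plaq = "vertex \<times> bool"

fun plaq_loop :: "plaq \<Rightarrow> edge list" where
  "plaq_loop ((x, y), True) =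
     [((x, y), (x + 1, y)), ((x + 1, y), (x + 1, y + 1)),
      ((x + 1, y + 1), (x, y + 1)), ((x, y + 1), (x, y))]"
| "plaq_loop ((x, y), False) =
     [((x, y), (x, y + 1)), ((x, y + 1), (x + 1, y + 1)),
      ((x + 1, y + 1), (x + 1, y)), ((x + 1, y), (x, y))]"

definition plaqs_at :: "edge \<Rightarrow> plaq set" where
  "plaqs_at e = {p. e \<in> set (plaq_loop p)}"

text \<open>
  For \<open>e\<close> in \<open>p\<close>, this is the walk \<open>\<pi>\<close> such that \<open>p\<close>, read from \<open>e\<close> on, is \<open>e # \<pi>\<close>.
\<close>

definition plaq_rest :: "edge \<Rightarrow> plaq \<Rightarrow> edge list" where
  "plaq_rest e p = tl (dropWhile (\<lambda>x. x \<noteq> e) (plaq_loop p)) @ takeWhile (\<lambda>x. x \<noteq> e) (plaq_loop p)"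


section \<open>Lattice Yang--Mills measure\<close>

definition mtrace :: "complex mat \<Rightarrow> complex" where
  "mtrace A = (\<Sum>i < dim_row A. A $$ (i, i))"

definition unitary_group :: "nat \<Rightarrow> complex mat set" where
  "unitary_group N = {U \<in> carrier_mat N N. U * mat_adjoint U = 1\<^sub>m N \<and> mat_adjoint U * U = 1\<^sub>m N}"

text \<open>
  The Borel sets of the unitary group: the trace of the Borel sets of the space of all
  \<open>N \<times> N\<close> matrices, which are identified with families of \<open>N * N\<close> complex numbers.
\<close>

definition unitary_borel :: "nat \<Rightarrow> complex mat measure" where
  "unitary_borel N = vimage_algebra (unitary_group N)
     (\<lambda>U. \<lambda>ij \<in> {..<N} \<times> {..<N}. U $$ ij) (PiM ({..<N} \<times> {..<N}) (\<lambda>_. borel))"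

text \<open>Left-invariance determines the Haar probability measure of a compact group.\<close>

definition haar_unitary :: "nat \<Rightarrow> complex mat measure \<Rightarrow> bool" where
  "haar_unitary N H \<longleftrightarrow> prob_space H \<and> sets H = sets (unitary_borel N) \<and>
     (\<forall>U \<in> unitary_group N. distr H H (\<lambda>V. U * V) = H)"

definition pos_edges :: "vertex set \<Rightarrow> edge set" where
  "pos_edges \<Lambda> = {e \<in> lattice_edges. pos_oriented e \<and> fst e \<in> \<Lambda> \<and> snd e \<in> \<Lambda>}"

definition plaqs_in :: "vertex set \<Rightarrow> plaq set" where
  "plaqs_in \<Lambda> = {p. fst ` set (plaq_loop p) \<subseteq> \<Lambda>}"

type_synonym config = "edge \<Rightarrow> complex mat"

text \<open>The adjoint is the inverse of a unitary matrix.\<close>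

definition edge_mat :: "config \<Rightarrow> edge \<Rightarrow> complex mat" where
  "edge_mat Q e = (if pos_oriented e then Q e else mat_adjoint (Q (rev_edge e)))"

definition loop_mat :: "nat \<Rightarrow> config \<Rightarrow> edge list \<Rightarrow> complex mat" where
  "loop_mat N Q l = foldr (\<lambda>e A. edge_mat Q e * A) l (1\<^sub>m N)"

text \<open>
  The product below is a positive real number, since \<^const>\<open>plaqs_in\<close> contains each plaquette
  together with the reversed one; \<^const>\<open>Re\<close> only serves as a change of type.
\<close>

definition ym_weight :: "vertex set \<Rightarrow> nat \<Rightarrow> real \<Rightarrow> config \<Rightarrow> real" where
  "ym_weight \<Lambda> N \<beta> Q =
     Re (\<Prod>p\<in>plaqs_in \<Lambda>. exp (of_real (\<beta> * real N) * mtrace (loop_mat N Q (plaq_loop p))))"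

definition ym_partition :: "complex mat measure \<Rightarrow> vertex set \<Rightarrow> nat \<Rightarrow> real \<Rightarrow> real" where
  "ym_partition H \<Lambda> N \<beta> = (\<integral>Q. ym_weight \<Lambda> N \<beta> Q \<partial>PiM (pos_edges \<Lambda>) (\<lambda>_. H))"

text \<open>In the following definitions, \<open>H\<close> is the Haar measure on the unitary group of size \<open>N\<close>.\<close>

definition ym_measure :: "complex mat measure \<Rightarrow> vertex set \<Rightarrow> nat \<Rightarrow> real \<Rightarrow> config measure" where
  "ym_measure H \<Lambda> N \<beta> = density (PiM (pos_edges \<Lambda>) (\<lambda>_. H))
     (\<lambda>Q. ennreal (ym_weight \<Lambda> N \<beta> Q / ym_partition H \<Lambda> N \<beta>))"

definition wilson_expectation ::
  "complex mat measure \<Rightarrow> vertex set \<Rightarrow> nat \<Rightarrow> real \<Rightarrow> edge list multiset \<Rightarrow> complex" where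
  "wilson_expectation H \<Lambda> N \<beta> s =
     (\<integral>Q. (\<Prod>l\<in>#s. mtrace (loop_mat N Q l) / of_nat N) \<partial>ym_measure H \<Lambda> N \<beta>)"

text \<open>
  The index \<open>N\<close> is also the matrix size and starts from 1; \<open>\<Lambda> 0\<close> is irrelevant.
\<close>

definition exhaustion :: "(nat \<Rightarrow> vertex set) \<Rightarrow> bool" where
  "exhaustion \<Lambda> \<longleftrightarrow> (\<forall>N\<ge>1. finite (\<Lambda> N) \<and> \<Lambda> N \<subseteq> \<Lambda> (Suc N)) \<and> (\<Union>N\<in>{1..}. \<Lambda> N) = UNIV"


section \<open>Large-\<open>N\<close> surface sums\<close>

text \<open>
  A finite plaquette assignment is a finite multiset of plaquettes: \<open>K(p)\<close> is \<open>count K p\<close>,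
  the area of \<open>K\<close> is \<open>size K\<close>.
\<close>

definition edge_number :: "edge \<Rightarrow> edge list \<Rightarrow> plaq multiset \<Rightarrow> nat" where
  "edge_number e l K = count_list l e + (\<Sum>p\<in>plaqs_at e. count K p)"

definition balanced :: "edge list \<Rightarrow> plaq multiset \<Rightarrow> bool" where
  "balanced l K \<longleftrightarrow> (\<forall>e\<in>lattice_edges. edge_number e l K = edge_number (rev_edge e) l K)"

definition conv ::
  "(edge list \<Rightarrow> plaq multiset \<Rightarrow> real) \<Rightarrow> plaq multiset \<Rightarrow> edge list \<Rightarrow> edge list \<Rightarrow> real" where
  "conv c K l1 l2 = (\<Sum>(K1, K2) \<in> {(K1, K2). K1 + K2 = K}. c l1 K1 * c l2 K2)"

text \<open>
  The recursion is stated for the first edge of the closed walk \<open>e # \<pi>\<close>. Rotation invariance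
  makes this the recursion at an arbitrary copy of an arbitrary edge of a loop. The copies of
  \<open>e\<inverse>\<close> (for negative splittings) and the other copies of \<open>e\<close> (for positive splittings) are
  enumerated by their positions \<open>i\<close> in \<open>\<pi>\<close>: with \<open>\<pi> = \<pi>\<^sub>2 e\<^sup>\<plusminus>\<^sup>1 \<pi>\<^sub>3\<close>, the two new loops are
  \<open>{\<pi>\<^sub>3, \<pi>\<^sub>2}\<close> and \<open>{e \<pi>\<^sub>3, \<pi>\<^sub>2 e}\<close>, respectively.
\<close>

definition surface_coefficients :: "(edge list \<Rightarrow> plaq multiset \<Rightarrow> real) \<Rightarrow> bool" where
  "surface_coefficients c \<longleftrightarrow>
     (\<forall>l K k. closed_walk l \<longrightarrow> c (rotate k l) K = c l K) \<and>
     (\<forall>l K. closed_walk l \<longrightarrow> \<not> balanced l K \<longrightarrow> c l K = 0) \<and>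
     (\<forall>l. closed_walk l \<longrightarrow> \<not> trivial_loop l \<longrightarrow> c l {#} = 0) \<and>
     c [] {#} = 1 \<and>
     (\<forall>K. K \<noteq> {#} \<longrightarrow> c [] K = 0) \<and>
     (\<forall>e \<pi> K. closed_walk (e # \<pi>) \<longrightarrow>
        c (e # \<pi>) K =
          (\<Sum>i | i < length \<pi> \<and> \<pi> ! i = rev_edge e.
             conv c K (drop (Suc i) \<pi>) (take i \<pi>))
        - (\<Sum>i | i < length \<pi> \<and> \<pi> ! i = e.
             conv c K (e # drop (Suc i) \<pi>) (take i \<pi> @ [e]))
        + (\<Sum>p | p \<in> plaqs_at (rev_edge e) \<and> p \<in># K.
             c (plaq_rest (rev_edge e) p @ \<pi>) (K - {#p#}))
        - (\<Sum>q | q \<in> plaqs_at e \<and> q \<in># K.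
             c (e # plaq_rest e q @ e # \<pi>) (K - {#q#})))"

text \<open>Here \<open>c\<close> is the coefficient function characterised by \<^const>\<open>surface_coefficients\<close>.\<close>

definition surface_sum :: "(edge list \<Rightarrow> plaq multiset \<Rightarrow> real) \<Rightarrow> real \<Rightarrow> edge list \<Rightarrow> real" where
  "surface_sum c \<beta> l = (\<Sum>\<^sub>\<infinity>K. c l K * \<beta> ^ size K)"


section \<open>Empirical spectral distribution and its limit\<close>

definition circle_borel :: "complex measure" where
  "circle_borel = restrict_space borel (sphere 0 1)"

text \<open>The eigenvalues listed with their algebraic multiplicities, in an unspecified order.\<close>

definition eigenvalue_list :: "complex mat \<Rightarrow> complex list" where
  "eigenvalue_list A = (SOME as. char_poly A = (\<Prod>a\<leftarrow>as. [:- a, 1:]))"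

definition empirical_spectral_distribution :: "complex mat \<Rightarrow> complex measure" where
  "empirical_spectral_distribution A =
     distr (uniform_count_measure {..<dim_row A}) circle_borel (\<lambda>i. eigenvalue_list A ! i)"

definition c_coeff :: "nat \<Rightarrow> nat \<Rightarrow> real" where
  "c_coeff n a = (if a = 1 then (if n = 1 then 1 else 0)
     else (- 1) ^ (n + 1) / real n * real ((n * a - 2) choose (n - 1)))"

definition limit_term :: "nat \<Rightarrow> real \<Rightarrow> real \<Rightarrow> nat \<Rightarrow> real" where
  "limit_term a \<beta> x n = c_coeff n a * cos (real n * x) * \<beta> ^ (n * a)"

definition limit_density :: "nat \<Rightarrow> real \<Rightarrow> real \<Rightarrow> real" where
  "limit_density a \<beta> x = 1 / (2 * pi) * (1 + 2 * (\<Sum>n. limit_term a \<beta> x (Suc n)))"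

definition limit_measure :: "nat \<Rightarrow> real \<Rightarrow> complex measure" where
  "limit_measure a \<beta> =
     distr (density (restrict_space lborel {0..<2 * pi}) (\<lambda>x. ennreal (limit_density a \<beta> x)))
       circle_borel cis"

definition probability_density_on :: "real set \<Rightarrow> (real \<Rightarrow> real) \<Rightarrow> bool" where
  "probability_density_on S f \<longleftrightarrow>
     (\<forall>x\<in>S. 0 \<le> f x) \<and> set_integrable lborel S f \<and> (LINT x:S|lborel. f x) = 1"

text \<open>
  Convergence in probability to a constant, for random variables on varying probability spaces.
  Measurability is required explicitly because \<^const>\<open>measure\<close> is zero on non-measurable sets. It is
  only required for large \<open>N\<close>, as the loop may leave \<open>\<Lambda> N\<close> for small \<open>N\<close>.
\<close>

definition tendsto_in_probability ::
  "(nat \<Rightarrow> 'a measure) \<Rightarrow> (nat \<Rightarrow> 'a \<Rightarrow> complex) \<Rightarrow> complex \<Rightarrow> bool" where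
  "tendsto_in_probability M X z \<longleftrightarrow>
     (\<forall>\<^sub>F N in sequentially. prob_space (M N) \<and> X N \<in> borel_measurable (M N)) \<and>
     (\<forall>\<epsilon>>0. (\<lambda>N. measure (M N) {\<omega> \<in> space (M N). dist (X N \<omega>) z > \<epsilon>}) \<longlonglongrightarrow> 0)"

definition weakly_in_probability ::
  "(nat \<Rightarrow> 'a measure) \<Rightarrow> (nat \<Rightarrow> 'a \<Rightarrow> complex measure) \<Rightarrow> complex measure \<Rightarrow> bool" where
  "weakly_in_probability M \<mu> \<nu> \<longleftrightarrow>
     (\<forall>g :: complex \<Rightarrow> complex. continuous_on (sphere 0 1) g \<longrightarrow>
        tendsto_in_probability M (\<lambda>N \<omega>. \<integral>z. g z \<partial>\<mu> N \<omega>) (\<integral>z. g z \<partial>\<nu>))"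

end

theory Submission
  imports Defs "HOL-Computational_Algebra.Formal_Power_Series"
begin

text \<open>
  The theorem reduces to the moments of \<open>Q\<^sub>\<ell>\<close>. By hypothesis the Wilson loop expectations of the powers
  \<open>\<ell>^n\<close> converge to surface sums and factorise in the limit. Applied to \<open>\<ell>^n\<close> together with its reversal,
  factorisation says that the normalised trace of \<open>Q\<^sub>\<ell>^n\<close> converges in mean square to \<open>\<phi>(\<ell>^n)\<close>. These
  traces are the moments of the empirical spectral distribution, and trigonometric polynomials are dense, so
  it converges weakly in probability to any measure with moments \<open>\<phi>(\<ell>^n)\<close>. Such a measure exists:
  the moments are absolutely summable for \<open>\<bar>\<beta>\<bar> \<le> 1 / 2\<close>, by a bound on binomial coefficients, so
  that the density is a continuous function given by its Fourier series; it is nonnegative because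
  limits of moment sequences of measures on the circle are positive definite. It remains to show
  \<open>\<phi>(\<ell>^n) = c\<^sub>n(a) \<beta>^(n a)\<close> for a loop of area \<open>a\<close>.

  In two dimensions the law of \<open>Q\<^sub>\<ell>\<close> depends on \<open>\<ell>\<close> only through the area, at each finite \<open>N\<close>.
  Integrating over the edge shared by two regions convolves the plaquette weights of the regions
  (\<open>migdal_merge\<close>), so the squares enclosed by \<open>\<ell>\<close> combine to one weight of \<open>Q\<^sub>\<ell>\<close>, a convolution
  power (\<open>migdal_bounds\<close>). The induction removes the square in the top left corner and needs
  some planar topology: the enclosed squares are those around which \<open>\<ell>\<close> winds, and \<open>\<ell>\<close> winds once around
  them (\<open>simple_cycle_winding\<close>). The squares outside can be decoupled from \<open>\<ell>\<close> since a topmost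
  enclosed square has an unobstructed column above it (\<open>bounds_law\<close>).

  Hence \<open>\<ell>\<close> may be taken as the boundary of a row of \<open>a\<close> squares. It is a product \<open>A B\<close> of a square \<open>A\<close>
  and the boundary \<open>B\<close> of a row of \<open>a - 1\<close> squares, up to backtracks. The master loop equation, applied at
  the upper edge of \<open>A\<close>, closes on the words \<open>A^j B^i (A B)^n\<close> (\<open>y_master\<close>): the two plaquettes above this
  edge cancel because the square above \<open>A\<close> can be reversed by gauge symmetry (\<open>upper_loop_reflect\<close>). The
  equation determines the surface sums of these words from those of the powers of \<open>B\<close>, and the
  solution, written with generating functions, is given by a functional equation (\<open>moment_fps_Suc\<close>).
  Its solution is the compositional inverse of \<open>X (1 + X)^(a - 1)\<close>, whose coefficients are \<open>c\<^sub>n(a)\<close> by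
  Lagrange inversion (\<open>moment_fps_nth\<close>).
\<close>

section \<open>Closed walks and winding numbers\<close>

fun walk :: "vertex \<Rightarrow> edge list \<Rightarrow> vertex \<Rightarrow> bool" where
  "walk u [] v \<longleftrightarrow> u = v"
| "walk u (e # l) v \<longleftrightarrow> e \<in> lattice_edges \<and> fst e = u \<and> walk (snd e) l v"

lemma walk_append [simp]: "walk u (l @ m) w \<longleftrightarrow> (\<exists>v. walk u l v \<and> walk v m w)"
  by (induction l arbitrary: u) auto

lemma walk_edges: "walk u l v \<Longrightarrow> set l \<subseteq> lattice_edges"
proof (induction l arbitrary: u)
  case (Cons e l)
  then have "set l \<subseteq> lattice_edges" "e \<in> lattice_edges" using Cons.IH[of "snd e"] by simp_all
  then show ?case by simp
qed simp

lemma walk_iff: "walk u l v \<longleftrightarrow> set l \<subseteq> lattice_edges \<and> u # map snd l = map fst l @ [v]"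
  by (induction l arbitrary: u) auto

lemma closed_walk_iff: "closed_walk l \<longleftrightarrow> (\<exists>u. walk u l u)"
proof (cases l)
  case Nil
  then show ?thesis by (simp add: closed_walk_def)
next
  case (Cons e m)
  have "closed_walk l \<longleftrightarrow> set l \<subseteq> lattice_edges \<and> map snd l = rotate1 (map fst l)"
  proof -
    have "map snd l ! i = rotate1 (map fst l) ! i \<longleftrightarrow> snd (l ! i) = fst (l ! (Suc i mod length l))"
      if "i < length l" for i
    proof -
      have "Suc i mod length l < length l" using Cons by (intro mod_less_divisor) simp
      then show ?thesis using that nth_rotate1[of i "map fst l"] by simp
    qed
    then have "map snd l = rotate1 (map fst l) \<longleftrightarrow>
      (\<forall>i<length l. snd (l ! i) = fst (l ! (Suc i mod length l)))"
      by (subst list_eq_iff_nth_eq) simp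
    then show ?thesis unfolding closed_walk_def by blast
  qed
  also have "\<dots> \<longleftrightarrow> (\<exists>u. walk u l u)"
    unfolding walk_iff Cons by auto
  finally show ?thesis .
qed

lemma closed_walk_rotate1: "closed_walk l \<Longrightarrow> closed_walk (rotate1 l)"
  by (cases l) (auto simp: closed_walk_iff)

lemma closed_walk_rotate: "closed_walk l \<Longrightarrow> closed_walk (rotate k l)"
  by (induction k) (auto simp: closed_walk_rotate1)

definition rev_walk :: "edge list \<Rightarrow> edge list" where
  "rev_walk l = rev (map rev_edge l)"

lemma rev_walk_simps [simp]:
  "rev_walk [] = []" "rev_walk (e # l) = rev_walk l @ [rev_edge e]"
  "rev_walk (l @ m) = rev_walk m @ rev_walk l"
  by (auto simp: rev_walk_def)

lemma rev_edge_lattice [simp]: "rev_edge e \<in> lattice_edges \<longleftrightarrow> e \<in> lattice_edges"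
  by (cases e) (auto simp: lattice_edges_def abs_minus_commute)

lemma walk_rev_walk: "walk u l v \<Longrightarrow> walk v (rev_walk l) u"
  by (induction l arbitrary: u) auto

lemma closed_walk_rev_walk: "closed_walk l \<Longrightarrow> closed_walk (rev_walk l)"
  by (auto simp: closed_walk_iff intro: walk_rev_walk)

lemma lattice_edge_cases:
  assumes "e \<in> lattice_edges"
  obtains a b where "e = ((a, b), (a + 1, b))" | a b where "e = ((a + 1, b), (a, b))"
    | a b where "e = ((a, b), (a, b + 1))" | a b where "e = ((a, b + 1), (a, b))"
proof -
  obtain a b a' b' where e: "e = ((a, b), (a', b'))" by (metis surj_pair)
  have "(a' = a + 1 \<and> b' = b) \<or> (a = a' + 1 \<and> b' = b) \<or> (a = a' \<and> b' = b + 1) \<or> (a = a' \<and> b = b' + 1)"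
  proof -
    have "\<bar>a - a'\<bar> + \<bar>b - b'\<bar> = 1" using assms unfolding e lattice_edges_def by simp
    then show ?thesis by (smt (verit))
  qed
  then show ?thesis unfolding e
    using that(1)[of a b] that(2)[of a' b] that(3)[of a b] that(4)[of a b'] e
    by (elim disjE conjE) simp_all
qed

lemma lattice_edges_intros [simp]:
  "((a, b), (a + 1, b)) \<in> lattice_edges" "((a + 1, b), (a, b)) \<in> lattice_edges"
  "((a, b), (a, b + 1)) \<in> lattice_edges" "((a, b + 1), (a, b)) \<in> lattice_edges"
  by (auto simp: lattice_edges_def)

text \<open>
  The square seen on the left when walking along the edge, so that a counterclockwise loop has its
  squares on the left.
\<close>

fun left_square :: "edge \<Rightarrow> vertex" where
  "left_square ((x, y), (x', y')) =
     (if x' = x + 1 then (x, y) else if x' = x - 1 then (x', y - 1)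
      else if y' = y + 1 then (x - 1, y) else (x, y'))"

abbreviation right_square :: "edge \<Rightarrow> vertex" where
  "right_square e \<equiv> left_square (rev_edge e)"

text \<open>
  The contribution of an edge to the winding number around the square \<open>(x, y)\<close>: the vertical ray
  going up from the centre of the square is crossed by horizontal edges only, counted \<open>1\<close> when they
  run westward and \<open>- 1\<close> when they run eastward.
\<close>

fun overhead :: "vertex \<Rightarrow> edge \<Rightarrow> int" where
  "overhead (x, y) ((a, b), (a', b')) =
     (if b = b' \<and> y < b \<and> a = x + 1 \<and> a' = x then 1
      else if b = b' \<and> y < b \<and> a = x \<and> a' = x + 1 then - 1 else 0)"

definition winding :: "edge list \<Rightarrow> vertex \<Rightarrow> int" where
  "winding l s = (\<Sum>e\<leftarrow>l. overhead s e)"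

lemma winding_simps [simp]:
  "winding [] s = 0" "winding (e # l) s = overhead s e + winding l s"
  "winding (l @ m) s = winding l s + winding m s"
  by (auto simp: winding_def)

lemma overhead_rev_edge [simp]: "overhead s (rev_edge e) = - overhead s e"
  by (cases s; cases e) auto

lemma winding_rev_walk [simp]: "winding (rev_walk l) s = - winding l s"
  by (induction l) auto

text \<open>
  This is the boundary of the 2-chain with coefficients \<^term>\<open>winding l\<close>, by
  \<open>passages_eq_winding_jump\<close> below.
\<close>

definition passages :: "edge list \<Rightarrow> edge \<Rightarrow> int" where
  "passages l e = int (count_list l e) - int (count_list l (rev_edge e))"

lemma passages_conv: "passages l e = (\<Sum>e'\<leftarrow>l. of_bool (e' = e) - of_bool (e' = rev_edge e))"
  by (induction l) (auto simp: passages_def)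

lemma walk_telescope:
  fixes f :: "vertex \<Rightarrow> int"
  shows "walk u l v \<Longrightarrow> (\<Sum>e\<leftarrow>l. f (snd e) - f (fst e)) = f v - f u"
  by (induction l arbitrary: u) auto

text \<open>
  For an eastward edge both sides agree edge by edge. For a northward edge the rays above its two
  neighbouring squares are different, and the region above the edge between the two rays is a
  half-line of vertices, whose coboundary is the correction \<open>f\<close>. Along a closed walk
  this correction telescopes to zero.
\<close>

lemma overhead_jump:
  assumes "e \<in> lattice_edges"
  shows "\<exists>f. \<forall>e'\<in>lattice_edges. of_bool (e' = e) - of_bool (e' = rev_edge e) =
    overhead (left_square e) e' - overhead (right_square e) e' + (f (snd e') - f (fst e'))"
proof -
  define P where "P e \<longleftrightarrow> (\<exists>f. \<forall>e'\<in>lattice_edges. of_bool (e' = e) - of_bool (e' = rev_edge e) =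
    overhead (left_square e) e' - overhead (right_square e) e' + (f (snd e') - f (fst e')))" for e
  have east: "P ((a, b), (a + 1, b))" for a b
    unfolding P_def
  proof (intro exI[of _ "\<lambda>_. 0"] ballI)
    fix e' assume "e' \<in> lattice_edges"
    then show "of_bool (e' = ((a, b), (a + 1, b))) - of_bool (e' = rev_edge ((a, b), (a + 1, b))) =
      overhead (left_square ((a, b), (a + 1, b))) e' - overhead (right_square ((a, b), (a + 1, b))) e'
      + (0 - 0)"
      by (cases rule: lattice_edge_cases) (auto simp: of_bool_def split: if_split)
  qed
  have north: "P ((a, b), (a, b + 1))" for a b
    unfolding P_def
  proof (intro exI[of _ "\<lambda>(x, y). if x = a \<and> b < y then 1 else 0"] ballI)
    fix e' assume "e' \<in> lattice_edges"
    then show "of_bool (e' = ((a, b), (a, b + 1))) - of_bool (e' = rev_edge ((a, b), (a, b + 1))) =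
      overhead (left_square ((a, b), (a, b + 1))) e' - overhead (right_square ((a, b), (a, b + 1))) e'
      + ((case snd e' of (x, y) \<Rightarrow> if x = a \<and> b < y then 1 else 0)
         - (case fst e' of (x, y) \<Rightarrow> if x = a \<and> b < y then 1 else 0))"
    proof (cases rule: lattice_edge_cases)
      case (1 c d)
      then show ?thesis by (cases "c = a"; cases "c = a - 1"; cases "b < d") simp_all
    next
      case (2 c d)
      then show ?thesis by (cases "c = a"; cases "c = a - 1"; cases "b < d") simp_all
    next
      case (3 c d)
      then show ?thesis by (cases "c = a"; cases "d = b"; cases "b < d") simp_all
    next
      case (4 c d)
      then show ?thesis by (cases "c = a"; cases "d = b"; cases "b < d") simp_all
    qed
  qed
  have rev: "P (rev_edge e)" if "P e" for e
  proof -
    obtain f where f: "\<forall>e'\<in>lattice_edges. of_bool (e' = e) - of_bool (e' = rev_edge e) =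
      overhead (left_square e) e' - overhead (right_square e) e' + (f (snd e') - f (fst e'))"
      using \<open>P e\<close> unfolding P_def by blast
    then show ?thesis unfolding P_def
    proof (intro exI[of _ "\<lambda>v. - f v"] ballI)
      fix e' assume "e' \<in> lattice_edges"
      then have "of_bool (e' = e) - of_bool (e' = rev_edge e) =
        overhead (left_square e) e' - overhead (right_square e) e' + (f (snd e') - f (fst e'))"
        using f by blast
      then show "of_bool (e' = rev_edge e) - of_bool (e' = rev_edge (rev_edge e)) =
        overhead (left_square (rev_edge e)) e' - overhead (right_square (rev_edge e)) e'
        + (- f (snd e') - - f (fst e'))"
        unfolding swap_swap by linarith
    qed
  qed
  have "P e" using assms
  proof (cases rule: lattice_edge_cases)
    case (2 a b)
    then show ?thesis using rev[OF east[of a b]] by simp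
  next
    case (4 a b)
    then show ?thesis using rev[OF north[of a b]] by simp
  qed (use east north in auto)
  then show ?thesis unfolding P_def .
qed

lemma passages_eq_winding_jump:
  assumes "closed_walk l" "e \<in> lattice_edges"
  shows "passages l e = winding l (left_square e) - winding l (right_square e)"
proof -
  obtain u where u: "walk u l u" using assms(1) by (auto simp: closed_walk_iff)
  obtain f where f: "\<forall>e'\<in>lattice_edges. of_bool (e' = e) - of_bool (e' = rev_edge e) =
      overhead (left_square e) e' - overhead (right_square e) e' + (f (snd e') - f (fst e'))"
    using overhead_jump[OF assms(2)] by blast
  have "passages l e = (\<Sum>e'\<leftarrow>l. overhead (left_square e) e' - overhead (right_square e) e'
      + (f (snd e') - f (fst e')))"
    unfolding passages_conv
    by (rule arg_cong[of _ _ sum_list], rule map_cong[OF refl]) (use walk_edges[OF u] f in blast)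
  also have "\<dots> = winding l (left_square e) - winding l (right_square e)
     + (\<Sum>e'\<leftarrow>l. f (snd e') - f (fst e'))"
    unfolding sum_list_addf sum_list_subtractf winding_def by simp
  also have "(\<Sum>e'\<leftarrow>l. f (snd e') - f (fst e')) = 0" using walk_telescope[OF u, of f] by simp
  finally show ?thesis by simp
qed

lemma winding_above:
  assumes "\<forall>e\<in>set l. snd (fst e) \<le> y"
  shows "winding l (x, y) = 0"
  using assms by (induction l) auto

lemma winding_beside:
  assumes "\<forall>e\<in>set l. fst (fst e) \<le> x \<or> fst (snd e) \<le> x"
    "\<forall>e\<in>set l. fst (fst e) < x + 1 \<and> fst (snd e) < x + 1 "
  shows "winding l (x, y) = 0"
  using assms by (induction l) auto

text \<open>
  Moving the square sideways past the walk changes the winding number only where a vertical edge is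
  crossed, and below the walk there is none. So the square can be moved to where its ray misses the walk.
\<close>

lemma winding_below:
  assumes l: "closed_walk l" and y: "\<forall>e\<in>set l. y < snd (fst e) \<and> y < snd (snd e)"
  shows "winding l (x, y) = 0"
proof -
  define M where "M = Max (insert x ((\<lambda>e. fst (fst e)) ` set l \<union> (\<lambda>e. fst (snd e)) ` set l))"
  have M: "x \<le> M" "\<forall>e\<in>set l. fst (fst e) \<le> M \<and> fst (snd e) \<le> M"
    by (auto simp: M_def intro!: Max_ge)
  have step: "winding l (a, y) = winding l (a + 1, y)" for a
  proof -
    have "passages l ((a + 1, y), (a + 1, y + 1)) = 0"
    proof -
      have "((a + 1, y), (a + 1, y + 1)) \<notin> set l" "((a + 1, y + 1), (a + 1, y)) \<notin> set l"
        using y by force+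
      then show ?thesis by (simp add: passages_def count_notin)
    qed
    then show ?thesis
      using passages_eq_winding_jump[OF l, of "((a + 1, y), (a + 1, y + 1))"] by simp
  qed
  have "winding l (x, y) = winding l (x + int n, y)" for n
  proof (induction n)
    case (Suc n)
    then show ?case using step[of "x + int n"] by (simp add: algebra_simps)
  qed simp
  from this[of "nat (M - x)"] have "winding l (x, y) = winding l (M, y)" using M by simp
  also have "\<dots> = 0" by (rule winding_beside) (use M in auto)
  finally show ?thesis .
qed

text \<open>
  For closed walks without repeated vertices, having no backtrack is the same as traversing no edge in
  both directions. The latter is easier to check when loops are cut and glued.
\<close>

definition simple_cycle :: "edge list \<Rightarrow> bool" where
  "simple_cycle l \<longleftrightarrow> closed_walk l \<and> l \<noteq> [] \<and> distinct (map snd l) \<and>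
     (\<forall>e\<in>set l. rev_edge e \<notin> set l)"

lemma closed_walk_map_snd: "closed_walk l \<Longrightarrow> map snd l = rotate1 (map fst l)"
  by (cases l) (auto simp: closed_walk_iff walk_iff)

lemma simple_cycle_distinct_fst: "simple_cycle l \<Longrightarrow> distinct (map fst l)"
  by (metis closed_walk_map_snd distinct1_rotate simple_cycle_def)

lemma simple_cycle_fst_eq: "simple_cycle l \<Longrightarrow> e \<in> set l \<Longrightarrow> e' \<in> set l \<Longrightarrow> fst e = fst e' \<Longrightarrow> e = e'"
  by (metis distinct_map inj_onD simple_cycle_distinct_fst)

lemma simple_cycle_snd_eq: "simple_cycle l \<Longrightarrow> e \<in> set l \<Longrightarrow> e' \<in> set l \<Longrightarrow> snd e = snd e' \<Longrightarrow> e = e'"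
  by (metis distinct_map inj_onD simple_cycle_def)

lemma simple_cycle_rotate: "simple_cycle l \<Longrightarrow> simple_cycle (rotate k l)"
  by (auto simp: simple_cycle_def closed_walk_rotate rotate_map[symmetric])

lemma simple_cycle_append_commute: "simple_cycle (l @ m) \<Longrightarrow> simple_cycle (m @ l)"
  using simple_cycle_rotate[of "l @ m" "length l"] by (simp add: rotate_append)

lemma simple_loop_imp_simple_cycle:
  assumes "simple_loop l"
  shows "simple_cycle l"
proof -
  have l: "closed_walk l" "l \<noteq> []" "distinct (map snd l)" and nb: "\<not> has_backtrack l"
    using assms by (auto simp: simple_loop_def)
  have "distinct (map fst l)" using l closed_walk_map_snd by fastforce
  have False if e: "e \<in> set l" and re: "rev_edge e \<in> set l" for e
  proof -
    obtain m1 m2 where m: "l = m1 @ e # m2" using e by (meson split_list)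
    have r: "rotate (length m1) l = e # m2 @ m1" by (simp add: m rotate_append)
    have cw: "closed_walk (e # m2 @ m1)" using closed_walk_rotate[OF l(1)] r by metis
    obtain e' \<pi> where \<pi>: "m2 @ m1 = e' # \<pi>"
    proof (cases "m2 @ m1")
      case Nil
      then have "rev_edge e = e" using re m by simp
      then have "fst e = snd e" by (metis fst_swap)
      then have "e \<notin> lattice_edges" by (auto simp: lattice_edges_def)
      then show ?thesis using cw by (auto simp: closed_walk_iff)
    qed
    have "fst e' = fst (rev_edge e)" using cw \<pi> by (auto simp: closed_walk_iff)
    moreover have "e' \<in> set l" using \<pi> m by (metis Un_iff list.set_intros(1) list.set_intros(2) set_append)
    ultimately have "e' = rev_edge e" using \<open>distinct (map fst l)\<close> re
      by (metis distinct_map inj_onD)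
    then have "rotate (length m1) l = e # rev_edge e # \<pi>" using r \<pi> by simp
    then show False using nb unfolding has_backtrack_def by blast
  qed
  then show ?thesis using l by (auto simp: simple_cycle_def)
qed

lemma simple_cycle_rev_walk:
  assumes "simple_cycle l"
  shows "simple_cycle (rev_walk l)"
proof -
  have "map snd (rev_walk l) = rev (map fst l)"
    by (simp add: rev_walk_def rev_map)
  moreover have "set (rev_walk l) = rev_edge ` set l" by (simp add: rev_walk_def)
  ultimately show ?thesis using assms simple_cycle_distinct_fst[OF assms]
    by (auto simp: simple_cycle_def closed_walk_rev_walk simp del: rev_walk_simps)
qed

lemma count_list_distinct: "distinct l \<Longrightarrow> count_list l e = of_bool (e \<in> set l)"
  by (induction l) auto

text \<open>
  Integer functions on squares that are constant on the components of the complement of the walk.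
\<close>

definition jumps_across :: "(vertex \<Rightarrow> int) \<Rightarrow> edge list \<Rightarrow> bool" where
  "jumps_across f l \<longleftrightarrow> (\<forall>e\<in>lattice_edges. e \<notin> set l \<longrightarrow> rev_edge e \<notin> set l \<longrightarrow>
     f (left_square e) = f (right_square e))"

lemma jumps_across_winding: "closed_walk l \<Longrightarrow> jumps_across (winding l) l"
  unfolding jumps_across_def
proof (intro ballI impI)
  fix e assume "closed_walk l" "e \<in> lattice_edges" and e: "e \<notin> set l" "rev_edge e \<notin> set l"
  then have "passages l e = winding l (left_square e) - winding l (right_square e)"
    by (intro passages_eq_winding_jump)
  moreover have "passages l e = 0" using e by (simp add: passages_def count_notin)
  ultimately show "winding l (left_square e) = winding l (right_square e)" by linarith
qed

text \<open>
  The four jumps telescope around the four squares that meet at the vertex.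
\<close>

lemma sum_jumps_at_vertex:
  fixes f :: "vertex \<Rightarrow> int"
  shows "(\<Sum>w\<in>{(a + 1, b), (a - 1, b), (a, b + 1), (a, b - 1)}.
    f (left_square ((a, b), w)) - f (right_square ((a, b), w))) = 0"
  by simp

text \<open>
  At the vertex between two consecutive edges no other edge of a simple cycle is present, so only these
  two jumps contribute to the sum around the vertex.
\<close>

lemma simple_cycle_jump_consecutive:
  assumes l: "simple_cycle l" and f: "jumps_across f l"
    and e: "e \<in> set l" "e' \<in> set l" "snd e = fst e'"
  shows "f (left_square e) - f (right_square e) = f (left_square e') - f (right_square e')"
proof -
  obtain a b where v: "fst e' = (a, b)" by fastforce
  define N where "N = {(a + 1, b), (a - 1, b), (a, b + 1), (a, b - 1)}"
  define d where "d g = f (left_square g) - f (right_square g)" for g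
  have lat: "set l \<subseteq> lattice_edges" using l by (auto simp: simple_cycle_def closed_walk_def)
  have N: "((a, b), w) \<in> lattice_edges \<longleftrightarrow> w \<in> N" for w
    by (cases w) (auto simp: N_def lattice_edges_def abs_if split: if_splits)
  have "e' = ((a, b), snd e')" "rev_edge e = ((a, b), fst e)"
    using v e(3) by (auto simp: prod_eq_iff)
  note ee = this
  have "e' \<in> lattice_edges" "rev_edge e \<in> lattice_edges" using lat e by auto
  then have inN: "snd e' \<in> N" "fst e \<in> N" using N[of "snd e'"] N[of "fst e"] ee by simp_all
  have "rev_edge e \<noteq> e'" using l e(1,2) by (auto simp: simple_cycle_def)
  then have ne: "snd e' \<noteq> fst e" using ee by metis
  have "d ((a, b), w) = 0" if w: "w \<in> N - {snd e', fst e}" for w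
  proof -
    have "((a, b), w) \<notin> set l"
      using simple_cycle_fst_eq[OF l e(2), of "((a, b), w)"] w v by auto
    moreover have "(w, (a, b)) \<notin> set l"
      using simple_cycle_snd_eq[OF l e(1), of "(w, (a, b))"] w v e(3) by auto
    ultimately show ?thesis
      using f w N[of w] by (auto simp: jumps_across_def d_def simp del: left_square.simps)
  qed
  then have "(\<Sum>w\<in>N. d ((a, b), w)) = (\<Sum>w\<in>{snd e', fst e}. d ((a, b), w))"
    by (intro sum.mono_neutral_right) (use inN in \<open>auto simp: N_def\<close>)
  also have "\<dots> = d e' + d (rev_edge e)" using ne ee by simp
  finally have "d e' + d (rev_edge e) = 0"
    using sum_jumps_at_vertex[of f a b] unfolding N_def d_def by linarith
  moreover have "d (rev_edge e) = - d e" by (simp add: d_def del: left_square.simps)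
  ultimately show ?thesis by (simp add: d_def del: left_square.simps)
qed

lemma simple_cycle_const:
  assumes l: "simple_cycle l"
    and d: "\<And>e e'. e \<in> set l \<Longrightarrow> e' \<in> set l \<Longrightarrow> snd e = fst e' \<Longrightarrow> d e = d e'"
    and e: "e \<in> set l" "e' \<in> set l"
  shows "d e = d e'"
proof -
  have *: "i < length l \<Longrightarrow> d (l ! i) = d (l ! 0)" for i
  proof (induction i)
    case (Suc i)
    have "snd (l ! i) = fst (l ! Suc i)"
      using l Suc.prems unfolding simple_cycle_def closed_walk_def by (metis Suc_lessD mod_less)
    then show ?case using d[of "l ! i" "l ! Suc i"] Suc by simp
  qed simp
  then show ?thesis using e by (metis in_set_conv_nth)
qed

text \<open>
  The combinatorial core of the Jordan curve theorem: the jump of \<open>f\<close> is constant along a simple cycle,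
  so a multiple of the winding number has the same jumps, and the difference is constant on the whole
  plane; it vanishes far up.
\<close>

lemma simple_cycle_chain_unique:
  assumes l: "simple_cycle l" and f: "jumps_across f l" and M: "\<And>x y. M \<le> y \<Longrightarrow> f (x, y) = 0"
  shows "\<exists>k. \<forall>s. f s = k * winding l s"
proof -
  define d where "d g = f (left_square g) - f (right_square g)" for g
  have cw: "closed_walk l" using l by (simp add: simple_cycle_def)
  have lat: "set l \<subseteq> lattice_edges" using cw by (simp add: closed_walk_def)
  define k where "k = d (hd l)"
  have hd: "hd l \<in> set l" using l by (simp add: simple_cycle_def)
  have k: "d e = k" if "e \<in> set l" for e
    unfolding k_def using simple_cycle_const[OF l, of d, OF _ that hd]
      simple_cycle_jump_consecutive[OF l f] by (auto simp: d_def simp del: left_square.simps)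
  have dk: "d e = k * passages l e" if e: "e \<in> lattice_edges" for e
  proof -
    have dl: "distinct l" using l by (auto simp: simple_cycle_def distinct_map)
    consider "e \<in> set l" "rev_edge e \<notin> set l" | "rev_edge e \<in> set l" "e \<notin> set l"
      | "e \<notin> set l" "rev_edge e \<notin> set l" using l by (force simp: simple_cycle_def)
    then show ?thesis
    proof cases
      case 1
      then show ?thesis using k dl by (simp add: passages_def count_list_distinct)
    next
      case 2
      then have "d e = - k" using k[of "rev_edge e"] by (simp add: d_def del: left_square.simps)
      then show ?thesis using 2 dl by (simp add: passages_def count_list_distinct)
    next
      case 3
      then have "f (left_square e) = f (right_square e)" using f e unfolding jumps_across_def by blast
      then show ?thesis using 3 by (simp add: passages_def count_notin d_def)
    qed
  qed
  define g where "g s = f s - k * winding l s" for s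
  define M' where "M' = Max (insert M ((\<lambda>e. snd (fst e)) ` set l))"
  have M': "M \<le> M'" "\<forall>e\<in>set l. snd (fst e) \<le> M'" by (auto simp: M'_def)
  have g0: "g (x, y) = 0" if "M' \<le> y" for x y
    using M[of y x] winding_above[of l y x] M' that by (force simp: g_def)
  have step: "g (x, y) = g (x, y + 1)" for x y
  proof -
    have "passages l ((x, y + 1), (x + 1, y + 1)) = winding l (x, y + 1) - winding l (x, y)"
      using passages_eq_winding_jump[OF cw, of "((x, y + 1), (x + 1, y + 1))"] by simp
    then have "d ((x, y + 1), (x + 1, y + 1)) = k * (winding l (x, y + 1) - winding l (x, y))"
      using dk[of "((x, y + 1), (x + 1, y + 1))"] by simp
    then have "f (x, y + 1) - f (x, y) = k * (winding l (x, y + 1) - winding l (x, y))"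
      by (simp add: d_def)
    then show ?thesis by (simp add: g_def right_diff_distrib)
  qed
  have "g (x, y) = g (x, y + int n)" for x y n
  proof (induction n)
    case (Suc n)
    then show ?case using step[of x "y + int n"] by (simp add: algebra_simps)
  qed simp
  from this[of _ _ "nat (M' - y)" for y] have "g (x, y) = 0" for x y
    using g0[of "y + int (nat (M' - y))" x] by simp
  then show ?thesis by (intro exI[of _ k]) (auto simp: g_def)
qed

section \<open>Simple loops and the squares that they enclose\<close>

lemma mem_box_point: "z \<in> box (point (x, y)) (point (x', y')) \<longleftrightarrow>
    of_int x < Re z \<and> Re z < of_int x' \<and> of_int y < Im z \<and> Im z < of_int y'"
  by (auto simp: point_def in_box_complex_iff)

fun closed_square :: "vertex \<Rightarrow> complex set" where
  "closed_square (x, y) = cbox (point (x, y)) (point (x + 1, y + 1))"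

lemma mem_closed_square: "z \<in> closed_square (x, y) \<longleftrightarrow>
    of_int x \<le> Re z \<and> Re z \<le> of_int x + 1 \<and> of_int y \<le> Im z \<and> Im z \<le> of_int y + 1"
  by (auto simp: point_def in_cbox_complex_iff)

abbreviation edge_segment :: "edge \<Rightarrow> complex set" where
  "edge_segment e \<equiv> closed_segment (point (fst e)) (point (snd e))"

lemma edge_segment_horizontal:
  "z \<in> edge_segment ((a, b), (a + 1, b)) \<longleftrightarrow> Im z = of_int b \<and> of_int a \<le> Re z \<and> Re z \<le> of_int a + 1"
  by (simp add: point_def closed_segment_same_Im closed_segment_eq_real_ivl)

lemma edge_segment_vertical:
  "z \<in> edge_segment ((a, b), (a, b + 1)) \<longleftrightarrow> Re z = of_int a \<and> of_int b \<le> Im z \<and> Im z \<le> of_int b + 1"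
  by (simp add: point_def closed_segment_same_Re closed_segment_eq_real_ivl)

lemma edge_segment_cases:
  assumes "e \<in> lattice_edges" "z \<in> edge_segment e"
  obtains a b where "e = ((a, b), (a + 1, b)) \<or> e = ((a + 1, b), (a, b))"
      "Im z = of_int b" "of_int a \<le> Re z" "Re z \<le> of_int a + 1"
    | a b where "e = ((a, b), (a, b + 1)) \<or> e = ((a, b + 1), (a, b))"
      "Re z = of_int a" "of_int b \<le> Im z" "Im z \<le> of_int b + 1"
  using assms(1)
proof (cases rule: lattice_edge_cases)
  case (1 a b)
  then show ?thesis using that(1)[of a b] assms(2) edge_segment_horizontal[of z a b] by simp
next
  case (2 a b)
  then have "z \<in> edge_segment ((a, b), (a + 1, b))" using assms(2) by (simp add: closed_segment_commute)
  then show ?thesis using that(1)[of a b] 2 edge_segment_horizontal[of z a b] by simp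
next
  case (3 a b)
  then show ?thesis using that(2)[of a b] assms(2) edge_segment_vertical[of z a b] by simp
next
  case (4 a b)
  then have "z \<in> edge_segment ((a, b), (a, b + 1))" using assms(2) by (simp add: closed_segment_commute)
  then show ?thesis using that(2)[of a b] 4 edge_segment_vertical[of z a b] by simp
qed

lemma closed_segment_subset_trace: "e \<in> set l \<or> rev_edge e \<in> set l \<Longrightarrow> edge_segment e \<subseteq> loop_trace l"
proof -
  have "edge_segment (rev_edge e) = edge_segment e" by (simp add: closed_segment_commute)
  then show "e \<in> set l \<or> rev_edge e \<in> set l \<Longrightarrow> edge_segment e \<subseteq> loop_trace l"
    unfolding loop_trace_def by blast
qed

lemma compact_loop_trace: "compact (loop_trace l)"
  unfolding loop_trace_def by (intro compact_UN) auto

lemma int_between: "of_int a < (r::real) \<Longrightarrow> r < of_int a + 1 \<Longrightarrow> r \<noteq> of_int k"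
proof
  assume "of_int a < r" "r < of_int a + 1" "r = of_int k"
  then have "real_of_int a < real_of_int k" "real_of_int k < real_of_int (a + 1)" by simp_all
  then show False unfolding of_int_less_iff by linarith
qed

lemma box_disjoint_trace:
  assumes l: "set l \<subseteq> lattice_edges"
  shows "box (point (x, y)) (point (x + 1, y + 1)) \<inter> loop_trace l = {}"
proof -
  have False if "z \<in> box (point (x, y)) (point (x + 1, y + 1))" "e \<in> set l" "z \<in> edge_segment e" for z e
  proof -
    have e: "e \<in> lattice_edges" using that l by auto
    show False using e that(3)
      by (cases rule: edge_segment_cases) (use that(1) int_between[of x "Re z"] int_between[of y "Im z"] in \<open>auto simp: mem_box_point\<close>)
  qed
  then show ?thesis by (auto simp: loop_trace_def)
qed

lemma domino_horizontal_disjoint_trace: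
  assumes l: "set l \<subseteq> lattice_edges" and e: "((x, y), (x + 1, y)) \<notin> set l" "((x + 1, y), (x, y)) \<notin> set l"
  shows "box (point (x, y - 1)) (point (x + 1, y + 1)) \<inter> loop_trace l = {}"
proof -
  have False if z: "z \<in> box (point (x, y - 1)) (point (x + 1, y + 1))" "e \<in> set l" "z \<in> edge_segment e" for z e
  proof -
    have z': "of_int x < Re z" "Re z < of_int x + 1" "of_int y - 1 < Im z" "Im z < of_int y + 1"
      using z(1) by (auto simp: mem_box_point)
    have "e \<in> lattice_edges" using z l by auto
    then show False using z(3)
    proof (cases rule: edge_segment_cases)
      case (1 a b)
      have "real_of_int b < real_of_int (y + 1)" "real_of_int (y - 1) < real_of_int b"
        using 1 z' by auto
      then have "b = y" unfolding of_int_less_iff by linarith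
      moreover have "real_of_int a < real_of_int (x + 1)" "real_of_int x < real_of_int (a + 1)"
        using 1 z' by auto
      then have "a = x" unfolding of_int_less_iff by linarith
      ultimately show ?thesis using 1 e z(2) by auto
    next
      case (2 a b)
      then show ?thesis using z' int_between[of x "Re z" a] by simp
    qed
  qed
  then show ?thesis by (auto simp: loop_trace_def)
qed

lemma domino_vertical_disjoint_trace:
  assumes l: "set l \<subseteq> lattice_edges" and e: "((x, y), (x, y + 1)) \<notin> set l" "((x, y + 1), (x, y)) \<notin> set l"
  shows "box (point (x - 1, y)) (point (x + 1, y + 1)) \<inter> loop_trace l = {}"
proof -
  have False if z: "z \<in> box (point (x - 1, y)) (point (x + 1, y + 1))" "e \<in> set l" "z \<in> edge_segment e" for z e
  proof -
    have z': "of_int x - 1 < Re z" "Re z < of_int x + 1" "of_int y < Im z" "Im z < of_int y + 1"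
      using z(1) by (auto simp: mem_box_point)
    have "e \<in> lattice_edges" using z l by auto
    then show False using z(3)
    proof (cases rule: edge_segment_cases)
      case (1 a b)
      then show ?thesis using z' int_between[of y "Im z" b] by simp
    next
      case (2 a b)
      have "real_of_int a < real_of_int (x + 1)" "real_of_int (x - 1) < real_of_int a"
        using 2 z' by auto
      then have "a = x" unfolding of_int_less_iff by linarith
      moreover have "real_of_int b < real_of_int (y + 1)" "real_of_int y < real_of_int (b + 1)"
        using 2 z' by auto
      then have "b = y" unfolding of_int_less_iff by linarith
      ultimately show ?thesis using 2 e z(2) by auto
    qed
  qed
  then show ?thesis by (auto simp: loop_trace_def)
qed

fun enclosed :: "edge list \<Rightarrow> vertex \<Rightarrow> bool" where
  "enclosed l (x, y) \<longleftrightarrow> box (point (x, y)) (point (x + 1, y + 1)) \<subseteq> inside (loop_trace l)"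

lemma convex_disjoint_inside:
  assumes "convex C" "C \<inter> T = {}" "z \<in> C" "z \<in> inside T"
  shows "C \<subseteq> inside (T :: complex set)"
proof
  fix w assume "w \<in> C"
  then have "connected_component (- T) z w"
    unfolding connected_component_def using assms convex_connected by blast
  then show "w \<in> inside T" using assms inside_same_component by blast
qed

text \<open>
  Both squares lie in a rectangle that the loop does not meet.
\<close>

lemma enclosed_eqI:
  assumes C: "box (point (a, b)) (point (a', b')) \<inter> loop_trace l = {}"
    and s: "a \<le> x" "x + 1 \<le> a'" "b \<le> y" "y + 1 \<le> b'" and t: "a \<le> x'" "x' + 1 \<le> a'" "b \<le> y'" "y' + 1 \<le> b'"
  shows "enclosed l (x, y) = enclosed l (x', y')"
proof -
  have sub: "box (point (x, y)) (point (x + 1, y + 1)) \<subseteq> box (point (a, b)) (point (a', b'))"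
    if "a \<le> x" "x + 1 \<le> a'" "b \<le> y" "y + 1 \<le> b'" for x y
  proof -
    have "real_of_int a \<le> of_int x" "real_of_int (x + 1) \<le> of_int a'"
      "real_of_int b \<le> of_int y" "real_of_int (y + 1) \<le> of_int b'"
      using that by (simp_all only: of_int_le_iff)
    then show ?thesis by (auto simp: mem_box_point)
  qed
  have one: "enclosed l (x', y')" if e: "enclosed l (x, y)"
    and s: "a \<le> x" "x + 1 \<le> a'" "b \<le> y" "y + 1 \<le> b'" and t: "a \<le> x'" "x' + 1 \<le> a'" "b \<le> y'" "y' + 1 \<le> b'"
    for x y x' y'
  proof -
    define z where "z = Complex (of_int x + 1 / 2) (of_int y + 1 / 2)"
    have z: "z \<in> box (point (x, y)) (point (x + 1, y + 1))" by (simp add: mem_box_point z_def)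
    have "box (point (a, b)) (point (a', b')) \<subseteq> inside (loop_trace l)"
      by (rule convex_disjoint_inside[OF convex_box(2) C, of z]) (use z e sub[OF s] in auto)
    then show ?thesis using sub[OF t] by auto
  qed
  show ?thesis using one[OF _ s t] one[OF _ t s] by blast
qed

lemma enclosed_jump:
  assumes l: "set l \<subseteq> lattice_edges"
  shows "jumps_across (\<lambda>s. of_bool (enclosed l s)) l"
  unfolding jumps_across_def
proof (intro ballI impI)
  fix e assume e: "e \<in> lattice_edges" and n: "e \<notin> set l" "rev_edge e \<notin> set l"
  have "enclosed l (left_square e) = enclosed l (right_square e)"
    using e
  proof (cases rule: lattice_edge_cases)
    case (1 a b)
    then show ?thesis using enclosed_eqI[OF domino_horizontal_disjoint_trace[OF l, of a b], of a b a "b - 1"] n by simp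
  next
    case (2 a b)
    then show ?thesis using enclosed_eqI[OF domino_horizontal_disjoint_trace[OF l, of a b], of a b a "b - 1"] n by simp
  next
    case (3 a b)
    then show ?thesis using enclosed_eqI[OF domino_vertical_disjoint_trace[OF l, of a b], of a b "a - 1" b] n by simp
  next
    case (4 a b)
    then show ?thesis using enclosed_eqI[OF domino_vertical_disjoint_trace[OF l, of a b], of a b "a - 1" b] n by simp
  qed
  then show "(of_bool (enclosed l (left_square e)) :: int) = of_bool (enclosed l (right_square e))" by simp
qed

lemma bounded_complex_coords:
  assumes "bounded (A :: complex set)"
  obtains m :: int where "\<And>z. z \<in> A \<Longrightarrow> \<bar>Re z\<bar> < of_int m \<and> \<bar>Im z\<bar> < of_int m"
proof -
  obtain B where B: "\<And>z. z \<in> A \<Longrightarrow> cmod z \<le> B" using assms by (auto simp: bounded_iff)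
  obtain m :: int where m: "B < of_int m" using ex_less_of_int by blast
  show ?thesis
  proof (rule that[of m])
    fix z assume "z \<in> A"
    then show "\<bar>Re z\<bar> < of_int m \<and> \<bar>Im z\<bar> < of_int m"
      using B[of z] m abs_Re_le_cmod[of z] abs_Im_le_cmod[of z] by linarith
  qed
qed

lemma enclosed_bound: "\<exists>m. \<forall>x y. enclosed l (x, y) \<longrightarrow> \<bar>x\<bar> < m \<and> \<bar>y\<bar> < m"
proof -
  have "bounded (inside (loop_trace l))"
    by (intro bounded_inside compact_imp_bounded compact_loop_trace)
  then obtain m where m: "\<And>z. z \<in> inside (loop_trace l) \<Longrightarrow> \<bar>Re z\<bar> < of_int m \<and> \<bar>Im z\<bar> < of_int m"
    using bounded_complex_coords by blast
  have "\<bar>x\<bar> < m + 1 \<and> \<bar>y\<bar> < m + 1" if "enclosed l (x, y)" for x y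
  proof -
    define z where "z = Complex (of_int x + 1 / 2) (of_int y + 1 / 2)"
    have "z \<in> box (point (x, y)) (point (x + 1, y + 1))" by (simp add: mem_box_point z_def)
    then have "\<bar>of_int x + 1 / 2 :: real\<bar> < of_int m" "\<bar>of_int y + 1 / 2 :: real\<bar> < of_int m"
      using m[of z] that by (auto simp: z_def)
    then show ?thesis by linarith
  qed
  then show ?thesis by blast
qed

lemma finite_enclosed: "finite {s. enclosed l s}"
proof -
  obtain m where m: "\<And>x y. enclosed l (x, y) \<Longrightarrow> \<bar>x\<bar> < m \<and> \<bar>y\<bar> < m"
    using enclosed_bound by blast
  have "{s. enclosed l s} \<subseteq> {-m..m} \<times> {-m..m}"
  proof
    fix s assume "s \<in> {s. enclosed l s}"
    then show "s \<in> {-m..m} \<times> {-m..m}" using m[of "fst s" "snd s"] by (cases s) auto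
  qed
  then show ?thesis by (rule finite_subset) auto
qed

lemma winding_finite_support:
  assumes l: "closed_walk l"
  shows "\<exists>m. \<forall>x y. winding l (x, y) \<noteq> 0 \<longrightarrow> \<bar>x\<bar> < m \<and> \<bar>y\<bar> < m"
proof -
  define C where "C = insert 0 ((\<lambda>e. \<bar>fst (fst e)\<bar>) ` set l \<union> (\<lambda>e. \<bar>snd (fst e)\<bar>) ` set l
     \<union> (\<lambda>e. \<bar>fst (snd e)\<bar>) ` set l \<union> (\<lambda>e. \<bar>snd (snd e)\<bar>) ` set l)"
  define m where "m = Max C"
  have fin: "finite C" by (simp add: C_def)
  have m: "\<bar>fst (fst e)\<bar> \<le> m" "\<bar>snd (fst e)\<bar> \<le> m" "\<bar>fst (snd e)\<bar> \<le> m" "\<bar>snd (snd e)\<bar> \<le> m"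
    if "e \<in> set l" for e
    unfolding m_def by (rule Max_ge[OF fin]; use that in \<open>auto simp: C_def\<close>)+
  have "\<bar>x\<bar> < m + 2 \<and> \<bar>y\<bar> < m + 2" if w: "winding l (x, y) \<noteq> 0" for x y
  proof -
    have "\<not> y > m"
    proof
      assume "y > m"
      then have "\<forall>e\<in>set l. snd (fst e) \<le> y" using m(2) by (meson abs_le_D1 less_imp_le order.trans)
      then show False using w winding_above by blast
    qed
    moreover have "\<not> y < - m - 1"
    proof
      assume y: "y < - m - 1"
      have "winding l (x, y) = 0"
      proof (rule winding_below[OF l], intro ballI conjI)
        fix e assume "e \<in> set l"
        then show "y < snd (fst e)" "y < snd (snd e)" using m(2)[of e] m(4)[of e] y by linarith+
      qed
      then show False using w by simp
    qed
    moreover have "winding l (x, y) = 0" if "m < x \<or> x < - m - 1"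
    proof -
      have "overhead (x, y) e = 0" if "e \<in> set l" for e
        using m(1)[OF that] m(3)[OF that] \<open>m < x \<or> x < - m - 1\<close> by (cases e) auto
      then have "map (overhead (x, y)) l = map (\<lambda>_. 0) l" by (intro map_cong refl)
      then have "winding l (x, y) = (\<Sum>_\<leftarrow>l. 0)" unfolding winding_def by (rule arg_cong)
      then show ?thesis by simp
    qed
    ultimately show ?thesis using w by fastforce
  qed
  then show ?thesis by blast
qed

text \<open>
  Two squares with a common point off the trace are connected through edges that contain this point,
  and the walk uses none of them.
\<close>

lemma winding_unique_off_trace:
  assumes l: "closed_walk l" and z: "z \<notin> loop_trace l" "z \<in> closed_square s" "z \<in> closed_square t"
  shows "winding l s = winding l t"
proof -
  have jump: "e \<in> lattice_edges \<Longrightarrow> z \<in> edge_segment e \<Longrightarrow> winding l (left_square e) = winding l (right_square e)" for e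
    using jumps_across_winding[OF l] closed_segment_subset_trace[of e l] z(1)
    unfolding jumps_across_def by blast
  have hor: "winding l (x, y) = winding l (x + 1, y)"
    if "z \<in> closed_square (x, y)" "z \<in> closed_square (x + 1, y)" for x y
  proof -
    have "z \<in> edge_segment ((x + 1, y), (x + 1, y + 1))"
      using that unfolding edge_segment_vertical mem_closed_square by simp
    then show ?thesis using jump[of "((x + 1, y), (x + 1, y + 1))"] by simp
  qed
  have ver: "winding l (x, y) = winding l (x, y + 1)"
    if "z \<in> closed_square (x, y)" "z \<in> closed_square (x, y + 1)" for x y
  proof -
    have "z \<in> edge_segment ((x, y + 1), (x + 1, y + 1))"
      using that unfolding edge_segment_horizontal mem_closed_square by simp
    then show ?thesis using jump[of "((x, y + 1), (x + 1, y + 1))"] by simp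
  qed
  obtain x y x' y' where st: "s = (x, y)" "t = (x', y')" by (metis surj_pair)
  have zs: "z \<in> closed_square (x, y)" "z \<in> closed_square (x', y')" using z st by auto
  have cl: "a = b \<or> b = a + 1 \<or> a = b + 1" if "of_int a \<le> r" "r \<le> of_int a + 1" "of_int b \<le> r" "r \<le> of_int b + 1" for a b and r :: real
    using that by linarith
  have "x = x' \<or> x' = x + 1 \<or> x = x' + 1"
    by (rule cl[of _ "Re z"]) (use zs in \<open>auto simp: mem_closed_square simp del: closed_square.simps\<close>)
  moreover have "y = y' \<or> y' = y + 1 \<or> y = y' + 1"
    by (rule cl[of _ "Im z"]) (use zs in \<open>auto simp: mem_closed_square simp del: closed_square.simps\<close>)
  moreover have mid: "z \<in> closed_square (x', y)" using zs unfolding mem_closed_square by simp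
  ultimately have "winding l (x, y) = winding l (x', y)" "winding l (x', y) = winding l (x', y')"
    using hor[of x y] hor[of x' y] ver[of x' y] ver[of x' y'] zs
    by (metis, metis)
  then show ?thesis unfolding st by (rule trans)
qed

lemma floor_square: "z \<in> closed_square (\<lfloor>Re z\<rfloor>, \<lfloor>Im z\<rfloor>)"
  unfolding mem_closed_square by linarith

text \<open>
  The closed squares with nonzero winding number cover a bounded set \<open>U\<close>, the others together with the
  outside of a large box a closed set \<open>T\<close>; away from the trace they are disjoint. So the
  component of a point of \<open>U\<close> stays in \<open>U\<close> and is bounded.
\<close>

lemma winding_imp_inside:
  assumes l: "closed_walk l" and w: "winding l (x, y) \<noteq> 0"
  shows "enclosed l (x, y)"
proof -
  obtain m where m: "\<And>x y. winding l (x, y) \<noteq> 0 \<Longrightarrow> \<bar>x\<bar> < m \<and> \<bar>y\<bar> < m"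
    using winding_finite_support[OF l] by blast
  define B where "B = {-m-1..m+1} \<times> {-m-1..m+1}"
  define U where "U = (\<Union>s\<in>{s\<in>B. winding l s \<noteq> 0}. closed_square s)"
  define T where "T = (\<Union>s\<in>{s\<in>B. winding l s = 0}. closed_square s)
     \<union> - box (point (-m-1, -m-1)) (point (m+1, m+1))"
  have finB: "finite B" by (simp add: B_def)
  have csq: "closed (closed_square s)" "bounded (closed_square s)" for s
    by (cases s, simp only: closed_square.simps closed_cbox bounded_cbox)+
  have clU: "closed U" unfolding U_def using finB csq by (intro closed_UN) auto
  have bdU: "bounded U" unfolding U_def using finB csq by (intro bounded_UN) auto
  have clT: "closed T" unfolding T_def using finB csq
    by (intro closed_Un closed_UN) (auto simp: open_box)
  have inB: "s \<in> B" if "winding l s \<noteq> 0" for s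
    using m[of "fst s" "snd s"] that by (cases s) (auto simp: B_def)
  have cover: "UNIV \<subseteq> U \<union> T"
  proof
    fix z :: complex
    define s where "s = (\<lfloor>Re z\<rfloor>, \<lfloor>Im z\<rfloor>)"
    have zs: "z \<in> closed_square s" unfolding s_def by (rule floor_square)
    show "z \<in> U \<union> T"
    proof (cases "s \<in> B")
      case True
      then show ?thesis using zs unfolding U_def T_def by blast
    next
      case False
      then have "z \<notin> box (point (-m-1, -m-1)) (point (m+1, m+1))"
        unfolding mem_box_point B_def s_def by (auto simp: le_floor_iff floor_le_iff not_le)
      then show ?thesis by (simp add: T_def)
    qed
  qed
  have disj: "U \<inter> T \<inter> - loop_trace l = {}"
  proof -
    have False if zU: "z \<in> U" and zT: "z \<in> T" and z: "z \<notin> loop_trace l" for z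
    proof -
      obtain s where s: "winding l s \<noteq> 0" "z \<in> closed_square s" using zU by (auto simp: U_def)
      obtain a b where ab: "s = (a, b)" by fastforce
      have "\<bar>a\<bar> < m" "\<bar>b\<bar> < m" using m s ab by blast+
      then have "real_of_int (-m) \<le> of_int a" "real_of_int (a + 1) \<le> of_int m"
        "real_of_int (-m) \<le> of_int b" "real_of_int (b + 1) \<le> of_int m"
        unfolding of_int_le_iff by linarith+
      then have "z \<in> box (point (-m-1, -m-1)) (point (m+1, m+1))"
        using s(2) unfolding ab mem_closed_square mem_box_point by simp
      then obtain t where "winding l t = 0" "z \<in> closed_square t" using zT by (auto simp: T_def)
      then show False using winding_unique_off_trace[OF l z s(2)] s(1) by metis
    qed
    then show ?thesis by blast
  qed
  show ?thesis
    unfolding enclosed.simps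
  proof
    fix z assume z: "z \<in> box (point (x, y)) (point (x + 1, y + 1))"
    have nt: "z \<notin> loop_trace l"
      using box_disjoint_trace[of l x y] l z by (auto simp: closed_walk_def)
    define C where "C = connected_component_set (- loop_trace l) z"
    have conC: "connected C" and subC: "C \<subseteq> - loop_trace l" and zC: "z \<in> C"
      using nt connected_component_subset by (auto simp: C_def connected_connected_component)
    have "z \<in> closed_square (x, y)" using z unfolding mem_box_point mem_closed_square by simp
    then have zU: "z \<in> U" using w inB by (auto simp: U_def simp del: closed_square.simps)
    have "T \<inter> C = {}"
    proof (rule ccontr)
      assume "T \<inter> C \<noteq> {}"
      moreover have "U \<inter> C \<noteq> {}" using zU zC by blast
      moreover have "C \<subseteq> U \<union> T" "U \<inter> T \<inter> C = {}" using cover disj subC by auto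
      ultimately show False using conC clU clT unfolding connected_closed by blast
    qed
    then have "C \<subseteq> U" using cover by blast
    then have "bounded C" using bdU bounded_subset by blast
    then show "z \<in> inside (loop_trace l)" using nt by (simp add: inside_def C_def)
  qed
qed

text \<open>
  The indicator of the enclosed squares jumps only across the loop, hence is a multiple of the winding
  number. The factor is a sign because the winding number takes a nonzero value, on an enclosed square.
\<close>

lemma simple_cycle_winding:
  assumes l: "simple_cycle l"
  obtains k :: int where "k = 1 \<or> k = -1" "\<And>s. of_bool (enclosed l s) = k * winding l s"
proof -
  have cw: "closed_walk l" using l by (simp add: simple_cycle_def)
  have lat: "set l \<subseteq> lattice_edges" using cw by (simp add: closed_walk_def)
  obtain m where m: "\<And>x y. enclosed l (x, y) \<Longrightarrow> \<bar>x\<bar> < m \<and> \<bar>y\<bar> < m"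
    using enclosed_bound by blast
  have M: "of_bool (enclosed l (x, y)) = (0::int)" if "m \<le> y" for x y
    using m[of x y] that by fastforce
  obtain k :: int where k: "\<forall>s. of_bool (enclosed l s) = k * winding l s"
    using simple_cycle_chain_unique[OF l enclosed_jump[OF lat] M] by blast
  define e where "e = hd l"
  have e: "e \<in> set l" "rev_edge e \<notin> set l" "e \<in> lattice_edges"
    using l lat by (auto simp: e_def simple_cycle_def)
  have "distinct l" using l by (auto simp: simple_cycle_def distinct_map)
  then have "passages l e = 1" using e by (simp add: passages_def count_list_distinct)
  then have "winding l (left_square e) \<noteq> 0 \<or> winding l (right_square e) \<noteq> 0"
    using passages_eq_winding_jump[OF cw e(3)] by linarith
  then obtain s where s: "winding l s \<noteq> 0" by blast
  then have "enclosed l s" using winding_imp_inside[OF cw] by (cases s) blast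
  then have "k * winding l s = 1" using k by (metis of_bool_eq(2))
  then have "k = 1 \<or> k = -1" by (metis zmult_eq_1_iff)
  then show ?thesis using k that by blast
qed

lemma loop_area_eq: "loop_area l = card {s. enclosed l s}"
proof -
  have "{(x, y). box (point (x, y)) (point (x + 1, y + 1)) \<subseteq> inside (loop_trace l)} = {s. enclosed l s}"
    by auto
  then show ?thesis by (simp add: loop_area_def)
qed

section \<open>Convolution of class functions on a group with invariant measure\<close>

text \<open>
  Bounded measurable functions. All integrands below are of this kind, so that integrability and
  Fubini's theorem come for free.
\<close>

definition bdm :: "'a measure \<Rightarrow> ('a \<Rightarrow> complex) \<Rightarrow> bool" where
  "bdm M f \<longleftrightarrow> f \<in> borel_measurable M \<and> (\<exists>B. \<forall>x\<in>space M. cmod (f x) \<le> B)"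

lemma bdm_measurable: "bdm M f \<Longrightarrow> f \<in> borel_measurable M"
  by (simp add: bdm_def)

lemma bdm_integrable:
  assumes "finite_measure M" "bdm M f"
  shows "integrable M f"
proof -
  obtain B where "\<forall>x\<in>space M. cmod (f x) \<le> B" using assms by (auto simp: bdm_def)
  then show ?thesis
    using assms by (intro finite_measure.integrable_const_bound[where B = B]) (auto simp: bdm_def)
qed

lemma bdm_const [simp]: "bdm M (\<lambda>_. c)"
  by (auto simp: bdm_def)

lemma bdm_mult: "bdm M f \<Longrightarrow> bdm M g \<Longrightarrow> bdm M (\<lambda>x. f x * g x)"
proof -
  assume "bdm M f" "bdm M g"
  then obtain A B where "f \<in> borel_measurable M" "g \<in> borel_measurable M"
    and A: "\<forall>x\<in>space M. cmod (f x) \<le> A" and B: "\<forall>x\<in>space M. cmod (g x) \<le> B"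
    by (auto simp: bdm_def)
  moreover have "\<forall>x\<in>space M. cmod (f x * g x) \<le> A * B"
    using A B by (auto simp: norm_mult intro!: mult_mono intro: order_trans[OF norm_ge_zero])
  ultimately show ?thesis by (auto simp: bdm_def)
qed

lemma bdm_prod: "(\<And>i. i \<in> T \<Longrightarrow> bdm M (f i)) \<Longrightarrow> bdm M (\<lambda>x. \<Prod>i\<in>T. f i x)"
  by (induction T rule: infinite_finite_induct) (auto intro: bdm_mult)

lemma bdm_compose: "bdm N f \<Longrightarrow> h \<in> measurable M N \<Longrightarrow> bdm M (\<lambda>x. f (h x))"
  unfolding bdm_def by (metis measurable_compose measurable_space)

lemma bdm_cong: "bdm M f \<Longrightarrow> (\<And>x. x \<in> space M \<Longrightarrow> f x = g x) \<Longrightarrow> bdm M g"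
  unfolding bdm_def by (metis measurable_cong)

lemma bdm_lebesgue_integral:
  assumes "prob_space M" "bdm (N \<Otimes>\<^sub>M M) (\<lambda>(x, y). f x y)"
  shows "bdm N (\<lambda>x. \<integral>y. f x y \<partial>M)"
proof -
  interpret prob_space M by fact
  obtain B where B: "\<And>x y. x \<in> space N \<Longrightarrow> y \<in> space M \<Longrightarrow> cmod (f x y) \<le> B"
    using assms(2) by (auto simp: bdm_def space_pair_measure)
  have m: "(\<lambda>(x, y). f x y) \<in> borel_measurable (N \<Otimes>\<^sub>M M)" using assms(2) by (simp add: bdm_def)
  have "cmod (\<integral>y. f x y \<partial>M) \<le> B" if x: "x \<in> space N" for x
  proof -
    have fx: "(\<lambda>y. f x y) \<in> borel_measurable M"
      using measurable_compose[OF measurable_Pair1'[OF x] m] by simp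
    have "integrable M (\<lambda>y. f x y)"
      by (rule integrable_const_bound[where B = B]) (use B x fx in auto)
    then have "cmod (\<integral>y. f x y \<partial>M) \<le> (\<integral>y. B \<partial>M)"
      by (intro order_trans[OF integral_norm_bound] integral_mono) (use B x in auto)
    then show ?thesis by (simp add: prob_space)
  qed
  moreover have "(\<lambda>x. \<integral>y. f x y \<partial>M) \<in> borel_measurable N"
    using m by (rule borel_measurable_lebesgue_integral)
  ultimately show ?thesis by (auto simp: bdm_def)
qed

locale haar_group = group G + prob_space H
  for G :: "('g, 'more) monoid_scheme" (structure) and H :: "'g measure" +
  assumes space_H: "space H = carrier G"
    and mult_measurable: "(\<lambda>(x, y). x \<otimes> y) \<in> measurable (H \<Otimes>\<^sub>M H) H"
    and inv_measurable: "m_inv G \<in> measurable H H"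
    and left_invariant: "x \<in> carrier G \<Longrightarrow> distr H H (\<lambda>y. x \<otimes> y) = H"
begin

lemma measurable_const_H: "x \<in> carrier G \<Longrightarrow> (\<lambda>_. x) \<in> measurable M H"
  by (simp add: space_H)

lemma measurable_mult_H:
  "f \<in> measurable M H \<Longrightarrow> g \<in> measurable M H \<Longrightarrow> (\<lambda>z. f z \<otimes> g z) \<in> measurable M H"
  using measurable_compose[OF measurable_Pair mult_measurable] by simp

lemma measurable_inv_H: "f \<in> measurable M H \<Longrightarrow> (\<lambda>z. inv (f z)) \<in> measurable M H"
  by (rule measurable_compose[OF _ inv_measurable])

lemmas meas_H = measurable_const_H measurable_mult_H measurable_inv_H

lemma integral_left:
  fixes f :: "'g \<Rightarrow> complex"
  assumes x: "x \<in> carrier G" and f: "f \<in> borel_measurable H"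
  shows "(\<integral>y. f (x \<otimes> y) \<partial>H) = (\<integral>y. f y \<partial>H)"
proof -
  have "(\<integral>y. f y \<partial>H) = (\<integral>y. f y \<partial>distr H H (\<lambda>y. x \<otimes> y))" by (simp add: left_invariant x)
  also have "\<dots> = (\<integral>y. f (x \<otimes> y) \<partial>H)"
    by (intro integral_distr meas_H x f measurable_ident) simp
  finally show ?thesis ..
qed

lemma nn_integral_left:
  assumes x: "x \<in> carrier G" and f: "f \<in> borel_measurable H"
  shows "(\<integral>\<^sup>+y. f (x \<otimes> y) \<partial>H) = (\<integral>\<^sup>+y. f y \<partial>H)"
proof -
  have "(\<integral>\<^sup>+y. f y \<partial>H) = (\<integral>\<^sup>+y. f y \<partial>distr H H (\<lambda>y. x \<otimes> y))" by (simp add: left_invariant x)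
  also have "\<dots> = (\<integral>\<^sup>+y. f (x \<otimes> y) \<partial>H)"
    by (intro nn_integral_distr meas_H x) (use f in auto)
  finally show ?thesis ..
qed

text \<open>
  Average \<open>indicator A (inv x * y)\<close> over both variables. By left invariance in \<open>y\<close> the result is the
  measure of \<open>A\<close>; replacing \<open>x\<close> by \<open>y * x\<close> it is the measure of the inverse of \<open>A\<close>.
\<close>

lemma inv_invariant: "distr H H (m_inv G) = H"
proof (rule measure_eqI)
  fix A assume "A \<in> sets (distr H H (m_inv G))"
  then have A: "A \<in> sets H" by simp
  interpret P: pair_prob_space H H ..
  have i: "(indicator A :: 'g \<Rightarrow> ennreal) \<in> borel_measurable H" using A by simp
  have pm: "(\<lambda>(x, y). indicator A (inv x \<otimes> y) :: ennreal) \<in> borel_measurable (H \<Otimes>\<^sub>M H)"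
    using measurable_compose[OF measurable_mult_H[OF measurable_inv_H[OF measurable_fst] measurable_snd] i]
    by (simp add: split_beta)
  have "emeasure H A = (\<integral>\<^sup>+x. emeasure H A \<partial>H)" by (simp add: emeasure_space_1)
  also have "\<dots> = (\<integral>\<^sup>+x. \<integral>\<^sup>+y. indicator A (inv x \<otimes> y) \<partial>H \<partial>H)"
    by (intro nn_integral_cong) (subst nn_integral_left[OF _ i], auto simp: space_H A)
  also have "\<dots> = (\<integral>\<^sup>+y. \<integral>\<^sup>+x. indicator A (inv x \<otimes> y) \<partial>H \<partial>H)"
    using P.Fubini'[OF pm] by simp
  also have "\<dots> = (\<integral>\<^sup>+y. \<integral>\<^sup>+x. indicator A (inv x) \<partial>H \<partial>H)"
  proof (rule nn_integral_cong)
    fix y assume "y \<in> space H"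
    then have y: "y \<in> carrier G" by (simp add: space_H)
    have m: "(\<lambda>x. indicator A (inv x \<otimes> y) :: ennreal) \<in> borel_measurable H"
      by (rule measurable_compose[OF _ i]) (intro meas_H y measurable_ident, simp)
    have "(\<integral>\<^sup>+x. indicator A (inv x \<otimes> y) \<partial>H) = (\<integral>\<^sup>+x. indicator A (inv (y \<otimes> x) \<otimes> y) \<partial>H)"
      using nn_integral_left[OF y m] by simp
    also have "\<dots> = (\<integral>\<^sup>+x. indicator A (inv x) \<partial>H)"
      by (intro nn_integral_cong) (use y in \<open>simp add: space_H inv_mult_group m_assoc\<close>)
    finally show "(\<integral>\<^sup>+x. indicator A (inv x \<otimes> y) \<partial>H) = (\<integral>\<^sup>+x. indicator A (inv x) \<partial>H)" .
  qed
  also have "\<dots> = (\<integral>\<^sup>+x. indicator A (inv x) \<partial>H)" by (simp add: emeasure_space_1)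
  also have "\<dots> = (\<integral>\<^sup>+x. indicator A x \<partial>distr H H (m_inv G))"
    by (rule nn_integral_distr[symmetric, OF inv_measurable]) (use i in simp)
  also have "\<dots> = emeasure (distr H H (m_inv G)) A" using A by simp
  finally show "emeasure (distr H H (m_inv G)) A = emeasure H A" ..
qed simp

lemma integral_inv:
  fixes f :: "'g \<Rightarrow> complex"
  assumes f: "f \<in> borel_measurable H"
  shows "(\<integral>y. f (inv y) \<partial>H) = (\<integral>y. f y \<partial>H)"
proof -
  have "(\<integral>y. f y \<partial>H) = (\<integral>y. f y \<partial>distr H H (m_inv G))" by (simp add: inv_invariant)
  also have "\<dots> = (\<integral>y. f (inv y) \<partial>H)"
    by (intro integral_distr inv_measurable f)
  finally show ?thesis ..
qed

lemma integral_right: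
  fixes f :: "'g \<Rightarrow> complex"
  assumes x: "x \<in> carrier G" and f: "f \<in> borel_measurable H"
  shows "(\<integral>y. f (y \<otimes> x) \<partial>H) = (\<integral>y. f y \<partial>H)"
proof -
  have m: "(\<lambda>y. f (inv y)) \<in> borel_measurable H" by (rule measurable_compose[OF inv_measurable f])
  have m2: "(\<lambda>y. f (y \<otimes> x)) \<in> borel_measurable H"
    by (rule measurable_compose[OF _ f]) (intro meas_H x measurable_ident, simp)
  have "(\<integral>y. f (y \<otimes> x) \<partial>H) = (\<integral>y. f (inv y \<otimes> x) \<partial>H)" using integral_inv[OF m2] by simp
  also have "\<dots> = (\<integral>y. f (inv (inv x \<otimes> y)) \<partial>H)"
    by (intro Bochner_Integration.integral_cong) (use x in \<open>auto simp: space_H inv_mult_group\<close>)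
  also have "\<dots> = (\<integral>y. f (inv y) \<partial>H)" using integral_left[OF inv_closed[OF x] m] by simp
  also have "\<dots> = (\<integral>y. f y \<partial>H)" by (rule integral_inv[OF f])
  finally show ?thesis .
qed

definition cv :: "('g \<Rightarrow> complex) \<Rightarrow> ('g \<Rightarrow> complex) \<Rightarrow> 'g \<Rightarrow> complex" where
  "cv f g x = (\<integral>y. f (x \<otimes> inv y) * g y \<partial>H)"

lemma bdm_cv:
  assumes "bdm H f" "bdm H g"
  shows "bdm H (cv f g)"
proof -
  have "bdm H (\<lambda>x. \<integral>y. f (x \<otimes> inv y) * g y \<partial>H)"
    by (rule bdm_lebesgue_integral[OF prob_space_axioms], unfold split_beta)
      (intro bdm_mult bdm_compose[OF assms(1)] bdm_compose[OF assms(2)] meas_H measurable_fst measurable_snd)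
  then show ?thesis by (simp add: cv_def[abs_def])
qed

text \<open>
  Right invariance removes \<open>y\<close> from the second factor. This computes the integral over one
  edge variable that occurs, inverted, in one of two weights and directly in the other.
\<close>

lemma integral_two_factors:
  assumes f: "bdm H f" and g: "bdm H g" and x: "x \<in> carrier G" "y \<in> carrier G"
  shows "(\<integral>u. f (x \<otimes> inv u) * g (u \<otimes> y) \<partial>H) = cv f g (x \<otimes> y)"
proof -
  have m: "(\<lambda>u. f (x \<otimes> inv u) * g (u \<otimes> y)) \<in> borel_measurable H"
    by (intro bdm_measurable bdm_mult bdm_compose[OF f] bdm_compose[OF g] meas_H x measurable_ident) auto
  have "(\<integral>u. f (x \<otimes> inv u) * g (u \<otimes> y) \<partial>H)
     = (\<integral>u. f (x \<otimes> inv (u \<otimes> inv y)) * g (u \<otimes> inv y \<otimes> y) \<partial>H)"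
    using integral_right[OF inv_closed[OF x(2)] m] by simp
  also have "\<dots> = cv f g (x \<otimes> y)" unfolding cv_def
    by (intro Bochner_Integration.integral_cong) (use x in \<open>auto simp: space_H inv_mult_group m_assoc\<close>)
  finally show ?thesis .
qed

lemma cv_assoc:
  assumes f: "bdm H f" and g: "bdm H g" and h: "bdm H h" and x: "x \<in> carrier G"
  shows "cv (cv f g) h x = cv f (cv g h) x"
proof -
  interpret P: pair_prob_space H H ..
  have pm: "bdm (H \<Otimes>\<^sub>M H) (\<lambda>(z, y). f (x \<otimes> inv z) * (g (z \<otimes> inv y) * h y))"
    unfolding split_beta
    by (intro bdm_mult bdm_compose[OF f] bdm_compose[OF g] bdm_compose[OF h] meas_H x measurable_fst measurable_snd)
  have "cv f (cv g h) x = (\<integral>z. \<integral>y. f (x \<otimes> inv z) * (g (z \<otimes> inv y) * h y) \<partial>H \<partial>H)"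
    unfolding cv_def
    by (simp add: integral_mult_right_zero)
  also have "\<dots> = (\<integral>y. \<integral>z. f (x \<otimes> inv z) * (g (z \<otimes> inv y) * h y) \<partial>H \<partial>H)"
    by (rule P.Fubini_integral[symmetric]) (rule bdm_integrable[OF P.finite_measure_axioms pm])
  also have "\<dots> = (\<integral>y. cv f g (x \<otimes> inv y) * h y \<partial>H)"
  proof (intro Bochner_Integration.integral_cong refl)
    fix y assume "y \<in> space H"
    then have y: "y \<in> carrier G" by (simp add: space_H)
    have "(\<integral>z. f (x \<otimes> inv z) * (g (z \<otimes> inv y) * h y) \<partial>H)
       = (\<integral>z. f (x \<otimes> inv z) * g (z \<otimes> inv y) \<partial>H) * h y"
      by (simp flip: integral_mult_left_zero mult.assoc)
    then show "(\<integral>z. f (x \<otimes> inv z) * (g (z \<otimes> inv y) * h y) \<partial>H) = cv f g (x \<otimes> inv y) * h y"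
      using integral_two_factors[OF f g x inv_closed[OF y]] by simp
  qed
  finally show ?thesis by (simp add: cv_def)
qed

end

definition (in group) class_fun :: "('a \<Rightarrow> complex) \<Rightarrow> bool" where
  "class_fun f \<longleftrightarrow> (\<forall>x\<in>carrier G. \<forall>y\<in>carrier G. f (x \<otimes> y) = f (y \<otimes> x))"

context haar_group begin

lemma class_fun_conj:
  assumes "class_fun f" "x \<in> carrier G" "u \<in> carrier G"
  shows "f (u \<otimes> x \<otimes> inv u) = f x"
proof -
  have "f (u \<otimes> x \<otimes> inv u) = f (inv u \<otimes> (u \<otimes> x))" using assms by (simp add: class_fun_def)
  then show ?thesis using assms by (simp add: m_assoc[symmetric])
qed

lemma class_fun_cv:
  assumes f: "bdm H f" "class_fun f" and g: "bdm H g" "class_fun g"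
  shows "class_fun (cv f g)"
proof -
  have conj: "cv f g (u \<otimes> x \<otimes> inv u) = cv f g x" if u: "u \<in> carrier G" and x: "x \<in> carrier G" for u x
  proof -
    have m: "(\<lambda>y. f (u \<otimes> x \<otimes> inv u \<otimes> inv y) * g y) \<in> borel_measurable H"
      "(\<lambda>y. f (u \<otimes> x \<otimes> inv u \<otimes> inv (u \<otimes> y)) * g (u \<otimes> y)) \<in> borel_measurable H"
      by (intro bdm_measurable bdm_mult bdm_compose[OF f(1)] bdm_compose[OF g(1)] g(1) meas_H u x measurable_ident, auto)+
    have "cv f g (u \<otimes> x \<otimes> inv u)
      = (\<integral>y. f (u \<otimes> x \<otimes> inv u \<otimes> inv (u \<otimes> (y \<otimes> inv u))) * g (u \<otimes> (y \<otimes> inv u)) \<partial>H)"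
      unfolding cv_def using integral_left[OF u m(1)] integral_right[OF inv_closed[OF u] m(2)] by simp
    also have "\<dots> = cv f g x" unfolding cv_def
    proof (intro Bochner_Integration.integral_cong refl)
      fix y assume "y \<in> space H"
      then have y: "y \<in> carrier G" by (simp add: space_H)
      have "u \<otimes> x \<otimes> inv u \<otimes> inv (u \<otimes> (y \<otimes> inv u)) = u \<otimes> (x \<otimes> inv y) \<otimes> inv u"
        using u x y by (simp add: inv_mult_group m_assoc) (simp add: m_assoc[symmetric])
      moreover have "u \<otimes> (y \<otimes> inv u) = u \<otimes> y \<otimes> inv u" using u y by (simp add: m_assoc)
      ultimately show "f (u \<otimes> x \<otimes> inv u \<otimes> inv (u \<otimes> (y \<otimes> inv u))) * g (u \<otimes> (y \<otimes> inv u)) = f (x \<otimes> inv y) * g y"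
        using class_fun_conj[OF f(2) _ u, of "x \<otimes> inv y"] class_fun_conj[OF g(2) y u] x y by simp
    qed
    finally show ?thesis .
  qed
  show ?thesis unfolding class_fun_def
  proof (intro ballI)
    fix x y assume x: "x \<in> carrier G" and y: "y \<in> carrier G"
    have "x \<otimes> y = x \<otimes> (y \<otimes> x) \<otimes> inv x" using x y by (simp add: m_assoc)
    then show "cv f g (x \<otimes> y) = cv f g (y \<otimes> x)" using conj[OF x, of "y \<otimes> x"] x y by simp
  qed
qed

end

text \<open>
  The weights of Yang--Mills plaquettes are of this kind: invariance under inversion means that the
  orientation of the plaquette is irrelevant, the trace property that its starting point is.
\<close>

locale class_weight = haar_group +
  fixes \<psi> :: "'a \<Rightarrow> complex"
  assumes weight_bdm: "bdm H \<psi>" and weight_class: "class_fun \<psi>"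
    and weight_inv: "x \<in> carrier G \<Longrightarrow> \<psi> (inv x) = \<psi> x"
begin

text \<open>
  The \<open>Suc n\<close>-fold convolution power of \<open>\<psi>\<close>; the shift avoids a unit for the convolution.
\<close>

primrec cpow :: "nat \<Rightarrow> 'a \<Rightarrow> complex" where
  "cpow 0 = \<psi>"
| "cpow (Suc n) = cv \<psi> (cpow n)"

lemma bdm_cpow: "bdm H (cpow n)"
  by (induction n) (auto intro: bdm_cv weight_bdm)

lemma class_fun_cpow: "class_fun (cpow n)"
  by (induction n) (auto intro: class_fun_cv weight_bdm weight_class bdm_cpow)

lemma cv_cpow: "x \<in> carrier G \<Longrightarrow> cv (cpow m) (cpow n) x = cpow (Suc (m + n)) x"
proof (induction m arbitrary: x)
  case (Suc m)
  have "cv (cpow (Suc m)) (cpow n) x = cv \<psi> (cv (cpow m) (cpow n)) x"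
    using cv_assoc[OF weight_bdm bdm_cpow bdm_cpow Suc.prems] by simp
  also have "\<dots> = cv \<psi> (cpow (Suc (m + n))) x"
    unfolding cv_def[of \<psi>] by (intro Bochner_Integration.integral_cong) (auto simp: space_H Suc.IH)
  finally show ?case by simp
qed simp

end

section \<open>Lattice gauge theory and integration over single edges\<close>

text \<open>
  Independent variables are attached to unoriented edges, represented by their positive orientation.
\<close>

definition und :: "edge \<Rightarrow> edge" where
  "und e = (if pos_oriented e then e else rev_edge e)"

lemma pos_oriented_rev_edge: "e \<in> lattice_edges \<Longrightarrow> pos_oriented (rev_edge e) \<longleftrightarrow> \<not> pos_oriented e"
  by (erule lattice_edge_cases) (auto simp: pos_oriented_def)

lemma und_rev_edge [simp]: "e \<in> lattice_edges \<Longrightarrow> und (rev_edge e) = und e"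
  by (simp add: und_def pos_oriented_rev_edge)

lemma und_eq_iff: "und e = und e' \<Longrightarrow> e' = e \<or> e' = rev_edge e"
  by (metis swap_swap und_def)

lemma disjoint_singletonI: "a \<notin> A \<Longrightarrow> A \<inter> {a} = {}"
  by auto

lemma disjoint_Un_singletonI: "A \<inter> B = {} \<Longrightarrow> a \<notin> A \<Longrightarrow> A \<inter> (B \<union> {a}) = {}"
  by auto

lemma und_notin_image:
  assumes "e \<notin> A" "rev_edge e \<notin> A"
  shows "und e \<notin> und ` A"
  using assms und_eq_iff by blast

abbreviation square_loop :: "vertex \<Rightarrow> edge list" where
  "square_loop s \<equiv> plaq_loop (s, True)"

lemma square_loop_lattice: "set (square_loop s) \<subseteq> lattice_edges"
  by (cases s) auto

lemma mem_square_loop: "e \<in> set (square_loop s) \<longleftrightarrow> e \<in> lattice_edges \<and> left_square e = s"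
proof
  assume e: "e \<in> set (square_loop s)"
  then show "e \<in> lattice_edges \<and> left_square e = s"
    using square_loop_lattice[of s] by (cases s) auto
next
  assume *: "e \<in> lattice_edges \<and> left_square e = s"
  then have "e \<in> lattice_edges" by simp
  then show "e \<in> set (square_loop s)"
    by (cases rule: lattice_edge_cases) (use * in auto)
qed

lemma winding_square_loop: "winding (square_loop s) t = of_bool (t = s)"
  by (cases s; cases t) auto

text \<open>
  The edges that have squares of \<open>R\<close> on both sides; these are integrated out below.
\<close>

definition interior_edges :: "vertex set \<Rightarrow> edge set" where
  "interior_edges R = und ` {e \<in> lattice_edges. left_square e \<in> R \<and> right_square e \<in> R}"

lemma und_mem_interior:
  assumes "e \<in> lattice_edges"
  shows "und e \<in> interior_edges R \<longleftrightarrow> left_square e \<in> R \<and> right_square e \<in> R"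
proof
  assume "und e \<in> interior_edges R"
  then obtain e' where e': "und e = und e'" "e' \<in> lattice_edges" "left_square e' \<in> R" "right_square e' \<in> R"
    by (auto simp: interior_edges_def simp del: left_square.simps)
  then show "left_square e \<in> R \<and> right_square e \<in> R" using und_eq_iff[OF e'(1)] by (metis swap_swap)
qed (use assms in \<open>auto simp: interior_edges_def simp del: left_square.simps\<close>)

lemma interior_edges_mono: "R \<subseteq> S \<Longrightarrow> interior_edges R \<subseteq> interior_edges S"
  by (auto simp: interior_edges_def simp del: left_square.simps)

text \<open>
  Lattice gauge theory with a general gauge group and plaquette weight, on the finite edge set \<open>I\<close>.
\<close>

locale lattice_gauge = class_weight G H \<psi>
  for G :: "('g, 'more) monoid_scheme" (structure) and H :: "'g measure" and \<psi> :: "'g \<Rightarrow> complex" +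
  fixes I :: "edge set"
  assumes finite_I: "finite I"
begin

abbreviation confs :: "(edge \<Rightarrow> 'g) measure" where
  "confs \<equiv> PiM I (\<lambda>_. H)"

sublocale P: prob_space confs
  by (intro prob_space_PiM prob_space_axioms)

text \<open>
  Both orientations of an edge use the variable of the positive one.
\<close>

definition edge_hol :: "(edge \<Rightarrow> 'g) \<Rightarrow> edge \<Rightarrow> 'g" where
  "edge_hol Q e = (if pos_oriented e then Q (und e) else inv (Q (und e)))"

definition hol :: "(edge \<Rightarrow> 'g) \<Rightarrow> edge list \<Rightarrow> 'g" where
  "hol Q l = foldr (\<lambda>e A. edge_hol Q e \<otimes> A) l \<one>"

text \<open>
  The walks whose edge variables are among the integration variables.
\<close>

definition supp :: "edge list \<Rightarrow> bool" where
  "supp l \<longleftrightarrow> set l \<subseteq> lattice_edges \<and> und ` set l \<subseteq> I"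

lemma supp_simps [simp]: "supp []" "supp (e # l) \<longleftrightarrow> e \<in> lattice_edges \<and> und e \<in> I \<and> supp l"
  "supp (l @ m) \<longleftrightarrow> supp l \<and> supp m" "supp (rev_walk l) \<longleftrightarrow> supp l"
proof -
  show "supp (rev_walk l) \<longleftrightarrow> supp l"
  proof -
    have "set (rev_walk l) \<subseteq> lattice_edges \<longleftrightarrow> set l \<subseteq> lattice_edges"
    proof -
      have "set (rev_walk l) \<subseteq> lattice_edges \<longleftrightarrow> (\<forall>e\<in>set l. rev_edge e \<in> lattice_edges)"
        by (simp only: rev_walk_def set_rev set_map image_subset_iff)
      then show ?thesis by (simp only: rev_edge_lattice subset_iff) blast
    qed
    moreover have "und ` set (rev_walk l) = und ` set l" if "set l \<subseteq> lattice_edges"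
      unfolding rev_walk_def set_rev set_map image_image
      by (rule image_cong[OF refl]) (use that in \<open>auto simp del: und_rev_edge intro!: und_rev_edge\<close>)
    ultimately show ?thesis unfolding supp_def by metis
  qed
qed (auto simp: supp_def)

lemma hol_simps [simp]: "hol Q [] = \<one>" "hol Q (e # l) = edge_hol Q e \<otimes> hol Q l"
  by (auto simp: hol_def)

lemma conf_closed: "Q \<in> space confs \<Longrightarrow> e \<in> I \<Longrightarrow> Q e \<in> carrier G"
  by (auto simp: space_PiM space_H)

lemma edge_hol_closed: "Q \<in> space confs \<Longrightarrow> und e \<in> I \<Longrightarrow> edge_hol Q e \<in> carrier G"
  by (auto simp: edge_hol_def conf_closed)

lemma hol_closed: "Q \<in> space confs \<Longrightarrow> supp l \<Longrightarrow> hol Q l \<in> carrier G"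
  by (induction l) (auto intro: edge_hol_closed)

lemma hol_append: "Q \<in> space confs \<Longrightarrow> supp l \<Longrightarrow> supp m \<Longrightarrow> hol Q (l @ m) = hol Q l \<otimes> hol Q m"
  by (induction l) (auto simp: edge_hol_closed hol_closed m_assoc)

lemma edge_hol_rev: "Q \<in> space confs \<Longrightarrow> e \<in> lattice_edges \<Longrightarrow> und e \<in> I \<Longrightarrow>
    edge_hol Q (rev_edge e) = inv (edge_hol Q e)"
  by (auto simp: edge_hol_def pos_oriented_rev_edge conf_closed)

lemma hol_rev_walk: "Q \<in> space confs \<Longrightarrow> supp l \<Longrightarrow> hol Q (rev_walk l) = inv (hol Q l)"
  by (induction l) (auto simp: hol_append edge_hol_rev hol_closed edge_hol_closed inv_mult_group)

lemma hol_backtrack: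
  assumes "Q \<in> space confs" "supp l" "supp m" "e \<in> lattice_edges" "und e \<in> I"
  shows "hol Q (l @ e # rev_edge e # m) = hol Q (l @ m)" "hol Q (l @ rev_edge e # e # m) = hol Q (l @ m)"
proof -
  have c: "edge_hol Q e \<in> carrier G" "hol Q m \<in> carrier G" using assms edge_hol_closed hol_closed by auto
  then have "edge_hol Q e \<otimes> (inv (edge_hol Q e) \<otimes> hol Q m) = hol Q m"
    "inv (edge_hol Q e) \<otimes> (edge_hol Q e \<otimes> hol Q m) = hol Q m"
    by (simp_all add: m_assoc[symmetric])
  then show "hol Q (l @ e # rev_edge e # m) = hol Q (l @ m)" "hol Q (l @ rev_edge e # e # m) = hol Q (l @ m)"
    using assms by (simp_all add: hol_append edge_hol_rev)
qed

lemma hol_upd: "i \<notin> und ` set l \<Longrightarrow> hol (Q(i := u)) l = hol Q l"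
  by (induction l) (auto simp: edge_hol_def)

lemma upd_space: "Q \<in> space confs \<Longrightarrow> i \<in> I \<Longrightarrow> u \<in> carrier G \<Longrightarrow> Q(i := u) \<in> space confs"
  by (auto simp: space_PiM space_H PiE_def extensional_def)

lemma measurable_edge_hol: "und e \<in> I \<Longrightarrow> (\<lambda>Q. edge_hol Q e) \<in> measurable confs H"
  unfolding edge_hol_def by (cases "pos_oriented e")
    (auto intro!: measurable_inv_H measurable_component_singleton)

lemma measurable_hol: "supp l \<Longrightarrow> (\<lambda>Q. hol Q l) \<in> measurable confs H"
proof (induction l)
  case (Cons e l)
  then show ?case by (auto intro!: measurable_mult_H measurable_edge_hol)
qed (auto intro: measurable_const_H)

lemma bdm_hol: "bdm H F \<Longrightarrow> supp l \<Longrightarrow> bdm confs (\<lambda>Q. F (hol Q l))"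
  by (rule bdm_compose[OF _ measurable_hol])

text \<open>
  An integral over all edge variables is not changed by averaging over one of them first.
\<close>

lemma resample:
  assumes F: "bdm confs F" and i: "i \<in> I"
  shows "(\<integral>Q. F Q \<partial>confs) = (\<integral>Q. \<integral>u. F (Q(i := u)) \<partial>H \<partial>confs)"
proof -
  interpret S: product_sigma_finite "\<lambda>_::edge. H" ..
  define J where "J = I - {i}"
  have J: "finite J" "i \<notin> J" "insert i J = I" using finite_I i by (auto simp: J_def)
  define g where "g Q = (\<integral>u. F (Q(i := u)) \<partial>H)" for Q
  have upd: "(\<lambda>(Q, u). Q(i := u)) \<in> measurable (confs \<Otimes>\<^sub>M H) confs"
    unfolding split_beta
    by (rule measurable_fun_upd[where J = I]) (use i in auto)
  have g: "bdm confs g" unfolding g_def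
    by (rule bdm_lebesgue_integral[OF prob_space_axioms])
      (rule bdm_cong[OF bdm_compose[OF F upd]], auto)
  have "(\<integral>Q. F Q \<partial>confs) = (\<integral>x. \<integral>y. F (x(i := y)) \<partial>H \<partial>PiM J (\<lambda>_. H))"
    using S.product_integral_insert[OF J(1,2), of F] bdm_integrable[OF P.finite_measure_axioms F]
    by (simp add: J(3))
  also have "\<dots> = (\<integral>x. \<integral>y. g (x(i := y)) \<partial>H \<partial>PiM J (\<lambda>_. H))"
    by (simp add: g_def prob_space)
  also have "\<dots> = (\<integral>Q. g Q \<partial>confs)"
    using S.product_integral_insert[OF J(1,2), of g] bdm_integrable[OF P.finite_measure_axioms g]
    by (simp add: J(3))
  finally show ?thesis by (simp add: g_def)
qed

definition set_edge :: "(edge \<Rightarrow> 'g) \<Rightarrow> edge \<Rightarrow> 'g \<Rightarrow> (edge \<Rightarrow> 'g)" where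
  "set_edge Q e u = Q(und e := (if pos_oriented e then u else inv u))"

lemma edge_hol_set_edge: "u \<in> carrier G \<Longrightarrow> edge_hol (set_edge Q e u) e = u"
  by (simp add: edge_hol_def set_edge_def)

lemma set_edge_space: "Q \<in> space confs \<Longrightarrow> und e \<in> I \<Longrightarrow> u \<in> carrier G \<Longrightarrow> set_edge Q e u \<in> space confs"
  by (simp add: set_edge_def upd_space)

lemma hol_set_edge: "und e \<notin> und ` set l \<Longrightarrow> hol (set_edge Q e u) l = hol Q l"
  by (simp add: set_edge_def hol_upd)

lemma resample_edge:
  assumes F: "bdm confs F" and e: "und e \<in> I"
  shows "(\<integral>Q. F Q \<partial>confs) = (\<integral>Q. \<integral>u. F (set_edge Q e u) \<partial>H \<partial>confs)"
proof (cases "pos_oriented e")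
  case True
  then show ?thesis using resample[OF F e] by (simp add: set_edge_def)
next
  case False
  have "(\<integral>u. F (Q(und e := inv u)) \<partial>H) = (\<integral>u. F (Q(und e := u)) \<partial>H)" if Q: "Q \<in> space confs" for Q
  proof -
    have "(\<lambda>u. Q(und e := u)) \<in> measurable H confs"
      by (rule measurable_fun_upd[where J = I]) (use e Q in auto)
    then have "(\<lambda>u. F (Q(und e := u))) \<in> borel_measurable H"
      using measurable_compose bdm_measurable[OF F] by blast
    then show ?thesis by (rule integral_inv)
  qed
  then show ?thesis using resample[OF F e] False
    by (simp add: set_edge_def cong: Bochner_Integration.integral_cong)
qed

text \<open>
  Independence in the pointwise sense: changing the variables in \<open>J\<close> does not change the value.
\<close>

definition indep_of :: "edge set \<Rightarrow> ((edge \<Rightarrow> 'g) \<Rightarrow> complex) \<Rightarrow> bool" where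
  "indep_of J F \<longleftrightarrow> (\<forall>Q\<in>space confs. \<forall>i\<in>J. \<forall>u\<in>carrier G. F (Q(i := u)) = F Q)"

lemma indep_of_mult: "indep_of J F \<Longrightarrow> indep_of J F' \<Longrightarrow> indep_of J (\<lambda>Q. F Q * F' Q)"
  by (auto simp: indep_of_def)

lemma indep_of_prod: "(\<And>s. s \<in> T \<Longrightarrow> indep_of J (F s)) \<Longrightarrow> indep_of J (\<lambda>Q. \<Prod>s\<in>T. F s Q)"
  by (auto simp: indep_of_def intro!: prod.cong)

lemma indep_of_hol: "und ` set l \<inter> J = {} \<Longrightarrow> indep_of J (\<lambda>Q. F (hol Q l))"
  by (subst indep_of_def) (metis disjoint_iff hol_upd)

lemma indep_of_mono: "indep_of J F \<Longrightarrow> J' \<subseteq> J \<Longrightarrow> indep_of J' F"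
  by (auto simp: indep_of_def)

lemma indep_of_set_edge:
  "indep_of J F \<Longrightarrow> und e \<in> J \<Longrightarrow> Q \<in> space confs \<Longrightarrow> u \<in> carrier G \<Longrightarrow> F (set_edge Q e u) = F Q"
  by (auto simp: indep_of_def set_edge_def)

lemma integral_shift:
  assumes K: "bdm H K" and a: "a \<in> carrier G" and b: "b \<in> carrier G"
  shows "(\<integral>u. K (a \<otimes> (u \<otimes> b)) \<partial>H) = (\<integral>u. K u \<partial>H)"
proof -
  have "(\<lambda>u. K (a \<otimes> u)) \<in> borel_measurable H"
    by (intro bdm_measurable bdm_compose[OF K] meas_H a measurable_ident) simp
  then have "(\<integral>u. K (a \<otimes> (u \<otimes> b)) \<partial>H) = (\<integral>u. K (a \<otimes> u) \<partial>H)" by (rule integral_right[OF b])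
  also have "\<dots> = (\<integral>u. K u \<partial>H)" by (rule integral_left[OF a bdm_measurable[OF K]])
  finally show ?thesis .
qed

lemma integrate_out:
  assumes F: "bdm H F" and G: "bdm confs W" "indep_of {und e} W"
    and s: "supp (x @ e # y)" and e: "und e \<notin> und ` set x" "und e \<notin> und ` set y"
  shows "(\<integral>Q. F (hol Q (x @ e # y)) * W Q \<partial>confs) = (\<integral>u. F u \<partial>H) * (\<integral>Q. W Q \<partial>confs)"
proof -
  have I: "und e \<in> I" using s by simp
  have "(\<integral>Q. F (hol Q (x @ e # y)) * W Q \<partial>confs)
    = (\<integral>Q. \<integral>u. F (hol (set_edge Q e u) (x @ e # y)) * W (set_edge Q e u) \<partial>H \<partial>confs)"
    by (rule resample_edge[OF _ I]) (intro bdm_mult bdm_hol F G s)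
  also have "\<dots> = (\<integral>Q. (\<integral>u. F u \<partial>H) * W Q \<partial>confs)"
  proof (intro Bochner_Integration.integral_cong refl)
    fix Q assume Q: "Q \<in> space confs"
    have "(\<integral>u. F (hol (set_edge Q e u) (x @ e # y)) * W (set_edge Q e u) \<partial>H)
       = (\<integral>u. F (hol Q x \<otimes> (u \<otimes> hol Q y)) * W Q \<partial>H)"
    proof (intro Bochner_Integration.integral_cong refl)
      fix u assume "u \<in> space H"
      then have u: "u \<in> carrier G" by (simp add: space_H)
      have "hol (set_edge Q e u) (x @ e # y) = hol Q x \<otimes> (u \<otimes> hol Q y)"
        using set_edge_space[OF Q I u] s u by (simp add: hol_append hol_set_edge e edge_hol_set_edge)
      then show "F (hol (set_edge Q e u) (x @ e # y)) * W (set_edge Q e u)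
        = F (hol Q x \<otimes> (u \<otimes> hol Q y)) * W Q"
        using indep_of_set_edge[OF G(2) _ Q u] by simp
    qed
    also have "\<dots> = (\<integral>u. F u \<partial>H) * W Q"
      using integral_shift[OF F, of "hol Q x" "hol Q y"] hol_closed[OF Q] s by simp
    finally show "(\<integral>u. F (hol (set_edge Q e u) (x @ e # y)) * W (set_edge Q e u) \<partial>H)
       = (\<integral>u. F u \<partial>H) * W Q" .
  qed
  finally show ?thesis by simp
qed

text \<open>
  The weight of the square named \<open>s\<close>; both of its orientations are already accounted for in \<open>\<psi>\<close>.
\<close>

definition W :: "vertex \<Rightarrow> (edge \<Rightarrow> 'g) \<Rightarrow> complex" where
  "W s Q = \<psi> (hol Q (square_loop s))"

abbreviation supp_squares :: "vertex set \<Rightarrow> bool" where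
  "supp_squares R \<equiv> (\<forall>s\<in>R. supp (square_loop s))"

lemma bdm_W: "supp (square_loop s) \<Longrightarrow> bdm confs (W s)"
  unfolding W_def[abs_def] by (rule bdm_hol[OF weight_bdm])

lemma bdm_prod_W: "supp_squares R \<Longrightarrow> bdm confs (\<lambda>Q. \<Prod>s\<in>R. W s Q)"
  by (intro bdm_prod bdm_W) auto

lemma indep_prod_W:
  "(\<And>s. s \<in> R \<Longrightarrow> und ` set (square_loop s) \<inter> J = {}) \<Longrightarrow> indep_of J (\<lambda>Q. \<Prod>s\<in>R. W s Q)"
  unfolding W_def by (intro indep_of_prod indep_of_hol) auto

text \<open>
  Migdal's integration over the inside of a region \<open>R\<close> with boundary loop \<open>l\<close>: for the observer of
  all other edges, the weights of the squares of \<open>R\<close> combine to a single weight of \<open>l\<close>. In the uses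
  below \<open>n\<close> is one less than the number of squares and \<open>J\<close> consists of the edges integrated out.
\<close>

definition migdal :: "edge list \<Rightarrow> vertex set \<Rightarrow> edge set \<Rightarrow> nat \<Rightarrow> bool" where
  "migdal l R J n \<longleftrightarrow> (\<forall>F. bdm confs F \<longrightarrow> indep_of J F \<longrightarrow>
     (\<integral>Q. (\<Prod>s\<in>R. W s Q) * F Q \<partial>confs) = (\<integral>Q. cpow n (hol Q l) * F Q \<partial>confs))"

lemma migdal_cong:
  assumes "migdal l R J n" "\<And>Q. Q \<in> space confs \<Longrightarrow> cpow n (hol Q l) = cpow n (hol Q l')" "J \<subseteq> J'"
  shows "migdal l' R J' n"
proof -
  have "(\<integral>Q. cpow n (hol Q l) * F Q \<partial>confs) = (\<integral>Q. cpow n (hol Q l') * F Q \<partial>confs)" for F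
    by (intro Bochner_Integration.integral_cong) (auto simp: assms(2))
  moreover have "indep_of J F" if "indep_of J' F" for F using indep_of_mono[OF that assms(3)] .
  ultimately show ?thesis using assms(1) unfolding migdal_def by simp
qed

lemma cpow_hol_commute:
  assumes "Q \<in> space confs" "supp l" "supp m"
  shows "cpow n (hol Q (l @ m)) = cpow n (hol Q (m @ l))"
  using class_fun_cpow[of n] hol_closed[OF assms(1)] assms unfolding class_fun_def
  by (simp add: hol_append)

lemma migdal_append_commute: "migdal (l @ m) R J n \<Longrightarrow> supp l \<Longrightarrow> supp m \<Longrightarrow> migdal (m @ l) R J n"
  by (erule migdal_cong) (auto intro: cpow_hol_commute)

lemma migdal_square: "migdal (square_loop s) {s} {} 0"
  by (simp add: migdal_def W_def)

text \<open>
  Two regions with boundary loops \<open>x g\<inverse>\<close> and \<open>g y\<close> share the edge \<open>g\<close>. Integrating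
  over \<open>g\<close> glues the boundary to \<open>x y\<close> and convolves the weights. If the regions share
  more edges, \<open>x y\<close> contains backtracks that are removed afterwards.
\<close>

lemma migdal_merge:
  assumes m1: "migdal (x @ [rev_edge g]) R1 J1 n1" and m2: "migdal (g # y) R2 J2 n2"
    and fin: "finite R1" "finite R2" and dis: "R1 \<inter> R2 = {}"
    and s: "supp x" "supp (g # y)" "supp_squares R2"
    and J1: "\<And>s. s \<in> R2 \<Longrightarrow> und ` set (square_loop s) \<inter> J1 = {}"
    and J2: "und ` set (g # x) \<inter> J2 = {}"
    and g: "und g \<notin> und ` set x" "und g \<notin> und ` set y"
  shows "migdal (x @ y) (R1 \<union> R2) (J1 \<union> J2 \<union> {und g}) (Suc (n1 + n2))"
  unfolding migdal_def
proof (intro allI impI)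
  fix F assume F: "bdm confs F" and ind: "indep_of (J1 \<union> J2 \<union> {und g}) F"
  have sg: "supp (x @ [rev_edge g])" "g \<in> lattice_edges" "und g \<in> I" using s by auto
  have indF: "indep_of J1 F" "indep_of J2 F" "indep_of {und g} F"
    by (rule indep_of_mono[OF ind]; blast)+
  have ug: "und ` set (x @ [rev_edge g]) \<inter> J2 = {}" using J2 sg(2) by auto
  have "(\<integral>Q. (\<Prod>s\<in>R1 \<union> R2. W s Q) * F Q \<partial>confs)
    = (\<integral>Q. (\<Prod>s\<in>R1. W s Q) * ((\<Prod>s\<in>R2. W s Q) * F Q) \<partial>confs)"
    by (simp add: prod.union_disjoint[OF fin dis] mult.assoc)
  also have "\<dots> = (\<integral>Q. cpow n1 (hol Q (x @ [rev_edge g])) * ((\<Prod>s\<in>R2. W s Q) * F Q) \<partial>confs)"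
  proof -
    have "bdm confs (\<lambda>Q. (\<Prod>s\<in>R2. W s Q) * F Q)" by (intro bdm_mult bdm_prod_W s F)
    moreover have "indep_of J1 (\<lambda>Q. (\<Prod>s\<in>R2. W s Q) * F Q)"
      by (intro indep_of_mult indep_prod_W indF J1)
    ultimately show ?thesis using m1 unfolding migdal_def by blast
  qed
  also have "\<dots> = (\<integral>Q. (\<Prod>s\<in>R2. W s Q) * (cpow n1 (hol Q (x @ [rev_edge g])) * F Q) \<partial>confs)"
    by (simp only: mult.left_commute)
  also have "\<dots> = (\<integral>Q. cpow n2 (hol Q (g # y)) * (cpow n1 (hol Q (x @ [rev_edge g])) * F Q) \<partial>confs)"
  proof -
    have "bdm confs (\<lambda>Q. cpow n1 (hol Q (x @ [rev_edge g])) * F Q)"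
      by (intro bdm_mult bdm_hol bdm_cpow sg F)
    moreover have "indep_of J2 (\<lambda>Q. cpow n1 (hol Q (x @ [rev_edge g])) * F Q)"
      by (intro indep_of_mult indep_of_hol indF ug)
    ultimately show ?thesis using m2 unfolding migdal_def by blast
  qed
  also have "\<dots> = (\<integral>Q. \<integral>u. cpow n2 (hol (set_edge Q g u) (g # y)) *
      (cpow n1 (hol (set_edge Q g u) (x @ [rev_edge g])) * F (set_edge Q g u)) \<partial>H \<partial>confs)"
    by (rule resample_edge[OF _ sg(3)]) (intro bdm_mult bdm_hol bdm_cpow sg s F)
  also have "\<dots> = (\<integral>Q. cpow (Suc (n1 + n2)) (hol Q (x @ y)) * F Q \<partial>confs)"
  proof (intro Bochner_Integration.integral_cong refl)
    fix Q assume Q: "Q \<in> space confs"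
    have c: "hol Q x \<in> carrier G" "hol Q y \<in> carrier G" using hol_closed[OF Q] s by auto
    have "(\<integral>u. cpow n2 (hol (set_edge Q g u) (g # y)) *
      (cpow n1 (hol (set_edge Q g u) (x @ [rev_edge g])) * F (set_edge Q g u)) \<partial>H)
      = (\<integral>u. (cpow n1 (hol Q x \<otimes> inv u) * cpow n2 (u \<otimes> hol Q y)) * F Q \<partial>H)"
    proof (intro Bochner_Integration.integral_cong refl)
      fix u assume "u \<in> space H"
      then have u: "u \<in> carrier G" by (simp add: space_H)
      note Q' = set_edge_space[OF Q sg(3) u]
      have "hol (set_edge Q g u) (g # y) = u \<otimes> hol Q y"
        by (simp add: edge_hol_set_edge u hol_set_edge g)
      moreover have "hol (set_edge Q g u) (x @ [rev_edge g]) = hol Q x \<otimes> inv u"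
        using Q' s sg u by (simp add: hol_append edge_hol_rev edge_hol_set_edge hol_set_edge g)
      ultimately show "cpow n2 (hol (set_edge Q g u) (g # y)) *
        (cpow n1 (hol (set_edge Q g u) (x @ [rev_edge g])) * F (set_edge Q g u))
        = (cpow n1 (hol Q x \<otimes> inv u) * cpow n2 (u \<otimes> hol Q y)) * F Q"
        using indep_of_set_edge[OF indF(3) _ Q u, of g] by simp
    qed
    also have "\<dots> = cv (cpow n1) (cpow n2) (hol Q x \<otimes> hol Q y) * F Q"
      using integral_two_factors[OF bdm_cpow bdm_cpow c] by simp
    also have "\<dots> = cpow (Suc (n1 + n2)) (hol Q (x @ y)) * F Q"
      using cv_cpow[of "hol Q x \<otimes> hol Q y" n1 n2] c s Q by (simp add: hol_append)
    finally show "(\<integral>u. cpow n2 (hol (set_edge Q g u) (g # y)) *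
      (cpow n1 (hol (set_edge Q g u) (x @ [rev_edge g])) * F (set_edge Q g u)) \<partial>H)
      = cpow (Suc (n1 + n2)) (hol Q (x @ y)) * F Q" .
  qed
  finally show "(\<integral>Q. (\<Prod>s\<in>R1 \<union> R2. W s Q) * F Q \<partial>confs)
    = (\<integral>Q. cpow (Suc (n1 + n2)) (hol Q (x @ y)) * F Q \<partial>confs)" .
qed

text \<open>
  A square with an edge that occurs nowhere else contributes just a constant factor.
\<close>

lemma remove_square:
  assumes T: "finite T" "s \<in> T" "supp_squares T" and F: "bdm confs F" "indep_of {und e} F"
    and e: "e \<in> lattice_edges" "left_square e = s" "right_square e \<notin> T"
  shows "(\<integral>Q. (\<Prod>s\<in>T. W s Q) * F Q \<partial>confs)
    = (\<integral>u. \<psi> u \<partial>H) * (\<integral>Q. (\<Prod>s\<in>T - {s}. W s Q) * F Q \<partial>confs)"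
proof -
  have sq: "e \<in> set (square_loop s)" using e by (simp add: mem_square_loop)
  then obtain x y where xy: "square_loop s = x @ e # y" by (meson split_list)
  have "distinct (map und (square_loop s))" by (cases s) (simp add: und_def pos_oriented_def)
  then have n: "und e \<notin> und ` set x" "und e \<notin> und ` set y" by (auto simp: xy)
  have "supp (square_loop s)" using T by blast
  then have sup: "supp (x @ e # y)" by (simp only: xy)
  have other: "und ` set (square_loop t) \<inter> {und e} = {}" if "t \<in> T - {s}" for t
  proof -
    have "e \<notin> set (square_loop t)" "rev_edge e \<notin> set (square_loop t)"
    proof -
      show "e \<notin> set (square_loop t)"
      proof
        assume "e \<in> set (square_loop t)"
        then have "left_square e = t" unfolding mem_square_loop by (elim conjE)
        from trans[OF e(2)[symmetric] this] show False using that by blast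
      qed
      show "rev_edge e \<notin> set (square_loop t)"
      proof
        assume "rev_edge e \<in> set (square_loop t)"
        then have "right_square e = t" unfolding mem_square_loop by (elim conjE)
        then show False using that e(3) by blast
      qed
    qed
    then have "und e \<notin> und ` set (square_loop t)" by (rule und_notin_image)
    then show ?thesis by (rule disjoint_singletonI)
  qed
  have "(\<integral>Q. (\<Prod>s\<in>T. W s Q) * F Q \<partial>confs)
    = (\<integral>Q. \<psi> (hol Q (x @ e # y)) * ((\<Prod>s\<in>T - {s}. W s Q) * F Q) \<partial>confs)"
  proof -
    have "(\<Prod>s\<in>T. W s Q) = \<psi> (hol Q (x @ e # y)) * (\<Prod>s\<in>T - {s}. W s Q)" for Q
      unfolding prod.remove[OF T(1,2)] by (simp only: W_def[of s] xy)
    then show ?thesis by (simp only: mult.assoc)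
  qed
  also have "\<dots> = (\<integral>u. \<psi> u \<partial>H) * (\<integral>Q. (\<Prod>s\<in>T - {s}. W s Q) * F Q \<partial>confs)"
  proof (rule integrate_out[OF weight_bdm _ _ sup n])
    show "bdm confs (\<lambda>Q. (\<Prod>s\<in>T - {s}. W s Q) * F Q)"
      by (intro bdm_mult bdm_prod_W F) (use T in blast)
    show "indep_of {und e} (\<lambda>Q. (\<Prod>s\<in>T - {s}. W s Q) * F Q)"
      by (intro indep_of_mult indep_prod_W F other)
  qed
  finally show ?thesis .
qed

text \<open>
  The squares of a column above height \<open>j\<close> are removed from the top down; at each moment the
  topmost one has a free upper edge.
\<close>

lemma remove_column:
  assumes T: "finite T" "supp_squares T" and F: "bdm confs F"
    and ind: "indep_of {und ((x + 1, i + 1), (x, i + 1)) |i. j \<le> i} F"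
  shows "(\<integral>Q. (\<Prod>s\<in>T. W s Q) * F Q \<partial>confs) =
    (\<integral>u. \<psi> u \<partial>H) ^ card {s \<in> T. fst s = x \<and> j \<le> snd s} *
    (\<integral>Q. (\<Prod>s\<in>{s \<in> T. \<not> (fst s = x \<and> j \<le> snd s)}. W s Q) * F Q \<partial>confs)"
  using T
proof (induction "card {s \<in> T. fst s = x \<and> j \<le> snd s}" arbitrary: T)
  case 0
  then have "{s \<in> T. fst s = x \<and> j \<le> snd s} = {}" by simp
  then have "{s \<in> T. \<not> (fst s = x \<and> j \<le> snd s)} = T" by blast
  then show ?case unfolding 0(1)[symmetric] by simp
next
  case (Suc n)
  define C where "C = {s \<in> T. fst s = x \<and> j \<le> snd s}"
  have C: "finite C" using Suc.prems by (simp add: C_def)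
  moreover have "card C \<noteq> 0" using Suc.hyps(2) by (simp add: C_def)
  ultimately have C: "finite C" "C \<noteq> {}" by auto
  define i where "i = Max (snd ` C)"
  have "i \<in> snd ` C" unfolding i_def using C by (intro Max_in) auto
  then have s: "(x, i) \<in> T" "j \<le> i" by (auto simp: C_def)
  have top: "(x, i + 1) \<notin> T"
  proof
    assume "(x, i + 1) \<in> T"
    then have "i + 1 \<in> snd ` C" using s by (force simp: C_def)
    then have "i + 1 \<le> i" unfolding i_def using C by (intro Max_ge) auto
    then show False by simp
  qed
  define T' where "T' = T - {(x, i)}"
  have CT': "{s \<in> T'. fst s = x \<and> j \<le> snd s} = C - {(x, i)}" by (auto simp: T'_def C_def)
  have cC: "card C = Suc n" using Suc(2) by (simp add: C_def)
  then have card: "n = card {s \<in> T'. fst s = x \<and> j \<le> snd s}"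
    unfolding CT' using C(1) s by (subst card_Diff_singleton) (auto simp: C_def)
  have rest: "{s \<in> T'. \<not> (fst s = x \<and> j \<le> snd s)} = {s \<in> T. \<not> (fst s = x \<and> j \<le> snd s)}"
    using s by (auto simp: T'_def)
  have T': "finite T'" "supp_squares T'" using Suc.prems by (auto simp: T'_def)
  have "indep_of {und ((x + 1, i + 1), (x, i + 1))} F"
    by (rule indep_of_mono[OF ind]) (use s in blast)
  then have "(\<integral>Q. (\<Prod>s\<in>T. W s Q) * F Q \<partial>confs)
    = (\<integral>u. \<psi> u \<partial>H) * (\<integral>Q. (\<Prod>s\<in>T'. W s Q) * F Q \<partial>confs)"
    unfolding T'_def
    by (intro remove_square[OF Suc.prems(1) s(1) Suc.prems(2) F]) (use top in auto)
  also have "\<dots> = (\<integral>u. \<psi> u \<partial>H) ^ card C * (\<integral>Q. (\<Prod>s\<in>{s \<in> T. \<not> (fst s = x \<and> j \<le> snd s)}. W s Q) * F Q \<partial>confs)"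
    unfolding Suc.hyps(1)[OF card T'] card[symmetric] cC rest by simp
  finally show ?case by (simp add: C_def)
qed

end

section \<open>Integrating out a simply connected region\<close>

text \<open>
  The counterclockwise boundary of a region: the winding number is one inside and zero outside. This is
  easier to maintain when squares are removed than topological enclosure, and agrees with it by
  \<open>simple_cycle_winding\<close>.
\<close>

definition bounds :: "edge list \<Rightarrow> vertex set \<Rightarrow> bool" where
  "bounds l R \<longleftrightarrow> simple_cycle l \<and> finite R \<and> (\<forall>s. winding l s = of_bool (s \<in> R))"

lemma simple_cycle_edge_passages:
  assumes "simple_cycle l"
  shows "passages l e = of_bool (e \<in> set l) - of_bool (rev_edge e \<in> set l)"
  using assms by (simp add: simple_cycle_def distinct_map passages_def count_list_distinct)

text \<open>
  The passages of an edge are the jump of the winding number, so the boundary loop is determined by \<open>R\<close>.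
\<close>

lemma bounds_edge_iff:
  assumes b: "bounds l R"
  shows "e \<in> set l \<longleftrightarrow> e \<in> lattice_edges \<and> left_square e \<in> R \<and> right_square e \<notin> R"
proof -
  have l: "simple_cycle l" "closed_walk l" and w: "\<And>s. winding l s = of_bool (s \<in> R)"
    using b by (auto simp: bounds_def simple_cycle_def)
  have lat: "set l \<subseteq> lattice_edges" using l by (simp add: closed_walk_def)
  have "e \<in> set l \<Longrightarrow> rev_edge e \<notin> set l" using l by (simp add: simple_cycle_def)
  then show ?thesis
    using simple_cycle_edge_passages[OF l(1), of e] passages_eq_winding_jump[OF l(2), of e] lat w
    by (cases "e \<in> lattice_edges") (auto simp: of_bool_def simp del: left_square.simps split: if_splits)
qed

lemma bounds_nonempty: "bounds l R \<Longrightarrow> R \<noteq> {}"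
  using bounds_edge_iff[of l R "hd l"] by (auto simp: bounds_def simple_cycle_def)

lemma bounds_rotate: "bounds (l @ m) R \<Longrightarrow> bounds (m @ l) R"
  unfolding bounds_def using simple_cycle_append_commute by (auto simp: add.commute)

text \<open>
  The corner at which the region is peeled: nothing lies above this square or to its left.
\<close>

lemma top_left_square:
  fixes R :: "vertex set"
  assumes "finite R" "R \<noteq> {}"
  obtains x y where "(x, y) \<in> R" "\<And>x' y'. (x', y') \<in> R \<Longrightarrow> y' \<le> y" "(x - 1, y) \<notin> R"
proof -
  define y where "y = Max (snd ` R)"
  have y: "y' \<le> y" if "(x', y') \<in> R" for x' y'
    unfolding y_def using assms that by (intro Max_ge) force+
  have "y \<in> snd ` R" unfolding y_def using assms by (intro Max_in) auto
  then have ne: "{x. (x, y) \<in> R} \<noteq> {}" by force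
  have "{x. (x, y) \<in> R} \<subseteq> fst ` R" by force
  then have fin: "finite {x. (x, y) \<in> R}" using assms finite_subset by blast
  define x where "x = Min {x. (x, y) \<in> R}"
  have "x \<in> {x. (x, y) \<in> R}" unfolding x_def using fin ne by (rule Min_in)
  moreover have "(x - 1, y) \<notin> R"
  proof
    assume "(x - 1, y) \<in> R"
    then have "x \<le> x - 1" unfolding x_def using fin by (intro Min_le) auto
    then show False by simp
  qed
  ultimately show ?thesis using that y by blast
qed

lemma simple_cycle_sublist:
  assumes l: "simple_cycle l" and w: "walk u (ns @ m) u" and ns: "ns \<noteq> []"
    and sub: "set m \<subseteq> set l" and dis: "distinct (map snd (ns @ m))"
    and new: "\<And>g. g \<in> set ns \<Longrightarrow> rev_edge g \<notin> set l \<and> rev_edge g \<notin> set ns"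
  shows "simple_cycle (ns @ m)"
  unfolding simple_cycle_def
proof (intro conjI ballI)
  show "closed_walk (ns @ m)" using w unfolding closed_walk_iff by blast
  fix e assume e: "e \<in> set (ns @ m)"
  show "rev_edge e \<notin> set (ns @ m)"
  proof
    assume re: "rev_edge e \<in> set (ns @ m)"
    have "e \<notin> set ns" using new[of e] re sub by auto
    moreover have "rev_edge e \<notin> set ns" using new[of "rev_edge e"] e sub by auto
    ultimately show False using e re sub l by (auto simp: simple_cycle_def)
  qed
qed (use ns dis in auto)

text \<open>
  The value zero on the right of one edge excludes the clockwise orientation.
\<close>

lemma cycle_positively_oriented:
  assumes l: "simple_cycle l" and g: "g \<in> set l" and z: "winding l (right_square g) = 0"
  shows "bounds l {s. enclosed l s}" "enclosed l (left_square g)"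
proof -
  have cw: "closed_walk l" using l by (simp add: simple_cycle_def)
  then have "g \<in> lattice_edges" using g by (auto simp: closed_walk_def)
  moreover have "passages l g = 1"
    using simple_cycle_edge_passages[OF l, of g] g l by (simp add: simple_cycle_def)
  ultimately have w1: "winding l (left_square g) = 1"
    using passages_eq_winding_jump[OF cw, of g] z by simp
  obtain k where k: "k = 1 \<or> k = -1" and ek: "\<And>s. of_bool (enclosed l s) = k * winding l s"
    using simple_cycle_winding[OF l] by blast
  have "k = 1" using k ek[of "left_square g"] w1 by (auto simp: of_bool_def split: if_splits)
  then have ek': "winding l s = of_bool (enclosed l s)" for s using ek[of s] by simp
  show "bounds l {s. enclosed l s}" using l finite_enclosed by (simp add: bounds_def ek')
  show "enclosed l (left_square g)" using w1 unfolding ek' by simp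
qed

context lattice_gauge begin

lemma supp_bounds:
  assumes b: "bounds l R" and s: "supp_squares R"
  shows "supp l"
proof -
  have "e \<in> lattice_edges \<and> und e \<in> I" if e: "e \<in> set l" for e
  proof -
    have e': "e \<in> lattice_edges" "left_square e \<in> R" using bounds_edge_iff[OF b] e by auto
    then have "e \<in> set (square_loop (left_square e))" by (simp add: mem_square_loop)
    then show ?thesis using s e' by (auto simp: supp_def)
  qed
  then show ?thesis by (auto simp: supp_def)
qed

lemma square_interior_disjoint: "s \<notin> R \<Longrightarrow> und ` set (square_loop s) \<inter> interior_edges R = {}"
proof -
  assume s: "s \<notin> R"
  have "und e \<notin> interior_edges R" if "e \<in> set (square_loop s)" for e
    using that s und_mem_interior[of e R] mem_square_loop[of e s] by metis
  then show ?thesis by blast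
qed

lemma bounds_interior_disjoint:
  assumes "bounds l R" "R \<inter> S = {}"
  shows "und ` set l \<inter> interior_edges S = {}"
proof -
  have "und e \<notin> interior_edges S" if "e \<in> set l" for e
    using that und_mem_interior[of e S] bounds_edge_iff[OF assms(1), of e] assms(2) by blast
  then show ?thesis by blast
qed

text \<open>
  Induction on the number of squares, removing the square \<open>p\<close> in the top left corner. Its upper
  edge \<open>e\<close> and left edge \<open>f\<close> are consecutive in the boundary loop \<open>e f \<pi>\<close>. According to
  whether the squares on the right and below belong to \<open>R\<close>, the right edge \<open>r\<close> and the lower
  edge \<open>d\<close> of \<open>p\<close> replace edges of \<open>\<pi>\<close> to bound the rest, and \<open>p\<close> is glued to it by
  \<open>migdal_merge\<close>. If both belong to \<open>R\<close>, it matters whether \<open>\<pi>\<close> visits the lower right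
  corner of \<open>p\<close>. If so, removing \<open>p\<close> disconnects \<open>R\<close> there into two regions, each
  bounded by a simple cycle, which are glued to \<open>p\<close> one after the other.
\<close>

theorem migdal_bounds:
  assumes "bounds l R" "supp_squares R"
  shows "migdal l R (interior_edges R) (card R - 1)"
  using assms
proof (induction "card R" arbitrary: l R rule: less_induct)
  case less
  note b = less.prems(1)
  have R: "finite R" "R \<noteq> {}" using b bounds_nonempty by (auto simp: bounds_def)
  have lcyc: "simple_cycle l" using b by (simp add: bounds_def)
  have cR: "0 < card R" using R by (simp add: card_gt_0_iff)
  obtain x y where p: "(x, y) \<in> R" and top: "\<And>x' y'. (x', y') \<in> R \<Longrightarrow> y' \<le> y"
    and left: "(x - 1, y) \<notin> R"
    using top_left_square[OF R] by blast
  define p where "p = (x, y)"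
  define e where "e = ((x + 1, y + 1), (x, y + 1))"
  define f where "f = ((x, y + 1), (x, y))"
  define r where "r = ((x + 1, y + 1), (x + 1, y))"
  define d where "d = ((x + 1, y), (x, y))"
  note defs = e_def f_def r_def d_def p_def
  have above: "(x', y + 1) \<notin> R" for x' using top[of x' "y + 1"] by auto
  have lat: "e \<in> lattice_edges" "f \<in> lattice_edges" "r \<in> lattice_edges" "d \<in> lattice_edges"
    by (auto simp: defs)
  have el: "e \<in> set l" using bounds_edge_iff[OF b, of e] p above[of x] lat by (simp add: e_def)
  have fl: "f \<in> set l" using bounds_edge_iff[OF b, of f] p left lat by (simp add: f_def)
  have rl: "r \<notin> set l" using bounds_edge_iff[OF b, of r] p by (simp add: r_def)
  have dl: "d \<notin> set l" using bounds_edge_iff[OF b, of d] p by (simp add: d_def)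
  have rr: "rev_edge r \<in> set l \<longleftrightarrow> (x + 1, y) \<notin> R"
    using bounds_edge_iff[OF b, of "rev_edge r"] p lat by (simp add: r_def)
  have rd: "rev_edge d \<in> set l \<longleftrightarrow> (x, y - 1) \<notin> R"
    using bounds_edge_iff[OF b, of "rev_edge d"] p lat by (simp add: d_def)
  obtain l1 l2 where l12: "l = l1 @ e # l2" using el by (meson split_list)
  define l' where "l' = e # l2 @ l1"
  have b': "bounds l' R" using bounds_rotate[of l1 "e # l2" R] b by (simp add: l12 l'_def)
  have cyc': "simple_cycle l'" using b' by (simp add: bounds_def)
  have set': "set l' = set l" by (auto simp: l12 l'_def)
  have "\<exists>\<pi>. l2 @ l1 = f # \<pi>"
  proof (cases "l2 @ l1")
    case Nil
    then have "f = e" using fl by (simp add: l12)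
    then show ?thesis by (simp add: e_def f_def)
  next
    case (Cons f' \<pi>)
    have "closed_walk (e # f' # \<pi>)" using cyc' by (simp add: l'_def Cons simple_cycle_def)
    then have "fst f' = fst f" by (auto simp: closed_walk_iff e_def f_def)
    moreover have "f' \<in> set l" using Cons set' l'_def by auto
    ultimately show ?thesis using simple_cycle_fst_eq[OF lcyc _ fl] Cons by auto
  qed
  then obtain \<pi> where l'\<pi>: "l' = e # f # \<pi>" by (auto simp: l'_def)
  have wk: "walk (x, y) \<pi> (x + 1, y + 1)"
    using cyc' unfolding l'\<pi> by (auto simp: simple_cycle_def closed_walk_iff e_def f_def)
  have dist: "distinct (map snd (e # f # \<pi>))" using cyc' by (simp add: l'\<pi> simple_cycle_def)
  have sub\<pi>: "set \<pi> \<subseteq> set l" using l'\<pi> set' by auto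
  have e\<pi>: "e \<notin> set \<pi>" "f \<notin> set \<pi>" using dist by auto
  have suppl: "supp l" "supp l'" using supp_bounds less.prems b' by auto
  have sup\<pi>: "supp \<pi>" "supp [e, f]" "supp [f]" "supp [e]" using suppl(2) by (auto simp: l'\<pi>)
  have suppp: "supp (square_loop p)" using less.prems(2) p by (auto simp: p_def)
  have sqp: "square_loop p = [rev_edge d, rev_edge r, e, f]" by (simp add: defs)
  have suprd: "supp [rev_edge d]" "supp [rev_edge r]" "supp [r]" "supp [d]"
  proof -
    show "supp [rev_edge d]" "supp [rev_edge r]" using suppp unfolding sqp by auto
    then show "supp [r]" "supp [d]" using lat by auto
  qed
  have undne: "und r \<noteq> und e" "und r \<noteq> und f" "und r \<noteq> und d" "und d \<noteq> und e" "und d \<noteq> und f"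
    by (auto simp: defs und_def pos_oriented_def)
  have wsq: "winding l' s = winding (e # f # \<pi>) s" for s by (simp add: l'\<pi>)
  have w': "winding l' s = of_bool (s \<in> R)" for s using b' unfolding bounds_def by blast
  have wp: "overhead s e + overhead s f - overhead s d - overhead s r = of_bool (s = p)" for s
  proof -
    have "winding (square_loop p) s = of_bool (s = p)" by (rule winding_square_loop)
    then show ?thesis unfolding sqp by (simp del: overhead.simps)
  qed
  \<comment> \<open>The chain \<open>r d \<pi>\<close> has the winding number of the region without \<open>p\<close>; in the cases below it
    becomes a simple cycle after cancelling \<open>r\<close> or \<open>d\<close>, or a sum of two simple cycles.\<close>
  have wB: "overhead s d + overhead s r + winding \<pi> s = of_bool (s \<in> R - {p})" for s
    using wp[of s] w'[of s] p unfolding l'\<pi> by (auto simp: p_def of_bool_def simp del: overhead.simps split: if_splits)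
  have edge_p: "und ` set (square_loop p) \<inter> interior_edges S = {}" if "p \<notin> S" for S
    using that by (rule square_interior_disjoint)
  have restrict: "supp_squares S" if "S \<subseteq> R" for S using that less.prems(2) by blast
  have fromp: "migdal l R (interior_edges R) (card R - 1)"
    if "migdal (e # f # \<pi>) R (interior_edges R) (card R - 1)"
  proof -
    have "migdal ((e # l2) @ l1) R (interior_edges R) (card R - 1)"
      using that l'\<pi> by (simp add: l'_def)
    then have "migdal (l1 @ (e # l2)) R (interior_edges R) (card R - 1)"
      by (rule migdal_append_commute) (use suppl l12 in auto)
    then show ?thesis by (simp add: l12)
  qed
  have sqm: "migdal ([rev_edge d] @ [rev_edge r, e, f]) {p} {} 0"
    "migdal ([rev_edge d, rev_edge r] @ [e, f]) {p} {} 0"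
    using migdal_square[of p] unfolding sqp by simp_all
  have sq_r: "migdal ([e, f, rev_edge d] @ [rev_edge r]) {p} {} 0"
    using migdal_append_commute[OF sqm(2)] sup\<pi> suprd by simp
  have sq_d: "migdal ([rev_edge r, e, f] @ [rev_edge d]) {p} {} 0"
    using migdal_append_commute[OF sqm(1)] sup\<pi> suprd by simp
  have pr: "und r \<in> interior_edges R" if "(x + 1, y) \<in> R"
    using und_mem_interior[OF lat(3), of R] that p by (simp add: r_def)
  have pd: "und d \<in> interior_edges R" if "(x, y - 1) \<in> R"
    using und_mem_interior[OF lat(4), of R] that p by (simp add: d_def)
  have Rp: "{p} \<union> (R - {p}) = R" using p by (auto simp: p_def)
  have cRp: "card (R - {p}) < card R" "card (R - {p}) = card R - 1"
    using p R cR card_Diff_singleton[of p R] by (simp_all add: p_def)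
  have und_notin_l: "und g \<notin> und ` A" if "g \<notin> set l" "rev_edge g \<notin> set l" "A \<subseteq> set l" for g A
    by (rule und_notin_image) (use that in auto)
  have r\<pi>: "\<pi> \<noteq> []" using wk by auto
  consider (single) "(x + 1, y) \<notin> R" "(x, y - 1) \<notin> R" | (right) "(x + 1, y) \<in> R" "(x, y - 1) \<notin> R"
    | (below) "(x + 1, y) \<notin> R" "(x, y - 1) \<in> R"
    | (corner) "(x + 1, y) \<in> R" "(x, y - 1) \<in> R" "(x + 1, y) \<notin> snd ` set \<pi>"
    | (pinch) "(x + 1, y) \<in> R" "(x, y - 1) \<in> R" "(x + 1, y) \<in> snd ` set \<pi>"
    by blast
  then show ?case
  proof cases
    case single
    obtain g \<rho> where g: "\<pi> = g # \<rho>" using r\<pi> by (cases \<pi>) auto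
    have "g = rev_edge d"
      using simple_cycle_fst_eq[OF lcyc, of g "rev_edge d"] rd single g sub\<pi> wk by (auto simp: d_def)
    then have wk2: "walk (x + 1, y) \<rho> (x + 1, y + 1)" using wk g by (simp add: d_def)
    obtain h \<sigma> where h: "\<rho> = h # \<sigma>" using wk2 by (cases \<rho>) auto
    have "h = rev_edge r"
      using simple_cycle_fst_eq[OF lcyc, of h "rev_edge r"] rr single g h sub\<pi> wk2 by (auto simp: r_def)
    then have wk3: "walk (x + 1, y + 1) \<sigma> (x + 1, y + 1)" using wk2 h by (simp add: r_def)
    have "\<sigma> = []"
    proof (cases \<sigma>)
      case (Cons k \<tau>)
      then have "k = e" using simple_cycle_fst_eq[OF lcyc, of k e] el g h sub\<pi> wk3 by (auto simp: e_def)
      then show ?thesis using e\<pi> g h Cons by auto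
    qed simp
    then have \<pi>: "\<pi> = [rev_edge d, rev_edge r]" using g h \<open>g = rev_edge d\<close> \<open>h = rev_edge r\<close> by simp
    have RR: "R = {p}"
    proof -
      have "of_bool (s \<in> R) = (of_bool (s = p) :: int)" for s
        using wp[of s] w'[of s] unfolding l'\<pi> \<pi> by (simp del: overhead.simps)
      then have "s \<in> R \<longleftrightarrow> s = p" for s by (metis of_bool_eq_iff)
      then show ?thesis by blast
    qed
    have "migdal (e # f # \<pi>) {p} {} 0"
      using migdal_append_commute[OF sqm(2)] sup\<pi> suprd \<pi> by simp
    then have "migdal (e # f # \<pi>) R {} (card R - 1)" by (simp add: RR)
    then have "migdal (e # f # \<pi>) R (interior_edges R) (card R - 1)" by (rule migdal_cong) auto
    then show ?thesis by (rule fromp)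
  next
    case right
    obtain g \<rho> where g: "\<pi> = g # \<rho>" using r\<pi> by (cases \<pi>) auto
    have gd: "g = rev_edge d"
      using simple_cycle_fst_eq[OF lcyc, of g "rev_edge d"] rd right g sub\<pi> wk by (auto simp: d_def)
    have "bounds (r # \<rho>) (R - {p})"
      unfolding bounds_def
    proof (intro conjI allI)
      show "simple_cycle (r # \<rho>)"
      proof -
        have "simple_cycle ([r] @ \<rho>)"
        proof (rule simple_cycle_sublist[OF lcyc])
          show "walk (x + 1, y + 1) ([r] @ \<rho>) (x + 1, y + 1)"
          using wk lat unfolding g gd by (simp add: r_def d_def)
          show "set \<rho> \<subseteq> set l" using sub\<pi> g by auto
          show "distinct (map snd ([r] @ \<rho>))"
          using dist unfolding g gd by (auto simp: r_def d_def)
          show "rev_edge g' \<notin> set l \<and> rev_edge g' \<notin> set [r]" if "g' \<in> set [r]" for g'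
            using that rr right by (auto simp: r_def)
        qed simp
        then show ?thesis by simp
      qed
      show "winding (r # \<rho>) s = of_bool (s \<in> R - {p})" for s
        using wB[of s] unfolding g gd by (simp del: overhead.simps)
    qed (use R in simp)
    note br = this
    have mr: "migdal (r # \<rho>) (R - {p}) (interior_edges (R - {p})) (card (R - {p}) - 1)"
      by (rule less.hyps[OF cRp(1) br]) (rule restrict, blast)
    have "migdal ([e, f, rev_edge d] @ \<rho>) ({p} \<union> (R - {p})) ({} \<union> interior_edges (R - {p}) \<union> {und r})
      (Suc (0 + (card (R - {p}) - 1)))"
    proof (rule migdal_merge[OF sq_r mr])
      show "supp (r # \<rho>)" "supp [e, f, rev_edge d]" using suprd sup\<pi> g by auto
      show "supp_squares (R - {p})" by (rule restrict) blast
      show "und ` set (r # [e, f, rev_edge d]) \<inter> interior_edges (R - {p}) = {}"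
        using edge_p[of "R - {p}"] lat unfolding sqp by auto
      show "und r \<notin> und ` set [e, f, rev_edge d]" using undne lat by auto
      show "und r \<notin> und ` set \<rho>" by (rule und_notin_l) (use rl rr right sub\<pi> g in auto)
    qed (use R in auto)
    moreover have "Suc (0 + (card (R - {p}) - 1)) = card R - 1"
    proof -
      have "(x + 1, y) \<in> R - {p}" using right by (simp add: p_def)
      then have "0 < card (R - {p})" using R by (auto simp: card_gt_0_iff)
      then show ?thesis using cRp by simp
    qed
    ultimately have "migdal (e # f # \<pi>) R ({} \<union> interior_edges (R - {p}) \<union> {und r}) (card R - 1)"
      using Rp by (simp add: g gd)
    then have "migdal (e # f # \<pi>) R (interior_edges R) (card R - 1)"
      by (rule migdal_cong) (use pr right interior_edges_mono[of "R - {p}" R] in auto)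
    then show ?thesis by (rule fromp)
  next
    case below
    obtain g \<rho> where g: "\<pi> = \<rho> @ [g]" using r\<pi> by (metis rev_exhaust)
    have gr: "g = rev_edge r"
      using simple_cycle_snd_eq[OF lcyc, of g "rev_edge r"] rr below g sub\<pi> wk by (auto simp: r_def)
    have "bounds (d # \<rho>) (R - {p})"
      unfolding bounds_def
    proof (intro conjI allI)
      show "simple_cycle (d # \<rho>)"
      proof -
        have "simple_cycle ([d] @ \<rho>)"
        proof (rule simple_cycle_sublist[OF lcyc])
          show "walk (x + 1, y) ([d] @ \<rho>) (x + 1, y)"
          using wk lat unfolding g gr by (auto simp: r_def d_def)
          show "set \<rho> \<subseteq> set l" using sub\<pi> g by auto
          show "distinct (map snd ([d] @ \<rho>))"
          using dist unfolding g gr by (auto simp: f_def d_def)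
          show "rev_edge g' \<notin> set l \<and> rev_edge g' \<notin> set [d]" if "g' \<in> set [d]" for g'
            using that rd below by (auto simp: d_def)
        qed simp
        then show ?thesis by simp
      qed
      show "winding (d # \<rho>) s = of_bool (s \<in> R - {p})" for s
        using wB[of s] unfolding g gr by (simp del: overhead.simps)
    qed (use R in simp)
    note br = this
    have mr: "migdal (d # \<rho>) (R - {p}) (interior_edges (R - {p})) (card (R - {p}) - 1)"
      by (rule less.hyps[OF cRp(1) br]) (rule restrict, blast)
    have "migdal ([rev_edge r, e, f] @ \<rho>) ({p} \<union> (R - {p})) ({} \<union> interior_edges (R - {p}) \<union> {und d})
      (Suc (0 + (card (R - {p}) - 1)))"
    proof (rule migdal_merge[OF sq_d mr])
      show "supp (d # \<rho>)" "supp [rev_edge r, e, f]" using suprd sup\<pi> g by auto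
      show "supp_squares (R - {p})" by (rule restrict) blast
      show "und ` set (d # [rev_edge r, e, f]) \<inter> interior_edges (R - {p}) = {}"
        using edge_p[of "R - {p}"] lat unfolding sqp by auto
      show "und d \<notin> und ` set [rev_edge r, e, f]" using undne lat by auto
      show "und d \<notin> und ` set \<rho>" by (rule und_notin_l) (use dl rd below sub\<pi> g in auto)
    qed (use R in auto)
    moreover have "Suc (0 + (card (R - {p}) - 1)) = card R - 1"
    proof -
      have "(x, y - 1) \<in> R - {p}" using below by (simp add: p_def)
      then have "0 < card (R - {p})" using R by (auto simp: card_gt_0_iff)
      then show ?thesis using cRp by simp
    qed
    ultimately have "migdal ([rev_edge r] @ (e # f # \<rho>)) R ({} \<union> interior_edges (R - {p}) \<union> {und d}) (card R - 1)"
      using Rp by simp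
    then have "migdal ((e # f # \<rho>) @ [rev_edge r]) R ({} \<union> interior_edges (R - {p}) \<union> {und d}) (card R - 1)"
      by (rule migdal_append_commute) (use suprd sup\<pi> g in auto)
    then have "migdal (e # f # \<pi>) R (interior_edges R) (card R - 1)"
      by (rule migdal_cong) (use pd below interior_edges_mono[of "R - {p}" R] g gr in auto)
    then show ?thesis by (rule fromp)
  next
    case corner
    have "bounds (r # d # \<pi>) (R - {p})"
      unfolding bounds_def
    proof (intro conjI allI)
      have "simple_cycle ([r, d] @ \<pi>)"
      proof (rule simple_cycle_sublist[OF lcyc])
        show "walk (x + 1, y + 1) ([r, d] @ \<pi>) (x + 1, y + 1)"
          using wk lat by (simp add: r_def d_def)
        show "set \<pi> \<subseteq> set l" by (rule sub\<pi>)
        show "distinct (map snd ([r, d] @ \<pi>))"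
          using dist corner by (auto simp: r_def d_def f_def)
        show "rev_edge g \<notin> set l \<and> rev_edge g \<notin> set [r, d]" if "g \<in> set [r, d]" for g
          using that rr rd corner by (auto simp: r_def d_def)
      qed simp
      then show "simple_cycle (r # d # \<pi>)" by simp
      show "winding (r # d # \<pi>) s = of_bool (s \<in> R - {p})" for s
        using wB[of s] by (simp del: overhead.simps)
    qed (use R in simp)
    note br = this
    have mr: "migdal (r # d # \<pi>) (R - {p}) (interior_edges (R - {p})) (card (R - {p}) - 1)"
      by (rule less.hyps[OF cRp(1) br]) (rule restrict, blast)
    have "migdal ([e, f, rev_edge d] @ (d # \<pi>)) ({p} \<union> (R - {p})) ({} \<union> interior_edges (R - {p}) \<union> {und r})
      (Suc (0 + (card (R - {p}) - 1)))"
    proof (rule migdal_merge[OF sq_r mr])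
      show "supp (r # d # \<pi>)" "supp [e, f, rev_edge d]" using suprd sup\<pi> by auto
      show "supp_squares (R - {p})" by (rule restrict) blast
      show "und ` set (r # [e, f, rev_edge d]) \<inter> interior_edges (R - {p}) = {}"
        using edge_p[of "R - {p}"] lat unfolding sqp by auto
      show "und r \<notin> und ` set [e, f, rev_edge d]" using undne lat by auto
      have "und r \<notin> und ` set \<pi>" by (rule und_notin_l) (use rl rr corner sub\<pi> in auto)
      then show "und r \<notin> und ` set (d # \<pi>)" using undne by auto
    qed (use R in auto)
    moreover have "Suc (0 + (card (R - {p}) - 1)) = card R - 1"
    proof -
      have "(x, y - 1) \<in> R - {p}" using corner by (simp add: p_def)
      then have "0 < card (R - {p})" using R by (auto simp: card_gt_0_iff)
      then show ?thesis using cRp by simp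
    qed
    ultimately have "migdal ([e, f] @ rev_edge d # d # \<pi>) R ({} \<union> interior_edges (R - {p}) \<union> {und r}) (card R - 1)"
      using Rp by simp
    then have "migdal ([e, f] @ \<pi>) R (interior_edges R) (card R - 1)"
    proof (rule migdal_cong)
      show "cpow (card R - 1) (hol Q ([e, f] @ rev_edge d # d # \<pi>)) = cpow (card R - 1) (hol Q ([e, f] @ \<pi>))"
        if "Q \<in> space confs" for Q
        using hol_backtrack(2)[OF that, of "[e, f]" \<pi> d] sup\<pi> suprd lat by simp
    qed (use pr corner interior_edges_mono[of "R - {p}" R] in auto)
    then show ?thesis using fromp by simp
  next
    case pinch
    then obtain g where g: "g \<in> set \<pi>" "snd g = (x + 1, y)" by auto
    then obtain \<alpha> \<beta> where \<alpha>: "\<pi> = \<alpha> @ g # \<beta>" by (meson split_list)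
    define \<pi>1 where "\<pi>1 = \<alpha> @ [g]"
    have \<pi>: "\<pi> = \<pi>1 @ \<beta>" by (simp add: \<pi>1_def \<alpha>)
    have wk1: "walk (x, y) \<pi>1 (x + 1, y)" and wk2: "walk (x + 1, y) \<beta> (x + 1, y + 1)"
      using wk g by (auto simp: \<pi>1_def \<alpha>)
    have SE: "(x + 1, y) \<in> snd ` set \<pi>1" "(x + 1, y) \<notin> snd ` set \<beta>"
      using g dist by (auto simp: \<pi>1_def \<alpha>)
    have cycd: "simple_cycle (d # \<pi>1)"
    proof -
      have "simple_cycle ([d] @ \<pi>1)"
      proof (rule simple_cycle_sublist[OF lcyc])
        show "walk (x + 1, y) ([d] @ \<pi>1) (x + 1, y)"
        using wk1 lat by (auto simp: d_def)
        show "set \<pi>1 \<subseteq> set l" using sub\<pi> \<pi> by auto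
        show "distinct (map snd ([d] @ \<pi>1))"
        using dist unfolding \<pi> by (auto simp: f_def d_def)
        show "rev_edge g' \<notin> set l \<and> rev_edge g' \<notin> set [d]" if "g' \<in> set [d]" for g'
          using that rd pinch by (auto simp: d_def)
      qed simp
      then show ?thesis by simp
      qed
    have cycr: "simple_cycle (r # \<beta>)"
    proof -
      have "simple_cycle ([r] @ \<beta>)"
      proof (rule simple_cycle_sublist[OF lcyc])
        show "walk (x + 1, y + 1) ([r] @ \<beta>) (x + 1, y + 1)"
        using wk2 lat by (simp add: r_def)
        show "set \<beta> \<subseteq> set l" using sub\<pi> \<pi> by auto
        show "distinct (map snd ([r] @ \<beta>))"
        using dist SE unfolding \<pi> by (auto simp: r_def)
        show "rev_edge g' \<notin> set l \<and> rev_edge g' \<notin> set [r]" if "g' \<in> set [r]" for g'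
          using that rr pinch by (auto simp: r_def)
      qed simp
      then show ?thesis by simp
      qed
    \<comment> \<open>Both cycles wind zero times around \<open>p\<close>, since \<open>p\<close> is topmost; so they are counterclockwise.\<close>
    have over0: "overhead p h = 0" if h: "h \<in> set \<pi>" for h
    proof -
      have hl: "h \<in> lattice_edges" "left_square h \<in> R" using bounds_edge_iff[OF b, of h] h sub\<pi> by auto
      have "h \<noteq> e" using h e\<pi> by auto
      show ?thesis
        using hl(1)
      proof (cases rule: lattice_edge_cases)
        case (1 a c)
        then show ?thesis using hl top[of a c] by (auto simp: p_def)
      next
        case (2 a c)
        then have "c - 1 \<le> y" using hl top[of a "c - 1"] by simp
        then show ?thesis using 2 \<open>h \<noteq> e\<close> by (auto simp: p_def e_def)
      qed (auto simp: p_def)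
    qed
    have w0: "winding m p = 0" if "set m \<subseteq> set \<pi>" for m
      using that by (induction m) (auto simp: over0)
    have wd0: "winding (d # \<pi>1) p = 0" and wr0: "winding (r # \<beta>) p = 0"
      using w0[of \<pi>1] w0[of \<beta>] \<pi> by (auto simp: p_def d_def r_def)
    define Rd where "Rd = {s. enclosed (d # \<pi>1) s}"
    define Rr where "Rr = {s. enclosed (r # \<beta>) s}"
    have bd: "bounds (d # \<pi>1) Rd" and inRd: "(x, y - 1) \<in> Rd"
      using cycle_positively_oriented[OF cycd, of d] wd0 unfolding Rd_def by (auto simp: d_def p_def)
    have br: "bounds (r # \<beta>) Rr" and inRr: "(x + 1, y) \<in> Rr"
      using cycle_positively_oriented[OF cycr, of r] wr0 unfolding Rr_def by (auto simp: r_def p_def)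
    have sum: "of_bool (s \<in> Rd) + of_bool (s \<in> Rr) = (of_bool (s \<in> R - {p}) :: int)" for s
    proof -
      have "winding (d # \<pi>1) s = of_bool (s \<in> Rd)" "winding (r # \<beta>) s = of_bool (s \<in> Rr)"
        using bd br unfolding bounds_def by blast+
      then show ?thesis using wB[of s] unfolding \<pi> by (simp del: overhead.simps)
    qed
    have dis: "Rd \<inter> Rr = {}" and un: "Rd \<union> Rr = R - {p}"
    proof -
      have "\<not> (s \<in> Rd \<and> s \<in> Rr)" "s \<in> Rd \<or> s \<in> Rr \<longleftrightarrow> s \<in> R - {p}" for s
        using sum[of s] by (auto simp: of_bool_def split: if_splits)
      then show "Rd \<inter> Rr = {}" "Rd \<union> Rr = R - {p}" by blast+
    qed
    have fin: "finite Rd" "finite Rr" using bd br by (auto simp: bounds_def)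
    have sub: "Rd \<subseteq> R" "Rr \<subseteq> R" "p \<notin> Rd" "p \<notin> Rr" using un by auto
    have card_sum: "card Rd + card Rr = card R - 1" using card_Un_disjoint[OF fin dis] un cRp by simp
    have pos: "0 < card Rd" "0 < card Rr" using inRd inRr fin by (auto simp: card_gt_0_iff)
    have lt: "card Rd < card R" "card Rr < card R" using card_sum pos by auto
    have md: "migdal (d # \<pi>1) Rd (interior_edges Rd) (card Rd - 1)"
      by (rule less.hyps[OF lt(1) bd]) (rule restrict, rule sub)
    have mr: "migdal (r # \<beta>) Rr (interior_edges Rr) (card Rr - 1)"
      by (rule less.hyps[OF lt(2) br]) (rule restrict, rule sub)
    have sp: "supp \<pi>1" "supp \<beta>" using sup\<pi> \<pi> by auto
    have "migdal ([e, f, rev_edge d] @ \<beta>) ({p} \<union> Rr) ({} \<union> interior_edges Rr \<union> {und r}) (Suc (0 + (card Rr - 1)))"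
    proof (rule migdal_merge[OF sq_r mr])
      show "supp (r # \<beta>)" "supp [e, f, rev_edge d]" using suprd sup\<pi> sp by auto
      show "supp_squares Rr" by (rule restrict) (rule sub)
      show "und ` set (r # [e, f, rev_edge d]) \<inter> interior_edges Rr = {}"
        using edge_p[OF sub(4)] lat unfolding sqp by auto
      show "und r \<notin> und ` set [e, f, rev_edge d]" using undne lat by auto
      show "und r \<notin> und ` set \<beta>" by (rule und_notin_l) (use rl rr pinch sub\<pi> \<pi> in auto)
    qed (use fin sub in auto)
    then have "migdal (([e, f] @ [rev_edge d]) @ \<beta>) ({p} \<union> Rr) (interior_edges Rr \<union> {und r}) (card Rr)"
      using pos by simp
    then have "migdal (\<beta> @ ([e, f] @ [rev_edge d])) ({p} \<union> Rr) (interior_edges Rr \<union> {und r}) (card Rr)"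
      by (rule migdal_append_commute) (use sp suprd sup\<pi> in auto)
    then have m1: "migdal ((\<beta> @ [e, f]) @ [rev_edge d]) ({p} \<union> Rr) (interior_edges Rr \<union> {und r}) (card Rr)"
      by simp
    have "migdal ((\<beta> @ [e, f]) @ \<pi>1) (({p} \<union> Rr) \<union> Rd) ((interior_edges Rr \<union> {und r}) \<union> interior_edges Rd \<union> {und d})
      (Suc (card Rr + (card Rd - 1)))"
    proof (rule migdal_merge[OF m1 md])
      show "supp (d # \<pi>1)" "supp (\<beta> @ [e, f])" using suprd sup\<pi> sp by auto
      show "supp_squares Rd" by (rule restrict) (rule sub)
      show "und ` set (square_loop s) \<inter> (interior_edges Rr \<union> {und r}) = {}" if s: "s \<in> Rd" for s
      proof -
        have "und ` set (square_loop s) \<inter> interior_edges Rr = {}"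
          by (rule square_interior_disjoint) (use s dis in auto)
        moreover have "r \<notin> set (square_loop s)" "rev_edge r \<notin> set (square_loop s)"
          using s dis inRr sub by (auto simp: mem_square_loop r_def p_def simp del: plaq_loop.simps)
        then have "und r \<notin> und ` set (square_loop s)" by (rule und_notin_image)
        ultimately show ?thesis by (rule disjoint_Un_singletonI)
      qed
      show "und ` set (d # \<beta> @ [e, f]) \<inter> interior_edges Rd = {}"
      proof -
        have "und ` set (r # \<beta>) \<inter> interior_edges Rd = {}"
          by (rule bounds_interior_disjoint[OF br]) (use dis in auto)
        then show ?thesis using edge_p[OF sub(3)] lat unfolding sqp by auto
      qed
      have "und d \<notin> und ` set \<beta>" by (rule und_notin_l) (use dl rd pinch sub\<pi> \<pi> in auto)
      then show "und d \<notin> und ` set (\<beta> @ [e, f])" using undne by auto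
      show "und d \<notin> und ` set \<pi>1" by (rule und_notin_l) (use dl rd pinch sub\<pi> \<pi> in auto)
    qed (use fin sub dis in auto)
    moreover have "({p} \<union> Rr) \<union> Rd = R" using un Rp by blast
    moreover have "Suc (card Rr + (card Rd - 1)) = card R - 1" using card_sum pos by simp
    ultimately have "migdal (\<beta> @ ([e, f] @ \<pi>1)) R ((interior_edges Rr \<union> {und r}) \<union> interior_edges Rd \<union> {und d}) (card R - 1)"
      by simp
    then have "migdal (([e, f] @ \<pi>1) @ \<beta>) R ((interior_edges Rr \<union> {und r}) \<union> interior_edges Rd \<union> {und d}) (card R - 1)"
      by (rule migdal_append_commute) (use sp sup\<pi> in auto)
    then have "migdal (e # f # \<pi>) R (interior_edges R) (card R - 1)"
      by (rule migdal_cong) (use pd pr pinch interior_edges_mono[OF sub(1)] interior_edges_mono[OF sub(2)] \<pi> in auto)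
    then show ?thesis by (rule fromp)
  qed
qed

text \<open>
  After the region is integrated out, only the weight of \<open>l\<close> couples \<open>l\<close> to the squares outside. The
  column above a topmost square of \<open>R\<close> does not meet \<open>l\<close> again; removing it frees the top edge of
  this square, and integrating over this edge factors off the law of the holonomy. The constant \<open>K\<close>
  does not depend on the test function.
\<close>

theorem bounds_law:
  assumes b: "bounds l R" and T: "finite T" "R \<subseteq> T" "supp_squares T"
  obtains K where "\<And>F. bdm H F \<Longrightarrow>
    (\<integral>Q. (\<Prod>s\<in>T. W s Q) * F (hol Q l) \<partial>confs) = K * (\<integral>u. cpow (card R - 1) u * F u \<partial>H)"
proof -
  have R: "finite R" "R \<noteq> {}" using b bounds_nonempty by (auto simp: bounds_def)
  have sR: "supp_squares R" using T by blast
  have lcyc: "simple_cycle l" using b by (simp add: bounds_def)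
  obtain x y where p: "(x, y) \<in> R" and top: "\<And>x' y'. (x', y') \<in> R \<Longrightarrow> y' \<le> y"
    and "(x - 1, y) \<notin> R"
    using top_left_square[OF R] by blast
  define e where "e = ((x + 1, y + 1), (x, y + 1))"
  have above: "(x, j) \<notin> R" if "y + 1 \<le> j" for j using top[of x j] that by auto
  have el: "e \<in> set l" using bounds_edge_iff[OF b, of e] p above[of "y + 1"] by (simp add: e_def)
  obtain l1 l2 where l12: "l = l1 @ e # l2" using el by (meson split_list)
  have sl: "supp (l1 @ e # l2)" using supp_bounds[OF b sR] l12 by simp
  have ul: "und e \<notin> und ` set l1" "und e \<notin> und ` set l2"
  proof -
    have "distinct l" using lcyc by (auto simp: simple_cycle_def distinct_map)
    moreover have "rev_edge e \<notin> set l" using lcyc el by (auto simp: simple_cycle_def)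
    ultimately show "und e \<notin> und ` set l1" "und e \<notin> und ` set l2"
      by (intro und_notin_image; simp add: l12)+
  qed
  define n where "n = card R - 1"
  define T1 where "T1 = {s \<in> T - R. \<not> (fst s = x \<and> y + 1 \<le> snd s)}"
  define K where "K = (\<integral>u. \<psi> u \<partial>H) ^ card {s \<in> T - R. fst s = x \<and> y + 1 \<le> snd s} * (\<integral>Q. (\<Prod>s\<in>T1. W s Q) \<partial>confs)"
  show ?thesis
  proof (rule that[of K])
    fix F assume F: "bdm H F"
    define G' where "G' u = cpow n u * F u" for u
    have G': "bdm H G'" unfolding G'_def by (intro bdm_mult bdm_cpow F)
    have sTR: "supp_squares (T - R)" using T by blast
    have "(\<integral>Q. (\<Prod>s\<in>T. W s Q) * F (hol Q l) \<partial>confs)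
       = (\<integral>Q. (\<Prod>s\<in>R. W s Q) * ((\<Prod>s\<in>T - R. W s Q) * F (hol Q l)) \<partial>confs)"
    proof -
      have "(\<Prod>s\<in>T. W s Q) = (\<Prod>s\<in>R. W s Q) * (\<Prod>s\<in>T - R. W s Q)" for Q
        using prod.subset_diff[OF T(2,1), of "\<lambda>s. W s Q"] by (simp only: mult.commute)
      then show ?thesis by (simp only: mult.assoc)
    qed
    also have "\<dots> = (\<integral>Q. cpow n (hol Q l) * ((\<Prod>s\<in>T - R. W s Q) * F (hol Q l)) \<partial>confs)"
    proof -
      have "bdm confs (\<lambda>Q. (\<Prod>s\<in>T - R. W s Q) * F (hol Q l))"
        by (intro bdm_mult bdm_prod_W bdm_hol F sTR) (use sl l12 in simp)
      moreover have "indep_of (interior_edges R) (\<lambda>Q. (\<Prod>s\<in>T - R. W s Q) * F (hol Q l))"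
      proof (intro indep_of_mult indep_prod_W indep_of_hol)
        show "und ` set (square_loop s) \<inter> interior_edges R = {}" if "s \<in> T - R" for s
          by (rule square_interior_disjoint) (use that in auto)
        show "und ` set l \<inter> interior_edges R = {}"
        proof -
          have "und e \<notin> interior_edges R" if "e \<in> set l" for e
            using that und_mem_interior[of e R] bounds_edge_iff[OF b, of e] by blast
          then show ?thesis by blast
        qed
      qed
      ultimately show ?thesis
        using migdal_bounds[OF b sR] unfolding migdal_def n_def by blast
    qed
    also have "\<dots> = (\<integral>Q. (\<Prod>s\<in>T - R. W s Q) * G' (hol Q l) \<partial>confs)"
      by (simp only: G'_def mult.left_commute)
    also have "\<dots> = (\<integral>u. \<psi> u \<partial>H) ^ card {s \<in> T - R. fst s = x \<and> y + 1 \<le> snd s} *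
        (\<integral>Q. (\<Prod>s\<in>T1. W s Q) * G' (hol Q l) \<partial>confs)"
      unfolding T1_def
    proof (rule remove_column)
      show "bdm confs (\<lambda>Q. G' (hol Q l))" by (rule bdm_hol[OF G']) (use sl l12 in simp)
      show "indep_of {und ((x + 1, i + 1), x, i + 1) |i. y + 1 \<le> i} (\<lambda>Q. G' (hol Q l))"
      proof (rule indep_of_hol)
        have "und ((x + 1, i + 1), x, i + 1) \<notin> und ` set l" if "y + 1 \<le> i" for i
        proof (rule und_notin_image)
          show "((x + 1, i + 1), x, i + 1) \<notin> set l"
            using bounds_edge_iff[OF b, of "((x + 1, i + 1), x, i + 1)"] above[of i] that by simp
          show "rev_edge ((x + 1, i + 1), x, i + 1) \<notin> set l"
            using bounds_edge_iff[OF b, of "rev_edge ((x + 1, i + 1), x, i + 1)"] above[of "i + 1"] that by simp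
        qed
        then have "z \<notin> und ` set l" if "z \<in> {und ((x + 1, i + 1), x, i + 1) |i. y + 1 \<le> i}" for z
          using that by (elim CollectE exE conjE) (simp only: not_False_eq_True)
        then show "und ` set l \<inter> {und ((x + 1, i + 1), x, i + 1) |i. y + 1 \<le> i} = {}"
          by (intro equals0I) (elim IntE, simp only: not_True_eq_False)
      qed
    qed (use T sTR in auto)
    also have "(\<integral>Q. (\<Prod>s\<in>T1. W s Q) * G' (hol Q l) \<partial>confs)
       = (\<integral>Q. G' (hol Q (l1 @ e # l2)) * (\<Prod>s\<in>T1. W s Q) \<partial>confs)"
      by (simp add: l12 mult.commute)
    also have "\<dots> = (\<integral>u. G' u \<partial>H) * (\<integral>Q. (\<Prod>s\<in>T1. W s Q) \<partial>confs)"
    proof (rule integrate_out[OF G' _ _ sl ul])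
      show "bdm confs (\<lambda>Q. \<Prod>s\<in>T1. W s Q)" by (rule bdm_prod_W) (use T T1_def in blast)
      show "indep_of {und e} (\<lambda>Q. \<Prod>s\<in>T1. W s Q)"
      proof (rule indep_prod_W)
        fix s assume s: "s \<in> T1"
        have "left_square e \<noteq> s" "right_square e \<noteq> s"
          using s p by (auto simp: e_def T1_def)
        then have "e \<notin> set (square_loop s)" "rev_edge e \<notin> set (square_loop s)"
          using mem_square_loop[of e s] mem_square_loop[of "rev_edge e" s] by blast+
        then have "und e \<notin> und ` set (square_loop s)" by (rule und_notin_image)
        then show "und ` set (square_loop s) \<inter> {und e} = {}" by (rule disjoint_singletonI)
      qed
    qed
    finally show "(\<integral>Q. (\<Prod>s\<in>T. W s Q) * F (hol Q l) \<partial>confs) = K * (\<integral>u. cpow (card R - 1) u * F u \<partial>H)"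
      by (simp add: K_def G'_def n_def mult_ac)
  qed
qed

text \<open>
  The constants in \<open>bounds_law\<close> are determined by the case of a constant test function.
\<close>

corollary bounds_same_law:
  assumes b: "bounds l R" "bounds l' R'" and c: "card R = card R'"
    and T: "finite T" "R \<subseteq> T" "R' \<subseteq> T" "supp_squares T"
    and nz: "(\<integral>Q. (\<Prod>s\<in>T. W s Q) \<partial>confs) \<noteq> 0" and F: "bdm H F"
  shows "(\<integral>Q. (\<Prod>s\<in>T. W s Q) * F (hol Q l) \<partial>confs) = (\<integral>Q. (\<Prod>s\<in>T. W s Q) * F (hol Q l') \<partial>confs)"
proof -
  obtain K where K: "\<And>F. bdm H F \<Longrightarrow>
    (\<integral>Q. (\<Prod>s\<in>T. W s Q) * F (hol Q l) \<partial>confs) = K * (\<integral>u. cpow (card R - 1) u * F u \<partial>H)"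
    using bounds_law[OF b(1) T(1,2,4)] by blast
  obtain K' where K': "\<And>F. bdm H F \<Longrightarrow>
    (\<integral>Q. (\<Prod>s\<in>T. W s Q) * F (hol Q l') \<partial>confs) = K' * (\<integral>u. cpow (card R' - 1) u * F u \<partial>H)"
    using bounds_law[OF b(2) T(1,3,4)] by blast
  have "K * (\<integral>u. cpow (card R - 1) u \<partial>H) = K' * (\<integral>u. cpow (card R - 1) u \<partial>H)"
    "K * (\<integral>u. cpow (card R - 1) u \<partial>H) \<noteq> 0"
    using K[of "\<lambda>_. 1"] K'[of "\<lambda>_. 1"] nz c by simp_all
  then have "K = K'" by simp
  then show ?thesis using K[OF F] K'[OF F] c by simp
qed

end

section \<open>Surface sums as power series\<close>

lemma powser_zero_coeffs:
  fixes a :: "nat \<Rightarrow> real"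
  assumes s: "0 < s" and sums: "\<And>x. x \<noteq> 0 \<Longrightarrow> \<bar>x\<bar> < s \<Longrightarrow> (\<lambda>n. a n * x ^ n) sums 0"
  shows "a n = 0"
  using sums
proof (induction n arbitrary: a)
  case (0 a)
  have "((\<lambda>_. 0) \<longlongrightarrow> a 0) (at (0::real))"
    by (rule powser_limit_0_strong[OF s]) (use 0 in auto)
  then show ?case by (simp add: tendsto_const_iff)
next
  case (Suc n a)
  have a0: "a 0 = 0"
  proof -
    have "((\<lambda>_. 0) \<longlongrightarrow> a 0) (at (0::real))"
      by (rule powser_limit_0_strong[OF s]) (use Suc.prems in auto)
    then show ?thesis by (simp add: tendsto_const_iff)
  qed
  have "(\<lambda>n. a (Suc n) * x ^ n) sums 0" if "x \<noteq> 0" "\<bar>x\<bar> < s" for x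
  proof -
    have "(\<lambda>n. a (Suc n) * x ^ Suc n) sums 0"
      using sums_Suc_iff[of "\<lambda>n. a n * x ^ n" 0] Suc.prems[OF that] a0 by simp
    then have "(\<lambda>n. inverse x * (a (Suc n) * x ^ Suc n)) sums (inverse x * 0)" by (rule sums_mult)
    then show ?thesis using that by (simp add: field_simps)
  qed
  then show ?case using Suc.IH[of "\<lambda>n. a (Suc n)"] by blast
qed

lemma closed_walkI: "walk u l u \<Longrightarrow> closed_walk l"
  unfolding closed_walk_iff by blast

lemma closed_walk_split:
  assumes "closed_walk (e # \<pi>)" "i < length \<pi>"
  shows "\<pi> ! i = rev_edge e \<Longrightarrow> closed_walk (drop (Suc i) \<pi>) \<and> closed_walk (take i \<pi>)"
    and "\<pi> ! i = e \<Longrightarrow> closed_walk (e # drop (Suc i) \<pi>) \<and> closed_walk (take i \<pi> @ [e])"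
proof -
  have \<pi>: "\<pi> = take i \<pi> @ \<pi> ! i # drop (Suc i) \<pi>" by (rule id_take_nth_drop[OF assms(2)])
  obtain v where e: "e \<in> lattice_edges" "walk (snd e) \<pi> (fst e)"
    using assms(1) by (auto simp: closed_walk_iff)
  then have w: "walk (snd e) (take i \<pi> @ \<pi> ! i # drop (Suc i) \<pi>) (fst e)" using \<pi> by simp
  from w have w': "walk (snd e) (take i \<pi>) (fst (\<pi> ! i))" "walk (snd (\<pi> ! i)) (drop (Suc i) \<pi>) (fst e)"
    unfolding walk_append walk.simps by blast+
  show "\<pi> ! i = rev_edge e \<Longrightarrow> closed_walk (drop (Suc i) \<pi>) \<and> closed_walk (take i \<pi>)"
    using w' by (auto intro: closed_walkI)
  show "\<pi> ! i = e \<Longrightarrow> closed_walk (e # drop (Suc i) \<pi>) \<and> closed_walk (take i \<pi> @ [e])"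
  proof
    assume a: "\<pi> ! i = e"
    have "walk (snd e) (take i \<pi> @ [e]) (snd e)"
      unfolding walk_append walk.simps using w'(1)[unfolded a] e(1) by blast
    then show "closed_walk (take i \<pi> @ [e])" by (rule closed_walkI)
    have "walk (fst e) (e # drop (Suc i) \<pi>) (fst e)" using w'(2)[unfolded a] e(1) by simp
    then show "closed_walk (e # drop (Suc i) \<pi>)" by (rule closed_walkI)
  qed
qed

lemma plaq_rest_cases:
  assumes "e \<in> set (plaq_loop p)"
  obtains u v where "plaq_loop p = u @ e # v" "plaq_rest e p = v @ u" "e \<notin> set u"
proof -
  obtain u v where uv: "plaq_loop p = u @ e # v" "e \<notin> set u" using assms by (meson split_list_first)
  moreover have "dropWhile (\<lambda>x. x \<noteq> e) (u @ e # v) = e # v" "takeWhile (\<lambda>x. x \<noteq> e) (u @ e # v) = u"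
    using uv(2) by (subst dropWhile_append2, auto, subst takeWhile_append2, auto)
  ultimately have "plaq_rest e p = v @ u"
    by (simp only: plaq_rest_def list.sel)
  then show ?thesis using that uv by blast
qed

lemma plaq_loop_closed: "closed_walk (plaq_loop p)"
proof (cases p rule: plaq_loop.cases)
  case (1 x y)
  then show ?thesis by (intro closed_walkI[of "(x, y)"]) simp
next
  case (2 x y)
  then show ?thesis by (intro closed_walkI[of "(x, y)"]) simp
qed

lemma walk_plaq_rest:
  assumes "e \<in> set (plaq_loop p)"
  shows "walk (snd e) (plaq_rest e p) (fst e)" "e \<in> lattice_edges"
proof -
  obtain u v where uv: "plaq_loop p = u @ e # v" "plaq_rest e p = v @ u"
    using plaq_rest_cases[OF assms] by blast
  have "closed_walk (u @ e # v)" using plaq_loop_closed[of p] uv(1) by simp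
  then obtain w where "walk w (u @ e # v) w" unfolding closed_walk_iff by blast
  then have w: "walk w u (fst e)" "e \<in> lattice_edges" "walk (snd e) v w"
    unfolding walk_append walk.simps by blast+
  then show "walk (snd e) (plaq_rest e p) (fst e)" unfolding uv(2) walk_append by blast
  show "e \<in> lattice_edges" by (rule w(2))
qed

lemma has_sum_sum_finite:
  fixes f :: "'i \<Rightarrow> 'a \<Rightarrow> real"
  assumes "finite T" "\<And>i. i \<in> T \<Longrightarrow> (f i has_sum s i) A"
  shows "((\<lambda>x. \<Sum>i\<in>T. f i x) has_sum (\<Sum>i\<in>T. s i)) A"
  using assms by (induction T rule: finite_induct) (auto intro!: has_sum_add)

lemma has_sum_diff_real:
  fixes f g :: "'a \<Rightarrow> real"
  assumes "(f has_sum a) A" "(g has_sum b) A"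
  shows "((\<lambda>x. f x - g x) has_sum (a - b)) A"
  using has_sum_add[OF assms(1) has_sum_cmult_right[OF assms(2), of "-1"]] by simp

text \<open>
  The coefficient of \<open>\<beta>^m\<close> in the surface sum: all plaquette assignments of area \<open>m\<close> together.
\<close>

definition surface_coeff :: "(edge list \<Rightarrow> plaq multiset \<Rightarrow> real) \<Rightarrow> edge list \<Rightarrow> nat \<Rightarrow> real" where
  "surface_coeff c l m = (\<Sum>\<^sub>\<infinity>K\<in>{K. size K = m}. c l K)"

text \<open>
  It suffices that the surface sums converge at one positive \<open>\<beta>\<close>, called \<open>b0\<close>; they are then power
  series that converge absolutely for \<open>\<bar>\<beta>\<bar> \<le> b0\<close>.
\<close>

locale surface =
  fixes c :: "edge list \<Rightarrow> plaq multiset \<Rightarrow> real" and b0 :: real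
  assumes sc: "surface_coefficients c" and b0: "0 < b0"
    and summ: "closed_walk l \<Longrightarrow> (\<lambda>K. \<bar>c l K * b0 ^ size K\<bar>) summable_on UNIV"
begin

abbreviation coe :: "edge list \<Rightarrow> nat \<Rightarrow> real" where
  "coe \<equiv> surface_coeff c"

lemma summable_at:
  assumes "closed_walk l" "\<bar>b\<bar> \<le> b0"
  shows "(\<lambda>K. norm (c l K * b ^ size K)) summable_on UNIV"
proof (rule Infinite_Sum.abs_summable_on_comparison_test)
  show "(\<lambda>K. norm (c l K * b0 ^ size K)) summable_on UNIV"
    using summ[OF assms(1)] by simp
  show "norm (c l K * b ^ size K) \<le> norm (c l K * b0 ^ size K)" for K
    using assms(2) b0 by (simp add: abs_mult power_abs mult_left_mono power_mono)
qed

lemma surface_sum_sums: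
  assumes "closed_walk l" "\<bar>b\<bar> \<le> b0"
  shows "(\<lambda>m. coe l m * b ^ m) sums surface_sum c b l"
proof -
  define f where "f = (\<lambda>(m::nat, K). c l K * b ^ size K)"
  define A where "A = (SIGMA m:UNIV. {K :: plaq multiset. size K = m})"
  have bij: "bij_betw (\<lambda>K. (size K, K)) UNIV A"
    by (rule bij_betwI[of _ _ _ snd]) (auto simp: A_def)
  have sA: "f summable_on A"
  proof -
    have "(\<lambda>K. f (size K, K)) summable_on UNIV"
      using abs_summable_summable[OF summable_at[OF assms]] by (simp add: f_def)
    then show ?thesis using summable_on_reindex_bij_betw[OF bij, of f] by simp
  qed
  have "infsum f A = surface_sum c b l"
    using infsum_reindex_bij_betw[OF bij, of f] by (simp add: f_def surface_sum_def)
  then have fA: "(f has_sum surface_sum c b l) A" using sA by (metis has_sum_infsum)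
  have inner: "((\<lambda>K. f (m, K)) has_sum (coe l m * b ^ m)) {K. size K = m}" for m
  proof -
    have "(\<lambda>K. c l K * b0 ^ size K) summable_on {K. size K = m}"
      by (rule summable_on_subset_banach[OF abs_summable_summable[OF summable_at[OF assms(1)]] subset_UNIV])
        (use b0 in simp)
    then have "(\<lambda>K. c l K * b0 ^ m) summable_on {K. size K = m}"
      by (rule summable_on_cong[THEN iffD1, rotated]) auto
    then have "(\<lambda>K. c l K * b0 ^ m * inverse (b0 ^ m)) summable_on {K. size K = m}"
      by (rule summable_on_cmult_left)
    then have "c l summable_on {K. size K = m}" using b0 by (simp add: mult.assoc)
    then have "(c l has_sum coe l m) {K. size K = m}" unfolding surface_coeff_def by (rule has_sum_infsum)
    then have "((\<lambda>K. c l K * b ^ m) has_sum (coe l m * b ^ m)) {K. size K = m}" by (rule has_sum_cmult_left)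
    then show ?thesis by (rule has_sum_cong[THEN iffD1, rotated]) (auto simp: f_def)
  qed
  have "((\<lambda>m. coe l m * b ^ m) has_sum surface_sum c b l) UNIV"
    by (rule has_sum_SigmaD[OF fA[unfolded A_def]]) (use inner in auto)
  then show ?thesis by (rule has_sum_imp_sums)
qed

lemma abs_summable_size:
  assumes "closed_walk l"
  shows "(\<lambda>K. norm (c l K)) summable_on {K. size K = m}"
proof -
  have "(\<lambda>K. norm (c l K * b0 ^ size K)) summable_on {K. size K = m}"
    by (rule summable_on_subset_banach[OF summable_at[OF assms] subset_UNIV]) (use b0 in simp)
  then have "(\<lambda>K. norm (c l K * b0 ^ size K) * inverse (b0 ^ m)) summable_on {K. size K = m}"
    by (rule summable_on_cmult_left)
  then show ?thesis
    by (rule summable_on_cong[THEN iffD1, rotated]) (use b0 in \<open>auto simp: abs_mult\<close>)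
qed

lemma coe_has_sum:
  assumes "closed_walk l"
  shows "(c l has_sum coe l m) {K. size K = m}"
  unfolding surface_coeff_def
  by (rule has_sum_infsum, rule abs_summable_summable, rule abs_summable_size[OF assms])

text \<open>
  This transfers symmetries of the lattice model, which are known for the sums, to their coefficients.
\<close>

lemma coe_eqI:
  assumes l: "closed_walk l" "closed_walk l'"
    and eq: "\<And>b. \<bar>b\<bar> \<le> b0 \<Longrightarrow> surface_sum c b l = surface_sum c b l'"
  shows "coe l m = coe l' m"
proof -
  have "(\<lambda>n. coe l n - coe l' n) m = 0"
  proof (rule powser_zero_coeffs[OF b0, where a = "\<lambda>n. coe l n - coe l' n"])
    fix x :: real assume "x \<noteq> 0" "\<bar>x\<bar> < b0"
    then have "(\<lambda>n. coe l n * x ^ n - coe l' n * x ^ n) sums (surface_sum c x l - surface_sum c x l')"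
      by (intro sums_diff surface_sum_sums l) auto
    then show "(\<lambda>n. (coe l n - coe l' n) * x ^ n) sums 0"
      using eq[of x] \<open>\<bar>x\<bar> < b0\<close> by (simp add: left_diff_distrib)
  qed
  then show ?thesis by simp
qed

lemma coe_rotate: "closed_walk l \<Longrightarrow> coe (rotate k l) m = coe l m"
proof -
  assume "closed_walk l"
  then have "c (rotate k l) K = c l K" for K using sc unfolding surface_coefficients_def by blast
  then have "c (rotate k l) = c l" by blast
  then show ?thesis by (simp only: surface_coeff_def)
qed

lemma coe_append_commute: "closed_walk (l @ l') \<Longrightarrow> coe (l' @ l) m = coe (l @ l') m"
  using coe_rotate[of "l @ l'" "length l" m] by (simp add: rotate_append)

lemma coe_Nil: "coe [] m = of_bool (m = 0)"
proof -
  have nil: "c [] {#} = 1" "\<And>K. K \<noteq> {#} \<Longrightarrow> c [] K = 0"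
    using sc unfolding surface_coefficients_def by blast+
  show ?thesis
proof (cases "m = 0")
  case True
  then have "{K::plaq multiset. size K = m} = {{#}}" by auto
  then show ?thesis using nil(1) True by (simp add: surface_coeff_def)
next
  case False
  then have "coe [] m = (\<Sum>\<^sub>\<infinity>K\<in>{K::plaq multiset. size K = m}. 0)"
    unfolding surface_coeff_def by (intro infsum_cong nil(2)) (use False in auto)
  then show ?thesis using False by simp
qed
qed

definition cauchy :: "(nat \<Rightarrow> real) \<Rightarrow> (nat \<Rightarrow> real) \<Rightarrow> nat \<Rightarrow> real" where
  "cauchy f g m = (\<Sum>k\<le>m. f k * g (m - k))"

lemma finite_multiset_splits: "finite {(K1, K2). K1 + K2 = (K :: 'x multiset)}"
proof (induction K)
  case (add x K)
  let ?S = "{(K1, K2). K1 + K2 = K}"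
  have "{(K1, K2). K1 + K2 = add_mset x K} \<subseteq>
    (\<lambda>(a, b). (add_mset x a, b)) ` ?S \<union> (\<lambda>(a, b). (a, add_mset x b)) ` ?S"
  proof
    fix p assume p: "p \<in> {(K1, K2). K1 + K2 = add_mset x K}"
    obtain K1 K2 where p': "p = (K1, K2)" by fastforce
    then have eq: "K1 + K2 = add_mset x K" using p by simp
    then have "x \<in># K1 + K2" by simp
    then consider "x \<in># K1" | "x \<in># K2" by auto
    then show "p \<in> (\<lambda>(a, b). (add_mset x a, b)) ` ?S \<union> (\<lambda>(a, b). (a, add_mset x b)) ` ?S"
    proof cases
      case 1
      then obtain L where "K1 = add_mset x L" by (metis insert_DiffM)
      then show ?thesis using eq p' by (auto simp: image_iff)
    next
      case 2
      then obtain L where "K2 = add_mset x L" by (metis insert_DiffM)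
      then show ?thesis using eq p' by (auto simp: image_iff)
    qed
  qed
  moreover have "finite (\<dots>)" using add by simp
  ultimately show ?case by (rule finite_subset)
qed (auto intro: finite_subset[of _ "{({#}, {#})}"])

text \<open>
  Pairs of assignments of total area \<open>m\<close> can be grouped by their union, as in \<^const>\<open>conv\<close>, or by the
  area of the first one, as in the Cauchy product.
\<close>

lemma conv_has_sum:
  assumes l: "closed_walk l1" "closed_walk l2"
  shows "((\<lambda>K. conv c K l1 l2) has_sum cauchy (coe l1) (coe l2) m) {K. size K = m}"
proof -
  define f where "f = (\<lambda>(K1, K2). c l1 K1 * c l2 K2)"
  define S where "S k = {K1 :: plaq multiset. size K1 = k} \<times> {K2 :: plaq multiset. size K2 = m - k}" for k
  have fS: "(f has_sum (coe l1 k * coe l2 (m - k))) (S k)" for k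
    unfolding S_def f_def
  proof (rule has_sum_SigmaI[where g = "\<lambda>K1. c l1 K1 * coe l2 (m - k)"])
    show "((\<lambda>y. case (x, y) of (K1, K2) \<Rightarrow> c l1 K1 * c l2 K2) has_sum c l1 x * coe l2 (m - k)) {K2. size K2 = m - k}" for x
      using has_sum_cmult_right[OF coe_has_sum[OF l(2)]] by simp
    show "((\<lambda>K1. c l1 K1 * coe l2 (m - k)) has_sum coe l1 k * coe l2 (m - k)) {K1. size K1 = k}"
      by (intro has_sum_cmult_left coe_has_sum l)
    show "(\<lambda>(K1, K2). c l1 K1 * c l2 K2) summable_on {K1. size K1 = k} \<times> {K2. size K2 = m - k}"
    proof (rule abs_summable_summable)
      have "(\<lambda>K1. norm (c l1 K1) * (\<Sum>\<^sub>\<infinity>K2\<in>{K2. size K2 = m - k}. norm (c l2 K2))) summable_on {K1. size K1 = k}"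
        by (intro summable_on_cmult_left abs_summable_size l)
      then show "(\<lambda>x. norm (case x of (K1, K2) \<Rightarrow> c l1 K1 * c l2 K2)) summable_on {K1. size K1 = k} \<times> {K2. size K2 = m - k}"
        by (intro summable_on_SigmaI[where g = "\<lambda>K1. norm (c l1 K1) * (\<Sum>\<^sub>\<infinity>K2\<in>{K2. size K2 = m - k}. norm (c l2 K2))"])
          (auto simp: abs_mult intro!: has_sum_cmult_right has_sum_infsum abs_summable_size[OF l(2), simplified])
    qed
  qed
  have SU: "(\<Union>k\<in>{..m}. S k) = {(K1, K2). size K1 + size K2 = m}"
    by (auto simp: S_def)
  have "(f has_sum (\<Sum>k\<le>m. coe l1 k * coe l2 (m - k))) (\<Union>k\<in>{..m}. S k)"
    by (rule sum_has_sum) (use fS in \<open>auto simp: S_def\<close>)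
  then have P: "(f has_sum cauchy (coe l1) (coe l2) m) {(K1, K2). size K1 + size K2 = m}"
    unfolding SU cauchy_def .
  define A where "A = (SIGMA K:{K :: plaq multiset. size K = m}. {(K1, K2). K1 + K2 = K})"
  have bij: "bij_betw (\<lambda>(K1, K2). (K1 + K2, (K1, K2))) {(K1, K2). size K1 + size K2 = m} A"
    by (rule bij_betwI[of _ _ _ snd]) (auto simp: A_def)
  have "((\<lambda>(K, p). f p) has_sum cauchy (coe l1) (coe l2) m) A"
    using has_sum_reindex_bij_betw[OF bij, of "\<lambda>(K, p). f p"] P by (simp add: split_beta)
  then show ?thesis unfolding A_def
  proof (rule has_sum_SigmaD)
    show "((\<lambda>y. case (K, y) of (K, p) \<Rightarrow> f p) has_sum conv c K l1 l2) {(K1, K2). K1 + K2 = K}" for K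
      using has_sum_finite[OF finite_multiset_splits[of K], of f] by (simp add: conv_def f_def)
  qed
qed

lemma plaquette_has_sum:
  assumes fin: "finite P" and l: "\<And>p. p \<in> P \<Longrightarrow> closed_walk (L p)"
  shows "((\<lambda>K. \<Sum>p | p \<in> P \<and> p \<in># K. c (L p) (K - {#p#})) has_sum
    (\<Sum>p\<in>P. if m = 0 then 0 else coe (L p) (m - 1))) {K. size K = m}"
proof -
  have one: "((\<lambda>K. if p \<in># K then c (L p) (K - {#p#}) else 0) has_sum
     (if m = 0 then 0 else coe (L p) (m - 1))) {K. size K = m}" if p: "p \<in> P" for p
  proof (cases m)
    case 0
    then have "{K::plaq multiset. size K = m} = {{#}}" by auto
    then show ?thesis using 0 has_sum_finite[of "{{#}}" "\<lambda>K. if p \<in># K then c (L p) (K - {#p#}) else 0"] by simp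
  next
    case (Suc k)
    have bij: "bij_betw (add_mset p) {K. size K = k} {K. size K = m \<and> p \<in># K}"
      by (rule bij_betwI[of _ _ _ "\<lambda>K. K - {#p#}"]) (auto simp: Suc size_Diff_singleton)
    have "((\<lambda>K. c (L p) (K - {#p#})) has_sum coe (L p) k) {K. size K = m \<and> p \<in># K}"
      using has_sum_reindex_bij_betw[OF bij, of "\<lambda>K. c (L p) (K - {#p#})"] coe_has_sum[OF l[OF p], of k] by simp
    moreover have "((\<lambda>K. if p \<in># K then c (L p) (K - {#p#}) else 0) has_sum coe (L p) k) {K. size K = m}
      \<longleftrightarrow> ((\<lambda>K. c (L p) (K - {#p#})) has_sum coe (L p) k) {K. size K = m \<and> p \<in># K}"
      by (rule has_sum_cong_neutral) auto
    ultimately show ?thesis using Suc by simp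
  qed
  have "((\<lambda>K. \<Sum>p\<in>P. if p \<in># K then c (L p) (K - {#p#}) else 0) has_sum
    (\<Sum>p\<in>P. if m = 0 then 0 else coe (L p) (m - 1))) {K. size K = m}"
    using fin one by (intro has_sum_sum_finite) auto
  moreover have "(\<Sum>p\<in>P. if p \<in># K then c (L p) (K - {#p#}) else 0) = (\<Sum>p | p \<in> P \<and> p \<in># K. c (L p) (K - {#p#}))" for K
    by (rule sum.inter_filter[OF fin, symmetric])
  ultimately show ?thesis by simp
qed

text \<open>
  The recursion for the coefficients, summed over all plaquette assignments of a given area.
\<close>

theorem master_loop:
  assumes cw: "closed_walk (e # \<pi>)" and fin: "finite (plaqs_at e)" "finite (plaqs_at (rev_edge e))"
  shows "coe (e # \<pi>) m =
      (\<Sum>i | i < length \<pi> \<and> \<pi> ! i = rev_edge e. cauchy (coe (drop (Suc i) \<pi>)) (coe (take i \<pi>)) m)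
    - (\<Sum>i | i < length \<pi> \<and> \<pi> ! i = e. cauchy (coe (e # drop (Suc i) \<pi>)) (coe (take i \<pi> @ [e])) m)
    + (\<Sum>p\<in>plaqs_at (rev_edge e). if m = 0 then 0 else coe (plaq_rest (rev_edge e) p @ \<pi>) (m - 1))
    - (\<Sum>q\<in>plaqs_at e. if m = 0 then 0 else coe (e # plaq_rest e q @ e # \<pi>) (m - 1))"
proof -
  have e: "e \<in> lattice_edges" "walk (snd e) \<pi> (fst e)" using cw by (auto simp: closed_walk_iff)
  have c1: "closed_walk (plaq_rest (rev_edge e) p @ \<pi>)" if "p \<in> plaqs_at (rev_edge e)" for p
  proof (rule closed_walkI)
    have "walk (fst e) (plaq_rest (rev_edge e) p) (snd e)"
      using walk_plaq_rest(1)[of "rev_edge e" p] that by (simp add: plaqs_at_def)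
    then show "walk (fst e) (plaq_rest (rev_edge e) p @ \<pi>) (fst e)"
      unfolding walk_append using e(2) by blast
  qed
  have c2: "closed_walk (e # plaq_rest e q @ e # \<pi>)" if "q \<in> plaqs_at e" for q
  proof (rule closed_walkI)
    have "walk (snd e) (plaq_rest e q) (fst e)"
      using walk_plaq_rest(1)[of e q] that by (simp add: plaqs_at_def)
    then show "walk (fst e) (e # plaq_rest e q @ e # \<pi>) (fst e)"
      unfolding walk_append walk.simps using e by blast
  qed
  have rec: "c (e # \<pi>) K =
          (\<Sum>i | i < length \<pi> \<and> \<pi> ! i = rev_edge e.
             conv c K (drop (Suc i) \<pi>) (take i \<pi>))
        - (\<Sum>i | i < length \<pi> \<and> \<pi> ! i = e.
             conv c K (e # drop (Suc i) \<pi>) (take i \<pi> @ [e]))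
        + (\<Sum>p | p \<in> plaqs_at (rev_edge e) \<and> p \<in># K.
             c (plaq_rest (rev_edge e) p @ \<pi>) (K - {#p#}))
        - (\<Sum>q | q \<in> plaqs_at e \<and> q \<in># K.
             c (e # plaq_rest e q @ e # \<pi>) (K - {#q#}))" for K
    using sc cw unfolding surface_coefficients_def by blast
  have "(c (e # \<pi>) has_sum
      ((\<Sum>i | i < length \<pi> \<and> \<pi> ! i = rev_edge e. cauchy (coe (drop (Suc i) \<pi>)) (coe (take i \<pi>)) m)
    - (\<Sum>i | i < length \<pi> \<and> \<pi> ! i = e. cauchy (coe (e # drop (Suc i) \<pi>)) (coe (take i \<pi> @ [e])) m)
    + (\<Sum>p\<in>plaqs_at (rev_edge e). if m = 0 then 0 else coe (plaq_rest (rev_edge e) p @ \<pi>) (m - 1))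
    - (\<Sum>q\<in>plaqs_at e. if m = 0 then 0 else coe (e # plaq_rest e q @ e # \<pi>) (m - 1)))) {K. size K = m}"
  proof -
    have fin': "finite {i. i < length \<pi> \<and> \<pi> ! i = e'}" for e' by simp
    have h1: "((\<lambda>K. \<Sum>i | i < length \<pi> \<and> \<pi> ! i = rev_edge e. conv c K (drop (Suc i) \<pi>) (take i \<pi>)) has_sum
      (\<Sum>i | i < length \<pi> \<and> \<pi> ! i = rev_edge e. cauchy (coe (drop (Suc i) \<pi>)) (coe (take i \<pi>)) m)) {K. size K = m}"
    proof (rule has_sum_sum_finite[OF fin'])
      fix i assume "i \<in> {i. i < length \<pi> \<and> \<pi> ! i = rev_edge e}"
      then have i: "i < length \<pi>" "\<pi> ! i = rev_edge e" by auto
      show "((\<lambda>K. conv c K (drop (Suc i) \<pi>) (take i \<pi>)) has_sum cauchy (coe (drop (Suc i) \<pi>)) (coe (take i \<pi>)) m) {K. size K = m}"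
        using closed_walk_split(1)[OF cw i] by (intro conv_has_sum) auto
    qed
    have h2: "((\<lambda>K. \<Sum>i | i < length \<pi> \<and> \<pi> ! i = e. conv c K (e # drop (Suc i) \<pi>) (take i \<pi> @ [e])) has_sum
      (\<Sum>i | i < length \<pi> \<and> \<pi> ! i = e. cauchy (coe (e # drop (Suc i) \<pi>)) (coe (take i \<pi> @ [e])) m)) {K. size K = m}"
    proof (rule has_sum_sum_finite[OF fin'])
      fix i assume "i \<in> {i. i < length \<pi> \<and> \<pi> ! i = e}"
      then have i: "i < length \<pi>" "\<pi> ! i = e" by auto
      show "((\<lambda>K. conv c K (e # drop (Suc i) \<pi>) (take i \<pi> @ [e])) has_sum cauchy (coe (e # drop (Suc i) \<pi>)) (coe (take i \<pi> @ [e])) m) {K. size K = m}"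
        using closed_walk_split(2)[OF cw i] by (intro conv_has_sum) auto
    qed
    show ?thesis
      unfolding rec[abs_def]
      by (rule has_sum_diff_real[OF has_sum_add[OF has_sum_diff_real[OF h1 h2] plaquette_has_sum[OF fin(2) c1]] plaquette_has_sum[OF fin(1) c2]])
  qed
  from has_sum_unique[OF coe_has_sum[OF cw, of m] this] show ?thesis .
qed

end

unbundle fps_syntax

section \<open>The generating function of the moments\<close>

lemma fps_nth_X_mult_deriv: "(fps_X * fps_deriv v) $ n = of_nat n * (v :: real fps) $ n"
  by (cases n) simp_all

lemma fps_mult_inverse: "u $ 0 \<noteq> 0 \<Longrightarrow> u * inverse u = (1 :: real fps)"
  by (metis inverse_mult_eq_1 mult.commute)

text \<open>
  The formal residue of \<open>h' h^(- Suc j)\<close> for \<open>h = X u\<close>: it vanishes for positive \<open>j\<close>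
  because there it is a derivative.
\<close>

lemma residue_power:
  fixes u :: "real fps"
  assumes u: "u $ 0 \<noteq> 0"
  shows "(fps_deriv (fps_X * u) * inverse u ^ Suc j) $ j = (if j = 0 then 1 else 0)"
proof -
  define v where "v = inverse u ^ j"
  note u1 = fps_mult_inverse[OF u]
  have du: "fps_deriv (inverse u) = - fps_deriv u * (inverse u)\<^sup>2" using fps_inverse_deriv[OF u] .
  have "fps_deriv (fps_X * u) * inverse u ^ Suc j = v * (u * inverse u) + fps_X * fps_deriv u * inverse u ^ Suc j"
    by (simp add: v_def algebra_simps)
  then have *: "fps_deriv (fps_X * u) * inverse u ^ Suc j = v + fps_X * (fps_deriv u * inverse u ^ Suc j)"
    by (simp add: u1 mult.assoc)
  show ?thesis
  proof (cases j)
    case 0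
    then show ?thesis unfolding * by (simp add: v_def)
  next
    case (Suc i)
    define w where "w = fps_X * (fps_deriv u * inverse u ^ Suc j)"
    have "fps_deriv v = fps_const (real j) * fps_deriv (inverse u) * inverse u ^ (j - 1)"
      unfolding v_def by (rule fps_deriv_power)
    also have "\<dots> = - (fps_const (real j) * (fps_deriv u * inverse u ^ Suc j))"
      unfolding du using Suc by (simp add: power2_eq_square mult_ac)
    finally have "fps_X * fps_deriv v = - (fps_const (real j) * w)"
      by (simp add: w_def mult_ac)
    then have "(fps_X * fps_deriv v) $ j = - (real j * w $ j)" by simp
    then have "real j * v $ j = - (real j * w $ j)"
      unfolding fps_nth_X_mult_deriv .
    then have "real j * (v $ j + w $ j) = 0" by (simp only: distrib_left)
    then have "v $ j = - w $ j" using Suc by simp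
    then have "v $ j = - (fps_X * (fps_deriv u * inverse u ^ Suc j)) $ j" unfolding w_def .
    then show ?thesis unfolding * using Suc by simp
  qed
qed

text \<open>
  Lagrange inversion for \<open>h = X u\<close>, whose compositional inverse is \<open>\<psi>\<close>. The residue of
  \<open>\<psi>' (h) h' h^(- Suc n)\<close> picks out one coefficient of \<open>\<psi>'\<close>, and \<open>\<psi>' (h) h' = 1\<close>.
\<close>

lemma lagrange_inversion_nth:
  fixes u \<psi> :: "real fps"
  assumes u: "u $ 0 \<noteq> 0" and \<psi>: "\<psi> oo (fps_X * u) = fps_X"
  shows "of_nat (Suc n) * \<psi> $ Suc n = (inverse u ^ Suc n) $ n"
proof -
  define F where "F = fps_deriv \<psi>"
  define h where "h = fps_X * u"
  define A where "A = fps_deriv h * inverse u ^ Suc n"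
  note u1 = fps_mult_inverse[OF u]
  have c0: "h $ 0 = 0" by (simp add: h_def)
  have "fps_deriv (\<psi> oo h) = (F oo h) * fps_deriv h" unfolding F_def by (rule fps_compose_deriv[OF c0])
  then have one: "(F oo h) * fps_deriv h = 1" using \<psi> by (simp add: h_def)
  have pk: "(h ^ k * A) $ n = (if k = n then 1 else 0)" if "k \<le> n" for k
  proof -
    have "h ^ k * A = fps_X ^ k * (fps_deriv h * inverse u ^ Suc (n - k)) * (u * inverse u) ^ k"
    proof -
      have "Suc n = Suc (n - k) + k" using that by simp
      then have "inverse u ^ Suc n = inverse u ^ Suc (n - k) * inverse u ^ k" by (metis power_add)
      then show ?thesis unfolding A_def h_def by (simp only: power_mult_distrib mult_ac)
    qed
    then have "(h ^ k * A) $ n = (fps_deriv h * inverse u ^ Suc (n - k)) $ (n - k)"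
      using that by (simp add: u1 fps_X_power_mult_nth)
    also have "\<dots> = (if n - k = 0 then 1 else 0)" unfolding h_def by (rule residue_power[OF u])
    finally show ?thesis using that by auto
  qed
  have comp: "(F oo h) $ m = (\<Sum>k=0..n. F $ k * (h ^ k) $ m)" if "m \<le> n" for m
  proof -
    have "(h ^ k) $ m = 0" if "m < k" for k
      using that c0 by (intro startsby_zero_power_prefix[rule_format]) auto
    then show ?thesis unfolding fps_compose_nth
      by (intro sum.mono_neutral_left) (use that in auto)
  qed
  have "(inverse u ^ Suc n) $ n = ((F oo h) * A) $ n"
    using one by (simp add: A_def mult.assoc[symmetric])
  also have "\<dots> = (\<Sum>m=0..n. (F oo h) $ m * A $ (n - m))" by (simp add: fps_mult_nth)
  also have "\<dots> = (\<Sum>m=0..n. (\<Sum>k=0..n. F $ k * (h ^ k) $ m) * A $ (n - m))"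
    by (intro sum.cong refl) (auto simp: comp)
  also have "\<dots> = (\<Sum>k=0..n. F $ k * (\<Sum>m=0..n. (h ^ k) $ m * A $ (n - m)))"
    unfolding sum_distrib_right sum_distrib_left by (subst sum.swap) (simp add: mult.assoc)
  also have "\<dots> = (\<Sum>k=0..n. F $ k * (h ^ k * A) $ n)" by (simp add: fps_mult_nth)
  also have "\<dots> = (\<Sum>k=0..n. if k = n then F $ k else 0)"
    by (intro sum.cong refl) (auto simp: pk)
  also have "\<dots> = F $ n" by simp
  finally show ?thesis by (simp add: F_def)
qed

text \<open>
  The generating function of the moments of a loop of area \<open>a\<close> with the powers of \<open>\<beta>\<close> left out:
  \<open>1 + \<psi>\<close> where \<open>\<psi> (1 + \<psi>)^(a - 1) = X\<close>. For area zero all moments are one.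
\<close>

definition moment_fps :: "nat \<Rightarrow> real fps" where
  "moment_fps a = (if a = 0 then inverse (1 - fps_X) else 1 + fps_inv (fps_X * (1 + fps_X) ^ (a - 1)))"

lemma moment_fps_0 [simp]: "moment_fps a $ 0 = 1"
  by (simp add: moment_fps_def fps_inv_def)

lemma area_fps_nth:
  "(fps_X * (1 + fps_X) ^ m :: real fps) $ 0 = 0" "(fps_X * (1 + fps_X) ^ m :: real fps) $ 1 = 1"
  by (simp_all add: fps_power_zeroth)

lemma moment_fps_inverse:
  assumes "0 < a"
  shows "(moment_fps a - 1) * moment_fps a ^ (a - 1) = fps_X"
proof -
  define h where "h = (fps_X * (1 + fps_X) ^ (a - 1) :: real fps)"
  have \<psi>: "moment_fps a - 1 = fps_inv h" using assms by (simp add: moment_fps_def h_def)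
  have 0: "fps_inv h $ 0 = 0" by (simp add: fps_inv_def)
  have "h oo fps_inv h = fps_X"
    by (rule fps_inv_right) (use area_fps_nth[of "a - 1"] in \<open>auto simp: h_def\<close>)
  moreover have "h oo fps_inv h = fps_inv h * (1 + fps_inv h) ^ (a - 1)"
    unfolding h_def[symmetric]
    by (subst h_def, simp only: fps_compose_mult_distrib[OF 0] fps_compose_power[OF 0, symmetric]
        fps_compose_add_distrib fps_compose_1 fps_X_fps_compose_startby0[OF 0])
  ultimately show ?thesis using \<psi> by (simp add: algebra_simps)
qed

text \<open>
  By Lagrange inversion the coefficients are those of negative powers of \<open>1 + X\<close>.
\<close>

lemma moment_fps_nth:
  assumes a: "0 < a" and n: "0 < n"
  shows "moment_fps a $ n = c_coeff n a"
proof -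
  define u where "u = ((1 + fps_X) ^ (a - 1) :: real fps)"
  define m where "m = a - 1"
  obtain k where k: "n = Suc k" using n by (cases n) auto
  have u0: "u $ 0 \<noteq> 0" by (simp add: u_def fps_power_zeroth)
  have inv: "fps_inv (fps_X * u) oo (fps_X * u) = fps_X"
    by (rule fps_inv) (use area_fps_nth[of "a - 1"] in \<open>auto simp: u_def\<close>)
  have "of_nat n * fps_inv (fps_X * u) $ n = (inverse u ^ n) $ k"
    using lagrange_inversion_nth[OF u0 inv, of k] k by simp
  moreover have "moment_fps a $ n = fps_inv (fps_X * u) $ n"
    using a n by (simp add: moment_fps_def u_def)
  moreover have "inverse u ^ n = fps_binomial (- of_nat (m * n))"
    unfolding fps_binomial_minus_of_nat u_def m_def by (simp add: power_mult fps_inverse_power)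
  ultimately have nm: "of_nat n * moment_fps a $ n = (- real (m * n)) gchoose k"
    by simp
  have neg: "(- real (m * n)) gchoose k = (-1) ^ k * ((real k + real (m * n) - 1) gchoose k)"
    by (subst gbinomial_negated_upper) simp
  show ?thesis
  proof (cases "a = 1")
    case True
    then have "of_nat n * moment_fps a $ n = (0 gchoose k :: real)" using nm by (simp add: m_def)
    also have "\<dots> = (if k = 0 then 1 else 0)" by (cases k) auto
    finally show ?thesis using True k by (auto simp: c_coeff_def split: if_splits)
  next
    case False
    then have m: "1 \<le> m" using a by (simp add: m_def)
    have "1 \<le> m * n" using m n by simp
    moreover have "a = Suc m" using a by (simp add: m_def)
    then have "m * n + n = n * a" by simp
    ultimately have e: "real k + real (m * n) - 1 = real (n * a - 2)" "n - 1 = k" "even (n + 1) = even k"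
      using k by (auto simp: of_nat_diff simp flip: of_nat_add)
    have "of_nat n * moment_fps a $ n = (-1) ^ k * real ((n * a - 2) choose k)"
      unfolding nm neg e(1) binomial_gbinomial by simp
    then have "moment_fps a $ n = (-1) ^ k * real ((n * a - 2) choose k) / real n"
      using n by (simp add: field_simps)
    then show ?thesis using False e k by (simp add: c_coeff_def)
  qed
qed

lemma moment_fps_zero_nth: "moment_fps 0 $ n = 1"
  by (simp add: moment_fps_def fps_inverse_one_minus_fps_X)

text \<open>
  One more square substitutes \<open>X / M\<close> for \<open>X\<close>, with \<open>M\<close> the new generating function. This
  is the functional equation behind the induction on the area.
\<close>

lemma moment_fps_Suc:
  "moment_fps a oo (fps_X * inverse (moment_fps (Suc a))) = moment_fps (Suc a)"
proof -
  define G where "G = moment_fps (Suc a)"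
  define \<psi> where "\<psi> = G - 1"
  have G0: "G $ 0 \<noteq> 0" "\<psi> $ 0 = 0" by (simp_all add: G_def \<psi>_def)
  note GG = fps_mult_inverse[OF G0(1)]
  have X: "\<psi> * G ^ a = fps_X" using moment_fps_inverse[of "Suc a"] by (simp add: G_def \<psi>_def)
  define Y where "Y = fps_X * inverse G"
  have Y0: "Y $ 0 = 0" by (simp add: Y_def)
  have "moment_fps a oo Y = G"
  proof (cases a)
    case 0
    have G: "G = 1 + fps_X" using X 0 by (simp add: \<psi>_def algebra_simps)
    have "(1 - fps_X) oo Y = 1 - Y" using Y0 by (simp add: fps_compose_sub_distrib)
    moreover have "inverse (1 - fps_X) oo Y = inverse ((1 - fps_X) oo Y)"
      by (rule fps_inverse_compose[OF Y0]) simp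
    moreover have "(1 - Y) * G = 1"
    proof -
      have "Y * G = fps_X * (G * inverse G)" by (simp add: Y_def mult_ac)
      then have "(1 - Y) * G = G - fps_X" by (simp add: left_diff_distrib GG)
      then show ?thesis by (simp add: G)
    qed
    then have "inverse (1 - Y) = G" by (rule fps_inverse_unique)
    ultimately show ?thesis using 0 by (simp add: moment_fps_def)
  next
    case (Suc b)
    define h where "h = (fps_X * (1 + fps_X) ^ b :: real fps)"
    have c: "h $ 0 = 0" "h $ 1 \<noteq> 0" using area_fps_nth[of b] by (auto simp: h_def)
    have "h oo \<psi> = \<psi> * G ^ b"
      unfolding h_def using G0(2)
      by (simp add: fps_compose_mult_distrib fps_compose_power[symmetric] fps_compose_add_distrib \<psi>_def
        fps_X_fps_compose_startby0)
    also have "\<dots> = Y"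
    proof -
      have "\<psi> * G ^ b = (\<psi> * G ^ a) * inverse G" using GG Suc by (simp add: mult_ac)
      then show ?thesis by (simp add: X Y_def)
    qed
    finally have Y: "Y = h oo \<psi>" ..
    have "fps_inv h oo Y = (fps_inv h oo h) oo \<psi>"
      unfolding Y by (rule fps_compose_assoc[OF G0(2) c(1)])
    also have "\<dots> = \<psi>" using fps_inv[OF c] G0(2) by (simp add: fps_X_fps_compose_startby0)
    finally show ?thesis using Suc
      by (simp add: moment_fps_def h_def[symmetric] fps_compose_add_distrib \<psi>_def)
  qed
  then show ?thesis by (simp add: Y_def G_def)
qed

text \<open>
  The coefficients of this series will be those of the words \<open>A B^i (A B)^n\<close>, where \<open>A\<close> is a square and
  \<open>B\<close> a loop of area \<open>a\<close>. It is defined as the solution of the recursion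
  \<open>mixed_fps_nth_rec\<close> that the master loop equation gives for these words.
\<close>

definition mixed_fps :: "nat \<Rightarrow> nat \<Rightarrow> real fps" where
  "mixed_fps a i = (fps_shift i (moment_fps a) oo (fps_X * inverse (moment_fps (Suc a))))
     * inverse (moment_fps (Suc a))"

lemma mixed_fps_rec:
  "moment_fps (Suc a) * mixed_fps a i = fps_const (moment_fps a $ i) + fps_X * mixed_fps a (Suc i)"
proof -
  define G where "G = moment_fps (Suc a)"
  define Y where "Y = fps_X * inverse G"
  have Y0: "Y $ 0 = 0" by (simp add: Y_def)
  have "G $ 0 \<noteq> 0" by (simp add: G_def)
  then have GG: "G * inverse G = 1" by (rule fps_mult_inverse)
  have sh: "fps_shift i (moment_fps a) = fps_const (moment_fps a $ i) + fps_X * fps_shift (Suc i) (moment_fps a)"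
    by (rule fps_ext) (simp add: fps_X_mult_nth split: nat.split)
  have "G * mixed_fps a i = (fps_shift i (moment_fps a) oo Y) * (G * inverse G)"
    by (simp add: mixed_fps_def G_def Y_def mult_ac)
  also have "\<dots> = fps_const (moment_fps a $ i) + Y * (fps_shift (Suc i) (moment_fps a) oo Y)"
    unfolding sh GG using Y0
    by (simp add: fps_compose_add_distrib fps_compose_mult_distrib fps_X_fps_compose_startby0)
  also have "Y * (fps_shift (Suc i) (moment_fps a) oo Y) = fps_X * mixed_fps a (Suc i)"
    by (simp add: mixed_fps_def Y_def G_def mult_ac)
  finally show ?thesis by (simp add: G_def)
qed

lemma mixed_fps_0: "mixed_fps a 0 = 1"
proof -
  have "moment_fps (Suc a) $ 0 \<noteq> 0" by simp
  then have "moment_fps (Suc a) * inverse (moment_fps (Suc a)) = 1"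
    by (rule fps_mult_inverse)
  then show ?thesis by (simp add: mixed_fps_def moment_fps_Suc)
qed

lemma mixed_fps_1_nth: "mixed_fps a (Suc 0) $ n = moment_fps (Suc a) $ Suc n"
proof -
  have "moment_fps (Suc a) = 1 + fps_X * mixed_fps a (Suc 0)"
    using mixed_fps_rec[of a 0] by (simp add: mixed_fps_0)
  then have "moment_fps (Suc a) $ Suc n = (1 + fps_X * mixed_fps a (Suc 0)) $ Suc n" by simp
  then show ?thesis by simp
qed

lemma mixed_fps_nth_rec:
  "(\<Sum>k\<le>n. moment_fps (Suc a) $ (n - k) * mixed_fps a i $ k)
    = (case n of 0 \<Rightarrow> moment_fps a $ i | Suc n' \<Rightarrow> mixed_fps a (Suc i) $ n')"
proof -
  have "(\<Sum>k\<le>n. moment_fps (Suc a) $ (n - k) * mixed_fps a i $ k) = (mixed_fps a i * moment_fps (Suc a)) $ n"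
    by (simp add: fps_mult_nth atMost_atLeast0 mult.commute)
  also have "\<dots> = (fps_const (moment_fps a $ i) + fps_X * mixed_fps a (Suc i)) $ n"
    using mixed_fps_rec[of a i] by (simp add: mult.commute)
  also have "\<dots> = (case n of 0 \<Rightarrow> moment_fps a $ i | Suc n' \<Rightarrow> mixed_fps a (Suc i) $ n')"
    by (cases n) simp_all
  finally show ?thesis .
qed

section \<open>Summability\<close>

text \<open>
  The ratio of consecutive left-hand sides is \<open>4 (2 n + 1) (2 n + 3) / (n + 1)\<^sup>2\<close>, which is below \<open>16\<close>.
\<close>

lemma central_binomial_sq: "real ((2 * n) choose n) ^ 2 * (2 * real n + 1) \<le> 16 ^ n"
proof (induction n)
  case (Suc n)
  define C where "C = real ((2 * n) choose n)"
  have "Suc n * Suc n * ((2 * Suc n) choose Suc n) = (2 * n + 2) * (2 * n + 1) * ((2 * n) choose n)"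
  proof -
    have "Suc n * ((2 * Suc n) choose Suc n) = (2 * n + 2) * ((2 * n + 1) choose n)"
      using Suc_times_binomial_eq[of "2 * n + 1" n] by simp
    moreover have "Suc n * ((2 * n + 1) choose n) = (2 * n + 1) * ((2 * n) choose n)"
      using binomial_absorb_comp[of "2 * n + 1" n] by simp
    ultimately show ?thesis by (metis mult.assoc mult.left_commute)
  qed
  then have "real (Suc n) * real (Suc n) * real ((2 * Suc n) choose Suc n) = real (2 * n + 2) * real (2 * n + 1) * C"
    unfolding C_def by (metis of_nat_mult)
  moreover define D where "D = real ((2 * Suc n) choose Suc n)"
  ultimately have "(real n + 1) * ((real n + 1) * D) = (real n + 1) * (2 * (2 * real n + 1) * C)"
    by (simp add: algebra_simps)
  then have "(real n + 1) * D = 2 * (2 * real n + 1) * C"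
    by (subst (asm) mult_left_cancel) simp_all
  then have c: "real ((2 * Suc n) choose Suc n) = 2 * (2 * real n + 1) / (real n + 1) * C"
    unfolding D_def[symmetric] by (simp add: field_simps)
  have "real ((2 * Suc n) choose Suc n) ^ 2 * (2 * real (Suc n) + 1)
     = (C ^ 2 * (2 * real n + 1)) * (4 * (2 * real n + 1) * (2 * real n + 3) / (real n + 1) ^ 2)"
    unfolding c by (simp add: power2_eq_square field_simps)
  also have "\<dots> \<le> 16 ^ n * 16"
  proof (rule mult_mono)
    show "C ^ 2 * (2 * real n + 1) \<le> 16 ^ n" using Suc by (simp add: C_def)
    show "4 * (2 * real n + 1) * (2 * real n + 3) / (real n + 1) ^ 2 \<le> 16"
    proof -
      have "4 * (2 * real n + 1) * (2 * real n + 3) \<le> 16 * (real n + 1) ^ 2"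
        by (simp add: power2_eq_square algebra_simps)
      moreover have "0 < (real n + 1) ^ 2" by simp
      ultimately show ?thesis by (simp only: pos_divide_le_eq)
    qed
  qed auto
  finally show ?case by simp
qed simp

text \<open>
  The factor \<open>sqrt m\<close> gained over the trivial bound gives summability at \<open>\<bar>\<beta>\<bar> = 1 / 2\<close>.
\<close>

lemma binomial_bound: "real (m choose k) * sqrt (real m) \<le> 2 ^ m"
proof -
  have even: "real ((2 * j) choose k) * sqrt (2 * real j + 1) \<le> 2 ^ (2 * j)" for j k
  proof -
    have "(2 * j) choose k \<le> (2 * j) choose j" using binomial_maximum[of "2 * j" k] by simp
    then have "real ((2 * j) choose k) * sqrt (2 * real j + 1) \<le> real ((2 * j) choose j) * sqrt (2 * real j + 1)"
      by (intro mult_right_mono) auto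
    also have "\<dots> = sqrt (real ((2 * j) choose j) ^ 2 * (2 * real j + 1))"
      by (simp add: real_sqrt_mult)
    also have "\<dots> \<le> sqrt (16 ^ j)" using central_binomial_sq[of j] by simp
    also have "\<dots> = 2 ^ (2 * j)"
    proof -
      have "(2::real) ^ (2 * j) = 4 ^ j" by (simp add: power_mult)
      then have "(16::real) ^ j = (2 ^ (2 * j)) ^ 2"
        by (simp add: power2_eq_square flip: power_mult_distrib)
      then show ?thesis by simp
    qed
    finally show ?thesis .
  qed
  show ?thesis
  proof (cases "even m")
    case True
    then obtain j where m: "m = 2 * j" by (elim evenE)
    have "real (m choose k) * sqrt (real m) \<le> real (m choose k) * sqrt (2 * real j + 1)"
      by (intro mult_left_mono) (auto simp: m)
    then show ?thesis using even[of j k] m by simp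
  next
    case False
    then obtain j where m: "m = 2 * j + 1" by (elim oddE)
    show ?thesis
    proof (cases k)
      case 0
      have "sqrt (real m) \<le> real m" using m by (intro real_le_lsqrt) (auto simp: power2_eq_square)
      also have "\<dots> \<le> 2 ^ m" by (rule less_imp_le[OF of_nat_less_two_power])
      finally show ?thesis using 0 by simp
    next
      case (Suc i)
      have "real (m choose k) * sqrt (real m) = real ((2 * j) choose i) * sqrt (2 * real j + 1) + real ((2 * j) choose Suc i) * sqrt (2 * real j + 1)"
        using Suc m by (simp add: algebra_simps)
      also have "\<dots> \<le> 2 ^ (2 * j) + 2 ^ (2 * j)" by (intro add_mono even)
      also have "\<dots> = 2 ^ m" by (simp add: m)
      finally show ?thesis .
    qed
  qed
qed

lemma summable_c_coeff:
  assumes a: "0 < a" and b: "\<bar>\<beta>\<bar> \<le> 1 / 2"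
  shows "summable (\<lambda>n. \<bar>c_coeff (Suc n) a * \<beta> ^ (Suc n * a)\<bar>)"
proof (cases "a = 1")
  case True
  show ?thesis by (rule summable_finite[of "{0}"]) (auto simp: c_coeff_def True)
next
  case False
  show ?thesis
  proof (rule summable_comparison_test)
    show "summable (\<lambda>n. real (Suc n) powr (- (3 / 2)))"
      using summable_Suc_iff[of "\<lambda>n. real n powr (- (3 / 2))"] summable_real_powr_iff[of "- (3 / 2)"] by simp
    show "\<exists>N. \<forall>n\<ge>N. norm \<bar>c_coeff (Suc n) a * \<beta> ^ (Suc n * a)\<bar> \<le> real (Suc n) powr (- (3 / 2))"
    proof (intro exI[of _ 1] allI impI)
      fix k :: nat assume k: "1 \<le> k"
      define n where "n = Suc k"
      have n2: "2 \<le> n" using k by (simp add: n_def)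
      define m where "m = n * a - 2"
      have "n * 2 \<le> n * a" using a False by (intro mult_le_mono) auto
      then have mn: "n \<le> m" "m \<le> n * a" unfolding m_def using n2 by linarith+
      have B: "real (m choose (n - 1)) * sqrt (real n) \<le> 2 ^ (n * a)"
      proof -
        have "real (m choose (n - 1)) * sqrt (real n) \<le> real (m choose (n - 1)) * sqrt (real m)"
          using mn by (intro mult_left_mono) auto
        also have "\<dots> \<le> 2 ^ m" by (rule binomial_bound)
        also have "\<dots> \<le> 2 ^ (n * a)" using mn by (intro power_increasing) auto
        finally show ?thesis .
      qed
      have "\<bar>\<beta>\<bar> ^ (n * a) \<le> (1 / 2) ^ (n * a)" using b by (intro power_mono) auto
      then have "\<bar>c_coeff n a * \<beta> ^ (n * a)\<bar> \<le> real (m choose (n - 1)) / real n * (1 / 2) ^ (n * a)"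
        using False by (simp add: c_coeff_def abs_mult power_abs m_def mult_left_mono divide_right_mono)
      also have "\<dots> \<le> 1 / (real n * sqrt (real n))"
        using B n2 by (simp add: field_simps power_divide)
      also have "\<dots> = real n powr (- (3 / 2))"
      proof -
        have "real n powr (3 / 2) = real n powr 1 * real n powr (1 / 2)"
          using powr_add[of "real n" 1 "1 / 2"] by simp
        also have "\<dots> = real n * sqrt (real n)" using n2 by (simp add: powr_half_sqrt)
        finally show ?thesis by (simp add: powr_minus_divide)
      qed
      finally show "norm \<bar>c_coeff (Suc k) a * \<beta> ^ (Suc k * a)\<bar> \<le> real (Suc k) powr (- (3 / 2))"
        by (simp add: n_def)
    qed
  qed
qed

section \<open>The moments of a rectangle of height one\<close>

text \<open>
  Cancellation of any number of backtracks, not necessarily all of them.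
\<close>

inductive reduces :: "edge list \<Rightarrow> edge list \<Rightarrow> bool" where
  none: "reduces l l"
| cancel: "e \<in> lattice_edges \<Longrightarrow> reduces (u @ v) l \<Longrightarrow> reduces (u @ e # rev_edge e # v) l"

lemma reduces_trans: "reduces l m \<Longrightarrow> reduces m k \<Longrightarrow> reduces l k"
  by (induction rule: reduces.induct) (auto intro: reduces.intros)

lemma reduces_context: "reduces l m \<Longrightarrow> reduces (x @ l @ y) (x @ m @ y)"
proof (induction rule: reduces.induct)
  case (cancel e u v l)
  then show ?case using reduces.cancel[of e "x @ u" "v @ y" "x @ l @ y"] by simp
qed (rule reduces.none)

lemma reduces_append: "reduces l m \<Longrightarrow> reduces l' m' \<Longrightarrow> reduces (l @ l') (m @ m')"
  using reduces_trans[of "l @ l'" "m @ l'" "m @ m'"] reduces_context[of l m "[]" l'] reduces_context[of l' m' m "[]"]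
  by simp

lemma reduces_rev_walk: "set l \<subseteq> lattice_edges \<Longrightarrow> reduces (rev_walk l @ l) []"
proof (induction l)
  case (Cons e l)
  have "reduces (rev_walk l @ rev_edge e # rev_edge (rev_edge e) # l) []"
    by (rule reduces.cancel) (use Cons in auto)
  then show ?case by simp
qed (auto intro: reduces.none)

definition pw :: "edge list \<Rightarrow> nat \<Rightarrow> edge list" where
  "pw l n = concat (replicate n l)"

lemma pw_simps [simp]: "pw l 0 = []" "pw l (Suc n) = l @ pw l n"
  by (auto simp: pw_def)

lemma pw_Suc_right: "pw l (Suc n) = pw l n @ l"
  by (induction n) auto

lemma pw_swap: "pw (l @ m) n @ l = l @ pw (m @ l) n"
  by (induction n) auto

lemma set_pw: "set (pw l n) \<subseteq> set l"
  by (induction n) auto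

lemma walk_pw: "walk v l v \<Longrightarrow> walk v (pw l n) v"
proof (induction n)
  case (Suc n)
  then show ?case unfolding pw_simps walk_append by blast
qed simp

lemma reduces_pw: "reduces l m \<Longrightarrow> reduces (pw l n) (pw m n)"
  by (induction n) (auto intro: reduces.none reduces_append)

text \<open>
  The sum over the occurrences of an edge in a walk, by recursion over the walk; \<open>pre\<close> is the part already
  passed.
\<close>

fun split_sum :: "edge \<Rightarrow> (edge list \<Rightarrow> edge list \<Rightarrow> real) \<Rightarrow> edge list \<Rightarrow> edge list \<Rightarrow> real" where
  "split_sum e F pre [] = 0"
| "split_sum e F pre (a # v) = (if a = e then F v pre else 0) + split_sum e F (pre @ [a]) v"

lemma split_sum_eq:
  "(\<Sum>i | i < length \<pi> \<and> \<pi> ! i = e. F (drop (Suc i) \<pi>) (pre @ take i \<pi>)) = split_sum e F pre \<pi>"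
proof (induction \<pi> arbitrary: pre)
  case (Cons a v)
  let ?I = "{i. i < length v \<and> v ! i = e}"
  have I: "{i. i < length (a # v) \<and> (a # v) ! i = e} = (if a = e then {0} else {}) \<union> Suc ` ?I"
  proof (rule Set.set_eqI)
    fix i show "i \<in> {i. i < length (a # v) \<and> (a # v) ! i = e} \<longleftrightarrow> i \<in> (if a = e then {0} else {}) \<union> Suc ` ?I"
      by (cases i) auto
  qed
  have fin: "finite ?I" by simp
  have "(\<Sum>i | i < length (a # v) \<and> (a # v) ! i = e. F (drop (Suc i) (a # v)) (pre @ take i (a # v)))
     = (\<Sum>i\<in>(if a = e then {0} else {}). F (drop (Suc i) (a # v)) (pre @ take i (a # v)))
     + (\<Sum>i\<in>Suc ` ?I. F (drop (Suc i) (a # v)) (pre @ take i (a # v)))"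
    unfolding I by (rule sum.union_disjoint) (use fin in auto)
  also have "(\<Sum>i\<in>Suc ` ?I. F (drop (Suc i) (a # v)) (pre @ take i (a # v)))
    = (\<Sum>i\<in>?I. F (drop (Suc i) v) ((pre @ [a]) @ take i v))"
    by (subst sum.reindex) auto
  also have "\<dots> = split_sum e F (pre @ [a]) v" by (rule Cons.IH)
  finally show ?case by simp
qed simp

lemma split_sum_append_notin:
  "e \<notin> set u \<Longrightarrow> split_sum e F pre (u @ v) = split_sum e F (pre @ u) v"
  by (induction u arbitrary: pre) auto

lemma split_sum_pw:
  assumes "e \<notin> set w"
  shows "split_sum e F pre (pw (e # w) n @ v) =
    (\<Sum>k<n. F (w @ pw (e # w) (n - 1 - k) @ v) (pre @ pw (e # w) k)) + split_sum e F (pre @ pw (e # w) n) v"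
proof (induction n arbitrary: pre)
  case (Suc n)
  have "split_sum e F pre (pw (e # w) (Suc n) @ v)
    = F (w @ pw (e # w) n @ v) pre + split_sum e F (pre @ [e] @ w) (pw (e # w) n @ v)"
    using split_sum_append_notin[OF assms, of F "pre @ [e]" "pw (e # w) n @ v"] by simp
  also have "split_sum e F (pre @ [e] @ w) (pw (e # w) n @ v)
    = (\<Sum>k<n. F (w @ pw (e # w) (n - 1 - k) @ v) ((pre @ [e] @ w) @ pw (e # w) k))
      + split_sum e F ((pre @ [e] @ w) @ pw (e # w) n) v" by (rule Suc.IH)
  also have "(\<Sum>k<n. F (w @ pw (e # w) (n - 1 - k) @ v) ((pre @ [e] @ w) @ pw (e # w) k))
    = (\<Sum>k<n. F (w @ pw (e # w) (Suc n - 1 - Suc k) @ v) (pre @ pw (e # w) (Suc k)))"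
    by (intro sum.cong) auto
  finally show ?case by (simp add: sum.lessThan_Suc_shift del: sum.lessThan_Suc)
qed simp

text \<open>
  No horizontal edge of the walk lies in the column of \<open>x\<close> at height two or above.
\<close>

definition off_column :: "int \<Rightarrow> edge list \<Rightarrow> bool" where
  "off_column x l \<longleftrightarrow> (\<forall>j\<ge>2. ((x + 1, j), (x, j)) \<notin> set l \<and> ((x, j), (x + 1, j)) \<notin> set l)"

text \<open>
  The square \<open>(x, 1)\<close> as a loop based at its lower right corner.
\<close>

definition upper_loop :: "int \<Rightarrow> edge list" where
  "upper_loop x = [((x + 1, 1), (x + 1, 2)), ((x + 1, 2), (x, 2)), ((x, 2), (x, 1)), ((x, 1), (x + 1, 1))]"

text \<open>
  Surface coefficients that share two symmetries of the lattice model: cancellation of backtracks and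
  reversal of a square with nothing above it in its column.
\<close>

locale surface_gauge = surface +
  assumes coe_reduces: "closed_walk l \<Longrightarrow> closed_walk l' \<Longrightarrow> reduces l l' \<Longrightarrow> coe l m = coe l' m"
    and coe_reflect: "walk (x + 1, 1) w (x + 1, 1) \<Longrightarrow> off_column x w \<Longrightarrow>
      coe (upper_loop x @ w) m = coe (rev_walk (upper_loop x) @ w) m"
begin

text \<open>
  Each orientation of the edge between \<open>(x, 0)\<close> and \<open>(x, 1)\<close> is contained in two plaquettes.
\<close>

lemma plaqs_at_top:
  "plaqs_at ((x + 1, 1), (x, 1)) = {((x, 0), True), ((x, 1), False)}"
  "plaqs_at ((x, 1), (x + 1, 1)) = {((x, 0), False), ((x, 1), True)}"
proof -
  have E: "((x + 1, 1), (x, 1)) \<in> set (plaq_loop ((a, b), o')) \<longleftrightarrow> (a = x \<and> b = 0 \<and> o') \<or> (a = x \<and> b = 1 \<and> \<not> o')"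
    "((x, 1), (x + 1, 1)) \<in> set (plaq_loop ((a, b), o')) \<longleftrightarrow> (a = x \<and> b = 0 \<and> \<not> o') \<or> (a = x \<and> b = 1 \<and> o')"
    for a b o'
    by (cases o'; simp only: plaq_loop.simps list.set insert_iff empty_iff prod.inject; presburger)+
  show "plaqs_at ((x + 1, 1), (x, 1)) = {((x, 0), True), ((x, 1), False)}"
  proof (rule Set.set_eqI)
    fix p :: plaq
    obtain a b o' where p: "p = ((a, b), o')" by (metis surj_pair)
    show "p \<in> plaqs_at ((x + 1, 1), (x, 1)) \<longleftrightarrow> p \<in> {((x, 0), True), ((x, 1), False)}"
      unfolding p plaqs_at_def mem_Collect_eq E(1) by auto
  qed
  show "plaqs_at ((x, 1), (x + 1, 1)) = {((x, 0), False), ((x, 1), True)}"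
  proof (rule Set.set_eqI)
    fix p :: plaq
    obtain a b o' where p: "p = ((a, b), o')" by (metis surj_pair)
    show "p \<in> plaqs_at ((x, 1), (x + 1, 1)) \<longleftrightarrow> p \<in> {((x, 0), False), ((x, 1), True)}"
      unfolding p plaqs_at_def mem_Collect_eq E(2) by auto
  qed
qed

context
  fixes x :: int and B :: "edge list"
  assumes B: "walk (x + 1, 1) B (x + 1, 1)" "off_column x B"
    "((x + 1, 1), (x, 1)) \<notin> set B" "((x, 1), (x + 1, 1)) \<notin> set B"
begin

definition top_edge :: edge where "top_edge = ((x + 1, 1), (x, 1))"

definition tail :: "edge list" where
  "tail = [((x, 1), (x, 0)), ((x, 0), (x + 1, 0)), ((x + 1, 0), (x + 1, 1))]"

text \<open>
  With \<open>A = top_edge # tail\<close>, the square \<open>(x, 0)\<close> as a loop based at its upper right corner, this is the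
  word \<open>A^j B^i (A B)^n\<close>. These words are closed under the loop operations at \<open>top_edge\<close>.
\<close>

definition word :: "nat \<Rightarrow> nat \<Rightarrow> nat \<Rightarrow> edge list" where
  "word j i n = pw (top_edge # tail) j @ pw B i @ pw ((top_edge # tail) @ B) n"

definition y :: "nat \<Rightarrow> nat \<Rightarrow> nat \<Rightarrow> nat \<Rightarrow> real" where
  "y j i n = coe (word j i n)"

lemma A_walk: "walk (x + 1, 1) (top_edge # tail) (x + 1, 1)"
  using lattice_edges_intros[of x 0] lattice_edges_intros[of "x + 1" 0] lattice_edges_intros[of x 1]
  by (simp add: top_edge_def tail_def)

lemma tail_walk: "walk (x, 1) tail (x + 1, 1)" "top_edge \<in> lattice_edges" "set tail \<subseteq> lattice_edges"
  using lattice_edges_intros[of x 0] lattice_edges_intros[of "x + 1" 0] lattice_edges_intros[of x 1]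
  by (auto simp: top_edge_def tail_def)

lemma word_walk: "walk (x + 1, 1) (word j i n) (x + 1, 1)"
proof -
  have "walk (x + 1, 1) ((top_edge # tail) @ B) (x + 1, 1)"
    unfolding walk_append using A_walk B(1) by blast
  from walk_pw[OF this] show ?thesis
    unfolding word_def walk_append using walk_pw[OF A_walk] walk_pw[OF B(1)] by blast
qed

lemma off_column_word: "off_column x (word j i n)"
  unfolding off_column_def
proof (intro allI impI)
  fix k :: int assume k: "2 \<le> k"
  have "set (word j i n) \<subseteq> insert top_edge (set tail \<union> set B)"
    unfolding word_def using set_pw[of "top_edge # tail" j] set_pw[of B i] set_pw[of "(top_edge # tail) @ B" n] by auto
  then show "((x + 1, k), (x, k)) \<notin> set (word j i n) \<and> ((x, k), (x + 1, k)) \<notin> set (word j i n)"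
    using k B(2) by (auto simp: off_column_def top_edge_def tail_def)
qed

lemma notin:
  "top_edge \<notin> set tail" "rev_edge top_edge \<notin> set tail" "top_edge \<notin> set B" "rev_edge top_edge \<notin> set (tail @ word j i n)"
proof -
  show 1: "top_edge \<notin> set tail" "rev_edge top_edge \<notin> set tail" by (auto simp: top_edge_def tail_def)
  show 2: "top_edge \<notin> set B" using B by (simp add: top_edge_def)
  have "rev_edge top_edge \<notin> set B" "rev_edge top_edge \<noteq> top_edge" using B by (auto simp: top_edge_def)
  moreover have "set (word j i n) \<subseteq> insert top_edge (set tail \<union> set B)"
    unfolding word_def using set_pw[of "top_edge # tail" j] set_pw[of B i] set_pw[of "(top_edge # tail) @ B" n] by auto
  ultimately show "rev_edge top_edge \<notin> set (tail @ word j i n)" using 1 by auto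
qed

lemma word_closed: "closed_walk (word j i n)"
  using word_walk by (rule closed_walkI)

lemma word_Suc: "word (Suc j) i n = top_edge # tail @ word j i n"
  by (simp add: word_def)

text \<open>
  Splitting at another copy of \<open>top_edge\<close> cuts the word before another \<open>A\<close>, either in the first power or
  in the last one.
\<close>

lemma positive_splits:
  "(\<Sum>k | k < length (tail @ word j i n) \<and> (tail @ word j i n) ! k = top_edge.
      cauchy (coe (top_edge # drop (Suc k) (tail @ word j i n))) (coe (take k (tail @ word j i n) @ [top_edge])) m)
   = (\<Sum>k<j. cauchy (y (j - k) i n) (y (Suc k) 0 0) m) + (\<Sum>k<n. cauchy (y 0 0 (n - k)) (y (Suc j) i k) m)"
proof -
  define F where "F d t = cauchy (coe (top_edge # d)) (coe (t @ [top_edge])) m" for d t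
  let ?A = "top_edge # tail"
  have nB: "top_edge \<notin> set (tail @ B)" "top_edge \<notin> set (pw B i)" using notin set_pw[of B i] by auto
  have "(\<Sum>k | k < length (tail @ word j i n) \<and> (tail @ word j i n) ! k = top_edge.
      F (drop (Suc k) (tail @ word j i n)) ([] @ take k (tail @ word j i n)))
     = split_sum top_edge F [] (tail @ word j i n)" by (rule split_sum_eq)
  also have "\<dots> = split_sum top_edge F tail (pw ?A j @ (pw B i @ pw (?A @ B) n))"
    using split_sum_append_notin[OF notin(1), of F "[]"] by (simp add: word_def)
  also have "\<dots> = (\<Sum>k<j. F (tail @ pw ?A (j - 1 - k) @ (pw B i @ pw (?A @ B) n)) (tail @ pw ?A k))
     + split_sum top_edge F (tail @ pw ?A j) (pw B i @ pw (?A @ B) n)"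
    by (rule split_sum_pw[OF notin(1)])
  also have "split_sum top_edge F (tail @ pw ?A j) (pw B i @ pw (?A @ B) n)
     = split_sum top_edge F ((tail @ pw ?A j) @ pw B i) (pw (top_edge # (tail @ B)) n @ [])"
    using split_sum_append_notin[OF nB(2)] by simp
  also have "\<dots> = (\<Sum>k<n. F ((tail @ B) @ pw (top_edge # (tail @ B)) (n - 1 - k) @ []) (((tail @ pw ?A j) @ pw B i) @ pw (top_edge # (tail @ B)) k))"
    by (subst split_sum_pw[OF nB(1)]) simp
  also have "(\<Sum>k<j. F (tail @ pw ?A (j - 1 - k) @ (pw B i @ pw (?A @ B) n)) (tail @ pw ?A k))
    = (\<Sum>k<j. cauchy (y (j - k) i n) (y (Suc k) 0 0) m)"
  proof (rule sum.cong[OF refl])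
    fix k assume "k \<in> {..<j}"
    then have jk: "j - k = Suc (j - 1 - k)" by simp
    have "coe ((tail @ pw ?A k) @ [top_edge]) = coe (word (Suc k) 0 0)"
    proof
      fix m' show "coe ((tail @ pw ?A k) @ [top_edge]) m' = coe (word (Suc k) 0 0) m'"
        using coe_append_commute[of "[top_edge]" "tail @ pw ?A k" m'] word_closed[of "Suc k" 0 0] by (simp add: word_def)
    qed
    then show "F (tail @ pw ?A (j - 1 - k) @ (pw B i @ pw (?A @ B) n)) (tail @ pw ?A k)
      = cauchy (y (j - k) i n) (y (Suc k) 0 0) m"
      unfolding F_def y_def jk by (simp add: word_def)
  qed
  also have "(\<Sum>k<n. F ((tail @ B) @ pw (top_edge # (tail @ B)) (n - 1 - k) @ []) (((tail @ pw ?A j) @ pw B i) @ pw (top_edge # (tail @ B)) k))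
    = (\<Sum>k<n. cauchy (y 0 0 (n - k)) (y (Suc j) i k) m)"
  proof (rule sum.cong[OF refl])
    fix k assume "k \<in> {..<n}"
    then have nk: "n - k = Suc (n - 1 - k)" by simp
    let ?t = "((tail @ pw ?A j) @ pw B i) @ pw (top_edge # (tail @ B)) k"
    have "coe (?t @ [top_edge]) = coe (word (Suc j) i k)"
    proof
      fix m' show "coe (?t @ [top_edge]) m' = coe (word (Suc j) i k) m'"
        using coe_append_commute[of "[top_edge]" ?t m'] word_closed[of "Suc j" i k] by (simp add: word_def)
    qed
    then show "F ((tail @ B) @ pw (top_edge # (tail @ B)) (n - 1 - k) @ []) ?t = cauchy (y 0 0 (n - k)) (y (Suc j) i k) m"
      unfolding F_def y_def nk by (simp add: word_def)
  qed
  finally show ?thesis by (simp add: F_def)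
qed

text \<open>
  Of the two plaquettes on each side of \<open>top_edge\<close>, the lower ones remove and add a factor \<open>A\<close>; the upper
  ones lead to the same word with both orientations of the upper square and cancel by reflection.
\<close>

lemma plaquette_terms:
  "(\<Sum>p\<in>plaqs_at (rev_edge top_edge). coe (plaq_rest (rev_edge top_edge) p @ tail @ word j i n) m)
   - (\<Sum>q\<in>plaqs_at top_edge. coe (top_edge # plaq_rest top_edge q @ top_edge # tail @ word j i n) m)
   = y j i n m - y (Suc (Suc j)) i n m"
proof -
  define D :: "edge list" where "D = [((x, 1), (x, 2)), ((x, 2), (x + 1, 2)), ((x + 1, 2), (x + 1, 1::int))]"
  define w where "w = word j i n"
  have rest: "plaq_rest top_edge ((x, 0), True) = tail" "plaq_rest top_edge ((x, 1), False) = D"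
    "plaq_rest (rev_edge top_edge) ((x, 0), False) = rev_walk tail"
    "plaq_rest (rev_edge top_edge) ((x, 1), True) = rev_walk D"
    by (simp_all add: plaq_rest_def top_edge_def tail_def D_def)
  have U: "upper_loop x = rev_walk D @ [rev_edge top_edge]" "rev_walk (upper_loop x) = top_edge # D"
    by (simp_all add: upper_loop_def D_def top_edge_def)
  have lat: "set D \<subseteq> lattice_edges"
    using lattice_edges_intros[of x 1] lattice_edges_intros[of "x + 1" 1] lattice_edges_intros[of x 2] by (auto simp: D_def)
  have wD: "walk (x + 1, 1) (rev_walk D) (x, 1)" using lat by (auto simp: D_def lattice_edges_def)
  have ww: "walk (x + 1, 1) w (x + 1, 1)" unfolding w_def by (rule word_walk)
  have wt: "walk (x + 1, 1) (rev_walk tail) (x, 1)" using walk_rev_walk[OF tail_walk(1)] .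
  have c1: "walk (x + 1, 1) (rev_walk tail @ tail @ w) (x + 1, 1)"
    unfolding walk_append using wt tail_walk ww by blast
  have c2: "walk (x + 1, 1) (rev_walk D @ tail @ w) (x + 1, 1)"
    unfolding walk_append using wD tail_walk ww by blast
  have c3: "walk (x + 1, 1) (rev_walk D @ rev_edge top_edge # rev_edge (rev_edge top_edge) # tail @ w) (x + 1, 1)"
    unfolding walk_append walk.simps using wD tail_walk ww by (auto simp: top_edge_def)
  have r1: "coe (rev_walk tail @ tail @ w) m = y j i n m"
    unfolding y_def w_def[symmetric]
    by (rule coe_reduces[OF closed_walkI[OF c1] closed_walkI[OF ww]])
      (use reduces_append[OF reduces_rev_walk[OF tail_walk(3)] reduces.none[of w]] in simp)
  have "coe (rev_walk D @ rev_edge top_edge # rev_edge (rev_edge top_edge) # tail @ w) m = coe (rev_walk D @ tail @ w) m"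
    by (rule coe_reduces[OF closed_walkI[OF c3] closed_walkI[OF c2]], rule reduces.cancel)
      (use tail_walk in \<open>auto intro: reduces.none\<close>)
  moreover have "coe ((rev_walk D @ [rev_edge top_edge]) @ word (Suc j) i n) m = coe ((top_edge # D) @ word (Suc j) i n) m"
    unfolding U[symmetric] by (rule coe_reflect[OF word_walk off_column_word])
  ultimately have r2: "coe (rev_walk D @ tail @ w) m = coe (top_edge # D @ top_edge # tail @ w) m"
    unfolding word_Suc w_def by simp
  have ne: "((x, 0::int), False) \<noteq> ((x, 1), True)" "((x, 0::int), True) \<noteq> ((x, 1), False)" by auto
  have P: "plaqs_at (rev_edge top_edge) = {((x, 0), False), ((x, 1), True)}" "plaqs_at top_edge = {((x, 0), True), ((x, 1), False)}"
    using plaqs_at_top by (simp_all add: top_edge_def)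
  show ?thesis unfolding P w_def[symmetric] using ne r1 r2
    by (simp add: rest y_def word_Suc w_def[symmetric])
qed

lemma y_master:
  "y (Suc j) i n m = (if m = 0 then 0 else y j i n (m - 1) - y (Suc (Suc j)) i n (m - 1))
    - (\<Sum>k<j. cauchy (y (j - k) i n) (y (Suc k) 0 0) m) - (\<Sum>k<n. cauchy (y 0 0 (n - k)) (y (Suc j) i k) m)"
proof -
  have cw: "closed_walk (top_edge # tail @ word j i n)" using word_closed[of "Suc j" i n] by (simp add: word_Suc)
  have fin: "finite (plaqs_at top_edge)" "finite (plaqs_at (rev_edge top_edge))"
    using plaqs_at_top by (simp_all add: top_edge_def)
  have no: "{k. k < length (tail @ word j i n) \<and> (tail @ word j i n) ! k = rev_edge top_edge} = {}"
    using notin(4)[of j i n] by (metis (mono_tags, lifting) Collect_empty_eq nth_mem)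
  show ?thesis
  proof (cases "m = 0")
    case True
    show ?thesis using master_loop[OF cw fin, of m] unfolding positive_splits no True
      by (simp add: y_def word_Suc)
  next
    case False
    show ?thesis using master_loop[OF cw fin, of m] plaquette_terms[of j i n "m - 1"] False
      unfolding positive_splits no by (simp add: y_def word_Suc)
  qed
qed

lemma y_rotate: "y 0 i (Suc n) m = y (Suc 0) (Suc i) n m"
proof -
  let ?A = "top_edge # tail"
  have "word 0 i (Suc n) = (pw B i @ ?A @ pw (B @ ?A) n) @ B"
    using pw_swap[of ?A B n] pw_Suc_right[of "?A @ B" n] by (simp add: word_def)
  then have "coe (word 0 i (Suc n)) m = coe (B @ pw B i @ ?A @ pw (B @ ?A) n) m"
    using coe_append_commute[of "pw B i @ ?A @ pw (B @ ?A) n" B m] word_closed[of 0 i "Suc n"] by simp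
  also have "B @ pw B i @ ?A @ pw (B @ ?A) n = (pw B (Suc i) @ pw (?A @ B) n) @ ?A"
    using pw_swap[of ?A B n] by simp
  also have "coe \<dots> m = coe (?A @ pw B (Suc i) @ pw (?A @ B) n) m"
    using coe_append_commute[of ?A "pw B (Suc i) @ pw (?A @ B) n" m] word_closed[of "Suc 0" "Suc i" n]
    by (simp add: word_def)
  finally show ?thesis by (simp add: y_def word_def)
qed

text \<open>
  The solution of the recursion: words with two leading factors \<open>A\<close> have expectation zero, and the others
  are single powers of \<open>\<beta>\<close> with the exponent given by the total area.
\<close>

definition yhat :: "nat \<Rightarrow> nat \<Rightarrow> nat \<Rightarrow> nat \<Rightarrow> nat \<Rightarrow> real" where
  "yhat \<alpha> j i n m =
    (if 2 \<le> j then 0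
     else if j = 1 then (if m = \<alpha> * (i + n) + n + 1 then mixed_fps \<alpha> i $ n else 0)
     else if n = 0 then (if m = \<alpha> * i then moment_fps \<alpha> $ i else 0)
     else (if m = \<alpha> * (i + n) + n then mixed_fps \<alpha> (Suc i) $ (n - 1) else 0))"

lemma cauchy_delta:
  assumes "\<And>k. k \<le> m \<Longrightarrow> f k = (if k = p then a else 0)" "\<And>k. k \<le> m \<Longrightarrow> g k = (if k = q then b else 0)"
  shows "cauchy f g m = (if m = p + q then a * b else 0)"
proof -
  have "cauchy f g m = (\<Sum>k\<le>m. if k = p then (if m - k = q then a * b else 0) else 0)"
    unfolding cauchy_def by (intro sum.cong) (auto simp: assms)
  also have "\<dots> = (if p \<le> m \<and> m - p = q then a * b else 0)"
    by (simp add: sum.delta)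
  finally show ?thesis by auto
qed

text \<open>
  The recursion \<open>y_master\<close> determines the coefficients, by induction on the power of \<open>\<beta>\<close> and then on the
  number of factors \<open>A\<close>: splitting preserves the power and distributes the factors \<open>A\<close>,
  deformation lowers the power. Words with no leading \<open>A\<close> are rotated to have one.
\<close>

theorem y_eq_yhat:
  assumes base: "\<And>i m. coe (pw B i) m = (if m = \<alpha> * i then moment_fps \<alpha> $ i else 0)"
  shows "y j i n m = yhat \<alpha> j i n m"
proof -
  have b0: "y 0 i 0 m = yhat \<alpha> 0 i 0 m" for i m
    using base by (simp add: y_def word_def yhat_def)
  have "\<forall>j i n m. (m, j + n) = p \<longrightarrow> 0 < j \<longrightarrow> y j i n m = yhat \<alpha> j i n m" for p :: "nat \<times> nat"
  proof (induction p rule: wf_induct[OF wf_lex_prod[OF wf_less_than wf_less_than]])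
    case (1 p)
    have IH: "y j i n m' = yhat \<alpha> j i n m'"
      if "(m', j + n) = (q1, q2)" "q1 < fst p \<or> q1 = fst p \<and> q2 < snd p" for j i n m' q1 q2
    proof (cases "0 < j")
      case True
      then show ?thesis using 1[rule_format, of "(q1, q2)"] that by (cases p) auto
    next
      case False
      show ?thesis
      proof (cases n)
        case 0
        then show ?thesis using b0 False by simp
      next
        case (Suc k)
        have "y 1 (Suc i) k m' = yhat \<alpha> 1 (Suc i) k m'"
          using 1[rule_format, of "(q1, q2)" m' 1 k "Suc i"] that False Suc by (cases p) auto
        then show ?thesis using y_rotate[of i k m'] False Suc by (simp add: yhat_def)
      qed
    qed
    show ?case
    proof (intro allI impI)
      fix j i n m assume p: "(m, j + n) = p" and j: "0 < j"
      have IHs: "y j' i' n' m' = yhat \<alpha> j' i' n' m'" if "m' \<le> m" "j' + n' < j + n" for j' i' n' m'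
        by (rule IH[of _ _ _ m' "j' + n'"]) (use that p in auto)
      have IHm: "y j' i' n' m' = yhat \<alpha> j' i' n' m'" if "m' < m" for j' i' n' m'
        by (rule IH[of _ _ _ m' "j' + n'"]) (use that p in auto)
      obtain j' where j': "j = Suc j'" using j by (cases j) auto
      have S2: "cauchy (y 0 0 (n - k)) (y (Suc j') i k) m =
          (if j' = 0 \<and> m = \<alpha> * (i + n) + n + 1 then moment_fps (Suc \<alpha>) $ (n - k) * mixed_fps \<alpha> i $ k else 0)"
        if k: "k < n" for k
      proof -
        define q where "q = n - k - 1"
        have nk: "n - k = Suc q" "n = Suc q + k" using k by (auto simp: q_def)
        have f: "y 0 0 (n - k) r = (if r = \<alpha> * Suc q + Suc q then moment_fps (Suc \<alpha>) $ (n - k) else 0)" if "r \<le> m" for r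
        proof -
          have "y 0 0 (n - k) r = yhat \<alpha> 0 0 (n - k) r" by (rule IHs[OF that]) (use j k in auto)
          then show ?thesis by (simp add: yhat_def nk(1) mixed_fps_1_nth)
        qed
        show ?thesis
        proof (cases "j' = 0")
          case True
          have g: "y (Suc j') i k r = (if r = \<alpha> * (i + k) + k + 1 then mixed_fps \<alpha> i $ k else 0)" if "r \<le> m" for r
          proof -
            have "y (Suc j') i k r = yhat \<alpha> (Suc j') i k r" by (rule IHs[OF that]) (use j' k in auto)
            then show ?thesis using True by (simp add: yhat_def)
          qed
          have "\<alpha> * Suc q + Suc q + (\<alpha> * (i + k) + k + 1) = \<alpha> * (i + n) + n + 1"
            unfolding nk(2) by (simp add: algebra_simps)
          then show ?thesis using cauchy_delta[OF f g] True by simp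
        next
          case False
          have g: "y (Suc j') i k r = (if r = 0 then 0 else 0)" if "r \<le> m" for r
          proof -
            have "y (Suc j') i k r = yhat \<alpha> (Suc j') i k r" by (rule IHs[OF that]) (use j' k in auto)
            then show ?thesis using False by (simp add: yhat_def)
          qed
          show ?thesis using cauchy_delta[OF f g] False by simp
        qed
      qed
      show "y j i n m = yhat \<alpha> j i n m"
      proof (cases "j' = 0")
        case True
        define M where "M = \<alpha> * (i + n) + n + 1"
        have t: "mixed_fps \<alpha> i $ n = (case n of 0 \<Rightarrow> moment_fps \<alpha> $ i | Suc n' \<Rightarrow> mixed_fps \<alpha> (Suc i) $ n')
            - (\<Sum>k<n. moment_fps (Suc \<alpha>) $ (n - k) * mixed_fps \<alpha> i $ k)"
        proof -
          have "(\<Sum>k\<le>n. moment_fps (Suc \<alpha>) $ (n - k) * mixed_fps \<alpha> i $ k)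
            = (\<Sum>k<n. moment_fps (Suc \<alpha>) $ (n - k) * mixed_fps \<alpha> i $ k) + mixed_fps \<alpha> i $ n"
            by (simp add: lessThan_Suc_atMost[symmetric])
          then show ?thesis using mixed_fps_nth_rec[of \<alpha> n i] by linarith
        qed
        have "(\<Sum>k<n. cauchy (y 0 0 (n - k)) (y (Suc j') i k) m)
          = (\<Sum>k<n. if m = M then moment_fps (Suc \<alpha>) $ (n - k) * mixed_fps \<alpha> i $ k else 0)"
        proof (rule sum.cong[OF refl])
          fix k assume "k \<in> {..<n}"
          then show "cauchy (y 0 0 (n - k)) (y (Suc j') i k) m
            = (if m = M then moment_fps (Suc \<alpha>) $ (n - k) * mixed_fps \<alpha> i $ k else 0)"
            using S2[of k] True by (simp add: M_def)
        qed
        also have "\<dots> = (if m = M then \<Sum>k<n. moment_fps (Suc \<alpha>) $ (n - k) * mixed_fps \<alpha> i $ k else 0)"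
          by simp
        finally have S: "(\<Sum>k<n. cauchy (y 0 0 (n - k)) (y (Suc j') i k) m) = \<dots>" .
        have L: "(if m = 0 then 0 else y j' i n (m - 1) - y (Suc (Suc j')) i n (m - 1))
          = (if m = M then (case n of 0 \<Rightarrow> moment_fps \<alpha> $ i | Suc n' \<Rightarrow> mixed_fps \<alpha> (Suc i) $ n') else 0)"
        proof (cases "m = 0")
          case False
          then have "y j' i n (m - 1) = yhat \<alpha> 0 i n (m - 1)" "y (Suc (Suc j')) i n (m - 1) = yhat \<alpha> 2 i n (m - 1)"
            using IHm[of "m - 1"] True by (simp_all add: numeral_2_eq_2)
          then show ?thesis using False by (auto simp: yhat_def M_def split: nat.split)
        qed (simp add: M_def)
        show ?thesis using y_master[of j' i n m] t unfolding j' S L using True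
          by (simp add: yhat_def M_def)
      next
        case False
        have S: "(\<Sum>k<n. cauchy (y 0 0 (n - k)) (y (Suc j') i k) m) = 0"
          by (intro sum.neutral) (auto simp: S2 False)
        have f1: "y 1 0 0 r = (if r = 1 then 1 else 0)" if "r \<le> m" for r
        proof -
          have "y 1 0 0 r = yhat \<alpha> 1 0 0 r" by (rule IHs[OF that]) (use j' False in auto)
          then show ?thesis by (simp add: yhat_def mixed_fps_0)
        qed
        have T: "cauchy (y (j' - k) i n) (y (Suc k) 0 0) m
          = (if k = 0 \<and> j' = 1 \<and> m \<noteq> 0 then yhat \<alpha> 1 i n (m - 1) else 0)" if k: "k < j'" for k
        proof (cases "k = 0")
          case k0: True
          show ?thesis
          proof (cases "j' = 1")
            case True
            have "y (j' - k) i n r = (if r = \<alpha> * (i + n) + n + 1 then mixed_fps \<alpha> i $ n else 0)" if "r \<le> m" for r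
            proof -
              have "y (j' - k) i n r = yhat \<alpha> 1 i n r"
                using IHs[OF that, of 1 n i] j' True k0 by simp
              then show ?thesis by (simp add: yhat_def)
            qed
            then have "cauchy (y (j' - k) i n) (y (Suc k) 0 0) m
              = (if m = \<alpha> * (i + n) + n + 1 + 1 then mixed_fps \<alpha> i $ n * 1 else 0)"
              using f1 k0 by (intro cauchy_delta) auto
            then show ?thesis using True k0 by (auto simp: yhat_def)
          next
            case False
            have "y (j' - k) i n r = (if r = 0 then 0 else 0)" if "r \<le> m" for r
            proof -
              have "y (j' - k) i n r = yhat \<alpha> (j' - k) i n r" by (rule IHs[OF that]) (use j' k in auto)
              then show ?thesis using False k0 \<open>j' \<noteq> 0\<close> by (simp add: yhat_def)
            qed
            then show ?thesis using cauchy_delta[of m "y (j' - k) i n" 0 0 "y (Suc k) 0 0" 1 1] f1 k0 False by simp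
          qed
        next
          case False
          have "y (Suc k) 0 0 r = (if r = 0 then 0 else 0)" if "r \<le> m" for r
          proof -
            have "y (Suc k) 0 0 r = yhat \<alpha> (Suc k) 0 0 r" by (rule IHs[OF that]) (use j' k in auto)
            then show ?thesis using False by (simp add: yhat_def)
          qed
          then have "cauchy (y (j' - k) i n) (y (Suc k) 0 0) m = 0"
            unfolding cauchy_def by (intro sum.neutral) auto
          then show ?thesis using False by simp
        qed
        have "(\<Sum>k<j'. cauchy (y (j' - k) i n) (y (Suc k) 0 0) m)
          = (\<Sum>k<j'. if k = 0 then (if j' = 1 \<and> m \<noteq> 0 then yhat \<alpha> 1 i n (m - 1) else 0) else 0)"
          by (intro sum.cong) (auto simp: T)
        also have "\<dots> = (if j' = 1 \<and> m \<noteq> 0 then yhat \<alpha> 1 i n (m - 1) else 0)"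
          using False by (simp add: sum.delta')
        finally have S1: "(\<Sum>k<j'. cauchy (y (j' - k) i n) (y (Suc k) 0 0) m) = \<dots>" .
        have L: "(if m = 0 then 0 else y j' i n (m - 1) - y (Suc (Suc j')) i n (m - 1))
          = (if j' = 1 \<and> m \<noteq> 0 then yhat \<alpha> 1 i n (m - 1) else 0)"
        proof (cases "m = 0")
          case m: False
          then have "y j' i n (m - 1) = yhat \<alpha> j' i n (m - 1)" "y (Suc (Suc j')) i n (m - 1) = yhat \<alpha> (Suc (Suc j')) i n (m - 1)"
            using IHm[of "m - 1"] by simp_all
          then show ?thesis using m False by (auto simp: yhat_def)
        qed simp
        show ?thesis using y_master[of j' i n m] unfolding j' S L S1 using False by (simp add: yhat_def)
      qed
    qed
  qed
  then have pos: "0 < j \<Longrightarrow> y j i n m = yhat \<alpha> j i n m" for j i n m by blast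
  show ?thesis
  proof (cases "0 < j")
    case False
    then show ?thesis
    proof (cases n)
      case (Suc k)
      then show ?thesis using y_rotate[of i k m] pos[of 1 "Suc i" k m] False by (simp add: yhat_def)
    qed (use b0 in simp)
  qed (rule pos)
qed

lemma coe_product_power:
  assumes base: "\<And>i m. coe (pw B i) m = (if m = \<alpha> * i then moment_fps \<alpha> $ i else 0)"
  shows "coe (pw ((top_edge # tail) @ B) n) m = (if m = Suc \<alpha> * n then moment_fps (Suc \<alpha>) $ n else 0)"
proof -
  have "coe (pw ((top_edge # tail) @ B) n) m = yhat \<alpha> 0 0 n m"
    using y_eq_yhat[OF base, of 0 0 n m] by (simp add: y_def word_def)
  also have "\<dots> = (if m = Suc \<alpha> * n then moment_fps (Suc \<alpha>) $ n else 0)"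
    by (cases n) (auto simp: yhat_def mixed_fps_1_nth)
  finally show ?thesis .
qed

end

end

fun bottom_row :: "int \<Rightarrow> nat \<Rightarrow> edge list" where
  "bottom_row x 0 = []"
| "bottom_row x (Suc a) = ((x, 0), (x + 1, 0)) # bottom_row (x + 1) a"

fun top_row :: "int \<Rightarrow> nat \<Rightarrow> edge list" where
  "top_row x 0 = []"
| "top_row x (Suc a) = top_row (x + 1) a @ [((x + 1, 1), (x, 1))]"

lemma bottom_row_walk: "walk (x, 0) (bottom_row x a) (x + int a, 0)"
proof (induction a arbitrary: x)
  case (Suc a)
  show ?case
    using Suc.IH[of "x + 1"] lattice_edges_intros(1)[of x 0] lattice_edges_intros(2)[of x 1] by (simp add: algebra_simps)
qed simp

lemma set_bottom_row: "set (bottom_row x a) = {((i, 0), (i + 1, 0)) |i. x \<le> i \<and> i < x + int a}"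
proof (induction a arbitrary: x)
  case (Suc a)
  have iv: "{i. x \<le> i \<and> i < x + int (Suc a)} = insert x {i. x + 1 \<le> i \<and> i < x + 1 + int a}" by auto
  have im: "{((i, 0), (i + 1, 0)) |i. x \<le> i \<and> i < x + int a} = (\<lambda>i. ((i, 0), (i + 1, 0))) ` {i. x \<le> i \<and> i < x + int a}" for x a
    by auto
  show ?case using Suc.IH[of "x + 1"] unfolding im iv by simp
qed simp

lemma distinct_bottom_row: "distinct (map snd (bottom_row x a))"
proof (induction a arbitrary: x)
  case (Suc a)
  have "(x + 1, 0) \<notin> snd ` set (bottom_row (x + 1) a)" unfolding set_bottom_row by auto
  then show ?case using Suc.IH[of "x + 1"] by simp
qed simp

lemma top_row_walk: "walk (x + int a, 1) (top_row x a) (x, 1)"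
proof (induction a arbitrary: x)
  case (Suc a)
  show ?case
    using Suc.IH[of "x + 1"] lattice_edges_intros(1)[of x 0] lattice_edges_intros(2)[of x 1] by (simp add: algebra_simps)
qed simp

lemma set_top_row: "set (top_row x a) = {((i + 1, 1), (i, 1)) |i. x \<le> i \<and> i < x + int a}"
proof (induction a arbitrary: x)
  case (Suc a)
  have iv: "{i. x \<le> i \<and> i < x + int (Suc a)} = insert x {i. x + 1 \<le> i \<and> i < x + 1 + int a}" by auto
  have im: "{((i + 1, 1), (i, 1)) |i. x \<le> i \<and> i < x + int a} = (\<lambda>i. ((i + 1, 1), (i, 1))) ` {i. x \<le> i \<and> i < x + int a}" for x a
    by auto
  show ?case using Suc.IH[of "x + 1"] unfolding im iv by simp
qed simp

lemma distinct_top_row: "distinct (map snd (top_row x a))"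
proof (induction a arbitrary: x)
  case (Suc a)
  have "(x, 1) \<notin> snd ` set (top_row (x + 1) a)" unfolding set_top_row by auto
  then show ?case using Suc.IH[of "x + 1"] by simp
qed simp

lemmas bottom_row_props = bottom_row_walk set_bottom_row distinct_bottom_row
lemmas top_row_props = top_row_walk set_top_row distinct_top_row

text \<open>
  The counterclockwise boundary of a row of \<open>a\<close> squares, starting at its upper left corner.
\<close>

definition strip :: "int \<Rightarrow> nat \<Rightarrow> edge list" where
  "strip x a = ((x, 1), (x, 0)) # bottom_row x a @ ((x + int a, 0), (x + int a, 1)) # top_row x a"

lemma walk_strip: "walk (x, 1) (strip x a) (x, 1)"
  unfolding strip_def walk.simps walk_append
  using bottom_row_props(1) top_row_props(1) lattice_edges_intros[of x 0] lattice_edges_intros[of "x + int a" 0]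
  by force

lemma strip_coords:
  assumes "e \<in> set (strip x a)"
  shows "x \<le> fst (fst e)" "x \<le> fst (snd e)" "snd (fst e) \<le> 1" "snd (snd e) \<le> 1"
  using assms by (auto simp: strip_def bottom_row_props(2) top_row_props(2))

lemma strip_Suc_reduces:
  "reduces ([((x + 1, 1), (x, 1)), ((x, 1), (x, 0)), ((x, 0), (x + 1, 0)), ((x + 1, 0), (x + 1, 1))] @ strip (x + 1) a)
    ([((x + 1, 1), (x, 1))] @ (((x, 1), (x, 0)) # bottom_row x (Suc a) @ ((x + int (Suc a), 0), (x + int (Suc a), 1)) # top_row (x + 1) a))"
proof -
  let ?u = "[((x + 1, 1), (x, 1)), ((x, 1), (x, 0)), ((x, 0), (x + 1, 0))] :: edge list"
  let ?v = "bottom_row (x + 1) a @ ((x + 1 + int a, 0), (x + 1 + int a, 1)) # top_row (x + 1) a"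
  have "reduces (?u @ ((x + 1, 0), (x + 1, 1)) # rev_edge ((x + 1, 0), (x + 1, 1)) # ?v) (?u @ ?v)"
    by (rule reduces.cancel) (use lattice_edges_intros[of "x + 1" 0] in \<open>auto intro: reduces.none\<close>)
  then show ?thesis by (simp add: strip_def add.assoc)
qed

lemma strip_Suc_rotate: "strip x (Suc a) =
  (((x, 1), (x, 0)) # bottom_row x (Suc a) @ ((x + int (Suc a), 0), (x + int (Suc a), 1)) # top_row (x + 1) a)
    @ [((x + 1, 1), (x, 1))]"
  by (simp add: strip_def)

lemma simple_cycle_strip:
  assumes "0 < a"
  shows "simple_cycle (strip x a)"
  unfolding simple_cycle_def
proof (intro conjI ballI)
  show "closed_walk (strip x a)" using walk_strip by (rule closed_walkI)
  have s: "snd ` set (bottom_row x a) = {(i, 0) |i. x < i \<and> i \<le> x + int a}"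
    unfolding bottom_row_props(2) by (force intro: image_eqI[of _ _ "((i - 1, 0), (i, 0))" for i])
  have t: "snd ` set (top_row x a) = {(i, 1) |i. x \<le> i \<and> i < x + int a}"
    unfolding top_row_props(2) by force
  show "distinct (map snd (strip x a))"
    using bottom_row_props(3)[of x a] top_row_props(3)[of x a] assms
    by (auto simp: strip_def s t)
  fix e assume "e \<in> set (strip x a)"
  then show "rev_edge e \<notin> set (strip x a)"
    using assms by (auto simp: strip_def bottom_row_props(2) top_row_props(2))
qed (simp add: strip_def)

lemma winding_strip: "winding (strip x a) s = of_bool (s \<in> {x..<x + int a} \<times> {0})"
proof (induction a arbitrary: x)
  case 0
  then show ?case by (cases s) (simp add: strip_def)
next
  case (Suc a)
  obtain i j where s: "s = (i, j)" by fastforce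
  have "winding (strip x (Suc a)) s = winding (strip (x + 1) a) s + winding (plaq_loop ((x, 0), True)) s"
    unfolding s by (simp add: strip_def)
  also have "winding (plaq_loop ((x, 0), True)) s = of_bool (s = (x, 0))"
    unfolding s by auto
  also have "winding (strip (x + 1) a) s + of_bool (s = (x, 0)) = of_bool (s \<in> {x..<x + int (Suc a)} \<times> {0})"
    unfolding Suc.IH unfolding s by (auto simp: of_bool_def)
  finally show ?case .
qed

context surface_gauge begin

lemma coe_pw_commute:
  assumes "walk v (l @ m) v"
  shows "coe (pw (l @ m) n) k = coe (pw (m @ l) n) k"
proof (cases n)
  case (Suc i)
  have "closed_walk (l @ (m @ pw (l @ m) i))"
    using closed_walkI[OF walk_pw[OF assms, of n]] Suc by simp
  then have "coe ((m @ pw (l @ m) i) @ l) k = coe (l @ (m @ pw (l @ m) i)) k"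
    by (rule coe_append_commute)
  then show ?thesis using Suc pw_swap[of l m i] by simp
qed simp

text \<open>
  Induction on the area: a longer rectangle is, up to backtracks, the product of a square \<open>A\<close> and a
  rectangle \<open>B\<close> based at the same vertex.
\<close>

theorem coe_strip_power: "coe (pw (strip x a) n) m = (if m = a * n then moment_fps a $ n else 0)"
proof (induction a arbitrary: x n m)
  case 0
  have "reduces (strip x 0) []"
    using reduces.cancel[of "((x, 1), (x, 0))" "[]" "[]" "[]"] reduces.none[of "[]"] lattice_edges_intros(4)[of x 0]
    by (simp add: strip_def)
  then have "reduces (pw (strip x 0) n) (pw [] n)" by (rule reduces_pw)
  moreover have "pw [] n = []" by (induction n) auto
  ultimately have "coe (pw (strip x 0) n) m = coe [] m"
    by (intro coe_reduces closed_walkI[OF walk_pw[OF walk_strip]]) (auto simp: closed_walk_iff)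
  then show ?case by (simp add: coe_Nil moment_fps_zero_nth)
next
  case (Suc a)
  let ?B = "strip (x + 1) a"
  have B: "walk (x + 1, 1) ?B (x + 1, 1)" "off_column x ?B"
    "((x + 1, 1), (x, 1)) \<notin> set ?B" "((x, 1), (x + 1, 1)) \<notin> set ?B"
  proof -
    show "walk (x + 1, 1) ?B (x + 1, 1)" by (rule walk_strip)
    show "off_column x ?B"
      unfolding off_column_def
    proof (intro allI impI conjI notI)
      fix j :: int assume j: "2 \<le> j"
      show False if "((x + 1, j), (x, j)) \<in> set ?B" using strip_coords(3)[OF that] j by simp
      show False if "((x, j), (x + 1, j)) \<in> set ?B" using strip_coords(3)[OF that] j by simp
    qed
    show "((x + 1, 1), (x, 1)) \<notin> set ?B" using strip_coords(2)[of "((x + 1, 1), (x, 1))" "x + 1" a] by auto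
    show "((x, 1), (x + 1, 1)) \<notin> set ?B" using strip_coords(1)[of "((x, 1), (x + 1, 1))" "x + 1" a] by auto
  qed
  let ?A = "top_edge x # tail x"
  define t where "t = (((x, 1), (x, 0)) # bottom_row x (Suc a) @ ((x + int (Suc a), 0), (x + int (Suc a), 1)) # top_row (x + 1) a)"
  have red: "reduces (?A @ ?B) ([top_edge x] @ t)"
    using strip_Suc_reduces[of x a] by (simp add: top_edge_def[OF B] tail_def[OF B] t_def)
  have strip: "strip x (Suc a) = t @ [top_edge x]"
    unfolding t_def top_edge_def[OF B] by (rule strip_Suc_rotate)
  have "walk (x, 1) (t @ [top_edge x]) (x, 1)" using walk_strip[of x "Suc a"] strip by simp
  then have w1: "walk (x, 1) (t @ [top_edge x]) (x, 1)" "walk (x + 1, 1) ([top_edge x] @ t) (x + 1, 1)"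
    by (auto simp: top_edge_def[OF B])
  have w2: "walk (x + 1, 1) (?A @ ?B) (x + 1, 1)"
    unfolding walk_append using A_walk[OF B] B(1) by blast
  have "coe (pw (strip x (Suc a)) n) m = coe (pw ([top_edge x] @ t) n) m"
    unfolding strip by (rule coe_pw_commute[OF w1(1)])
  also have "\<dots> = coe (pw (?A @ ?B) n) m"
    by (rule coe_reduces[symmetric, OF closed_walkI[OF walk_pw[OF w2]] closed_walkI[OF walk_pw[OF w1(2)]] reduces_pw[OF red]])
  also have "\<dots> = (if m = Suc a * n then moment_fps (Suc a) $ n else 0)"
    by (rule coe_product_power[OF B]) (rule Suc.IH)
  finally show ?case .
qed

end

section \<open>Reversal of a square at the top of its column\<close>

context lattice_gauge begin

lemma integral_reflect:
  assumes F: "bdm H F" and a: "a \<in> carrier G" "b \<in> carrier G" "d \<in> carrier G"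
  shows "(\<integral>u. \<psi> (a \<otimes> (u \<otimes> b)) * F (a \<otimes> (u \<otimes> b) \<otimes> d) \<partial>H)
    = (\<integral>u. \<psi> (a \<otimes> (u \<otimes> b)) * F (inv (a \<otimes> (u \<otimes> b)) \<otimes> d) \<partial>H)"
proof -
  have m: "bdm H (\<lambda>u. \<psi> u * F (u \<otimes> d))" "bdm H (\<lambda>u. \<psi> u * F (inv u \<otimes> d))"
    by (intro bdm_mult weight_bdm bdm_compose[OF F] meas_H a measurable_ident, simp)+
  have "(\<integral>u. \<psi> u * F (u \<otimes> d) \<partial>H) = (\<integral>u. \<psi> (inv u) * F (inv u \<otimes> d) \<partial>H)"
    using integral_inv[OF bdm_measurable[OF m(1)]] by simp
  also have "\<dots> = (\<integral>u. \<psi> u * F (inv u \<otimes> d) \<partial>H)"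
    by (intro Bochner_Integration.integral_cong) (auto simp: space_H weight_inv)
  finally show ?thesis
    using integral_shift[OF m(1) a(1,2)] integral_shift[OF m(2) a(1,2)] by simp
qed

text \<open>
  After the column above is removed, the upper edge of the square occurs only in its own weight and its
  holonomy, which can thus be replaced by its inverse: the weight and the measure are invariant.
\<close>

theorem upper_loop_reflect:
  assumes T: "finite T" "supp_squares T" "(x, 1) \<in> T"
    and w: "supp w" "off_column x w" and F: "bdm H F"
  shows "(\<integral>Q. (\<Prod>s\<in>T. W s Q) * F (hol Q (upper_loop x @ w)) \<partial>confs)
    = (\<integral>Q. (\<Prod>s\<in>T. W s Q) * F (hol Q (rev_walk (upper_loop x) @ w)) \<partial>confs)"
proof -
  define C where "C = upper_loop x"
  define e :: edge where "e = ((x + 1, 2), (x, 2))"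
  define u v :: "edge list" where "u = [((x + 1, 1), (x + 1, 2))]" and "v = [((x, 2), (x, 1)), ((x, 1), (x + 1, 1))]"
  have C: "C = u @ e # v" by (simp add: C_def upper_loop_def u_def v_def e_def)
  have sq: "square_loop (x, 1) = [((x, 1), (x + 1, 1))] @ (u @ [e, ((x, 2), (x, 1))])"
    "C = (u @ [e, ((x, 2), (x, 1))]) @ [((x, 1), (x + 1, 1))]"
    by (simp_all add: C u_def v_def e_def)
  have "supp (square_loop (x, 1))" using T by blast
  then have sC: "supp C" unfolding sq supp_simps by blast
  have WC: "W (x, 1) Q = \<psi> (hol Q C)" if Q: "Q \<in> space confs" for Q
    unfolding W_def sq using cpow_hol_commute[OF Q, of "[((x, 1), (x + 1, 1))]" "u @ [e, ((x, 2), (x, 1))]" 0] sC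
    unfolding sq by (simp del: hol_simps)
  have su: "supp u" "supp v" "und e \<in> I" using sC unfolding C by auto
  have we: "und e \<notin> und ` set w" by (rule und_notin_image) (use w(2) in \<open>auto simp: off_column_def e_def\<close>)
  have ue: "und e \<notin> und ` set u" "und e \<notin> und ` set v" by (auto simp: u_def v_def e_def und_def pos_oriented_def)
  define T1 where "T1 = {s \<in> T. \<not> (fst s = x \<and> 2 \<le> snd s)}"
  define T2 where "T2 = T1 - {(x, 1)}"
  have x1: "(x, 1) \<in> T1" "finite T1" using T by (auto simp: T1_def)
  have T2: "supp_squares T2" using T by (auto simp: T1_def T2_def)
  define k where "k = card {s \<in> T. fst s = x \<and> 2 \<le> snd s}"
  define J where "J = {und ((x + 1, i + 1), (x, i + 1)) |i. 2 \<le> i}"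
  have offJ: "und ` set l \<inter> J = {}" if "off_column x l \<or> l = C \<or> l = rev_walk C" for l
  proof -
    have "und ((x + 1, i + 1), (x, i + 1)) \<notin> und ` set l" if i: "2 \<le> i" for i
      by (rule und_notin_image; use \<open>off_column x l \<or> l = C \<or> l = rev_walk C\<close> i in
        \<open>force simp: off_column_def C_def upper_loop_def\<close>)
    then have "z \<notin> und ` set l" if "z \<in> J" for z
      using that unfolding J_def by (elim CollectE exE conjE) (simp only: not_False_eq_True)
    then show ?thesis by (intro equals0I) (elim IntE, simp only: not_True_eq_False)
  qed
  define c where "c = (\<integral>u. \<psi> u \<partial>H) ^ k"
  have red: "(\<integral>Q. (\<Prod>s\<in>T. W s Q) * F (hol Q l) \<partial>confs) = c * (\<integral>Q. (\<Prod>s\<in>T1. W s Q) * F (hol Q l) \<partial>confs)"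
    if "supp l" "und ` set l \<inter> J = {}" for l
    unfolding T1_def c_def k_def
    by (rule remove_column[OF T(1,2) bdm_hol[OF F that(1)]]) (use indep_of_hol[OF that(2), of F] in \<open>simp add: J_def\<close>)
  have J1: "und ` set (C @ w) \<inter> J = {}" "und ` set (rev_walk C @ w) \<inter> J = {}"
    using offJ[of C] offJ[of "rev_walk C"] offJ[of w] w(2) by auto
  have split: "(\<Prod>s\<in>T1. W s Q) = W (x, 1) Q * (\<Prod>s\<in>T2. W s Q)" for Q
    unfolding T2_def by (rule prod.remove[OF x1(2,1)])
  have ind: "indep_of {und e} (\<lambda>Q. \<Prod>s\<in>T2. W s Q)"
  proof (rule indep_prod_W)
    fix s assume s: "s \<in> T2"
    have "left_square e \<noteq> s" "right_square e \<noteq> s" using s by (auto simp: T2_def T1_def e_def)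
    then have "e \<notin> set (square_loop s)" "rev_edge e \<notin> set (square_loop s)"
      using mem_square_loop[of e s] mem_square_loop[of "rev_edge e" s] by blast+
    then have "und e \<notin> und ` set (square_loop s)" by (rule und_notin_image)
    then show "und ` set (square_loop s) \<inter> {und e} = {}" by (rule disjoint_singletonI)
  qed
  have bp: "bdm confs (\<lambda>Q. \<Prod>s\<in>T2. W s Q)" by (rule bdm_prod_W[OF T2])
  have step: "(\<integral>Q. (\<Prod>s\<in>T1. W s Q) * F (hol Q (l @ w)) \<partial>confs)
      = (\<integral>Q. \<integral>z. (\<psi> (hol Q u \<otimes> (z \<otimes> hol Q v)) * F (\<phi> (hol Q u \<otimes> (z \<otimes> hol Q v)) \<otimes> hol Q w)) * (\<Prod>s\<in>T2. W s Q) \<partial>H \<partial>confs)"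
    if l: "supp l" and \<phi>: "\<And>Q. Q \<in> space confs \<Longrightarrow> hol Q l = \<phi> (hol Q C)" for l \<phi>
  proof -
    have "(\<integral>Q. (\<Prod>s\<in>T1. W s Q) * F (hol Q (l @ w)) \<partial>confs)
      = (\<integral>Q. (\<psi> (hol Q C) * F (hol Q (l @ w))) * (\<Prod>s\<in>T2. W s Q) \<partial>confs)"
      by (intro Bochner_Integration.integral_cong refl) (simp add: split WC)
    also have "\<dots> = (\<integral>Q. \<integral>z. (\<psi> (hol (set_edge Q e z) C) * F (hol (set_edge Q e z) (l @ w))) *
        (\<Prod>s\<in>T2. W s (set_edge Q e z)) \<partial>H \<partial>confs)"
      by (rule resample_edge[OF _ su(3)]) (intro bdm_mult bdm_hol bp F weight_bdm sC, use l w in simp)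
    also have "\<dots> = (\<integral>Q. \<integral>z. (\<psi> (hol Q u \<otimes> (z \<otimes> hol Q v)) * F (\<phi> (hol Q u \<otimes> (z \<otimes> hol Q v)) \<otimes> hol Q w)) * (\<Prod>s\<in>T2. W s Q) \<partial>H \<partial>confs)"
    proof (intro Bochner_Integration.integral_cong refl)
      fix Q z assume Q: "Q \<in> space confs" and "z \<in> space H"
      then have z: "z \<in> carrier G" by (simp add: space_H)
      note Q' = set_edge_space[OF Q su(3) z]
      have hC: "hol (set_edge Q e z) C = hol Q u \<otimes> (z \<otimes> hol Q v)"
        using Q' su sC unfolding C by (simp add: hol_append hol_set_edge ue edge_hol_set_edge z)
      have "hol (set_edge Q e z) (l @ w) = \<phi> (hol (set_edge Q e z) C) \<otimes> hol Q w"
        using Q' l w \<phi>[OF Q'] by (simp add: hol_append hol_set_edge we)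
      then show "\<psi> (hol (set_edge Q e z) C) * F (hol (set_edge Q e z) (l @ w)) * (\<Prod>s\<in>T2. W s (set_edge Q e z))
        = \<psi> (hol Q u \<otimes> (z \<otimes> hol Q v)) * F (\<phi> (hol Q u \<otimes> (z \<otimes> hol Q v)) \<otimes> hol Q w) * (\<Prod>s\<in>T2. W s Q)"
        using indep_of_set_edge[OF ind _ Q z] hC by simp
    qed
    finally show ?thesis .
  qed
  have "(\<integral>Q. (\<Prod>s\<in>T1. W s Q) * F (hol Q (C @ w)) \<partial>confs) = (\<integral>Q. (\<Prod>s\<in>T1. W s Q) * F (hol Q (rev_walk C @ w)) \<partial>confs)"
  proof -
    have inner: "(\<integral>z. (\<psi> (hol Q u \<otimes> (z \<otimes> hol Q v)) * F (hol Q u \<otimes> (z \<otimes> hol Q v) \<otimes> hol Q w)) * (\<Prod>s\<in>T2. W s Q) \<partial>H)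
      = (\<integral>z. (\<psi> (hol Q u \<otimes> (z \<otimes> hol Q v)) * F (inv (hol Q u \<otimes> (z \<otimes> hol Q v)) \<otimes> hol Q w)) * (\<Prod>s\<in>T2. W s Q) \<partial>H)"
      if Q: "Q \<in> space confs" for Q
      using integral_reflect[OF F, of "hol Q u" "hol Q v" "hol Q w"] hol_closed[OF Q] su w by simp
    have rev: "(\<integral>Q. (\<Prod>s\<in>T1. W s Q) * F (hol Q (rev_walk C @ w)) \<partial>confs)
      = (\<integral>Q. \<integral>z. (\<psi> (hol Q u \<otimes> (z \<otimes> hol Q v)) * F (inv (hol Q u \<otimes> (z \<otimes> hol Q v)) \<otimes> hol Q w)) * (\<Prod>s\<in>T2. W s Q) \<partial>H \<partial>confs)"
      by (rule step) (use sC hol_rev_walk[OF _ sC] in simp_all)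
    show ?thesis
      unfolding step[OF sC refl] rev by (intro Bochner_Integration.integral_cong refl inner)
  qed
  then show ?thesis using red[OF _ J1(1)] red[OF _ J1(2)] sC w(1) by (simp add: C_def)
qed

end

section \<open>The unitary group\<close>

definition unitary_monoid :: "nat \<Rightarrow> complex mat monoid" where
  "unitary_monoid N = \<lparr>carrier = unitary_group N, mult = (*), one = 1\<^sub>m N\<rparr>"

lemma unitary_monoid_simps [simp]:
  "carrier (unitary_monoid N) = unitary_group N" "mult (unitary_monoid N) = (*)" "one (unitary_monoid N) = 1\<^sub>m N"
  by (simp_all add: unitary_monoid_def)

lemma mat_adjoint_dims [simp]: "dim_row (mat_adjoint A) = dim_col A" "dim_col (mat_adjoint A) = dim_row A"
  by (simp_all add: mat_adjoint_def)

lemma mat_adjoint_index: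
  "i < dim_col A \<Longrightarrow> j < dim_row A \<Longrightarrow> mat_adjoint A $$ (i, j) = cnj (A $$ (j, i))"
  for A :: "complex mat"
  by (simp add: mat_adjoint_def mat_of_rows_index)

lemma mat_adjoint_carrier: "A \<in> carrier_mat n m \<Longrightarrow> mat_adjoint A \<in> carrier_mat m n"
  unfolding carrier_mat_def by simp

lemma mat_adjoint_mult:
  fixes A B :: "complex mat"
  assumes "A \<in> carrier_mat n n" "B \<in> carrier_mat n n"
  shows "mat_adjoint (A * B) = mat_adjoint B * mat_adjoint A"
  by (rule eq_matI) (use assms in \<open>auto simp: mat_adjoint_index scalar_prod_def mult.commute\<close>)

lemma mat_adjoint_one: "mat_adjoint (1\<^sub>m n) = (1\<^sub>m n :: complex mat)"
  by (rule eq_matI) (auto simp: mat_adjoint_index)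

lemma mat_adjoint_adjoint [simp]: "mat_adjoint (mat_adjoint A) = (A :: complex mat)"
  by (rule eq_matI) (auto simp: mat_adjoint_index)

lemma unitary_carrier: "U \<in> unitary_group N \<Longrightarrow> U \<in> carrier_mat N N"
  by (simp add: unitary_group_def)

lemma unitary_mult: "U \<in> unitary_group N \<Longrightarrow> V \<in> unitary_group N \<Longrightarrow> U * V \<in> unitary_group N"
proof -
  assume U: "U \<in> unitary_group N" and V: "V \<in> unitary_group N"
  note c = unitary_carrier[OF U] unitary_carrier[OF V]
    mat_adjoint_carrier[OF unitary_carrier[OF U]] mat_adjoint_carrier[OF unitary_carrier[OF V]]
  have u: "U * mat_adjoint U = 1\<^sub>m N" "mat_adjoint U * U = 1\<^sub>m N" "V * mat_adjoint V = 1\<^sub>m N" "mat_adjoint V * V = 1\<^sub>m N"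
    using U V by (auto simp: unitary_group_def)
  have "U * V * (mat_adjoint V * mat_adjoint U) = U * (V * mat_adjoint V) * mat_adjoint U"
    using c by (simp add: assoc_mult_mat[of _ N N _ N _ N])
  also have "\<dots> = 1\<^sub>m N" using u c by simp
  finally have 1: "U * V * (mat_adjoint V * mat_adjoint U) = 1\<^sub>m N" .
  have "mat_adjoint V * mat_adjoint U * (U * V) = mat_adjoint V * (mat_adjoint U * U) * V"
    using c by (simp add: assoc_mult_mat[of _ N N _ N _ N])
  also have "\<dots> = 1\<^sub>m N" using u c by simp
  finally have 2: "mat_adjoint V * mat_adjoint U * (U * V) = 1\<^sub>m N" .
  show ?thesis using 1 2 c mat_adjoint_mult[OF c(1,2)] by (simp add: unitary_group_def)
qed

lemma unitary_adjoint: "U \<in> unitary_group N \<Longrightarrow> mat_adjoint U \<in> unitary_group N"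
  by (auto simp: unitary_group_def mat_adjoint_carrier)

lemma unitary_one: "1\<^sub>m N \<in> unitary_group N"
  by (simp add: unitary_group_def mat_adjoint_one)

lemma unitary_group_is_group: "group (unitary_monoid N)"
proof (rule groupI)
  fix x y z assume "x \<in> carrier (unitary_monoid N)" "y \<in> carrier (unitary_monoid N)" "z \<in> carrier (unitary_monoid N)"
  then show "x \<otimes>\<^bsub>unitary_monoid N\<^esub> y \<otimes>\<^bsub>unitary_monoid N\<^esub> z = x \<otimes>\<^bsub>unitary_monoid N\<^esub> (y \<otimes>\<^bsub>unitary_monoid N\<^esub> z)"
    using assoc_mult_mat[of x N N y N z N] by (simp add: unitary_carrier)
next
  fix x assume x: "x \<in> carrier (unitary_monoid N)"
  then show "\<exists>y\<in>carrier (unitary_monoid N). y \<otimes>\<^bsub>unitary_monoid N\<^esub> x = \<one>\<^bsub>unitary_monoid N\<^esub>"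
    using unitary_adjoint by (intro bexI[of _ "mat_adjoint x"]) (auto simp: unitary_group_def)
  show "\<one>\<^bsub>unitary_monoid N\<^esub> \<otimes>\<^bsub>unitary_monoid N\<^esub> x = x"
    using x left_mult_one_mat[OF unitary_carrier[of x N]] by simp
qed (auto intro: unitary_mult unitary_one)

lemma unitary_inv: "U \<in> unitary_group N \<Longrightarrow> m_inv (unitary_monoid N) U = mat_adjoint U"
  by (rule group.inv_equality[OF unitary_group_is_group])
    (auto simp: unitary_adjoint, simp add: unitary_group_def)

lemma unitary_entry_bound:
  assumes U: "U \<in> unitary_group N" and ij: "i < N" "j < N"
  shows "cmod (U $$ (i, j)) \<le> 1"
proof -
  have c: "U \<in> carrier_mat N N" using U by (rule unitary_carrier)
  have "1 = (U * mat_adjoint U) $$ (i, i)" using U ij by (simp add: unitary_group_def)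
  also have "\<dots> = (\<Sum>k\<in>{0..<N}. U $$ (i, k) * cnj (U $$ (i, k)))"
    using c ij by (auto simp: scalar_prod_def mat_adjoint_index)
  also have "\<dots> = of_real (\<Sum>k\<in>{0..<N}. (cmod (U $$ (i, k)))\<^sup>2)"
    by (simp only: complex_norm_square[symmetric] of_real_sum of_real_power)
  finally have "(\<Sum>k\<in>{0..<N}. (cmod (U $$ (i, k)))\<^sup>2) = 1" by (metis of_real_eq_1_iff)
  moreover have "(cmod (U $$ (i, j)))\<^sup>2 \<le> (\<Sum>k\<in>{0..<N}. (cmod (U $$ (i, k)))\<^sup>2)"
    by (rule member_le_sum) (use ij in auto)
  ultimately show ?thesis by (simp add: abs_square_le_1)
qed

lemma mtrace_bound: "U \<in> unitary_group N \<Longrightarrow> cmod (mtrace U) \<le> real N"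
proof -
  assume U: "U \<in> unitary_group N"
  then have d: "dim_row U = N" using unitary_carrier by blast
  have "cmod (mtrace U) \<le> (\<Sum>i<N. 1)" unfolding mtrace_def d
    by (rule sum_norm_le) (use unitary_entry_bound[OF U] in auto)
  then show ?thesis by simp
qed

lemma mtrace_mult_commute:
  assumes "A \<in> carrier_mat n n" "B \<in> carrier_mat n n"
  shows "mtrace (A * B) = mtrace (B * A)"
proof -
  have "mtrace (A * B) = (\<Sum>i<n. \<Sum>k<n. A $$ (i, k) * B $$ (k, i))"
    using assms by (auto simp: mtrace_def scalar_prod_def atLeast0LessThan intro!: sum.cong)
  also have "\<dots> = (\<Sum>k<n. \<Sum>i<n. B $$ (k, i) * A $$ (i, k))"
    by (subst sum.swap) (simp add: mult.commute)
  also have "\<dots> = mtrace (B * A)"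
    using assms by (auto simp: mtrace_def scalar_prod_def atLeast0LessThan intro!: sum.cong)
  finally show ?thesis .
qed

lemma mtrace_adjoint: "A \<in> carrier_mat n n \<Longrightarrow> mtrace (mat_adjoint A) = cnj (mtrace A)"
  by (auto simp: mtrace_def mat_adjoint_index intro!: sum.cong)

section \<open>Haar measure\<close>

lemma space_unitary_borel [simp]: "space (unitary_borel N) = unitary_group N"
  by (simp add: unitary_borel_def)

lemma measurable_unitary_entry:
  assumes "i < N" "j < N"
  shows "(\<lambda>U. U $$ (i, j)) \<in> borel_measurable (unitary_borel N)"
proof -
  define S where "S = {..<N} \<times> {..<N}"
  have "(\<lambda>U. \<lambda>ij\<in>S. U $$ ij) \<in> measurable (unitary_borel N) (PiM S (\<lambda>_. borel :: complex measure))"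
    unfolding unitary_borel_def S_def
    by (rule measurable_vimage_algebra1) (auto simp: space_PiM)
  then have "(\<lambda>U. (\<lambda>ij\<in>S. U $$ ij) (i, j)) \<in> borel_measurable (unitary_borel N)"
    by (rule measurable_compose[OF _ measurable_component_singleton]) (use assms in \<open>simp add: S_def\<close>)
  then show ?thesis using assms by (simp add: S_def)
qed

text \<open>
  The Borel sets of the unitary group are generated by the matrix entries.
\<close>

lemma measurable_into_unitary:
  assumes "\<And>x. x \<in> space M \<Longrightarrow> f x \<in> unitary_group N"
    and "\<And>i j. i < N \<Longrightarrow> j < N \<Longrightarrow> (\<lambda>x. f x $$ (i, j)) \<in> borel_measurable M"
  shows "f \<in> measurable M (unitary_borel N)"
  unfolding unitary_borel_def
proof (rule measurable_vimage_algebra2)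
  show "f \<in> space M \<rightarrow> unitary_group N" using assms(1) by auto
  show "(\<lambda>x. \<lambda>ij\<in>{..<N} \<times> {..<N}. f x $$ ij) \<in> measurable M (PiM ({..<N} \<times> {..<N}) (\<lambda>_. borel))"
    by (rule measurable_restrict) (use assms(2) in auto)
qed

lemma haar_unitary_haar_group:
  assumes H: "haar_unitary N H"
  shows "haar_group (unitary_monoid N) H"
proof -
  have p: "prob_space H" and s: "sets H = sets (unitary_borel N)" using H by (auto simp: haar_unitary_def)
  have sp: "space H = unitary_group N" using sets_eq_imp_space_eq[OF s] by simp
  interpret prob_space H by fact
  interpret group "unitary_monoid N" by (rule unitary_group_is_group)
  have ent: "(\<lambda>U. U $$ (i, j)) \<in> borel_measurable H" if "i < N" "j < N" for i j
    using measurable_unitary_entry[OF that] by (simp add: measurable_cong_sets[OF s refl])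
  have into: "f \<in> measurable M H" if "f \<in> measurable M (unitary_borel N)" for f and M :: "'x measure"
    using that by (simp add: measurable_cong_sets[OF refl s])
  show ?thesis
  proof
    show "space H = carrier (unitary_monoid N)" by (simp add: sp)
    show "(\<lambda>(x, y). x \<otimes>\<^bsub>unitary_monoid N\<^esub> y) \<in> measurable (H \<Otimes>\<^sub>M H) H"
    proof (rule into, rule measurable_into_unitary)
      fix p assume "p \<in> space (H \<Otimes>\<^sub>M H)"
      then show "(case p of (x, y) \<Rightarrow> x \<otimes>\<^bsub>unitary_monoid N\<^esub> y) \<in> unitary_group N"
        by (auto simp: space_pair_measure sp unitary_mult)
    next
      fix i j assume ij: "i < N" "j < N"
      have "(\<lambda>p. \<Sum>k\<in>{0..<N}. fst p $$ (i, k) * snd p $$ (k, j)) \<in> borel_measurable (H \<Otimes>\<^sub>M H)"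
        by (intro borel_measurable_sum borel_measurable_times measurable_compose[OF measurable_fst ent]
            measurable_compose[OF measurable_snd ent]) (use ij in auto)
      moreover have "(case p of (x, y) \<Rightarrow> x \<otimes>\<^bsub>unitary_monoid N\<^esub> y) $$ (i, j) = (\<Sum>k\<in>{0..<N}. fst p $$ (i, k) * snd p $$ (k, j))"
        if "p \<in> space (H \<Otimes>\<^sub>M H)" for p
      proof -
        have "fst p \<in> carrier_mat N N" "snd p \<in> carrier_mat N N"
          using that by (auto simp: space_pair_measure sp unitary_carrier)
        then show ?thesis using ij by (simp add: split_beta scalar_prod_def)
      qed
      ultimately show "(\<lambda>p. (case p of (x, y) \<Rightarrow> x \<otimes>\<^bsub>unitary_monoid N\<^esub> y) $$ (i, j)) \<in> borel_measurable (H \<Otimes>\<^sub>M H)"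
        by (subst measurable_cong) auto
    qed
    show "m_inv (unitary_monoid N) \<in> measurable H H"
    proof (rule into, rule measurable_into_unitary)
      fix U assume "U \<in> space H"
      then show "m_inv (unitary_monoid N) U \<in> unitary_group N" by (simp add: sp unitary_inv unitary_adjoint)
    next
      fix i j assume ij: "i < N" "j < N"
      have "(\<lambda>U. cnj (U $$ (j, i))) \<in> borel_measurable H"
        by (rule measurable_compose[OF ent[OF ij(2,1)]])
          (auto intro!: borel_measurable_continuous_onI continuous_intros)
      moreover have "m_inv (unitary_monoid N) U $$ (i, j) = cnj (U $$ (j, i))" if "U \<in> space H" for U
        using that ij unitary_carrier[of U N] by (auto simp: sp unitary_inv mat_adjoint_index)
      ultimately show "(\<lambda>U. m_inv (unitary_monoid N) U $$ (i, j)) \<in> borel_measurable H"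
        by (subst measurable_cong) auto
    qed
    show "distr H H (\<lambda>y. x \<otimes>\<^bsub>unitary_monoid N\<^esub> y) = H" if "x \<in> carrier (unitary_monoid N)" for x
      using H that by (simp add: haar_unitary_def)
  qed
qed

text \<open>
  The weights of the two orientations of one plaquette, multiplied.
\<close>

definition ym_density :: "nat \<Rightarrow> real \<Rightarrow> complex mat \<Rightarrow> complex" where
  "ym_density N \<beta> U = exp (of_real (\<beta> * real N) * (mtrace U + cnj (mtrace U)))"

lemma haar_mtrace_bdm:
  assumes H: "haar_unitary N H"
  shows "bdm H mtrace"
proof -
  have s: "sets H = sets (unitary_borel N)" using H by (auto simp: haar_unitary_def)
  have sp: "space H = unitary_group N" using sets_eq_imp_space_eq[OF s] by simp
  have "(\<lambda>U. \<Sum>i<N. U $$ (i, i)) \<in> borel_measurable H"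
    by (intro borel_measurable_sum) (use measurable_unitary_entry in \<open>simp add: measurable_cong_sets[OF s refl]\<close>)
  moreover have "mtrace U = (\<Sum>i<N. U $$ (i, i))" if "U \<in> space H" for U
    using that unitary_carrier[of U N] by (auto simp: sp mtrace_def)
  ultimately have "mtrace \<in> borel_measurable H" by (subst measurable_cong) auto
  then show ?thesis using mtrace_bound[of _ N] by (auto simp: bdm_def sp)
qed

lemma ym_density_real: "ym_density N \<beta> U = of_real (exp (2 * \<beta> * real N * Re (mtrace U)))"
  by (simp add: ym_density_def complex_add_cnj exp_of_real[symmetric] mult_ac)

lemma haar_unitary_class_weight:
  assumes H: "haar_unitary N H"
  shows "class_weight (unitary_monoid N) H (ym_density N \<beta>)"
proof -
  interpret haar_group "unitary_monoid N" H by (rule haar_unitary_haar_group[OF H])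
  show ?thesis
  proof
    have "mtrace \<in> borel_measurable H" using haar_mtrace_bdm[OF H] by (rule bdm_measurable)
    then have "(\<lambda>U. ym_density N \<beta> U) \<in> borel_measurable H" unfolding ym_density_real by measurable
    moreover have "cmod (ym_density N \<beta> U) \<le> exp (2 * \<bar>\<beta>\<bar> * real N * real N)" if "U \<in> space H" for U
    proof -
      have "\<bar>Re (mtrace U)\<bar> \<le> real N"
        using mtrace_bound[of U N] that abs_Re_le_cmod[of "mtrace U"] by (simp add: space_H)
      then have "2 * \<bar>\<beta>\<bar> * real N * \<bar>Re (mtrace U)\<bar> \<le> 2 * \<bar>\<beta>\<bar> * real N * real N"
        by (intro mult_left_mono) auto
      moreover have "2 * \<beta> * real N * Re (mtrace U) \<le> \<bar>2 * \<beta> * real N * Re (mtrace U)\<bar>" by simp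
      moreover have "\<bar>2 * \<beta> * real N * Re (mtrace U)\<bar> = 2 * \<bar>\<beta>\<bar> * real N * \<bar>Re (mtrace U)\<bar>" by (simp add: abs_mult)
      ultimately show ?thesis by (simp add: ym_density_real)
    qed
    ultimately show "bdm H (ym_density N \<beta>)" by (auto simp: bdm_def)
    show "class_fun (ym_density N \<beta>)"
      unfolding class_fun_def
    proof (intro ballI)
      fix x y assume "x \<in> carrier (unitary_monoid N)" "y \<in> carrier (unitary_monoid N)"
      then have "mtrace (x * y) = mtrace (y * x)"
        by (intro mtrace_mult_commute[of _ N]) (simp_all add: unitary_carrier)
      then show "ym_density N \<beta> (x \<otimes>\<^bsub>unitary_monoid N\<^esub> y) = ym_density N \<beta> (y \<otimes>\<^bsub>unitary_monoid N\<^esub> x)"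
        by (simp add: ym_density_def)
    qed
    show "ym_density N \<beta> (m_inv (unitary_monoid N) x) = ym_density N \<beta> x" if "x \<in> carrier (unitary_monoid N)" for x
      using that mtrace_adjoint[OF unitary_carrier[of x N]]
      by (simp add: unitary_inv ym_density_def add.commute)
  qed
qed

lemma finite_pos_edges: "finite \<Lambda> \<Longrightarrow> finite (pos_edges \<Lambda>)"
  by (rule finite_subset[of _ "\<Lambda> \<times> \<Lambda>"]) (auto simp: pos_edges_def)

lemma haar_unitary_lattice_gauge:
  assumes "haar_unitary N H" "finite \<Lambda>"
  shows "lattice_gauge (unitary_monoid N) H (ym_density N \<beta>) (pos_edges \<Lambda>)"
  unfolding lattice_gauge_def lattice_gauge_axioms_def
  using haar_unitary_class_weight[OF assms(1)] finite_pos_edges[OF assms(2)] by blast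

section \<open>The lattice Yang--Mills measure\<close>

definition inner_squares :: "vertex set \<Rightarrow> vertex set" where
  "inner_squares \<Lambda> = {s. fst ` set (plaq_loop (s, True)) \<subseteq> \<Lambda>}"

lemma plaq_loop_False: "plaq_loop (s, False) = rev_walk (plaq_loop (s, True))"
  by (cases s) simp

lemma plaqs_in_eq: "plaqs_in \<Lambda> = inner_squares \<Lambda> \<times> UNIV"
proof -
  have vertices: "fst ` set (plaq_loop (s, b)) = fst ` set (plaq_loop (s, True))" for s b
    by (cases s; cases b) auto
  have *: "(s, b) \<in> plaqs_in \<Lambda> \<longleftrightarrow> (s, b) \<in> inner_squares \<Lambda> \<times> UNIV" for s b
    unfolding plaqs_in_def inner_squares_def mem_Times_iff mem_Collect_eq fst_conv vertices[of s b] by simp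
  show ?thesis
  proof (rule Set.set_eqI)
    show "p \<in> plaqs_in \<Lambda> \<longleftrightarrow> p \<in> inner_squares \<Lambda> \<times> UNIV" for p
      using *[of "fst p" "snd p"] by simp
  qed
qed

lemma subset_inner_squares:
  "R \<subseteq> inner_squares \<Lambda> \<longleftrightarrow> (\<Union>s\<in>R. fst ` set (plaq_loop (s, True))) \<subseteq> \<Lambda>"
  unfolding inner_squares_def UN_subset_iff subset_iff[of R] mem_Collect_eq Ball_def ..

lemma finite_inner_squares: "finite \<Lambda> \<Longrightarrow> finite (inner_squares \<Lambda>)"
  by (rule finite_subset[of _ \<Lambda>]) (auto simp: inner_squares_def)

locale ym =
  fixes N :: nat and H :: "complex mat measure" and \<Lambda> :: "vertex set" and \<beta> :: real
  assumes N: "1 \<le> N" and H: "haar_unitary N H" and fin: "finite \<Lambda>"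

sublocale ym \<subseteq> lattice_gauge "unitary_monoid N" H "ym_density N \<beta>" "pos_edges \<Lambda>"
  by (rule haar_unitary_lattice_gauge[OF H fin])

context ym begin

abbreviation Sq :: "vertex set" where "Sq \<equiv> inner_squares \<Lambda>"

lemma supp_iff: "supp l \<longleftrightarrow> set l \<subseteq> lattice_edges \<and> fst ` set l \<subseteq> \<Lambda> \<and> snd ` set l \<subseteq> \<Lambda>"
proof -
  have "und e \<in> pos_edges \<Lambda> \<longleftrightarrow> fst e \<in> \<Lambda> \<and> snd e \<in> \<Lambda>" if "e \<in> lattice_edges" for e
    using that by (auto simp: und_def pos_edges_def pos_oriented_rev_edge)
  then show ?thesis unfolding supp_def by blast
qed

lemma supp_Sq: "supp_squares Sq"
proof
  fix s assume "s \<in> Sq"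
  moreover have "snd ` set (plaq_loop (s, True)) = fst ` set (plaq_loop (s, True))" by (cases s) auto
  ultimately show "supp (plaq_loop (s, True))"
    using square_loop_lattice[of s] by (auto simp: supp_iff inner_squares_def simp del: plaq_loop.simps)
qed

lemma loop_mat_hol:
  assumes "Q \<in> space confs" "supp l"
  shows "loop_mat N Q l = hol Q l"
  using assms(2)
proof (induction l)
  case (Cons e l)
  have e: "e \<in> lattice_edges" "und e \<in> pos_edges \<Lambda>" using Cons.prems by auto
  have u: "Q (und e) \<in> unitary_group N" using conf_closed[OF assms(1) e(2)] by simp
  have "edge_mat Q e = edge_hol Q e"
    using unitary_inv[OF u]
    by (cases "pos_oriented e") (auto simp: edge_mat_def edge_hol_def und_def)
  moreover have "loop_mat N Q l = hol Q l" using Cons by simp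
  ultimately show ?case by (simp add: loop_mat_def)
qed (simp add: loop_mat_def)

lemma W_real: "W s Q = of_real (exp (2 * \<beta> * real N * Re (mtrace (hol Q (plaq_loop (s, True))))))"
  by (simp add: W_def ym_density_real del: plaq_loop.simps)

lemma ym_weight_eq:
  assumes Q: "Q \<in> space confs"
  shows "of_real (ym_weight \<Lambda> N \<beta> Q) = (\<Prod>s\<in>Sq. W s Q)" "0 < ym_weight \<Lambda> N \<beta> Q"
proof -
  let ?f = "\<lambda>p. exp (of_real (\<beta> * real N) * mtrace (loop_mat N Q (plaq_loop p))) :: complex"
  have "(\<Prod>p\<in>plaqs_in \<Lambda>. ?f p) = (\<Prod>s\<in>Sq. \<Prod>b\<in>UNIV. ?f (s, b))"
    unfolding plaqs_in_eq by (subst prod.cartesian_product) simp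
  also have "\<dots> = (\<Prod>s\<in>Sq. W s Q)"
  proof (rule prod.cong[OF refl])
    fix s assume s: "s \<in> Sq"
    have sup: "supp (plaq_loop (s, True))" "supp (plaq_loop (s, False))"
      using supp_Sq s unfolding plaq_loop_False supp_simps by blast+
    have c: "hol Q (plaq_loop (s, True)) \<in> unitary_group N" using hol_closed[OF Q sup(1)] by simp
    have F: "hol Q (plaq_loop (s, False)) = mat_adjoint (hol Q (plaq_loop (s, True)))"
      unfolding plaq_loop_False hol_rev_walk[OF Q sup(1)] by (rule unitary_inv[OF c])
    have "(\<Prod>b\<in>UNIV. ?f (s, b)) = ?f (s, True) * ?f (s, False)" by (simp add: UNIV_bool mult.commute)
    also have "\<dots> = W s Q"
      unfolding loop_mat_hol[OF Q sup(1)] loop_mat_hol[OF Q sup(2)] F mtrace_adjoint[OF unitary_carrier[OF c]]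
      by (simp add: W_def ym_density_def exp_add[symmetric] distrib_left del: plaq_loop.simps)
    finally show "(\<Prod>b\<in>UNIV. ?f (s, b)) = W s Q" .
  qed
  also have "\<dots> = of_real (\<Prod>s\<in>Sq. exp (2 * \<beta> * real N * Re (mtrace (hol Q (plaq_loop (s, True))))))"
    unfolding W_real by simp
  finally have 1: "(\<Prod>p\<in>plaqs_in \<Lambda>. ?f p) = of_real (\<Prod>s\<in>Sq. exp (2 * \<beta> * real N * Re (mtrace (hol Q (plaq_loop (s, True))))))" .
  then have 2: "ym_weight \<Lambda> N \<beta> Q = (\<Prod>s\<in>Sq. exp (2 * \<beta> * real N * Re (mtrace (hol Q (plaq_loop (s, True))))))"
    unfolding ym_weight_def by (simp only: Re_complex_of_real)
  show "0 < ym_weight \<Lambda> N \<beta> Q" unfolding 2 by (rule prod_pos) simp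
  show "of_real (ym_weight \<Lambda> N \<beta> Q) = (\<Prod>s\<in>Sq. W s Q)" unfolding 2 W_real by simp
qed

lemma bdm_weight: "bdm confs (\<lambda>Q. of_real (ym_weight \<Lambda> N \<beta> Q))"
  by (rule bdm_cong[OF bdm_prod_W[OF supp_Sq]]) (simp add: ym_weight_eq)

lemma measurable_weight [measurable]: "ym_weight \<Lambda> N \<beta> \<in> borel_measurable confs"
proof -
  have "(\<lambda>Q. Re (of_real (ym_weight \<Lambda> N \<beta> Q))) \<in> borel_measurable confs"
    using bdm_measurable[OF bdm_weight] by measurable
  then show ?thesis by simp
qed

lemma integrable_weight: "integrable confs (ym_weight \<Lambda> N \<beta>)"
  using integrable_Re[OF bdm_integrable[OF P.finite_measure_axioms bdm_weight]] by simp

lemma partition_eq: "of_real (ym_partition H \<Lambda> N \<beta>) = (\<integral>Q. (\<Prod>s\<in>Sq. W s Q) \<partial>confs)"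
  unfolding ym_partition_def integral_complex_of_real[symmetric]
  by (intro Bochner_Integration.integral_cong) (auto simp: ym_weight_eq)

lemma partition_pos: "0 < ym_partition H \<Lambda> N \<beta>"
  unfolding ym_partition_def
  by (rule P.expectation_greater[OF integrable_weight]) (auto simp: ym_weight_eq)

lemma prod_W_nonzero: "(\<integral>Q. (\<Prod>s\<in>Sq. W s Q) \<partial>confs) \<noteq> 0"
  using partition_pos partition_eq by (metis of_real_eq_0_iff less_irrefl)

lemma space_ym [simp]: "space (ym_measure H \<Lambda> N \<beta>) = space confs"
  by (simp add: ym_measure_def)

lemma sets_ym [simp]: "sets (ym_measure H \<Lambda> N \<beta>) = sets confs"
  by (simp add: ym_measure_def)

text \<open>
  The Yang--Mills measure is the lattice gauge theory above with the normalised plaquette weights.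
\<close>

lemma ym_integral:
  assumes F: "bdm confs F"
  shows "(\<integral>Q. F Q \<partial>ym_measure H \<Lambda> N \<beta>) = (\<integral>Q. (\<Prod>s\<in>Sq. W s Q) * F Q \<partial>confs) / (\<integral>Q. (\<Prod>s\<in>Sq. W s Q) \<partial>confs)"
proof -
  let ?Z = "ym_partition H \<Lambda> N \<beta>"
  have "(\<integral>Q. F Q \<partial>ym_measure H \<Lambda> N \<beta>) = (\<integral>Q. (ym_weight \<Lambda> N \<beta> Q / ?Z) *\<^sub>R F Q \<partial>confs)"
    unfolding ym_measure_def
    by (rule integral_density) (use bdm_measurable[OF F] partition_pos ym_weight_eq(2) in \<open>auto intro!: AE_I2 divide_nonneg_pos less_imp_le\<close>)
  also have "\<dots> = (\<integral>Q. ((\<Prod>s\<in>Sq. W s Q) * F Q) / of_real ?Z \<partial>confs)"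
    by (intro Bochner_Integration.integral_cong) (auto simp: scaleR_conv_of_real ym_weight_eq(1)[symmetric])
  also have "\<dots> = (\<integral>Q. (\<Prod>s\<in>Sq. W s Q) * F Q \<partial>confs) / of_real ?Z" by simp
  finally show ?thesis unfolding partition_eq .
qed

lemma prob_space_ym: "prob_space (ym_measure H \<Lambda> N \<beta>)"
proof
  let ?Z = "ym_partition H \<Lambda> N \<beta>"
  have "emeasure (ym_measure H \<Lambda> N \<beta>) (space (ym_measure H \<Lambda> N \<beta>)) = (\<integral>\<^sup>+Q. ennreal (ym_weight \<Lambda> N \<beta> Q / ?Z) \<partial>confs)"
    unfolding space_ym unfolding ym_measure_def
    by (subst emeasure_density) (auto intro!: nn_integral_cong)
  also have "\<dots> = ennreal (\<integral>Q. ym_weight \<Lambda> N \<beta> Q / ?Z \<partial>confs)"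
    by (rule nn_integral_eq_integral)
      (use integrable_weight partition_pos ym_weight_eq(2) in \<open>auto intro!: AE_I2 divide_nonneg_pos less_imp_le\<close>)
  also have "(\<integral>Q. ym_weight \<Lambda> N \<beta> Q / ?Z \<partial>confs) = 1"
    using partition_pos by (simp add: ym_partition_def)
  finally show "emeasure (ym_measure H \<Lambda> N \<beta>) (space (ym_measure H \<Lambda> N \<beta>)) = 1" by simp
qed

definition trn :: "complex mat \<Rightarrow> complex" where "trn U = mtrace U / of_nat N"

lemma bdm_trn: "bdm H trn"
  using bdm_mult[OF haar_mtrace_bdm[OF H] bdm_const[of H "1 / of_nat N"]] by (simp add: trn_def[abs_def])

lemma wilson_single:
  assumes "supp l"
  shows "wilson_expectation H \<Lambda> N \<beta> {#l#} = (\<integral>Q. (\<Prod>s\<in>Sq. W s Q) * trn (hol Q l) \<partial>confs) / (\<integral>Q. (\<Prod>s\<in>Sq. W s Q) \<partial>confs)"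
proof -
  have "wilson_expectation H \<Lambda> N \<beta> {#l#} = (\<integral>Q. trn (hol Q l) \<partial>ym_measure H \<Lambda> N \<beta>)"
    unfolding wilson_expectation_def
    by (intro Bochner_Integration.integral_cong) (auto simp: trn_def loop_mat_hol assms)
  then show ?thesis using ym_integral[OF bdm_hol[OF bdm_trn assms]] by simp
qed

lemma hol_reduces: "reduces l l' \<Longrightarrow> Q \<in> space confs \<Longrightarrow> supp l \<Longrightarrow> hol Q l = hol Q l' \<and> supp l'"
proof (induction rule: reduces.induct)
  case (cancel e u v l)
  then have "supp u" "supp v" "und e \<in> pos_edges \<Lambda>" by auto
  then show ?case using cancel hol_backtrack(1)[of Q u v e] by simp
qed simp

lemma wilson_reduces:
  assumes "reduces l l'" "supp l"
  shows "wilson_expectation H \<Lambda> N \<beta> {#l#} = wilson_expectation H \<Lambda> N \<beta> {#l'#}"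
proof -
  have sup: "supp l'" using hol_reduces[OF assms(1) _ assms(2)] P.not_empty by blast
  have "(\<integral>Q. (\<Prod>s\<in>Sq. W s Q) * trn (hol Q l) \<partial>confs) = (\<integral>Q. (\<Prod>s\<in>Sq. W s Q) * trn (hol Q l') \<partial>confs)"
    by (intro Bochner_Integration.integral_cong refl) (simp add: hol_reduces[OF assms(1) _ assms(2)])
  then show ?thesis by (simp add: wilson_single assms(2) sup)
qed

lemma wilson_reflect:
  assumes "supp (upper_loop x)" "supp w" "off_column x w" "(x, 1) \<in> Sq"
  shows "wilson_expectation H \<Lambda> N \<beta> {#upper_loop x @ w#} = wilson_expectation H \<Lambda> N \<beta> {#rev_walk (upper_loop x) @ w#}"
  using upper_loop_reflect[OF finite_inner_squares[OF fin] supp_Sq assms(4,2,3) bdm_trn]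
    wilson_single[of "upper_loop x @ w"] wilson_single[of "rev_walk (upper_loop x) @ w"] assms(1,2)
  by (simp only: supp_simps)

definition mpow :: "nat \<Rightarrow> complex mat \<Rightarrow> complex mat" where
  "mpow n U = ((\<lambda>A. U * A) ^^ n) (1\<^sub>m N)"

lemma hol_pw: "Q \<in> space confs \<Longrightarrow> supp l \<Longrightarrow> hol Q (pw l n) = mpow n (hol Q l) \<and> supp (pw l n)"
  by (induction n) (auto simp: mpow_def hol_append)

lemma bdm_trn_mpow: "bdm H (\<lambda>U. trn (mpow n U))"
proof (rule bdm_compose[OF bdm_trn])
  show "mpow n \<in> measurable H H"
  proof (induction n)
    case 0
    show ?case unfolding mpow_def using measurable_const_H[of "1\<^sub>m N" H] unitary_one by simp
  next
    case (Suc n)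
    have "(\<lambda>U. U \<otimes>\<^bsub>unitary_monoid N\<^esub> mpow n U) \<in> measurable H H"
      by (intro measurable_mult_H Suc) simp
    then show ?case by (simp add: mpow_def[abs_def])
  qed
qed

lemma wilson_same_law:
  assumes b: "bounds l R" "bounds l' R'" and c: "card R = card R'" and R: "R \<subseteq> Sq" "R' \<subseteq> Sq"
    and s: "supp l" "supp l'"
  shows "wilson_expectation H \<Lambda> N \<beta> {#pw l n#} = wilson_expectation H \<Lambda> N \<beta> {#pw l' n#}"
proof -
  have "supp (pw l n)" "supp (pw l' n)" using hol_pw s P.not_empty by blast+
  moreover have "(\<integral>Q. (\<Prod>s\<in>Sq. W s Q) * trn (hol Q (pw m n)) \<partial>confs) = (\<integral>Q. (\<Prod>s\<in>Sq. W s Q) * trn (mpow n (hol Q m)) \<partial>confs)"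
    if "supp m" for m
    by (intro Bochner_Integration.integral_cong refl) (simp add: hol_pw that)
  ultimately show ?thesis
    using bounds_same_law[OF b c finite_inner_squares[OF fin] R supp_Sq prod_W_nonzero bdm_trn_mpow[of n]] s
    by (simp add: wilson_single)
qed

end

section \<open>Symmetries of the surface sums\<close>

definition lattice_box :: "nat \<Rightarrow> vertex set" where
  "lattice_box n = {- int n..int n} \<times> {- int n..int n}"

lemma exhaustion_box: "exhaustion lattice_box"
proof -
  have "(x, y) \<in> (\<Union>N\<in>{1..}. lattice_box N)" for x y
  proof -
    have "(x, y) \<in> lattice_box (nat (\<bar>x\<bar> + \<bar>y\<bar> + 1))" by (auto simp: lattice_box_def)
    then show ?thesis by (intro UN_I[of "nat (\<bar>x\<bar> + \<bar>y\<bar> + 1)"]) auto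
  qed
  then have "(\<Union>N\<in>{1..}. lattice_box N) = UNIV" by auto
  moreover have "finite (lattice_box N)" "lattice_box N \<subseteq> lattice_box (Suc N)" for N
    by (auto simp: lattice_box_def)
  ultimately show ?thesis by (auto simp: exhaustion_def)
qed

lemma exhaustion_eventually:
  assumes "exhaustion \<Lambda>" "finite V"
  shows "\<forall>\<^sub>F N in sequentially. 1 \<le> N \<and> finite (\<Lambda> N) \<and> V \<subseteq> \<Lambda> N"
proof -
  have mono: "\<Lambda> N \<subseteq> \<Lambda> M" if "1 \<le> N" "N \<le> M" for N M
    using that(2,1)
  proof (induction rule: dec_induct)
    case (step n)
    have "\<Lambda> n \<subseteq> \<Lambda> (Suc n)" using assms(1) step unfolding exhaustion_def by (meson order_trans)
    then show ?case using step by (meson order_trans)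
  qed simp
  have "\<forall>\<^sub>F N in sequentially. 1 \<le> N \<and> v \<in> \<Lambda> N" for v
  proof -
    have "v \<in> (\<Union>N\<in>{1..}. \<Lambda> N)" using assms(1) by (simp add: exhaustion_def)
    then obtain n where n: "1 \<le> n" "v \<in> \<Lambda> n" by auto
    show ?thesis
      by (rule eventually_sequentiallyI[of n]) (use mono[of n] n in auto)
  qed
  then have "\<forall>\<^sub>F N in sequentially. \<forall>v\<in>V. 1 \<le> N \<and> v \<in> \<Lambda> N"
    by (intro eventually_ball_finite assms(2)) auto
  moreover have "\<forall>\<^sub>F N in sequentially. 1 \<le> (N::nat)" by (rule eventually_ge_at_top)
  ultimately show ?thesis
    by eventually_elim (use assms(1) in \<open>auto simp: exhaustion_def\<close>)
qed

text \<open>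
  The large \<open>N\<close> limit as a hypothesis. It transfers identities between Wilson loop expectations, valid
  for all large \<open>N\<close>, to surface sums.
\<close>

locale large_N =
  fixes haar :: "nat \<Rightarrow> complex mat measure"
    and c :: "edge list \<Rightarrow> plaq multiset \<Rightarrow> real" and b0 :: real
  assumes haar: "\<And>N. N \<ge> 1 \<Longrightarrow> haar_unitary N (haar N)"
    and sc: "surface_coefficients c" and b0: "0 < b0"
    and lim: "\<And>\<Lambda> \<beta>' s. exhaustion \<Lambda> \<Longrightarrow> \<bar>\<beta>'\<bar> \<le> b0 \<Longrightarrow> (\<forall>l\<in>#s. closed_walk l) \<Longrightarrow>
        (\<forall>l\<in>#s. (\<lambda>K. \<bar>c l K * \<beta>' ^ size K\<bar>) summable_on UNIV) \<and>
        (\<lambda>N. wilson_expectation (haar N) (\<Lambda> N) N \<beta>' s)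
          \<longlonglongrightarrow> of_real (\<Prod>l\<in>#s. surface_sum c \<beta>' l)"
begin

sublocale surface c b0
proof
  show "(\<lambda>K. \<bar>c l K * b0 ^ size K\<bar>) summable_on UNIV" if "closed_walk l" for l
    using lim[OF exhaustion_box, of b0 "{#l#}"] that b0 by simp
qed (rule sc b0)+

lemma surface_sum_lim:
  assumes "exhaustion \<Lambda>" "\<bar>\<beta>\<bar> \<le> b0" "closed_walk l"
  shows "(\<lambda>N. wilson_expectation (haar N) (\<Lambda> N) N \<beta> {#l#}) \<longlonglongrightarrow> of_real (surface_sum c \<beta> l)"
  using lim[OF assms(1,2), of "{#l#}"] assms(3) by simp

lemma surface_sum_eqI:
  assumes l: "closed_walk l" "closed_walk l'" and b: "\<bar>\<beta>\<bar> \<le> b0" and V: "finite V"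
    and eq: "\<And>N. 1 \<le> N \<Longrightarrow> V \<subseteq> lattice_box N \<Longrightarrow>
      wilson_expectation (haar N) (lattice_box N) N \<beta> {#l#} = wilson_expectation (haar N) (lattice_box N) N \<beta> {#l'#}"
  shows "surface_sum c \<beta> l = surface_sum c \<beta> l'"
proof -
  have "\<forall>\<^sub>F N in sequentially. wilson_expectation (haar N) (lattice_box N) N \<beta> {#l#} = wilson_expectation (haar N) (lattice_box N) N \<beta> {#l'#}"
    using exhaustion_eventually[OF exhaustion_box V] by eventually_elim (use eq in auto)
  with surface_sum_lim[OF exhaustion_box b l(1)]
  have "(\<lambda>N. wilson_expectation (haar N) (lattice_box N) N \<beta> {#l'#}) \<longlonglongrightarrow> of_real (surface_sum c \<beta> l)"
    by (rule Lim_transform_eventually)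
  from LIMSEQ_unique[OF this surface_sum_lim[OF exhaustion_box b l(2)]] show ?thesis by simp
qed

definition endpoints :: "edge list \<Rightarrow> vertex set" where
  "endpoints l = fst ` set l \<union> snd ` set l"

lemma ym_box: "1 \<le> N \<Longrightarrow> ym N (haar N) (lattice_box N)"
  by unfold_locales (auto simp: haar lattice_box_def)

lemma box_supp:
  assumes "1 \<le> N" "endpoints l \<subseteq> lattice_box N" "set l \<subseteq> lattice_edges"
  shows "lattice_gauge.supp (pos_edges (lattice_box N)) l"
proof -
  interpret ym N "haar N" "lattice_box N" 0 by (rule ym_box[OF assms(1)])
  show ?thesis unfolding supp_iff using assms by (auto simp: endpoints_def)
qed

sublocale surface_gauge c b0
proof
  show "coe l m = coe l' m" if l: "closed_walk l" "closed_walk l'" "reduces l l'" for l l' m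
  proof (rule coe_eqI[OF l(1,2)])
    fix b :: real assume b: "\<bar>b\<bar> \<le> b0"
    show "surface_sum c b l = surface_sum c b l'"
    proof (rule surface_sum_eqI[OF l(1,2) b, of "endpoints l"])
      fix N :: nat assume N: "1 \<le> N" and V: "endpoints l \<subseteq> lattice_box N"
      interpret ym N "haar N" "lattice_box N" b by (rule ym_box[OF N])
      show "wilson_expectation (haar N) (lattice_box N) N b {#l#} = wilson_expectation (haar N) (lattice_box N) N b {#l'#}"
        by (rule wilson_reduces[OF l(3)]) (use box_supp[OF N V] l(1) in \<open>simp add: closed_walk_def\<close>)
    qed (simp add: endpoints_def)
  qed
  show "coe (upper_loop x @ w) m = coe (rev_walk (upper_loop x) @ w) m"
    if w: "walk (x + 1, 1) w (x + 1, 1)" "off_column x w" for x w m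
  proof -
    have lat: "((x + 1, 1), (x + 1, 2)) \<in> lattice_edges" "((x + 1, 2), (x, 2)) \<in> lattice_edges"
      "((x, 2), (x, 1)) \<in> lattice_edges" "((x, 1), (x + 1, 1)) \<in> lattice_edges"
      by (auto simp: lattice_edges_def)
    have u: "walk (x + 1, 1) (upper_loop x) (x + 1, 1)" using lat by (simp add: upper_loop_def)
    have cw: "closed_walk (upper_loop x @ w)" "closed_walk (rev_walk (upper_loop x) @ w)"
      using u w(1) walk_rev_walk[OF u] by (auto intro!: closed_walkI[of "(x + 1, 1)"] simp del: split_paired_Ex)
    show ?thesis
    proof (rule coe_eqI[OF cw])
      fix b :: real assume b: "\<bar>b\<bar> \<le> b0"
      show "surface_sum c b (upper_loop x @ w) = surface_sum c b (rev_walk (upper_loop x) @ w)"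
      proof (rule surface_sum_eqI[OF cw b, of "endpoints w \<union> endpoints (upper_loop x)"])
        fix N :: nat assume N: "1 \<le> N" and V: "endpoints w \<union> endpoints (upper_loop x) \<subseteq> lattice_box N"
        interpret ym N "haar N" "lattice_box N" b by (rule ym_box[OF N])
        show "wilson_expectation (haar N) (lattice_box N) N b {#upper_loop x @ w#}
          = wilson_expectation (haar N) (lattice_box N) N b {#rev_walk (upper_loop x) @ w#}"
        proof (rule wilson_reflect[OF _ _ w(2)])
          show "supp (upper_loop x)" "supp w"
            using V walk_edges[OF u] walk_edges[OF w(1)] by (auto intro!: box_supp[OF N])
          show "(x, 1) \<in> inner_squares (lattice_box N)"
            using V by (auto simp: inner_squares_def endpoints_def upper_loop_def)
        qed
      qed (simp add: endpoints_def)
    qed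
  qed
qed

text \<open>
  Loops bounding regions of the same area have the same law at each finite \<open>N\<close>, so a general region
  can be replaced by a row of squares.
\<close>

lemma coe_simple_cycle_power:
  assumes b: "bounds l R"
  shows "coe (pw l n) m = (if m = card R * n then moment_fps (card R) $ n else 0)"
proof -
  define a where "a = card R"
  have R: "finite R" "R \<noteq> {}" using b bounds_nonempty by (auto simp: bounds_def)
  then have a: "0 < a" by (simp add: a_def card_gt_0_iff)
  have cyc: "simple_cycle l" using b by (simp add: bounds_def)
  then have cl: "closed_walk l" by (simp add: simple_cycle_def)
  obtain u where wl: "walk u l u" using cl by (auto simp: closed_walk_iff)
  define R' where "R' = {0..<int a} \<times> {0::int}"
  have b': "bounds (strip 0 a) R'"
    unfolding bounds_def using simple_cycle_strip[OF a] winding_strip[of 0 a] by (simp add: R'_def)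
  have card: "card R = card R'" by (simp add: R'_def a_def)
  define V where "V = endpoints l \<union> endpoints (strip 0 a) \<union> (\<Union>s\<in>R \<union> R'. fst ` set (plaq_loop (s, True)))"
  have cw: "closed_walk (pw l n)" "closed_walk (pw (strip 0 a) n)"
    by (rule closed_walkI[OF walk_pw[OF wl]], rule closed_walkI[OF walk_pw[OF walk_strip]])
  have "coe (pw l n) m = coe (pw (strip 0 a) n) m"
  proof (rule coe_eqI[OF cw])
    fix b1 :: real assume b1: "\<bar>b1\<bar> \<le> b0"
    show "surface_sum c b1 (pw l n) = surface_sum c b1 (pw (strip 0 a) n)"
    proof (rule surface_sum_eqI[OF cw b1, of V])
      show "finite V" using R by (simp add: V_def endpoints_def R'_def)
      fix N :: nat assume N: "1 \<le> N" and V: "V \<subseteq> lattice_box N"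
      interpret ym N "haar N" "lattice_box N" b1 by (rule ym_box[OF N])
      show "wilson_expectation (haar N) (lattice_box N) N b1 {#pw l n#}
        = wilson_expectation (haar N) (lattice_box N) N b1 {#pw (strip 0 a) n#}"
      proof (rule wilson_same_law[OF b b' card])
        show "R \<subseteq> inner_squares (lattice_box N)" "R' \<subseteq> inner_squares (lattice_box N)"
          using subset_inner_squares[of "R \<union> R'" "lattice_box N"] V by (simp_all add: V_def)
        show "supp l" "supp (strip 0 a)"
          using V walk_edges[OF wl] walk_edges[OF walk_strip] by (auto intro!: box_supp[OF N] simp: V_def)
      qed
    qed
  qed
  then show ?thesis using coe_strip_power[of 0 a n m] by (simp add: a_def)
qed

theorem surface_sum_simple_cycle_power:
  assumes b: "bounds l R" and n: "0 < n" and \<beta>: "\<bar>\<beta>\<bar> \<le> b0"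
  shows "surface_sum c \<beta> (pw l n) = c_coeff n (card R) * \<beta> ^ (n * card R)"
proof -
  have R: "finite R" "R \<noteq> {}" using b bounds_nonempty by (auto simp: bounds_def)
  then have a: "0 < card R" by (simp add: card_gt_0_iff)
  obtain u where wl: "walk u l u" using b by (auto simp: bounds_def simple_cycle_def closed_walk_iff)
  have "(\<lambda>m. coe (pw l n) m * \<beta> ^ m) sums surface_sum c \<beta> (pw l n)"
    by (rule surface_sum_sums[OF closed_walkI[OF walk_pw[OF wl]] \<beta>])
  moreover have "(\<lambda>m. coe (pw l n) m * \<beta> ^ m) = (\<lambda>m. if m = card R * n then moment_fps (card R) $ n * \<beta> ^ m else 0)"
    by (auto simp: coe_simple_cycle_power[OF b])
  moreover have "(\<lambda>m. if m = card R * n then moment_fps (card R) $ n * \<beta> ^ m else 0) sums (moment_fps (card R) $ n * \<beta> ^ (card R * n))"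
    by (rule sums_single)
  ultimately show ?thesis using moment_fps_nth[OF a n] sums_unique2 by (metis mult.commute)
qed

end

section \<open>The limit density\<close>

text \<open>
  Adding one index adds one row and one column, that is, twice the sum of the off-diagonal terms.
\<close>

lemma toeplitz_sum:
  fixes g :: "nat \<Rightarrow> real"
  shows "(\<Sum>j<n. \<Sum>k<n. g (nat \<bar>int j - int k\<bar>)) = (\<Sum>m<n. g 0 + 2 * (\<Sum>i<m. g (Suc i)))"
proof (induction n)
  case (Suc n)
  let ?h = "\<lambda>j k. g (nat \<bar>int j - int k\<bar>)"
  have r: "(\<Sum>i<n. g (n - i)) = (\<Sum>i<n. g (Suc i))"
    by (rule sum.reindex_bij_witness[of _ "\<lambda>i. n - Suc i" "\<lambda>i. n - Suc i"]) (auto simp: Suc_diff_Suc)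
  have "(\<Sum>k<n. ?h n k) = (\<Sum>i<n. g (n - i))" "(\<Sum>j<n. ?h j n) = (\<Sum>i<n. g (n - i))"
    by (auto intro!: sum.cong arg_cong[where f = g])
  then have *: "(\<Sum>k<n. ?h n k) = (\<Sum>i<n. g (Suc i))" "(\<Sum>j<n. ?h j n) = (\<Sum>i<n. g (Suc i))" using r by simp_all
  have "(\<Sum>j<Suc n. \<Sum>k<Suc n. ?h j k) = (\<Sum>j<n. \<Sum>k<n. ?h j k) + (\<Sum>j<n. ?h j n) + ((\<Sum>k<n. ?h n k) + g 0)"
    by (simp add: sum.distrib)
  then show ?case using Suc * by simp
qed simp

text \<open>
  If the limit were negative, the sums would tend to minus infinity.
\<close>

lemma cesaro_limit_nonneg:
  fixes s :: "nat \<Rightarrow> real"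
  assumes s: "s \<longlonglongrightarrow> L" and pos: "\<And>n. 0 \<le> (\<Sum>m<n. s m)"
  shows "0 \<le> L"
proof (rule ccontr)
  assume "\<not> 0 \<le> L"
  then have L: "L < L / 2" "L < 0" by auto
  from order_tendstoD(2)[OF s L(1)] obtain M where M: "\<And>m. M \<le> m \<Longrightarrow> s m < L / 2"
    by (auto simp: eventually_sequentially)
  have bound: "(\<Sum>m<M + k. s m) \<le> (\<Sum>m<M. s m) + real k * (L / 2)" for k
  proof (induction k)
    case (Suc k)
    have "real (Suc k) * (L / 2) = real k * (L / 2) + L / 2" by (simp add: algebra_simps)
    moreover have "(\<Sum>m<M + Suc k. s m) = (\<Sum>m<M + k. s m) + s (M + k)" by simp
    moreover have "s (M + k) < L / 2" by (rule M) simp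
    ultimately show ?case using Suc by linarith
  qed simp
  obtain k where "(\<Sum>m<M. s m) / (- (L / 2)) < real k" using reals_Archimedean2 by blast
  then have "(\<Sum>m<M. s m) + real k * (L / 2) < 0" using L(2) by (simp add: field_simps)
  then show False using bound[of k] pos[of "M + k"] by linarith
qed

abbreviation period :: "real measure" where
  "period \<equiv> restrict_space lborel {0..<2 * pi}"

lemma finite_measure_period: "finite_measure period"
  by (rule finite_measureI) (simp add: emeasure_restrict_space)

lemma integrable_period_bounded:
  fixes f :: "real \<Rightarrow> 'b :: {banach, second_countable_topology}"
  assumes "f \<in> borel_measurable borel" "\<And>x. norm (f x) \<le> B"
  shows "integrable period f"
proof -
  interpret finite_measure period by (rule finite_measure_period)
  show ?thesis
    by (rule integrable_const_bound[of _ B]) (use assms in \<open>auto intro!: measurable_restrict_space1\<close>)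
qed

lemma measurable_cis [measurable]: "cis \<in> borel_measurable borel"
  by (intro borel_measurable_continuous_onI continuous_intros)

lemma integral_cis_period:
  "(\<integral>x. cis (of_int k * x) \<partial>period) = (if k = 0 then of_real (2 * pi) else 0)"
proof -
  have eq: "(\<integral>x. cis (of_int k * x) \<partial>period) = (\<integral>x. indicator {0..2 * pi} x *\<^sub>R cis (of_int k * x) \<partial>lborel)"
  proof -
    have "AE x in lborel. x \<noteq> 2 * pi" by (rule AE_lborel_singleton)
    then have "AE x in lborel. indicator {0..<2 * pi} x *\<^sub>R cis (of_int k * x) = indicator {0..2 * pi} x *\<^sub>R cis (of_int k * x)"
      by eventually_elim (auto simp: indicator_def)
    moreover have "(\<lambda>x. cis (of_int k * x)) \<in> borel_measurable borel" by measurable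
    ultimately have "(\<integral>x. indicator {0..<2 * pi} x *\<^sub>R cis (of_int k * x) \<partial>lborel)
      = (\<integral>x. indicator {0..2 * pi} x *\<^sub>R cis (of_int k * x) \<partial>lborel)"
      by (intro integral_cong_AE) measurable
    then show ?thesis by (subst integral_restrict_space) auto
  qed
  show ?thesis
  proof (cases "k = 0")
    case True
    then show ?thesis unfolding eq by (simp add: scaleR_conv_of_real one_complex.code[symmetric])
  next
    case False
    define F where "F x = cis (of_int k * x) / (\<i> * of_int k)" for x :: real
    have "(F has_vector_derivative cis (of_int k * x)) (at x within {0..2 * pi})" for x
    proof -
      have "((\<lambda>x. cis (of_int k * x)) has_vector_derivative (\<i> * of_int k * cis (of_int k * x))) (at x within {0..2 * pi})"
      proof -
        have "((\<lambda>x. of_int k * x) has_real_derivative of_int k) (at x within {0..2 * pi})"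
          by (auto intro!: derivative_eq_intros)
        from has_derivative_cis[OF this[unfolded has_field_derivative_def]] show ?thesis
          unfolding has_vector_derivative_def
          by (rule has_derivative_eq_rhs) (auto simp: scaleR_conv_of_real algebra_simps)
      qed
      then have "((\<lambda>x. cis (of_int k * x) * (1 / (\<i> * of_int k))) has_vector_derivative
        (\<i> * of_int k * cis (of_int k * x)) * (1 / (\<i> * of_int k))) (at x within {0..2 * pi})"
        by (rule has_vector_derivative_mult_left)
      then show ?thesis using False by (simp add: F_def[abs_def])
    qed
    moreover have "continuous_on {0..2 * pi} (\<lambda>x. cis (of_int k * x))" by (intro continuous_intros)
    ultimately have "(\<integral>x. indicator {0..2 * pi} x *\<^sub>R cis (of_int k * x) \<partial>lborel) = F (2 * pi) - F 0"
      by (intro integral_FTC_Icc) auto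
    moreover have "cis (of_int k * (2 * pi)) = 1"
      using cis_multiple_2pi[of "of_int k"] by (simp add: mult.commute mult.left_commute)
    ultimately show ?thesis unfolding eq using False by (simp add: F_def)
  qed
qed

text \<open>
  A function on the circle given by its Fourier coefficients \<open>\<mu>\<close>, which are absolutely summable and
  positive definite.
\<close>

locale moment_density =
  fixes \<mu> :: "nat \<Rightarrow> real" and f :: "real \<Rightarrow> real"
  assumes \<mu>0: "\<mu> 0 = 1" and sum: "summable (\<lambda>n. \<bar>\<mu> (Suc n)\<bar>)"
    and f: "\<And>x. f x = 1 / (2 * pi) * (1 + 2 * (\<Sum>n. \<mu> (Suc n) * cos (real (Suc n) * x)))"
    and toeplitz: "\<And>n x. 0 \<le> (\<Sum>j<n. \<Sum>k<n. \<mu> (nat \<bar>int j - int k\<bar>) * cos (real (nat \<bar>int j - int k\<bar>) * x))"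
begin

lemma summable_term: "summable (\<lambda>n. norm (\<mu> (Suc n) * cos (real (Suc n) * x)))"
proof (rule summable_comparison_test'[OF sum, of 0])
  show "norm (norm (\<mu> (Suc n) * cos (real (Suc n) * x))) \<le> \<bar>\<mu> (Suc n)\<bar>" for n
    using abs_cos_le_one[of "real (Suc n) * x"] mult_left_mono[of _ 1 "\<bar>\<mu> (Suc n)\<bar>"] by (simp add: abs_mult)
qed

text \<open>
  The positive definite sums are the sums of the partial sums of the Fourier series at \<open>x\<close>.
\<close>

lemma density_nonneg: "0 \<le> f x"
proof -
  let ?s = "\<lambda>m. \<mu> 0 * cos (real 0 * x) + 2 * (\<Sum>i<m. \<mu> (Suc i) * cos (real (Suc i) * x))"
  have "?s \<longlonglongrightarrow> \<mu> 0 * cos (real 0 * x) + 2 * (\<Sum>n. \<mu> (Suc n) * cos (real (Suc n) * x))"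
    by (intro tendsto_intros summable_LIMSEQ summable_norm_cancel[OF summable_term])
  moreover have "0 \<le> (\<Sum>m<n. ?s m)" for n
    using toeplitz[where n = n and x = x] toeplitz_sum[of "\<lambda>i. \<mu> i * cos (real i * x)" n] by simp
  ultimately have "0 \<le> \<mu> 0 * cos (real 0 * x) + 2 * (\<Sum>n. \<mu> (Suc n) * cos (real (Suc n) * x))"
    by (rule cesaro_limit_nonneg)
  then show ?thesis unfolding f by (simp add: \<mu>0)
qed

lemma measurable_density [measurable]: "f \<in> borel_measurable borel"
  unfolding f[abs_def] by measurable

lemma density_bounded: "norm (f x) \<le> 1 / (2 * pi) * (1 + 2 * (\<Sum>n. \<bar>\<mu> (Suc n)\<bar>))"
proof -
  have "(\<Sum>n. \<mu> (Suc n) * cos (real (Suc n) * x)) \<le> (\<Sum>n. \<bar>\<mu> (Suc n)\<bar>)"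
  proof (rule suminf_le[OF _ summable_norm_cancel[OF summable_term] sum])
    fix n
    have "\<mu> (Suc n) * cos (real (Suc n) * x) \<le> \<bar>\<mu> (Suc n)\<bar> * \<bar>cos (real (Suc n) * x)\<bar>"
      by (metis abs_ge_self abs_mult)
    also have "\<dots> \<le> \<bar>\<mu> (Suc n)\<bar> * 1" by (intro mult_left_mono abs_cos_le_one abs_ge_zero)
    finally show "\<mu> (Suc n) * cos (real (Suc n) * x) \<le> \<bar>\<mu> (Suc n)\<bar>" by simp
  qed
  then have "f x \<le> 1 / (2 * pi) * (1 + 2 * (\<Sum>n. \<bar>\<mu> (Suc n)\<bar>))"
    unfolding f by (intro mult_left_mono add_left_mono) simp_all
  then show ?thesis using density_nonneg[of x] by simp
qed

lemma integrable_density: "integrable period f"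
  by (rule integrable_period_bounded[OF measurable_density density_bounded])

text \<open>
  Termwise integration, by absolute convergence, and orthogonality of the characters.
\<close>

lemma density_fourier: "(\<integral>x. f x *\<^sub>R cis (real k * x) \<partial>period) = of_real (\<mu> k)"
proof -
  let ?e = "\<lambda>x::real. cis (of_int (int k) * x)"
  let ?c = "\<lambda>n x. of_real (\<mu> (Suc n) * cos (real (Suc n) * x)) * ?e x"
  define jp jm where "jp n = int k + int (Suc n)" and "jm n = int k - int (Suc n)" for n
  have j: "jp n \<noteq> 0" "jm n = 0 \<longleftrightarrow> k = Suc n" for n by (auto simp: jp_def jm_def)
  have c_eq: "?c n x = of_real (\<mu> (Suc n) / 2) * cis (of_int (jp n) * x)
      + of_real (\<mu> (Suc n) / 2) * cis (of_int (jm n) * x)" for n x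
  proof -
    have "of_real (cos (real (Suc n) * x)) = (cis (real (Suc n) * x) + cis (- (real (Suc n) * x))) / 2"
      by (simp add: complex_eq_iff)
    moreover have "cis (of_int (jp n) * x) = cis (real (Suc n) * x) * ?e x"
      "cis (of_int (jm n) * x) = cis (- (real (Suc n) * x)) * ?e x"
      by (simp_all add: jp_def jm_def cis_mult algebra_simps)
    ultimately show ?thesis
      by (simp only: of_real_mult of_real_divide of_real_numeral) (simp only: algebra_simps add_divide_distrib times_divide_eq_left times_divide_eq_right)
  qed
  have ic: "integrable period (\<lambda>x. cis (of_int j * x))" for j
    by (rule integrable_period_bounded[where B = 1]) (simp_all add: measurable_compose[OF _ measurable_cis])
  have int_c: "(\<integral>x. ?c n x \<partial>period) = (if k = Suc n then of_real (pi * \<mu> (Suc n)) else 0)" for n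
    unfolding c_eq using ic by (subst Bochner_Integration.integral_add) (auto simp: integral_cis_period j)
  have iint: "integrable period (?c n)" for n
    unfolding c_eq using ic by (intro Bochner_Integration.integrable_add integrable_mult_right) auto
  have norm_c: "norm (?c n x) \<le> \<bar>\<mu> (Suc n)\<bar>" for n x
    using abs_cos_le_one[of "real (Suc n) * x"] mult_left_mono[of "\<bar>cos (real (Suc n) * x)\<bar>" 1 "\<bar>\<mu> (Suc n)\<bar>"]
    by (simp add: norm_mult abs_mult)
  have sc: "summable (\<lambda>n. norm (?c n x))" for x
    by (rule summable_comparison_test'[OF sum, of 0]) (use norm_c in simp)
  have si: "summable (\<lambda>n. \<integral>x. norm (?c n x) \<partial>period)"
  proof (rule summable_comparison_test'[OF summable_mult[OF sum, of "measure period (space period)"], of 0])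
    fix n :: nat
    have "(\<integral>x. norm (?c n x) \<partial>period) \<le> (\<integral>x. \<bar>\<mu> (Suc n)\<bar> \<partial>period)"
    proof (rule integral_mono)
      show "integrable period (\<lambda>x. norm (?c n x))" by (rule integrable_norm[OF iint])
      show "integrable period (\<lambda>x. \<bar>\<mu> (Suc n)\<bar>)"
        by (rule integrable_period_bounded[where B = "\<bar>\<mu> (Suc n)\<bar>"]) auto
    qed (rule norm_c)
    then show "norm (\<integral>x. norm (?c n x) \<partial>period) \<le> measure period (space period) * \<bar>\<mu> (Suc n)\<bar>"
      by (simp add: mult.commute)
  qed
  have AE: "AE x in period. summable (\<lambda>n. norm (?c n x))" using sc by simp
  have sums: "(\<lambda>n. \<integral>x. ?c n x \<partial>period) sums (\<integral>x. (\<Sum>n. ?c n x) \<partial>period)"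
    by (rule sums_integral[OF iint AE si])
  have int_sum: "integrable period (\<lambda>x. \<Sum>n. ?c n x)"
    by (rule integrable_suminf[OF iint AE si])
  have total: "(\<integral>x. (\<Sum>n. ?c n x) \<partial>period) = (if k = 0 then 0 else of_real (pi * \<mu> k))"
  proof (cases k)
    case 0
    have "(\<lambda>_. 0) sums (\<integral>x. (\<Sum>n. ?c n x) \<partial>period)"
      using sums unfolding int_c unfolding 0 by (simp only: nat.distinct if_False)
    then have "(\<integral>x. (\<Sum>n. ?c n x) \<partial>period) = 0" by (rule sums_unique2[OF _ sums_zero])
    then show ?thesis by (simp only: 0 if_True simp_thms)
  next
    case (Suc j)
    have "(\<lambda>n. \<integral>x. ?c n x \<partial>period) = (\<lambda>n. if n = j then of_real (pi * \<mu> (Suc j)) else 0)"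
      unfolding int_c by (auto simp: Suc)
    then have "(\<lambda>n. if n = j then of_real (pi * \<mu> (Suc j)) else 0) sums (\<integral>x. (\<Sum>n. ?c n x) \<partial>period)"
      using sums by (simp only:)
    moreover have "(\<lambda>n. if n = j then of_real (pi * \<mu> (Suc j)) else 0) sums complex_of_real (pi * \<mu> (Suc j))"
      by (rule sums_single)
    ultimately have "(\<integral>x. (\<Sum>n. ?c n x) \<partial>period) = of_real (pi * \<mu> (Suc j))" by (rule sums_unique2)
    then show ?thesis by (simp only: Suc nat.distinct if_False)
  qed
  have "f x *\<^sub>R cis (real k * x) = of_real (1 / (2 * pi)) * (?e x + 2 * (\<Sum>n. ?c n x))" for x
  proof -
    have "(\<Sum>n. ?c n x) = of_real (\<Sum>n. \<mu> (Suc n) * cos (real (Suc n) * x)) * ?e x"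
    proof -
      have s: "summable (\<lambda>n. \<mu> (Suc n) * cos (real (Suc n) * x))" by (rule summable_norm_cancel[OF summable_term])
      have "complex_of_real (\<Sum>n. \<mu> (Suc n) * cos (real (Suc n) * x)) = (\<Sum>n. of_real (\<mu> (Suc n) * cos (real (Suc n) * x)))"
        by (rule suminf_of_real[OF s])
      then show ?thesis using suminf_mult2[OF summable_of_real[OF s], where c = "?e x"] by (simp only:)
    qed
    then show ?thesis unfolding f by (simp add: scaleR_conv_of_real algebra_simps)
  qed
  note expand = this
  define S where "S x = (\<Sum>n. ?c n x)" for x
  have iS: "integrable period S" unfolding S_def[abs_def] by (rule int_sum)
  have "(\<integral>x. ?e x + 2 * S x \<partial>period) = (\<integral>x. ?e x \<partial>period) + (\<integral>x. 2 * S x \<partial>period)"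
    by (rule Bochner_Integration.integral_add[OF ic integrable_mult_right[OF iS]])
  then have "(\<integral>x. f x *\<^sub>R cis (real k * x) \<partial>period) = of_real (1 / (2 * pi)) * ((\<integral>x. ?e x \<partial>period) + 2 * (\<integral>x. S x \<partial>period))"
    unfolding expand S_def[symmetric] by (simp only: integral_mult_right_zero)
  then show ?thesis unfolding integral_cis_period S_def total by (simp add: \<mu>0)
qed

lemma density_integral: "(\<integral>x. f x \<partial>period) = 1"
proof -
  have "complex_of_real (\<integral>x. f x \<partial>period) = (\<integral>x. f x *\<^sub>R cis (real 0 * x) \<partial>period)"
    unfolding integral_complex_of_real[symmetric] by (simp add: scaleR_conv_of_real)
  then show ?thesis unfolding density_fourier \<mu>0 by (simp only: of_real_1 of_real_eq_1_iff)
qed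

lemma probability_density: "probability_density_on {0..<2 * pi} f"
  using density_nonneg integrable_density density_integral
  by (simp add: probability_density_on_def set_integrable_def set_lebesgue_integral_def
      integrable_restrict_space integral_restrict_space)

definition law :: "complex measure" where
  "law = distr (density period (\<lambda>x. ennreal (f x))) circle_borel cis"

lemma measurable_cis_circle: "cis \<in> measurable (density period (\<lambda>x. ennreal (f x))) circle_borel"
  unfolding circle_borel_def by (rule measurable_restrict_space2) (auto intro!: measurable_restrict_space1)

lemma law_integral:
  fixes g :: "complex \<Rightarrow> complex"
  assumes g: "continuous_on (sphere 0 1) g"
  shows "(\<integral>z. g z \<partial>law) = (\<integral>x. f x *\<^sub>R g (cis x) \<partial>period)"
proof -
  have gm: "g \<in> borel_measurable circle_borel"
    unfolding circle_borel_def by (rule borel_measurable_continuous_on_restrict[OF g])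
  have "(\<lambda>x. g (cis x)) \<in> borel_measurable (density period (\<lambda>x. ennreal (f x)))"
    by (rule measurable_compose[OF measurable_cis_circle gm])
  then have "(\<lambda>x. g (cis x)) \<in> borel_measurable period" by simp
  then show ?thesis
    unfolding law_def integral_distr[OF measurable_cis_circle gm]
    by (intro integral_density) (auto intro!: measurable_restrict_space1 simp: density_nonneg)
qed

lemma law_moment: "(\<integral>z. z ^ k \<partial>law) = of_real (\<mu> k)"
proof -
  have "(\<integral>z. z ^ k \<partial>law) = (\<integral>x. f x *\<^sub>R cis x ^ k \<partial>period)"
    by (rule law_integral) (intro continuous_intros)
  then show ?thesis unfolding Complex.DeMoivre density_fourier .
qed

lemma prob_space_law: "prob_space law"
proof -
  have "prob_space (density period (\<lambda>x. ennreal (f x)))"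
  proof
    have "emeasure (density period (\<lambda>x. ennreal (f x))) (space (density period (\<lambda>x. ennreal (f x))))
      = emeasure (density period (\<lambda>x. ennreal (f x))) (space period)" by (simp only: space_density)
    also have "\<dots> = (\<integral>\<^sup>+x. ennreal (f x) * indicator (space period) x \<partial>period)"
      by (rule emeasure_density[OF _ sets.top]) (auto intro!: measurable_restrict_space1)
    also have "\<dots> = (\<integral>\<^sup>+x. ennreal (f x) \<partial>period)"
      by (rule nn_integral_cong) (simp only: indicator_simps mult_1_right)
    also have "\<dots> = 1"
      using nn_integral_eq_integral[OF integrable_density] density_nonneg density_integral by simp
    finally show "emeasure (density period (\<lambda>x. ennreal (f x))) (space (density period (\<lambda>x. ennreal (f x)))) = 1" .
  qed
  then show ?thesis unfolding law_def by (rule prob_space.prob_space_distr[OF _ measurable_cis_circle])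
qed

end

section \<open>Empirical spectral distributions\<close>

lemma eigenvalue_list_char_poly:
  assumes A: "A \<in> carrier_mat N N"
  shows "char_poly A = (\<Prod>a\<leftarrow>eigenvalue_list A. [:- a, 1:])" "length (eigenvalue_list A) = N"
proof -
  show 1: "char_poly A = (\<Prod>a\<leftarrow>eigenvalue_list A. [:- a, 1:])"
    unfolding eigenvalue_list_def by (rule someI_ex) (use char_poly_factorized[OF A] in blast)
  have "degree (char_poly A) = N" using degree_monic_char_poly[OF A] by simp
  then show "length (eigenvalue_list A) = N"
    using degree_linear_factors[of uminus "eigenvalue_list A"] 1 by simp
qed

text \<open>
  A unitary matrix preserves the norm of an eigenvector.
\<close>

lemma unitary_eigenvalue:
  assumes U: "U \<in> unitary_group N" and z: "z \<in> set (eigenvalue_list U)"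
  shows "cmod z = 1"
proof -
  have c: "U \<in> carrier_mat N N" by (rule unitary_carrier[OF U])
  have "poly (char_poly U) z = 0"
    unfolding eigenvalue_list_char_poly(1)[OF c] using linear_poly_root[OF z] .
  then have "eigenvalue U z" using eigenvalue_root_char_poly[OF c] by blast
  then obtain v where v: "v \<in> carrier_vec N" "v \<noteq> 0\<^sub>v N" "U *\<^sub>v v = z \<cdot>\<^sub>v v"
    using c unfolding eigenvalue_def eigenvector_def by auto
  define S where "S = (\<Sum>i<N. cmod (v $ i) ^ 2)"
  have comp: "(\<Sum>j<N. U $$ (i, j) * v $ j) = z * v $ i" if i: "i < N" for i
  proof -
    have "(U *\<^sub>v v) $ i = (\<Sum>j<N. U $$ (i, j) * v $ j)"
      using i c v(1) by (auto simp: scalar_prod_def atLeast0LessThan intro!: sum.cong)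
    then show ?thesis using v i by simp
  qed
  have orth: "(\<Sum>i<N. cnj (U $$ (i, k)) * U $$ (i, j)) = (if k = j then 1 else 0)" if "k < N" "j < N" for k j
  proof -
    have "mat_adjoint U * U = 1\<^sub>m N" using U by (simp add: unitary_group_def)
    then have "(mat_adjoint U * U) $$ (k, j) = (if k = j then 1 else 0)" using that by simp
    moreover have "(mat_adjoint U * U) $$ (k, j) = (\<Sum>i<N. cnj (U $$ (i, k)) * U $$ (i, j))"
      using that c mat_adjoint_carrier[OF c]
      by (auto simp: scalar_prod_def mat_adjoint_index atLeast0LessThan intro!: sum.cong)
    ultimately show ?thesis by simp
  qed
  have S: "of_real S = (\<Sum>i<N. cnj (v $ i) * v $ i)"
    unfolding S_def of_real_sum by (intro sum.cong refl) (simp only: complex_norm_square mult.commute)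
  have "of_real (cmod z ^ 2 * S) = (\<Sum>i<N. cnj (z * v $ i) * (z * v $ i))"
    unfolding of_real_mult S complex_norm_square sum_distrib_left by (intro sum.cong refl) (simp add: ac_simps)
  also have "\<dots> = (\<Sum>i<N. cnj (\<Sum>k<N. U $$ (i, k) * v $ k) * (\<Sum>j<N. U $$ (i, j) * v $ j))"
    by (intro sum.cong refl) (simp add: comp)
  also have "\<dots> = (\<Sum>i<N. \<Sum>k<N. \<Sum>j<N. cnj (v $ k) * v $ j * (cnj (U $$ (i, k)) * U $$ (i, j)))"
    unfolding cnj_sum sum_product by (intro sum.cong refl) (simp add: ac_simps)
  also have "\<dots> = (\<Sum>k<N. \<Sum>j<N. \<Sum>i<N. cnj (v $ k) * v $ j * (cnj (U $$ (i, k)) * U $$ (i, j)))"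
    by (rule trans[OF sum.swap]) (intro sum.cong refl sum.swap)
  also have "\<dots> = (\<Sum>k<N. \<Sum>j<N. cnj (v $ k) * v $ j * (if k = j then 1 else 0))"
    unfolding sum_distrib_left[symmetric] by (intro sum.cong refl) (simp only: orth lessThan_iff)
  also have "\<dots> = (\<Sum>k<N. cnj (v $ k) * v $ k)"
    by (intro sum.cong refl) (simp add: mult_if_delta if_distrib[of "(*) _"] cong: if_cong)
  also have "\<dots> = of_real S" by (simp only: S)
  finally have eq: "cmod z ^ 2 * S = S" by (simp only: of_real_eq_iff)
  have "S \<noteq> 0"
  proof
    assume "S = 0"
    then have "\<forall>i<N. v $ i = 0"
      unfolding S_def by (subst (asm) sum_nonneg_eq_0_iff) auto
    then have "v = 0\<^sub>v N" using v(1) by (intro eq_vecI) auto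
    then show False using v(2) by simp
  qed
  then have "cmod z ^ 2 = 1" using eq by simp
  then show ?thesis using power2_eq_1_iff[of "cmod z"] norm_ge_zero[of z] by auto
qed

text \<open>
  Powers of a triangular matrix have the powers of its diagonal entries on the diagonal.
\<close>

lemma upper_triangular_pow:
  assumes B: "B \<in> carrier_mat n n" "upper_triangular (B :: complex mat)"
  shows "upper_triangular (B ^\<^sub>m k) \<and> (\<forall>i<n. (B ^\<^sub>m k) $$ (i, i) = (B $$ (i, i)) ^ k)"
proof (induction k)
  case 0
  then show ?case using B by (auto simp: upper_triangular_def)
next
  case (Suc k)
  let ?P = "B ^\<^sub>m k"
  have P: "?P \<in> carrier_mat n n" using B by simp
  have entry: "(?P * B) $$ (i, j) = (\<Sum>m<n. ?P $$ (i, m) * B $$ (m, j))" if "i < n" "j < n" for i j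
    using that P B by (auto simp: scalar_prod_def atLeast0LessThan intro!: sum.cong)
  have zP: "?P $$ (i, m) = 0" if "m < i" "i < n" for i m using Suc P that by (auto simp: upper_triangular_def)
  have zB: "B $$ (i, m) = 0" if "m < i" "i < n" for i m using B that by (auto simp: upper_triangular_def)
  have "(?P * B) $$ (i, j) = 0" if "j < i" "i < n" for i j
  proof -
    have "?P $$ (i, m) * B $$ (m, j) = 0" if "m < n" for m
      using zP[of m i] zB[of j m] \<open>j < i\<close> \<open>i < n\<close> that by (cases "m < i") auto
    then have "(\<Sum>m<n. ?P $$ (i, m) * B $$ (m, j)) = 0" by (intro sum.neutral) simp
    then show ?thesis using entry[of i j] that by simp
  qed
  moreover have "(?P * B) $$ (i, i) = (B $$ (i, i)) ^ Suc k" if "i < n" for i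
  proof -
    have "?P $$ (i, m) * B $$ (m, i) = (if m = i then ?P $$ (i, i) * B $$ (i, i) else 0)" if "m < n" for m
      using zP[of m i] zB[of i m] \<open>i < n\<close> that by (cases "m < i"; cases "m = i") auto
    then have "(?P * B) $$ (i, i) = (\<Sum>m<n. if m = i then ?P $$ (i, i) * B $$ (i, i) else 0)"
      unfolding entry[OF that that] by (intro sum.cong) auto
    then show ?thesis using that Suc by simp
  qed
  ultimately show ?case using P B by (auto simp: upper_triangular_def)
qed

text \<open>
  By the Schur decomposition the matrix is similar to a triangular one with the eigenvalues on the diagonal.
\<close>

lemma mtrace_pow_eigenvalues:
  assumes A: "A \<in> carrier_mat N N"
  shows "mtrace (A ^\<^sub>m k) = (\<Sum>i<N. (eigenvalue_list A ! i) ^ k)"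
proof -
  let ?es = "eigenvalue_list A"
  note es = eigenvalue_list_char_poly[OF A]
  obtain B P Q where BPQ: "schur_decomposition A ?es = (B, P, Q)" by (cases "schur_decomposition A ?es") auto
  from schur_decomposition[OF A es(1) BPQ]
  have wit: "similar_mat_wit A B P Q" and tri: "upper_triangular B" and diag: "diag_mat B = ?es" by auto
  have c: "B \<in> carrier_mat N N" "P \<in> carrier_mat N N" "Q \<in> carrier_mat N N" "Q * P = 1\<^sub>m N"
    using wit A by (auto simp: similar_mat_wit_def Let_def)
  have Bk: "B ^\<^sub>m k \<in> carrier_mat N N" using c by simp
  have "mtrace (A ^\<^sub>m k) = mtrace (P * (B ^\<^sub>m k * Q))"
    unfolding similar_mat_wit_pow_id[OF wit] using c Bk by (simp add: assoc_mult_mat[of _ N N _ N _ N])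
  also have "\<dots> = mtrace (B ^\<^sub>m k * Q * P)" using c Bk by (intro mtrace_mult_commute[of _ N]) auto
  also have "B ^\<^sub>m k * Q * P = B ^\<^sub>m k * (Q * P)" by (rule assoc_mult_mat[OF Bk c(3,2)])
  also have "\<dots> = B ^\<^sub>m k" using c(4) right_mult_one_mat[OF Bk] by simp
  also have "mtrace (B ^\<^sub>m k) = (\<Sum>i<N. (B $$ (i, i)) ^ k)"
    using upper_triangular_pow[OF c(1) tri] Bk by (auto simp: mtrace_def intro!: sum.cong)
  also have "\<dots> = (\<Sum>i<N. (?es ! i) ^ k)"
    using c(1) by (intro sum.cong) (auto simp: diag[symmetric] diag_mat_def)
  finally show ?thesis .
qed

abbreviation esd :: "complex mat \<Rightarrow> complex measure" where
  "esd \<equiv> empirical_spectral_distribution"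

lemma esd_integral:
  fixes g :: "complex \<Rightarrow> complex"
  assumes U: "U \<in> unitary_group N" and g: "continuous_on (sphere 0 1) g"
  shows "(\<integral>z. g z \<partial>esd U) = (\<Sum>i<N. g (eigenvalue_list U ! i)) / of_nat N"
proof -
  have c: "U \<in> carrier_mat N N" by (rule unitary_carrier[OF U])
  have on: "eigenvalue_list U ! i \<in> sphere 0 1" if "i < N" for i
    using unitary_eigenvalue[OF U] eigenvalue_list_char_poly(2)[OF c] that by simp
  have m: "(\<lambda>i. eigenvalue_list U ! i) \<in> measurable (uniform_count_measure {..<N}) circle_borel"
    unfolding circle_borel_def
    by (rule measurable_restrict_space2)
      (use on in \<open>auto simp: space_uniform_count_measure measurable_def sets_uniform_count_measure\<close>)
  have gm: "g \<in> borel_measurable circle_borel"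
    unfolding circle_borel_def by (rule borel_measurable_continuous_on_restrict[OF g])
  have "(\<integral>z. g z \<partial>esd U) = (\<integral>i. g (eigenvalue_list U ! i) \<partial>uniform_count_measure {..<N})"
    unfolding empirical_spectral_distribution_def using c by (simp add: integral_distr[OF m gm])
  also have "\<dots> = (\<Sum>i<N. (1 / real N) *\<^sub>R g (eigenvalue_list U ! i))"
    unfolding uniform_count_measure_def by (subst lebesgue_integral_point_measure_finite) auto
  finally show ?thesis by (simp add: scaleR_conv_of_real sum_divide_distrib)
qed

lemma esd_moment:
  assumes U: "U \<in> unitary_group N"
  shows "(\<integral>z. z ^ k \<partial>esd U) = mtrace (U ^\<^sub>m k) / of_nat N"
  by (subst esd_integral[OF U]) (auto intro!: continuous_intros simp: mtrace_pow_eigenvalues[OF unitary_carrier[OF U]])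

lemma esd_add:
  fixes g h :: "complex \<Rightarrow> complex"
  assumes U: "U \<in> unitary_group N" and "continuous_on (sphere 0 1) g" "continuous_on (sphere 0 1) h"
  shows "(\<integral>z. g z + h z \<partial>esd U) = (\<integral>z. g z \<partial>esd U) + (\<integral>z. h z \<partial>esd U)"
  using assms by (simp add: esd_integral[OF U] continuous_on_add sum.distrib add_divide_distrib)

lemma esd_bound:
  fixes g :: "complex \<Rightarrow> complex"
  assumes U: "U \<in> unitary_group N" and N: "1 \<le> N" and g: "continuous_on (sphere 0 1) g"
    and b: "\<And>z. z \<in> sphere 0 1 \<Longrightarrow> cmod (g z) \<le> B"
  shows "cmod (\<integral>z. g z \<partial>esd U) \<le> B"
proof -
  have on: "eigenvalue_list U ! i \<in> sphere 0 1" if "i < N" for i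
    using unitary_eigenvalue[OF U] eigenvalue_list_char_poly(2)[OF unitary_carrier[OF U]] that by simp
  have "cmod (\<Sum>i<N. g (eigenvalue_list U ! i)) \<le> (\<Sum>i<N. B)"
    by (rule sum_norm_le) (use b on in auto)
  then show ?thesis unfolding esd_integral[OF U g] using N by (simp add: norm_divide field_simps)
qed

lemma esd_approx:
  fixes g h :: "complex \<Rightarrow> complex"
  assumes U: "U \<in> unitary_group N" and N: "1 \<le> N" and g: "continuous_on (sphere 0 1) g"
    and h: "continuous_on (sphere 0 1) h" and b: "\<And>z. z \<in> sphere 0 1 \<Longrightarrow> cmod (g z - h z) \<le> B"
  shows "cmod ((\<integral>z. h z \<partial>esd U) - (\<integral>z. g z \<partial>esd U)) \<le> B"
proof -
  have c: "continuous_on (sphere 0 1) (\<lambda>z. h z - g z)" using g h by (intro continuous_intros)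
  have "(\<integral>z. h z \<partial>esd U) - (\<integral>z. g z \<partial>esd U) = (\<integral>z. h z - g z \<partial>esd U)"
    unfolding esd_integral[OF U g] esd_integral[OF U h] esd_integral[OF U c]
    by (simp add: sum_subtractf diff_divide_distrib)
  then show ?thesis using esd_bound[OF U N c, of B] b by (simp add: norm_minus_commute)
qed

section \<open>Trigonometric polynomials\<close>

text \<open>
  Trigonometric polynomials; \<^term>\<open>cnj z\<close> is the inverse of \<open>z\<close> on the circle.
\<close>

inductive laurent :: "(complex \<Rightarrow> complex) \<Rightarrow> bool" where
  mono: "laurent (\<lambda>z. a * z ^ k)"
| cnj_mono: "laurent (\<lambda>z. a * cnj z ^ k)"
| add: "laurent p \<Longrightarrow> laurent q \<Longrightarrow> laurent (\<lambda>z. p z + q z)"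

text \<open>
  Restrictions of trigonometric polynomials to the circle. They form an algebra.
\<close>

definition trig :: "(complex \<Rightarrow> complex) \<Rightarrow> bool" where
  "trig f \<longleftrightarrow> (\<exists>p. laurent p \<and> (\<forall>z\<in>sphere 0 1. f z = p z))"

lemma laurent_continuous: "laurent p \<Longrightarrow> continuous_on S p"
  by (induction rule: laurent.induct) (auto intro!: continuous_intros)

lemma trig_add: "trig f \<Longrightarrow> trig g \<Longrightarrow> trig (\<lambda>z. f z + g z)"
proof -
  assume "trig f" "trig g"
  then obtain p q where p: "laurent p" "\<forall>z\<in>sphere 0 1. f z = p z" and q: "laurent q" "\<forall>z\<in>sphere 0 1. g z = q z"
    unfolding trig_def by blast
  have "laurent (\<lambda>z. p z + q z)" by (rule laurent.add[OF p(1) q(1)])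
  then show ?thesis unfolding trig_def using p(2) q(2) by (intro exI[of _ "\<lambda>z. p z + q z"]) simp
qed

lemma trig_laurent: "laurent p \<Longrightarrow> trig p"
  unfolding trig_def by blast

lemma trig_const: "trig (\<lambda>z. a)"
  using trig_laurent[OF laurent.mono[of a 0]] by simp

lemma circle_cancel:
  assumes "z \<in> sphere 0 (1::real)"
  shows "z ^ j * cnj z ^ k = (if k \<le> j then z ^ (j - k) else cnj z ^ (k - j))"
proof -
  have z: "z * cnj z = 1" using assms by (simp add: complex_norm_square[symmetric])
  have "z ^ j * cnj z ^ k = z ^ (j - k)" if "k \<le> j"
  proof -
    have "z ^ j * cnj z ^ k = z ^ (j - k) * (z * cnj z) ^ k"
      using that by (simp add: power_mult_distrib flip: power_add mult.assoc)
    then show ?thesis by (simp add: z)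
  qed
  moreover have "z ^ j * cnj z ^ k = cnj z ^ (k - j)" if "j \<le> k"
  proof -
    have "z ^ j * cnj z ^ k = (z * cnj z) ^ j * cnj z ^ (k - j)"
      using that by (simp add: power_mult_distrib mult.assoc flip: power_add)
    then show ?thesis by (simp add: z)
  qed
  ultimately show ?thesis by auto
qed

lemma laurent_mult: "laurent p \<Longrightarrow> laurent q \<Longrightarrow> trig (\<lambda>z. p z * q z)"
proof (induction rule: laurent.induct)
  case (mono a j)
  from mono show ?case
  proof (induction rule: laurent.induct)
    case (mono b k)
    show ?case using trig_laurent[OF laurent.mono[of "a * b" "j + k"]] by (simp add: power_add ac_simps)
  next
    case (cnj_mono b k)
    have "(a * z ^ j) * (b * cnj z ^ k) = (if k \<le> j then (a * b) * z ^ (j - k) else (a * b) * cnj z ^ (k - j))"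
      if "z \<in> sphere 0 1" for z
      using circle_cancel[OF that, of j k] by (simp add: ac_simps split: if_splits)
    moreover have "laurent (\<lambda>z. if k \<le> j then (a * b) * z ^ (j - k) else (a * b) * cnj z ^ (k - j))"
      by (cases "k \<le> j") (simp_all add: laurent.mono laurent.cnj_mono)
    ultimately show ?case unfolding trig_def by blast
  next
    case (add p q)
    then show ?case using trig_add by (simp add: distrib_left)
  qed
next
  case (cnj_mono a k)
  from cnj_mono show ?case
  proof (induction rule: laurent.induct)
    case (mono b j)
    have "(a * cnj z ^ k) * (b * z ^ j) = (if k \<le> j then (a * b) * z ^ (j - k) else (a * b) * cnj z ^ (k - j))"
      if "z \<in> sphere 0 1" for z
      using circle_cancel[OF that, of j k] by (simp add: ac_simps split: if_splits)
    moreover have "laurent (\<lambda>z. if k \<le> j then (a * b) * z ^ (j - k) else (a * b) * cnj z ^ (k - j))"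
      by (cases "k \<le> j") (simp_all add: laurent.mono laurent.cnj_mono)
    ultimately show ?case unfolding trig_def by blast
  next
    case (cnj_mono b j)
    show ?case using trig_laurent[OF laurent.cnj_mono[of "a * b" "k + j"]] by (simp add: power_add ac_simps)
  next
    case (add p q)
    then show ?case using trig_add by (simp add: distrib_left)
  qed
next
  case (add p1 p2)
  then show ?case using trig_add by (simp add: distrib_right)
qed

lemma trig_mult: "trig f \<Longrightarrow> trig g \<Longrightarrow> trig (\<lambda>z. f z * g z)"
proof -
  assume "trig f" "trig g"
  then obtain p q where p: "laurent p" "\<And>z. z \<in> sphere 0 1 \<Longrightarrow> f z = p z"
    and q: "laurent q" "\<And>z. z \<in> sphere 0 1 \<Longrightarrow> g z = q z" unfolding trig_def by blast
  from laurent_mult[OF p(1) q(1)] show ?thesis unfolding trig_def using p(2) q(2) by simp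
qed

lemma trig_real_polynomial: "real_polynomial_function r \<Longrightarrow> trig (\<lambda>z. of_real (r z))"
proof (induction rule: real_polynomial_function.induct)
  case (linear f)
  then interpret bounded_linear f .
  have "of_real (f z) = (of_real (f 1) / 2 - \<i> * of_real (f \<i>) / 2) * z ^ 1 + (of_real (f 1) / 2 + \<i> * of_real (f \<i>) / 2) * cnj z ^ 1" for z
  proof -
    have "z = Re z *\<^sub>R 1 + Im z *\<^sub>R \<i>" by (simp add: complex_eq_iff)
    then have "f z = Re z * f 1 + Im z * f \<i>" by (metis add scaleR real_scaleR_def)
    then show ?thesis by (simp add: complex_eq_iff algebra_simps)
  qed
  moreover have "laurent (\<lambda>z. (of_real (f 1) / 2 - \<i> * of_real (f \<i>) / 2) * z ^ 1 + (of_real (f 1) / 2 + \<i> * of_real (f \<i>) / 2) * cnj z ^ 1)"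
    by (intro laurent.intros)
  ultimately show ?case unfolding trig_def by blast
next
  case (const c)
  show ?case by (rule trig_const)
next
  case (add f g)
  then show ?case using trig_add by simp
next
  case (mult f g)
  then show ?case using trig_mult by simp
qed

text \<open>
  By the Stone--Weierstrass theorem polynomials in the real and imaginary parts are dense, and on the
  circle these are trigonometric polynomials.
\<close>

lemma laurent_approximation:
  assumes g: "continuous_on (sphere 0 1) g" and e: "0 < e"
  obtains p where "laurent p" "\<And>z. z \<in> sphere 0 1 \<Longrightarrow> cmod (g z - p z) \<le> e"
proof -
  from Stone_Weierstrass_polynomial_function[OF _ g e]
  obtain q where q: "polynomial_function q" "\<And>z. z \<in> sphere 0 1 \<Longrightarrow> cmod (g z - q z) < e" by auto
  have "trig (\<lambda>z. of_real (Re (q z)) + \<i> * of_real (Im (q z)))"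
    using q(1) bounded_linear_Re bounded_linear_Im unfolding polynomial_function_def comp_def
    by (intro trig_add trig_mult trig_const trig_real_polynomial) blast+
  moreover have "(\<lambda>z. of_real (Re (q z)) + \<i> * of_real (Im (q z))) = q" by (rule ext) (simp add: complex_eq_iff)
  ultimately have "trig q" by simp
  then obtain p where "laurent p" "\<forall>z\<in>sphere 0 1. q z = p z" unfolding trig_def by blast
  then show ?thesis using that[of p] q(2) by (simp add: less_imp_le)
qed

section \<open>Weak convergence in probability from moments\<close>

text \<open>
  Random unitary matrices of growing size whose normalised traces of powers converge in mean square.
\<close>

locale spectral_moments =
  fixes M :: "nat \<Rightarrow> 'a measure" and U :: "nat \<Rightarrow> 'a \<Rightarrow> complex mat" and m :: "nat \<Rightarrow> real"
  assumes model: "\<forall>\<^sub>F N in sequentially. 1 \<le> N \<and> prob_space (M N) \<and> (\<forall>\<omega>\<in>space (M N). U N \<omega> \<in> unitary_group N) \<and>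
      (\<forall>k. (\<lambda>\<omega>. mtrace (U N \<omega> ^\<^sub>m k) / of_nat N) \<in> borel_measurable (M N))"
    and mean: "\<And>k. (\<lambda>N. \<integral>\<omega>. mtrace (U N \<omega> ^\<^sub>m k) / of_nat N \<partial>M N) \<longlonglongrightarrow> of_real (m k)"
    and square: "\<And>k. (\<lambda>N. \<integral>\<omega>. of_real ((cmod (mtrace (U N \<omega> ^\<^sub>m k) / of_nat N))\<^sup>2) \<partial>M N) \<longlonglongrightarrow> (of_real ((m k)\<^sup>2) :: complex)"
begin

text \<open>
  The sizes at which everything is measurable, which are all but finitely many.
\<close>

definition good :: "nat \<Rightarrow> bool" where
  "good N \<longleftrightarrow> 1 \<le> N \<and> prob_space (M N) \<and> (\<forall>\<omega>\<in>space (M N). U N \<omega> \<in> unitary_group N) \<and>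
      (\<forall>k. (\<lambda>\<omega>. \<integral>z. z ^ k \<partial>esd (U N \<omega>)) \<in> borel_measurable (M N))"

lemma eventually_good: "\<forall>\<^sub>F N in sequentially. good N"
  using model
proof eventually_elim
  case (elim N)
  have "(\<lambda>\<omega>. \<integral>z. z ^ k \<partial>esd (U N \<omega>)) \<in> borel_measurable (M N)" for k
  proof -
    have "(\<lambda>\<omega>. mtrace (U N \<omega> ^\<^sub>m k) / of_nat N) \<in> borel_measurable (M N)" using elim by blast
    then show ?thesis
      by (rule measurable_cong[THEN iffD1, rotated]) (use elim esd_moment in auto)
  qed
  then show ?case unfolding good_def using elim by blast
qed

abbreviation Y :: "(complex \<Rightarrow> complex) \<Rightarrow> nat \<Rightarrow> 'a \<Rightarrow> complex" where
  "Y g N \<omega> \<equiv> \<integral>z. g z \<partial>esd (U N \<omega>)"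

lemma Y_cnj: "(\<integral>z. cnj z ^ k \<partial>\<nu>) = cnj (\<integral>z. z ^ k \<partial>\<nu>)" for \<nu> :: "complex measure"
  using Bochner_Integration.integral_cnj[of \<nu> "\<lambda>z. z ^ k"] by simp

lemma laurent_measurable: "laurent p \<Longrightarrow> good N \<Longrightarrow> Y p N \<in> borel_measurable (M N)"
proof (induction rule: laurent.induct)
  case (mono a k)
  then show ?case by (auto simp: good_def intro!: borel_measurable_times)
next
  case (cnj_mono a k)
  then have "(\<lambda>\<omega>. cnj (Y (\<lambda>z. z ^ k) N \<omega>)) \<in> borel_measurable (M N)"
    unfolding good_def by (intro borel_measurable_continuous_on[where f = cnj] continuous_intros) blast
  then show ?case by (auto simp: Y_cnj intro!: borel_measurable_times)
next
  case (add p q)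
  have "Y (\<lambda>z. p z + q z) N \<omega> = Y p N \<omega> + Y q N \<omega>" if "\<omega> \<in> space (M N)" for \<omega>
    using that add by (intro esd_add[of _ N]) (auto simp: good_def laurent_continuous)
  then show ?case using add by (simp cong: measurable_cong)
qed

text \<open>
  Integrals of trigonometric polynomials are measurable, and those of continuous functions are their limits.
\<close>

lemma Y_measurable:
  assumes g: "continuous_on (sphere 0 1) g" and N: "good N"
  shows "Y g N \<in> borel_measurable (M N)"
proof -
  have "\<exists>p. laurent p \<and> (\<forall>z\<in>sphere 0 1. cmod (g z - p z) \<le> 1 / real (Suc n))" for n
  proof -
    have "0 < 1 / real (Suc n)" by simp
    from laurent_approximation[OF g this] show ?thesis by metis
  qed
  then obtain p where p: "\<And>n. laurent (p n)" "\<And>n z. z \<in> sphere 0 1 \<Longrightarrow> cmod (g z - p n z) \<le> 1 / real (Suc n)" by metis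
  show ?thesis
  proof (rule borel_measurable_LIMSEQ_metric[where f = "\<lambda>n. Y (p n) N"])
    show "Y (p n) N \<in> borel_measurable (M N)" for n by (rule laurent_measurable[OF p(1) N])
    fix \<omega> assume \<omega>: "\<omega> \<in> space (M N)"
    have diff: "cmod (Y (p n) N \<omega> - Y g N \<omega>) \<le> 1 / real (Suc n)" for n
      using esd_approx[OF _ _ g laurent_continuous[OF p(1)] p(2)] \<omega> N by (auto simp: good_def)
    show "(\<lambda>n. Y (p n) N \<omega>) \<longlonglongrightarrow> Y g N \<omega>"
      by (rule LIM_zero_cancel, rule Lim_null_comparison[OF _ LIMSEQ_Suc[OF lim_1_over_n]]) (use diff in \<open>auto intro!: always_eventually\<close>)
  qed
qed

text \<open>
  The mean square distance of the random integral of \<open>g\<close> to \<open>y\<close>.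
\<close>

definition ms :: "(complex \<Rightarrow> complex) \<Rightarrow> complex \<Rightarrow> nat \<Rightarrow> real" where
  "ms g y N = (\<integral>\<omega>. (cmod (Y g N \<omega> - y))\<^sup>2 \<partial>M N)"

lemma integrable_ms:
  assumes g: "continuous_on (sphere 0 1) g" and N: "good N"
  shows "integrable (M N) (\<lambda>\<omega>. (cmod (Y g N \<omega> - y))\<^sup>2)"
proof -
  interpret prob_space "M N" using N by (simp add: good_def)
  have "compact (g ` sphere 0 1)" by (intro compact_continuous_image g) simp
  then obtain B where B: "\<And>z. z \<in> sphere 0 1 \<Longrightarrow> cmod (g z) \<le> B"
    using compact_imp_bounded bounded_iff by (metis (no_types, lifting) imageI)
  have [measurable]: "Y g N \<in> borel_measurable (M N)" by (rule Y_measurable[OF g N])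
  show ?thesis
  proof (rule integrable_const_bound[of _ "(B + cmod y)\<^sup>2"])
    show "AE \<omega> in M N. norm ((cmod (Y g N \<omega> - y))\<^sup>2) \<le> (B + cmod y)\<^sup>2"
    proof (rule AE_I2)
      fix \<omega> assume "\<omega> \<in> space (M N)"
      then have "cmod (Y g N \<omega>) \<le> B" using esd_bound[OF _ _ g B] N by (auto simp: good_def)
      then have "cmod (Y g N \<omega> - y) \<le> B + cmod y" using norm_triangle_ineq4[of "Y g N \<omega>" y] by linarith
      then show "norm ((cmod (Y g N \<omega> - y))\<^sup>2) \<le> (B + cmod y)\<^sup>2" by (simp add: power_mono)
    qed
  qed measurable
qed

lemma ms_nonneg: "0 \<le> ms g y N"
  unfolding ms_def by (rule integral_nonneg_AE) simp

lemma square_sum_bound: "cmod c \<le> a + b \<Longrightarrow> (cmod c)\<^sup>2 \<le> 2 * a\<^sup>2 + 2 * b\<^sup>2" for a b :: real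
proof -
  assume "cmod c \<le> a + b"
  then have "(cmod c)\<^sup>2 \<le> (a + b)\<^sup>2" by (intro power_mono) auto
  also have "\<dots> \<le> 2 * a\<^sup>2 + 2 * b\<^sup>2" using zero_le_power2[of "a - b"] by (simp add: power2_eq_square algebra_simps)
  finally show ?thesis .
qed

lemma ms_add:
  assumes p: "continuous_on (sphere 0 1) p" and q: "continuous_on (sphere 0 1) q" and N: "good N"
  shows "ms (\<lambda>z. p z + q z) (y + y') N \<le> 2 * ms p y N + 2 * ms q y' N"
proof -
  have "ms (\<lambda>z. p z + q z) (y + y') N \<le> (\<integral>\<omega>. 2 * (cmod (Y p N \<omega> - y))\<^sup>2 + 2 * (cmod (Y q N \<omega> - y'))\<^sup>2 \<partial>M N)"
    unfolding ms_def
  proof (rule integral_mono)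
    show "integrable (M N) (\<lambda>\<omega>. (cmod (Y (\<lambda>z. p z + q z) N \<omega> - (y + y')))\<^sup>2)"
      using integrable_ms[OF continuous_on_add[OF p q] N] .
    show "integrable (M N) (\<lambda>\<omega>. 2 * (cmod (Y p N \<omega> - y))\<^sup>2 + 2 * (cmod (Y q N \<omega> - y'))\<^sup>2)"
      using integrable_ms[OF p N] integrable_ms[OF q N] by simp
    fix \<omega> assume \<omega>: "\<omega> \<in> space (M N)"
    have eq: "Y (\<lambda>z. p z + q z) N \<omega> = Y p N \<omega> + Y q N \<omega>"
      using N \<omega> by (intro esd_add[of _ N] p q) (auto simp: good_def)
    show "(cmod (Y (\<lambda>z. p z + q z) N \<omega> - (y + y')))\<^sup>2 \<le> 2 * (cmod (Y p N \<omega> - y))\<^sup>2 + 2 * (cmod (Y q N \<omega> - y'))\<^sup>2"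
      unfolding eq by (rule square_sum_bound) (rule norm_diff_triangle_ineq)
  qed
  also have "\<dots> = 2 * ms p y N + 2 * ms q y' N"
    using integrable_ms[OF p N] integrable_ms[OF q N] by (simp add: ms_def)
  finally show ?thesis .
qed

lemma ms_approx:
  assumes g: "continuous_on (sphere 0 1) g" and p: "continuous_on (sphere 0 1) p" and N: "good N"
    and e: "\<And>z. z \<in> sphere 0 1 \<Longrightarrow> cmod (g z - p z) \<le> e" "cmod (y' - y) \<le> e"
  shows "ms g y N \<le> 2 * ms p y' N + 2 * (2 * e)\<^sup>2"
proof -
  interpret prob_space "M N" using N by (simp add: good_def)
  have "ms g y N \<le> (\<integral>\<omega>. 2 * (cmod (Y p N \<omega> - y'))\<^sup>2 + 2 * (2 * e)\<^sup>2 \<partial>M N)"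
    unfolding ms_def
  proof (rule integral_mono[OF integrable_ms[OF g N]])
    show "integrable (M N) (\<lambda>\<omega>. 2 * (cmod (Y p N \<omega> - y'))\<^sup>2 + 2 * (2 * e)\<^sup>2)"
      using integrable_ms[OF p N] by simp
    fix \<omega> assume \<omega>: "\<omega> \<in> space (M N)"
    have "cmod (Y p N \<omega> - Y g N \<omega>) \<le> e"
      using N \<omega> esd_approx[OF _ _ g p e(1)] by (auto simp: good_def)
    then have "cmod (Y g N \<omega> - y) \<le> cmod (Y p N \<omega> - y') + 2 * e"
      using e(2) norm_triangle_ineq[of "Y g N \<omega> - Y p N \<omega>" "Y p N \<omega> - y"]
        norm_triangle_ineq[of "Y p N \<omega> - y'" "y' - y"] by (simp add: norm_minus_commute)
    then show "(cmod (Y g N \<omega> - y))\<^sup>2 \<le> 2 * (cmod (Y p N \<omega> - y'))\<^sup>2 + 2 * (2 * e)\<^sup>2"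
      by (rule square_sum_bound)
  qed
  also have "\<dots> = 2 * ms p y' N + 2 * (2 * e)\<^sup>2"
    using integrable_ms[OF p N] by (simp add: ms_def prob_space)
  finally show ?thesis .
qed

lemma good_moment: "good N \<Longrightarrow> \<omega> \<in> space (M N) \<Longrightarrow> Y (\<lambda>z. z ^ k) N \<omega> = mtrace (U N \<omega> ^\<^sub>m k) / of_nat N"
  by (rule esd_moment) (auto simp: good_def)

lemma integrable_moment: "good N \<Longrightarrow> integrable (M N) (Y (\<lambda>z. z ^ k) N)"
proof -
  assume N: "good N"
  interpret prob_space "M N" using N by (simp add: good_def)
  have c: "continuous_on (sphere 0 1) (\<lambda>z::complex. z ^ k)" by (intro continuous_intros)
  show ?thesis
  proof (rule integrable_const_bound[of _ 1])
    have "cmod (Y (\<lambda>z. z ^ k) N \<omega>) \<le> 1" if "\<omega> \<in> space (M N)" for \<omega>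
      by (rule esd_bound[OF _ _ c]) (use N that in \<open>auto simp: good_def norm_power\<close>)
    then show "AE \<omega> in M N. cmod (Y (\<lambda>z. z ^ k) N \<omega>) \<le> 1" by (intro AE_I2)
  qed (rule Y_measurable[OF c N])
qed

lemma mean_esd: "(\<lambda>N. \<integral>\<omega>. Y (\<lambda>z. z ^ k) N \<omega> \<partial>M N) \<longlonglongrightarrow> of_real (m k)"
proof (rule Lim_transform_eventually[OF mean eventually_mono[OF eventually_good]])
  show "(\<integral>\<omega>. mtrace (U N \<omega> ^\<^sub>m k) / of_nat N \<partial>M N) = (\<integral>\<omega>. Y (\<lambda>z. z ^ k) N \<omega> \<partial>M N)" if "good N" for N
    by (intro Bochner_Integration.integral_cong refl) (simp only: good_moment[OF that])
qed

text \<open>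
  The variance is expressed by the first two moments.
\<close>

lemma ms_power: "(\<lambda>N. ms (\<lambda>z. z ^ k) (of_real (m k)) N) \<longlonglongrightarrow> 0"
proof -
  let ?X = "\<lambda>N. \<integral>\<omega>. mtrace (U N \<omega> ^\<^sub>m k) / of_nat N \<partial>M N"
  let ?V = "\<lambda>N. \<integral>\<omega>. complex_of_real ((cmod (mtrace (U N \<omega> ^\<^sub>m k) / of_nat N))\<^sup>2) \<partial>M N"
  have "(\<lambda>N. Re (?V N) - 2 * m k * Re (?X N) + (m k)\<^sup>2) \<longlonglongrightarrow> Re (of_real ((m k)\<^sup>2)) - 2 * m k * Re (of_real (m k)) + (m k)\<^sup>2"
    by (intro tendsto_intros mean square)
  then have "(\<lambda>N. Re (?V N) - 2 * m k * Re (?X N) + (m k)\<^sup>2) \<longlonglongrightarrow> 0"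
    by (simp add: power2_eq_square)
  moreover have "\<forall>\<^sub>F N in sequentially. Re (?V N) - 2 * m k * Re (?X N) + (m k)\<^sup>2 = ms (\<lambda>z. z ^ k) (of_real (m k)) N"
    using eventually_good
  proof eventually_elim
    case (elim N)
    interpret prob_space "M N" using elim by (simp add: good_def)
    have c: "continuous_on (sphere 0 1) (\<lambda>z::complex. z ^ k)" by (intro continuous_intros)
    have X: "?X N = (\<integral>\<omega>. Y (\<lambda>z. z ^ k) N \<omega> \<partial>M N)"
      by (intro Bochner_Integration.integral_cong refl) (simp add: good_moment[OF elim])
    have V: "?V N = of_real (\<integral>\<omega>. (cmod (Y (\<lambda>z. z ^ k) N \<omega>))\<^sup>2 \<partial>M N)"
      unfolding integral_complex_of_real[symmetric]
      by (intro Bochner_Integration.integral_cong refl) (simp add: good_moment[OF elim])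
    have i2: "integrable (M N) (\<lambda>\<omega>. (cmod (Y (\<lambda>z. z ^ k) N \<omega>))\<^sup>2)"
      using integrable_ms[OF c elim, of 0] by simp
    have i1: "integrable (M N) (\<lambda>\<omega>. Re (Y (\<lambda>z. z ^ k) N \<omega>))" by (rule integrable_Re[OF integrable_moment[OF elim]])
    have e: "(cmod (w - of_real r))\<^sup>2 = (cmod w)\<^sup>2 - 2 * r * Re w + r\<^sup>2" for w r
      unfolding cmod_power2 by (simp add: power2_eq_square algebra_simps)
    show ?case
      unfolding ms_def e X V using i1 i2 integral_Re[OF integrable_moment[OF elim]] by (simp add: prob_space)
  qed
  ultimately show ?thesis by (rule Lim_transform_eventually)
qed

text \<open>
  For the powers of \<open>z\<close> this is the convergence of the first and second moments. It extends to
  trigonometric polynomials by linearity and to continuous functions by uniform approximation, all in mean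
  square, and Markov's inequality gives convergence in probability.
\<close>

theorem weakly_in_probability_moments:
  assumes \<nu>: "prob_space \<nu>" "sets \<nu> = sets circle_borel" "\<And>k. (\<integral>z. z ^ k \<partial>\<nu>) = of_real (m k)"
  shows "weakly_in_probability M (\<lambda>N \<omega>. esd (U N \<omega>)) \<nu>"
proof -
  interpret \<nu>: prob_space \<nu> by (rule \<nu>(1))
  have sp: "space \<nu> = sphere 0 1" using sets_eq_imp_space_eq[OF \<nu>(2)] by (simp add: circle_borel_def space_restrict_space)
  have meas: "g \<in> borel_measurable \<nu>" if "continuous_on (sphere 0 1) g" for g :: "complex \<Rightarrow> complex"
  proof -
    have "g \<in> borel_measurable circle_borel"
      unfolding circle_borel_def by (rule borel_measurable_continuous_on_restrict[OF that])
    then show ?thesis by (simp add: measurable_cong_sets[OF \<nu>(2) refl])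
  qed
  have int: "integrable \<nu> g" if g: "continuous_on (sphere 0 1) g" for g :: "complex \<Rightarrow> complex"
  proof -
    have "compact (g ` sphere 0 1)" by (intro compact_continuous_image g) simp
    then obtain B where B: "\<And>z. z \<in> sphere 0 1 \<Longrightarrow> cmod (g z) \<le> B"
      using compact_imp_bounded bounded_iff by (metis (no_types, lifting) imageI)
    show ?thesis by (rule \<nu>.integrable_const_bound[of _ B]) (use meas[OF g] B sp in \<open>auto intro!: AE_I2\<close>)
  qed
  have laurent: "(\<lambda>N. ms p (\<integral>z. p z \<partial>\<nu>) N) \<longlonglongrightarrow> 0" if "laurent p" for p
    using that
  proof (induction rule: laurent.induct)
    case (mono a k)
    have "ms (\<lambda>z. a * z ^ k) (\<integral>z. a * z ^ k \<partial>\<nu>) N = (cmod a)\<^sup>2 * ms (\<lambda>z. z ^ k) (of_real (m k)) N" for N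
      unfolding ms_def by (simp add: \<nu>(3) norm_mult power_mult_distrib flip: right_diff_distrib)
    then show ?case using tendsto_mult_right_zero[OF ms_power, of "(cmod a)\<^sup>2" k] by simp
  next
    case (cnj_mono a k)
    have "ms (\<lambda>z. a * cnj z ^ k) (\<integral>z. a * cnj z ^ k \<partial>\<nu>) N = (cmod a)\<^sup>2 * ms (\<lambda>z. z ^ k) (of_real (m k)) N" for N
    proof -
      have "cmod (cnj w - complex_of_real r) = cmod (w - of_real r)" for w r
        by (metis complex_cnj_complex_of_real complex_cnj_diff complex_mod_cnj)
      then show ?thesis
        unfolding ms_def by (simp add: Y_cnj \<nu>(3) norm_mult power_mult_distrib flip: right_diff_distrib)
    qed
    then show ?case using tendsto_mult_right_zero[OF ms_power, of "(cmod a)\<^sup>2" k] by simp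
  next
    case (add p q)
    have c: "continuous_on (sphere 0 1) p" "continuous_on (sphere 0 1) q"
      using add laurent_continuous by blast+
    have eq: "(\<integral>z. p z + q z \<partial>\<nu>) = (\<integral>z. p z \<partial>\<nu>) + (\<integral>z. q z \<partial>\<nu>)"
      using int[OF c(1)] int[OF c(2)] by simp
    show ?case unfolding eq
    proof (rule tendsto_sandwich)
      show "\<forall>\<^sub>F N in sequentially. 0 \<le> ms (\<lambda>z. p z + q z) ((\<integral>z. p z \<partial>\<nu>) + (\<integral>z. q z \<partial>\<nu>)) N"
        by (intro always_eventually allI ms_nonneg)
      show "\<forall>\<^sub>F N in sequentially. ms (\<lambda>z. p z + q z) ((\<integral>z. p z \<partial>\<nu>) + (\<integral>z. q z \<partial>\<nu>)) N
        \<le> 2 * ms p (\<integral>z. p z \<partial>\<nu>) N + 2 * ms q (\<integral>z. q z \<partial>\<nu>) N"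
        using eventually_good by eventually_elim (rule ms_add[OF c])
      have "(\<lambda>N. 2 * ms p (\<integral>z. p z \<partial>\<nu>) N + 2 * ms q (\<integral>z. q z \<partial>\<nu>) N) \<longlonglongrightarrow> 2 * 0 + 2 * 0"
        by (intro tendsto_intros add.IH)
      then show "(\<lambda>N. 2 * ms p (\<integral>z. p z \<partial>\<nu>) N + 2 * ms q (\<integral>z. q z \<partial>\<nu>) N) \<longlonglongrightarrow> 0" by simp
    qed simp
  qed
  have cont: "(\<lambda>N. ms g (\<integral>z. g z \<partial>\<nu>) N) \<longlonglongrightarrow> 0" if g: "continuous_on (sphere 0 1) g" for g
  proof (rule tendstoI)
    fix r :: real assume r: "0 < r"
    define e where "e = sqrt r / 4"
    have e: "0 < e" "2 * (2 * e)\<^sup>2 = r / 2" using r by (auto simp: e_def power_mult_distrib power_divide)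
    obtain p where p: "laurent p" "\<And>z. z \<in> sphere 0 1 \<Longrightarrow> cmod (g z - p z) \<le> e"
      using laurent_approximation[OF g e(1)] by blast
    have c: "continuous_on (sphere 0 1) p" using laurent_continuous[OF p(1)] .
    have "cmod ((\<integral>z. p z \<partial>\<nu>) - (\<integral>z. g z \<partial>\<nu>)) = cmod (\<integral>z. p z - g z \<partial>\<nu>)"
      using int[OF c] int[OF g] by simp
    also have "\<dots> \<le> (\<integral>z. cmod (p z - g z) \<partial>\<nu>)" by (rule integral_norm_bound)
    also have "\<dots> \<le> (\<integral>z. e \<partial>\<nu>)"
      using int[OF c] int[OF g] p(2) by (intro integral_mono) (auto simp: sp norm_minus_commute)
    finally have d: "cmod ((\<integral>z. p z \<partial>\<nu>) - (\<integral>z. g z \<partial>\<nu>)) \<le> e" by (simp add: \<nu>.prob_space)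
    have "\<forall>\<^sub>F N in sequentially. ms p (\<integral>z. p z \<partial>\<nu>) N < r / 4"
      using order_tendstoD(2)[OF laurent[OF p(1)], of "r / 4"] r by simp
    with eventually_good show "\<forall>\<^sub>F N in sequentially. dist (ms g (\<integral>z. g z \<partial>\<nu>) N) 0 < r"
    proof eventually_elim
      case (elim N)
      have "ms g (\<integral>z. g z \<partial>\<nu>) N \<le> 2 * ms p (\<integral>z. p z \<partial>\<nu>) N + 2 * (2 * e)\<^sup>2"
        by (rule ms_approx[OF g c elim(1) p(2) d])
      then show ?case using elim(2) e(2) ms_nonneg[of g "\<integral>z. g z \<partial>\<nu>" N] by (simp add: dist_norm)
    qed
  qed
  show ?thesis
    unfolding weakly_in_probability_def tendsto_in_probability_def
  proof (intro allI impI conjI)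
    fix g :: "complex \<Rightarrow> complex" assume g: "continuous_on (sphere 0 1) g"
    show "\<forall>\<^sub>F N in sequentially. prob_space (M N) \<and> Y g N \<in> borel_measurable (M N)"
      using eventually_good
      by eventually_elim (use Y_measurable[OF g] in \<open>auto simp: good_def\<close>)
    fix \<epsilon> :: real assume \<epsilon>: "0 < \<epsilon>"
    let ?y = "\<integral>z. g z \<partial>\<nu>"
    show "(\<lambda>N. measure (M N) {\<omega> \<in> space (M N). dist (Y g N \<omega>) ?y > \<epsilon>}) \<longlonglongrightarrow> 0"
    proof (rule tendsto_sandwich[of "\<lambda>_. 0" _ _ "\<lambda>N. ms g ?y N / \<epsilon>\<^sup>2"])
      show "\<forall>\<^sub>F N in sequentially. measure (M N) {\<omega> \<in> space (M N). dist (Y g N \<omega>) ?y > \<epsilon>} \<le> ms g ?y N / \<epsilon>\<^sup>2"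
        using eventually_good
      proof eventually_elim
        case (elim N)
        interpret prob_space "M N" using elim by (simp add: good_def)
        have [measurable]: "Y g N \<in> borel_measurable (M N)" by (rule Y_measurable[OF g elim])
        have "measure (M N) {\<omega> \<in> space (M N). dist (Y g N \<omega>) ?y > \<epsilon>}
          \<le> measure (M N) {\<omega> \<in> space (M N). (cmod (Y g N \<omega> - ?y))\<^sup>2 \<ge> \<epsilon>\<^sup>2}"
        proof (rule finite_measure_mono)
          show "{\<omega> \<in> space (M N). dist (Y g N \<omega>) ?y > \<epsilon>} \<subseteq> {\<omega> \<in> space (M N). (cmod (Y g N \<omega> - ?y))\<^sup>2 \<ge> \<epsilon>\<^sup>2}"
            using \<epsilon> by (auto simp: dist_norm intro!: power_mono)
        qed measurable
        also have "\<dots> \<le> ms g ?y N / \<epsilon>\<^sup>2"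
          unfolding ms_def
          by (rule integral_Markov_inequality_measure[OF integrable_ms[OF g elim] sets.top]) (use \<epsilon> in auto)
        finally show ?case .
      qed
      show "(\<lambda>N. ms g ?y N / \<epsilon>\<^sup>2) \<longlonglongrightarrow> 0"
        using tendsto_divide[OF cont[OF g] tendsto_const, of "\<epsilon>\<^sup>2"] \<epsilon> by simp
    qed (auto intro!: always_eventually)
  qed
qed

text \<open>
  The moments of a measure on the circle form a positive definite sequence: the quadratic form with
  coefficients \<open>cis (- j x)\<close> is the integral of a squared modulus. This survives averaging and limits.
\<close>

lemma toeplitz_nonneg:
  "0 \<le> (\<Sum>j<n. \<Sum>k<n. m (nat \<bar>int j - int k\<bar>) * cos (real (nat \<bar>int j - int k\<bar>) * x))"
proof -
  let ?d = "\<lambda>j k. nat \<bar>int j - int k\<bar>"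
  let ?E = "\<lambda>N d. \<integral>\<omega>. Y (\<lambda>z. z ^ d) N \<omega> \<partial>M N"
  have circle: "0 \<le> (\<Sum>j<n. \<Sum>k<n. Re (cis (- (real (?d j k) * x)) * z ^ ?d j k))" if z: "z \<in> sphere 0 1" for z
  proof -
    let ?a = "\<lambda>j. cis (- (real j * x)) * z ^ j"
    have summand: "Re (?a j * cnj (?a k)) = Re (cis (- (real (?d j k) * x)) * z ^ ?d j k)" for j k
    proof -
      have "?a j * cnj (?a k) = cis (- ((real j - real k) * x)) * (z ^ j * cnj z ^ k)"
        by (simp add: cis_cnj cis_mult algebra_simps)
      moreover have "cis (- ((real j - real k) * x)) = cnj (cis (- ((real k - real j) * x)))"
        by (simp add: cis_cnj algebra_simps)
      ultimately show ?thesis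
        unfolding circle_cancel[OF z]
      proof (cases "k \<le> j")
        case True
        assume "?a j * cnj (?a k) = cis (- ((real j - real k) * x)) * (if k \<le> j then z ^ (j - k) else cnj z ^ (k - j))"
        moreover have "?d j k = j - k" using True by simp
        ultimately show ?thesis using True by (simp add: of_nat_diff)
      next
        case False
        assume a: "?a j * cnj (?a k) = cis (- ((real j - real k) * x)) * (if k \<le> j then z ^ (j - k) else cnj z ^ (k - j))"
          and b: "cis (- ((real j - real k) * x)) = cnj (cis (- ((real k - real j) * x)))"
        have d: "?d j k = k - j" using False by simp
        have "?a j * cnj (?a k) = cnj (cis (- ((real k - real j) * x)) * z ^ (k - j))"
          unfolding a b using False by simp
        then have "Re (?a j * cnj (?a k)) = Re (cis (- ((real k - real j) * x)) * z ^ (k - j))"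
          by (simp only: cnj.simps)
        then show ?thesis unfolding d using False by (simp only: of_nat_diff not_le less_imp_le)
      qed
    qed
    have "of_real ((cmod (\<Sum>j<n. ?a j))\<^sup>2) = (\<Sum>j<n. \<Sum>k<n. ?a j * cnj (?a k))"
      unfolding complex_norm_square cnj_sum sum_product ..
    then have "(cmod (\<Sum>j<n. ?a j))\<^sup>2 = Re (\<Sum>j<n. \<Sum>k<n. ?a j * cnj (?a k))" by (metis Re_complex_of_real)
    then have "(cmod (\<Sum>j<n. ?a j))\<^sup>2 = (\<Sum>j<n. \<Sum>k<n. Re (cis (- (real (?d j k) * x)) * z ^ ?d j k))"
      by (simp only: Re_sum summand)
    then show ?thesis by (metis zero_le_power2)
  qed
  have fin: "0 \<le> (\<Sum>j<n. \<Sum>k<n. Re (cis (- (real (?d j k) * x)) * ?E N (?d j k)))" if N: "good N" for N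
  proof -
    have point: "0 \<le> (\<Sum>j<n. \<Sum>k<n. Re (cis (- (real (?d j k) * x)) * Y (\<lambda>z. z ^ ?d j k) N \<omega>))"
      if \<omega>: "\<omega> \<in> space (M N)" for \<omega>
    proof -
      have u: "U N \<omega> \<in> unitary_group N" using N \<omega> by (simp add: good_def)
      let ?e = "\<lambda>i. eigenvalue_list (U N \<omega>) ! i"
      have on: "?e i \<in> sphere 0 1" if "i < N" for i
        using unitary_eigenvalue[OF u] eigenvalue_list_char_poly(2)[OF unitary_carrier[OF u]] that by simp
      have Yd: "Y (\<lambda>z. z ^ d) N \<omega> = (\<Sum>i<N. ?e i ^ d) / of_nat N" for d
        by (rule esd_integral[OF u]) (intro continuous_intros)
      have summand: "Re (cis (- (real d * x)) * Y (\<lambda>z. z ^ d) N \<omega>) = (\<Sum>i<N. Re (cis (- (real d * x)) * ?e i ^ d)) / real N" for d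
        unfolding Yd times_divide_eq_right sum_distrib_left Re_divide_of_nat Re_sum ..
      have swap: "(\<Sum>j<n. \<Sum>k<n. \<Sum>i<N. h i j k) = (\<Sum>i<N. \<Sum>j<n. \<Sum>k<n. h i j k)"
        for h :: "nat \<Rightarrow> nat \<Rightarrow> nat \<Rightarrow> real"
      proof -
        have "(\<Sum>j<n. \<Sum>k<n. \<Sum>i<N. h i j k) = (\<Sum>j<n. \<Sum>i<N. \<Sum>k<n. h i j k)"
          by (intro sum.cong refl sum.swap)
        also have "\<dots> = (\<Sum>i<N. \<Sum>j<n. \<Sum>k<n. h i j k)" by (rule sum.swap)
        finally show ?thesis .
      qed
      have "(\<Sum>j<n. \<Sum>k<n. Re (cis (- (real (?d j k) * x)) * Y (\<lambda>z. z ^ ?d j k) N \<omega>))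
        = (\<Sum>j<n. \<Sum>k<n. \<Sum>i<N. Re (cis (- (real (?d j k) * x)) * ?e i ^ ?d j k)) / real N"
        unfolding summand sum_divide_distrib ..
      also have "\<dots> = (\<Sum>i<N. \<Sum>j<n. \<Sum>k<n. Re (cis (- (real (?d j k) * x)) * ?e i ^ ?d j k)) / real N"
        unfolding swap ..
      also have "\<dots> \<ge> 0" by (intro divide_nonneg_nonneg sum_nonneg circle on) auto
      finally show ?thesis .
    qed
    have i: "integrable (M N) (\<lambda>\<omega>. cis (- (real d * x)) * Y (\<lambda>z. z ^ d) N \<omega>)" for d
      using integrable_moment[OF N] by simp
    have "(\<Sum>j<n. \<Sum>k<n. Re (cis (- (real (?d j k) * x)) * ?E N (?d j k)))
      = (\<integral>\<omega>. (\<Sum>j<n. \<Sum>k<n. Re (cis (- (real (?d j k) * x)) * Y (\<lambda>z. z ^ ?d j k) N \<omega>)) \<partial>M N)"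
    proof -
      have "Re (cis (- (real d * x)) * ?E N d) = (\<integral>\<omega>. Re (cis (- (real d * x)) * Y (\<lambda>z. z ^ d) N \<omega>) \<partial>M N)" for d
        unfolding integral_Re[OF i] by simp
      note Re_E = this
      define g where "g d \<omega> = Re (cis (- (real d * x)) * Y (\<lambda>z. z ^ d) N \<omega>)" for d \<omega>
      have g: "integrable (M N) (g d)" for d unfolding g_def by (rule integrable_Re[OF i])
      have "(\<integral>\<omega>. (\<Sum>j<n. \<Sum>k<n. g (?d j k) \<omega>) \<partial>M N) = (\<Sum>j<n. \<integral>\<omega>. (\<Sum>k<n. g (?d j k) \<omega>) \<partial>M N)"
        by (rule Bochner_Integration.integral_sum) (intro Bochner_Integration.integrable_sum g)
      also have "\<dots> = (\<Sum>j<n. \<Sum>k<n. \<integral>\<omega>. g (?d j k) \<omega> \<partial>M N)"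
        by (intro sum.cong refl Bochner_Integration.integral_sum g)
      finally show ?thesis unfolding Re_E g_def by (rule sym)
    qed
    also have "\<dots> \<ge> 0" by (rule integral_nonneg_AE) (use point in auto)
    finally show ?thesis .
  qed
  have "(\<lambda>N. \<Sum>j<n. \<Sum>k<n. Re (cis (- (real (?d j k) * x)) * ?E N (?d j k)))
    \<longlonglongrightarrow> (\<Sum>j<n. \<Sum>k<n. Re (cis (- (real (?d j k) * x)) * of_real (m (?d j k))))"
    by (intro tendsto_intros mean_esd)
  then have "0 \<le> (\<Sum>j<n. \<Sum>k<n. Re (cis (- (real (?d j k) * x)) * of_real (m (?d j k))))"
    by (rule tendsto_lowerbound) (use eventually_good fin in \<open>auto elim: eventually_mono\<close>)
  then show ?thesis by (simp add: mult.commute)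
qed

end

section \<open>The limit law of a simple loop\<close>

lemma pow_mat_Suc_left:
  assumes A: "A \<in> carrier_mat n n"
  shows "A ^\<^sub>m Suc k = A * A ^\<^sub>m k"
proof (induction k)
  case 0
  show ?case using A by simp
next
  case (Suc k)
  have "A ^\<^sub>m Suc (Suc k) = (A * A ^\<^sub>m k) * A" using Suc by simp
  also have "\<dots> = A * (A ^\<^sub>m k * A)" by (rule assoc_mult_mat[OF A _ A]) (use A in simp)
  finally show ?case by simp
qed

lemma rev_walk_rev_walk [simp]: "rev_walk (rev_walk l) = l"
  by (induction l) simp_all

lemma rev_walk_pw: "rev_walk (pw l n) = pw (rev_walk l) n"
proof (induction n)
  case (Suc n)
  have "rev_walk (pw l (Suc n)) = pw (rev_walk l) n @ rev_walk l" using Suc by simp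
  then show ?case by (simp only: pw_Suc_right)
qed simp

lemma closed_walk_pw:
  assumes "closed_walk l"
  shows "closed_walk (pw l n)"
proof -
  obtain u where "walk u l u" using assms by (auto simp: closed_walk_iff)
  from closed_walkI[OF walk_pw[OF this]] show ?thesis .
qed

context ym begin

lemma mpow_pow_mat: "U \<in> carrier_mat N N \<Longrightarrow> mpow k U = U ^\<^sub>m k"
proof (induction k)
  case (Suc k)
  have "mpow (Suc k) U = U * mpow k U" by (simp add: mpow_def)
  then show ?case using Suc by (simp only: pow_mat_Suc_left)
qed (simp add: mpow_def)

lemma loop_mat_unitary: "Q \<in> space confs \<Longrightarrow> supp l \<Longrightarrow> loop_mat N Q l \<in> unitary_group N"
  using hol_closed[of Q l] by (simp add: loop_mat_hol)

lemma loop_mat_rev_walk: "Q \<in> space confs \<Longrightarrow> supp l \<Longrightarrow> loop_mat N Q (rev_walk l) = mat_adjoint (loop_mat N Q l)"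
  using hol_rev_walk[of Q l] unitary_inv[of "hol Q l" N] hol_closed[of Q l] by (simp add: loop_mat_hol)

lemma trace_rev_walk: "Q \<in> space confs \<Longrightarrow> supp l \<Longrightarrow> mtrace (loop_mat N Q (rev_walk l)) = cnj (mtrace (loop_mat N Q l))"
  using mtrace_adjoint[OF unitary_carrier[OF loop_mat_unitary]] by (simp add: loop_mat_rev_walk)

lemma loop_mat_pw: "Q \<in> space confs \<Longrightarrow> supp l \<Longrightarrow> loop_mat N Q (pw l k) = loop_mat N Q l ^\<^sub>m k"
  using hol_pw[of Q l k] mpow_pow_mat[OF unitary_carrier[OF loop_mat_unitary]] by (simp add: loop_mat_hol)

lemma supp_pw: "supp l \<Longrightarrow> supp (pw l k)"
  using hol_pw P.not_empty by blast

lemma wilson_pw: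
  assumes "supp l"
  shows "wilson_expectation H \<Lambda> N \<beta> {#pw l k#} = (\<integral>Q. mtrace (loop_mat N Q l ^\<^sub>m k) / of_nat N \<partial>ym_measure H \<Lambda> N \<beta>)"
  unfolding wilson_expectation_def
  by (intro Bochner_Integration.integral_cong) (auto simp: loop_mat_pw assms)

lemma wilson_rev_walk:
  assumes "supp l"
  shows "wilson_expectation H \<Lambda> N \<beta> {#rev_walk l#} = cnj (wilson_expectation H \<Lambda> N \<beta> {#l#})"
proof -
  have "wilson_expectation H \<Lambda> N \<beta> {#rev_walk l#} = (\<integral>Q. cnj (mtrace (loop_mat N Q l) / of_nat N) \<partial>ym_measure H \<Lambda> N \<beta>)"
    unfolding wilson_expectation_def
    by (intro Bochner_Integration.integral_cong) (auto simp: trace_rev_walk assms)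
  also have "\<dots> = cnj (wilson_expectation H \<Lambda> N \<beta> {#l#})"
    unfolding wilson_expectation_def Bochner_Integration.integral_cnj by simp
  finally show ?thesis .
qed

lemma wilson_square:
  assumes "supp l"
  shows "wilson_expectation H \<Lambda> N \<beta> {#pw l k, rev_walk (pw l k)#}
    = (\<integral>Q. of_real ((cmod (mtrace (loop_mat N Q l ^\<^sub>m k) / of_nat N))\<^sup>2) \<partial>ym_measure H \<Lambda> N \<beta>)"
  unfolding wilson_expectation_def
proof (intro Bochner_Integration.integral_cong refl)
  fix Q assume "Q \<in> space (ym_measure H \<Lambda> N \<beta>)"
  then have Q: "Q \<in> space confs" by simp
  show "(\<Prod>w\<in>#{#pw l k, rev_walk (pw l k)#}. mtrace (loop_mat N Q w) / of_nat N)
    = of_real ((cmod (mtrace (loop_mat N Q l ^\<^sub>m k) / of_nat N))\<^sup>2)"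
    unfolding complex_norm_square
    using trace_rev_walk[OF Q supp_pw[OF assms, of k]] loop_mat_pw[OF Q assms, of k] by simp
qed

lemma measurable_trace_power:
  assumes "supp l"
  shows "(\<lambda>Q. mtrace (loop_mat N Q l ^\<^sub>m k) / of_nat N) \<in> borel_measurable (ym_measure H \<Lambda> N \<beta>)"
proof -
  have "(\<lambda>Q. trn (mpow k (hol Q l))) \<in> borel_measurable confs"
    by (rule bdm_measurable[OF bdm_hol[OF bdm_trn_mpow assms]])
  moreover have "trn (mpow k (hol Q l)) = mtrace (loop_mat N Q l ^\<^sub>m k) / of_nat N" if "Q \<in> space confs" for Q
    using mpow_pow_mat[OF unitary_carrier[OF loop_mat_unitary[OF that assms]]] loop_mat_hol[OF that assms] by (simp add: trn_def)
  ultimately have "(\<lambda>Q. mtrace (loop_mat N Q l ^\<^sub>m k) / of_nat N) \<in> borel_measurable confs"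
    by (simp cong: measurable_cong)
  then show ?thesis by (simp add: measurable_cong_sets[OF sets_ym refl])
qed

end

context large_N begin

lemma exhaustion_ym:
  assumes "exhaustion \<Lambda>" "set l \<subseteq> lattice_edges"
  shows "\<forall>\<^sub>F N in sequentially. 1 \<le> N \<and> ym N (haar N) (\<Lambda> N) \<and> lattice_gauge.supp (pos_edges (\<Lambda> N)) l"
proof -
  have "finite (endpoints l)" by (simp add: endpoints_def)
  from exhaustion_eventually[OF assms(1) this] show ?thesis
  proof eventually_elim
    case (elim N)
    then have y: "ym N (haar N) (\<Lambda> N)" by unfold_locales (simp_all add: haar)
    interpret ym N "haar N" "\<Lambda> N" 0 by (rule y)
    have "supp l" unfolding supp_iff using elim assms(2) by (auto simp: endpoints_def)
    then show ?case using elim y by blast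
  qed
qed

lemma surface_sum_rev_walk:
  assumes l: "closed_walk l" and \<beta>: "\<bar>\<beta>\<bar> \<le> b0"
  shows "surface_sum c \<beta> (rev_walk l) = surface_sum c \<beta> l"
proof -
  have lat: "set l \<subseteq> lattice_edges" using l by (simp add: closed_walk_def)
  have "\<forall>\<^sub>F N in sequentially. cnj (wilson_expectation (haar N) (lattice_box N) N \<beta> {#l#})
      = wilson_expectation (haar N) (lattice_box N) N \<beta> {#rev_walk l#}"
    using exhaustion_ym[OF exhaustion_box lat]
  proof eventually_elim
    case (elim N)
    then interpret ym N "haar N" "lattice_box N" \<beta> by blast
    show ?case using wilson_rev_walk[of l] elim by simp
  qed
  from Lim_transform_eventually[OF tendsto_cnj[OF surface_sum_lim[OF exhaustion_box \<beta> l]] this]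
  have "(\<lambda>N. wilson_expectation (haar N) (lattice_box N) N \<beta> {#rev_walk l#}) \<longlonglongrightarrow> of_real (surface_sum c \<beta> l)" by simp
  from LIMSEQ_unique[OF this surface_sum_lim[OF exhaustion_box \<beta> closed_walk_rev_walk[OF l]]] show ?thesis by simp
qed

text \<open>
  The Wilson loop expectation of a power of \<open>l\<close> together with its reversal is the second absolute moment
  of the normalised trace, so the factorisation of the limit makes the traces concentrate.
\<close>

lemma ym_spectral_moments:
  assumes l: "closed_walk l" and \<beta>: "\<bar>\<beta>\<bar> \<le> b0" and \<Lambda>: "exhaustion \<Lambda>"
  shows "spectral_moments (\<lambda>N. ym_measure (haar N) (\<Lambda> N) N \<beta>) (\<lambda>N Q. loop_mat N Q l) (\<lambda>k. surface_sum c \<beta> (pw l k))"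
proof
  have lat: "set l \<subseteq> lattice_edges" using l by (simp add: closed_walk_def)
  note ev = exhaustion_ym[OF \<Lambda> lat]
  show "\<forall>\<^sub>F N in sequentially. 1 \<le> N \<and> prob_space (ym_measure (haar N) (\<Lambda> N) N \<beta>) \<and>
      (\<forall>Q\<in>space (ym_measure (haar N) (\<Lambda> N) N \<beta>). loop_mat N Q l \<in> unitary_group N) \<and>
      (\<forall>k. (\<lambda>Q. mtrace (loop_mat N Q l ^\<^sub>m k) / of_nat N) \<in> borel_measurable (ym_measure (haar N) (\<Lambda> N) N \<beta>))"
    using ev
  proof eventually_elim
    case (elim N)
    then interpret ym N "haar N" "\<Lambda> N" \<beta> by blast
    show ?case using elim prob_space_ym loop_mat_unitary measurable_trace_power by auto
  qed
  fix k
  have w: "closed_walk (pw l k)" "closed_walk (rev_walk (pw l k))"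
    using closed_walk_pw[OF l] closed_walk_rev_walk by blast+
  show "(\<lambda>N. \<integral>Q. mtrace (loop_mat N Q l ^\<^sub>m k) / of_nat N \<partial>ym_measure (haar N) (\<Lambda> N) N \<beta>) \<longlonglongrightarrow> of_real (surface_sum c \<beta> (pw l k))"
  proof (rule Lim_transform_eventually[OF surface_sum_lim[OF \<Lambda> \<beta> w(1)]])
    show "\<forall>\<^sub>F N in sequentially. wilson_expectation (haar N) (\<Lambda> N) N \<beta> {#pw l k#}
      = (\<integral>Q. mtrace (loop_mat N Q l ^\<^sub>m k) / of_nat N \<partial>ym_measure (haar N) (\<Lambda> N) N \<beta>)"
      using ev
    proof eventually_elim
      case (elim N)
      then interpret ym N "haar N" "\<Lambda> N" \<beta> by blast
      show ?case using wilson_pw elim by blast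
    qed
  qed
  have "(\<lambda>N. wilson_expectation (haar N) (\<Lambda> N) N \<beta> {#pw l k, rev_walk (pw l k)#})
    \<longlonglongrightarrow> of_real ((surface_sum c \<beta> (pw l k))\<^sup>2)"
    using lim[OF \<Lambda> \<beta>, of "{#pw l k, rev_walk (pw l k)#}"] w surface_sum_rev_walk[OF w(1) \<beta>]
    by (simp add: power2_eq_square)
  then show "(\<lambda>N. \<integral>Q. complex_of_real ((cmod (mtrace (loop_mat N Q l ^\<^sub>m k) / of_nat N))\<^sup>2) \<partial>ym_measure (haar N) (\<Lambda> N) N \<beta>)
    \<longlonglongrightarrow> of_real ((surface_sum c \<beta> (pw l k))\<^sup>2)"
  proof (rule Lim_transform_eventually)
    show "\<forall>\<^sub>F N in sequentially. wilson_expectation (haar N) (\<Lambda> N) N \<beta> {#pw l k, rev_walk (pw l k)#}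
      = (\<integral>Q. complex_of_real ((cmod (mtrace (loop_mat N Q l ^\<^sub>m k) / of_nat N))\<^sup>2) \<partial>ym_measure (haar N) (\<Lambda> N) N \<beta>)"
      using ev
    proof eventually_elim
      case (elim N)
      then interpret ym N "haar N" "\<Lambda> N" \<beta> by blast
      show ?case using wilson_square elim by blast
    qed
  qed
qed

lemma surface_sum_Nil: "\<bar>\<beta>\<bar> \<le> b0 \<Longrightarrow> surface_sum c \<beta> [] = 1"
proof -
  assume b: "\<bar>\<beta>\<bar> \<le> b0"
  have "(\<lambda>m. coe [] m * \<beta> ^ m) sums surface_sum c \<beta> []"
    by (rule surface_sum_sums[OF _ b]) (simp add: closed_walk_def)
  moreover have "(\<lambda>m. coe [] m * \<beta> ^ m) = (\<lambda>m. if m = 0 then 1 else 0)"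
    by (auto simp: coe_Nil)
  ultimately show ?thesis using sums_unique2[OF _ sums_single[of 0 "\<lambda>_. 1 :: real"]] by simp
qed

text \<open>
  If \<open>l\<close> runs clockwise, its reversal bounds the enclosed region and has the same surface sums.
\<close>

lemma surface_sum_simple_loop_power:
  assumes l: "simple_loop l" and \<beta>: "\<bar>\<beta>\<bar> \<le> b0" and n: "0 < n"
  shows "surface_sum c \<beta> (pw l n) = c_coeff n (loop_area l) * \<beta> ^ (n * loop_area l)"
proof -
  have cyc: "simple_cycle l" by (rule simple_loop_imp_simple_cycle[OF l])
  then have cw: "closed_walk l" by (simp add: simple_cycle_def)
  obtain k :: int where k: "k = 1 \<or> k = -1" "\<And>s. of_bool (enclosed l s) = k * winding l s"
    using simple_cycle_winding[OF cyc] by blast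
  from k(1) show ?thesis
  proof
    assume "k = 1"
    then have "bounds l {s. enclosed l s}"
      using k(2) cyc finite_enclosed by (simp add: bounds_def)
    from surface_sum_simple_cycle_power[OF this n \<beta>] show ?thesis by (simp add: loop_area_eq)
  next
    assume "k = -1"
    then have "bounds (rev_walk l) {s. enclosed l s}"
      using k(2) simple_cycle_rev_walk[OF cyc] finite_enclosed by (simp add: bounds_def)
    from surface_sum_simple_cycle_power[OF this n \<beta>]
    have "surface_sum c \<beta> (rev_walk (pw l n)) = c_coeff n (loop_area l) * \<beta> ^ (n * loop_area l)"
      by (simp add: loop_area_eq rev_walk_pw)
    then show ?thesis unfolding surface_sum_rev_walk[OF closed_walk_pw[OF cw] \<beta>] .
  qed
qed

lemma loop_area_pos:
  assumes l: "simple_loop l"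
  shows "0 < loop_area l"
proof -
  have cyc: "simple_cycle l" by (rule simple_loop_imp_simple_cycle[OF l])
  obtain k :: int where k: "k = 1 \<or> k = -1" "\<And>s. of_bool (enclosed l s) = k * winding l s"
    using simple_cycle_winding[OF cyc] by blast
  have "bounds l {s. enclosed l s} \<or> bounds (rev_walk l) {s. enclosed l s}"
    using k cyc simple_cycle_rev_walk[OF cyc] finite_enclosed[of l] by (auto simp: bounds_def)
  then have "{s. enclosed l s} \<noteq> {}" using bounds_nonempty by blast
  then show ?thesis using finite_enclosed[of l] by (simp add: loop_area_eq card_gt_0_iff)
qed

text \<open>
  The moments of \<open>l\<close> are the claimed Fourier coefficients. They are positive definite as limits of moments
  of measures on the circle, and absolutely summable, so they define a continuous density.
\<close>

theorem simple_loop_limit_law: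
  assumes l: "simple_loop l" and \<beta>: "\<bar>\<beta>\<bar> \<le> b0" "\<bar>\<beta>\<bar> \<le> 1 / 2"
  shows "summable (\<lambda>n. limit_term (loop_area l) \<beta> x (Suc n))"
    and "probability_density_on {0..<2 * pi} (limit_density (loop_area l) \<beta>)"
    and "exhaustion \<Lambda> \<Longrightarrow> weakly_in_probability (\<lambda>N. ym_measure (haar N) (\<Lambda> N) N \<beta>)
         (\<lambda>N Q. empirical_spectral_distribution (loop_mat N Q l)) (limit_measure (loop_area l) \<beta>)"
proof -
  define a where "a = loop_area l"
  define m where "m k = surface_sum c \<beta> (pw l k)" for k
  have a: "0 < a" unfolding a_def by (rule loop_area_pos[OF l])
  have m0: "m 0 = 1" using surface_sum_Nil[OF \<beta>(1)] by (simp add: m_def)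
  have m_Suc: "m (Suc n) = c_coeff (Suc n) a * \<beta> ^ (Suc n * a)" for n
    unfolding m_def a_def by (rule surface_sum_simple_loop_power[OF l \<beta>(1)]) simp
  have cw: "closed_walk l" using l by (simp add: simple_loop_def)
  note sm = ym_spectral_moments[OF cw \<beta>(1), folded m_def]
  have term_eq: "limit_term a \<beta> x (Suc n) = m (Suc n) * cos (real (Suc n) * x)" for x n
    unfolding limit_term_def m_Suc by (simp add: ac_simps)
  interpret moment_density m "limit_density a \<beta>"
  proof
    show "m 0 = 1" by (rule m0)
    show "summable (\<lambda>n. \<bar>m (Suc n)\<bar>)" unfolding m_Suc by (rule summable_c_coeff[OF a \<beta>(2)])
    show "limit_density a \<beta> x = 1 / (2 * pi) * (1 + 2 * (\<Sum>n. m (Suc n) * cos (real (Suc n) * x)))" for x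
      unfolding limit_density_def term_eq ..
    show "0 \<le> (\<Sum>j<n. \<Sum>k<n. m (nat \<bar>int j - int k\<bar>) * cos (real (nat \<bar>int j - int k\<bar>) * x))" for n x
      by (rule spectral_moments.toeplitz_nonneg[OF sm[OF exhaustion_box]])
  qed
  show "summable (\<lambda>n. limit_term (loop_area l) \<beta> x (Suc n))"
    unfolding a_def[symmetric] term_eq by (rule summable_norm_cancel[OF summable_term])
  show "probability_density_on {0..<2 * pi} (limit_density (loop_area l) \<beta>)"
    unfolding a_def[symmetric] by (rule probability_density)
  have law: "limit_measure a \<beta> = law" unfolding limit_measure_def law_def ..
  show "weakly_in_probability (\<lambda>N. ym_measure (haar N) (\<Lambda> N) N \<beta>)
         (\<lambda>N Q. empirical_spectral_distribution (loop_mat N Q l)) (limit_measure (loop_area l) \<beta>)"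
    if "exhaustion \<Lambda>"
    unfolding a_def[symmetric] law
    by (rule spectral_moments.weakly_in_probability_moments[OF sm[OF that] prob_space_law _ law_moment])
      (simp add: law_def)
qed

end

theorem corollary1p18:
  fixes haar :: "nat \<Rightarrow> complex mat measure"
    and c :: "edge list \<Rightarrow> plaq multiset \<Rightarrow> real"
    and \<beta>0 \<beta> :: real
    and l :: "edge list"
  assumes haar: "\<And>N. N \<ge> 1 \<Longrightarrow> haar_unitary N (haar N)"
    and c: "surface_coefficients c"
    and \<beta>0_pos: "\<beta>0 > 0"
    and \<beta>0: "\<And>\<Lambda> \<beta>' s. exhaustion \<Lambda> \<Longrightarrow> \<bar>\<beta>'\<bar> \<le> \<beta>0 \<Longrightarrow> (\<forall>l\<in>#s. closed_walk l) \<Longrightarrow>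
        (\<forall>l\<in>#s. (\<lambda>K. \<bar>c l K * \<beta>' ^ size K\<bar>) summable_on UNIV) \<and>
        (\<lambda>N. wilson_expectation (haar N) (\<Lambda> N) N \<beta>' s)
          \<longlonglongrightarrow> of_real (\<Prod>l\<in>#s. surface_sum c \<beta>' l)"
    and \<beta>: "\<bar>\<beta>\<bar> \<le> min \<beta>0 (1 / 2)"
    and l: "simple_loop l"
  shows "(\<forall>x. summable (\<lambda>n. limit_term (loop_area l) \<beta> x (Suc n))) \<and>
    probability_density_on {0..<2 * pi} (limit_density (loop_area l) \<beta>) \<and>
    (\<forall>\<Lambda>. exhaustion \<Lambda> \<longrightarrow>
       weakly_in_probability
         (\<lambda>N. ym_measure (haar N) (\<Lambda> N) N \<beta>)
         (\<lambda>N Q. empirical_spectral_distribution (loop_mat N Q l))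
         (limit_measure (loop_area l) \<beta>))"
proof -
  interpret large_N haar c \<beta>0
    by (rule large_N.intro[OF haar c \<beta>0_pos \<beta>0])
  have b: "\<bar>\<beta>\<bar> \<le> \<beta>0" "\<bar>\<beta>\<bar> \<le> 1 / 2" using \<beta> by auto
  show ?thesis using simple_loop_limit_law[OF l b] by blast
qed

end
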